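(* Let $(M,\omega_g)$ be a compact connected Hermitian manifold of complex dimension $n\ge2$, let $p\geq 2$ be a real number, and let $\omega_p$ be a $p$-conformal extremal metric in the conformal class $\{e^f\omega_g: f\in C^\infty(M,\mathbb R)\}$ of $\omega_g$. Let $s_p$ denote the Chern scalar curvature of $\omega_p$. (1) If $\omega_p$ is Gauduchon and $(n-p)s_p\geq 0$ on $M$, then $\omega_p$ has constant Chern scalar curvature. (2) If $\omega_p$ has constant nonzero Chern scalar curvature, then $\omega_p$ is Gauduchon.
   Context: For a Hermitian metric $\omega=\sqrt{-1}\,g_{i\bar j}\,dz^i\wedge d\bar z^j$ on a complex manifold $M$ of dimension $n$, the Chern scalar curvature is $s=g^{i\bar j}g^{k\bar\ell}\Theta_{i\bar jk\bar\ell}$, where $\Theta$ is the curvature tensor of the Chern connection; equivalently $s=\mathrm{tr}_{\omega}\left(-\sqrt{-1}\,\partial\bar\partial\log\det(g_{i\bar j})\right)$. The metric $\omega$ is Gauduchon if $\partial\bar\partial\omega^{n-1}=0$. Hermitian metrics are smooth. For real $p>1$ the $p$-Calabi functional is $$C_p(\omega)=\left(\int_M|s|^p\frac{\omega^n}{n!}\right)\left(\int_M\frac{\omega^n}{n!}\right)^{-\frac{n-p}{n}}.$$ The metric $\omega$ is called $p$-conformal extremal if $\left.\frac{d}{dt}\right|_{t=0}C_p(e^{tf}\omega)=0$ for every $f\in C^\infty(M,\mathbb R)$. *)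

theory Defs
  imports "HOL-Analysis.Analysis" "HOL-Combinatorics.Permutations"
begin

section \<open>Smooth and holomorphic maps on open sets\<close>

primrec Ck_on :: "nat \<Rightarrow> 'a::real_normed_vector set \<Rightarrow> ('a \<Rightarrow> 'b::real_normed_vector) \<Rightarrow> bool" where
  "Ck_on 0 S f \<longleftrightarrow> continuous_on S f"
| "Ck_on (Suc k) S f \<longleftrightarrow>
     (\<forall>x\<in>S. f differentiable (at x)) \<and> (\<forall>v. Ck_on k S (\<lambda>x. frechet_derivative f (at x) v))"

definition smooth_on :: "'a::real_normed_vector set \<Rightarrow> ('a \<Rightarrow> 'b::real_normed_vector) \<Rightarrow> bool" where
  "smooth_on S f \<longleftrightarrow> (\<forall>k. Ck_on k S f)"

definition holomorphic_map_on ::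
  "(complex ^ 'n::finite) set \<Rightarrow> (complex ^ 'n \<Rightarrow> complex ^ 'm::finite) \<Rightarrow> bool" where
  "holomorphic_map_on S F \<longleftrightarrow>
     (\<forall>z\<in>S. \<exists>D. (F has_derivative D) (at z) \<and> (\<forall>c v. D (c *s v) = c *s D v))"

definition wirt :: "'n::finite \<Rightarrow> (complex ^ 'n \<Rightarrow> complex) \<Rightarrow> complex ^ 'n \<Rightarrow> complex" where
  "wirt i F z =
     (frechet_derivative F (at z) (axis i 1) - \<i> * frechet_derivative F (at z) (axis i \<i>)) / 2"

definition wirt_bar :: "'n::finite \<Rightarrow> (complex ^ 'n \<Rightarrow> complex) \<Rightarrow> complex ^ 'n \<Rightarrow> complex" where
  "wirt_bar i F z =
     (frechet_derivative F (at z) (axis i 1) + \<i> * frechet_derivative F (at z) (axis i \<i>)) / 2"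


section \<open>Complex differential forms on open subsets of complex n-space\<close>

text \<open>
  A k-covector is a function of a sequence of tangent vectors that is alternating and
  real-multilinear in the entries 0, ..., k - 1 and ignores the others; the degree k is passed to the
  operations explicitly.  The normalisation is (alpha /\ beta)(u, v) = alpha(u) beta(v) -
  alpha(v) beta(u) for 1-covectors.
\<close>

type_synonym 'n covector = "(nat \<Rightarrow> (complex, 'n) vec) \<Rightarrow> complex"

definition wedge :: "nat \<Rightarrow> nat \<Rightarrow> 'n covector \<Rightarrow> 'n covector \<Rightarrow> 'n covector" where
  "wedge k l \<alpha> \<beta> = (\<lambda>v. (\<Sum>\<sigma> | \<sigma> permutes {..<k + l}.
      of_int (sign \<sigma>) * \<alpha> (\<lambda>i. v (\<sigma> i)) * \<beta> (\<lambda>i. v (\<sigma> (k + i)))) / (fact k * fact l))"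

primrec wedge_power :: "nat \<Rightarrow> 'n covector \<Rightarrow> nat \<Rightarrow> 'n covector" where
  "wedge_power k \<alpha> 0 = (\<lambda>v. 1)"
| "wedge_power k \<alpha> (Suc m) = wedge k (k * m) \<alpha> (wedge_power k \<alpha> m)"

definition dz :: "'n::finite \<Rightarrow> 'n covector" where
  "dz i = (\<lambda>v. v 0 $ i)"

definition dzbar :: "'n::finite \<Rightarrow> 'n covector" where
  "dzbar i = (\<lambda>v. cnj (v 0 $ i))"

definition del_form ::
  "nat \<Rightarrow> ((complex, 'n::finite) vec \<Rightarrow> 'n covector) \<Rightarrow> (complex, 'n) vec \<Rightarrow> 'n covector" where
  "del_form k \<Omega> z = (\<lambda>v. \<Sum>i\<in>UNIV. wedge 1 k (dz i) (\<lambda>u. wirt i (\<lambda>w. \<Omega> w u) z) v)"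

definition delbar_form ::
  "nat \<Rightarrow> ((complex, 'n::finite) vec \<Rightarrow> 'n covector) \<Rightarrow> (complex, 'n) vec \<Rightarrow> 'n covector" where
  "delbar_form k \<Omega> z = (\<lambda>v. \<Sum>i\<in>UNIV. wedge 1 k (dzbar i) (\<lambda>u. wirt_bar i (\<lambda>w. \<Omega> w u) z) v)"

text \<open>The matrix entry h $ i $ j stands for $g_{i\bar j}$.\<close>

definition fund_form :: "complex ^ 'n::finite ^ 'n \<Rightarrow> 'n covector" where
  "fund_form h = (\<lambda>v. \<i> * (\<Sum>i\<in>UNIV. \<Sum>j\<in>UNIV. h $ i $ j * wedge 1 1 (dz i) (dzbar j) v))"

text \<open>
  The frame $(\partial_{x_1}, \partial_{y_1}, \dots, \partial_{x_n}, \partial_{y_n})$ for an arbitrary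
  enumeration of the index type; it is positively oriented whatever the enumeration.
\<close>

definition real_frame :: "nat \<Rightarrow> complex ^ 'n::finite" where
  "real_frame k =
     axis (from_nat_into (UNIV :: 'n set) (k div 2)) (if even k then 1 else \<i>)"

text \<open>
  The density of $\omega^n / n!$ with respect to Lebesgue measure, i.e. its value on the standard
  frame.  This value is real and positive for a positive definite Hermitian matrix.
\<close>

definition volume_density :: "complex ^ 'n::finite ^ 'n \<Rightarrow> real" where
  "volume_density h =
     Re (wedge_power 2 (fund_form h) CARD('n) real_frame) / fact CARD('n)"


section \<open>Complex manifolds and Hermitian metrics\<close>

text \<open>
  The manifold is the whole type 'm.  A chart is a domain together with a coordinate map on it; an
  atlas need not be maximal.
\<close>

type_synonym ('m, 'n) chart = "'m set \<times> ('m \<Rightarrow> (complex, 'n) vec)"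

definition chart_image :: "('m, 'n::finite) chart \<Rightarrow> (complex, 'n) vec set" where
  "chart_image c = snd c ` fst c"

definition chart_inv :: "('m, 'n::finite) chart \<Rightarrow> (complex, 'n) vec \<Rightarrow> 'm" where
  "chart_inv c = inv_into (fst c) (snd c)"

definition transition ::
  "('m, 'n::finite) chart \<Rightarrow> ('m, 'n) chart \<Rightarrow> (complex, 'n) vec \<Rightarrow> (complex, 'n) vec" where
  "transition c d = (\<lambda>z. snd d (chart_inv c z))"

definition complex_atlas ::
  "('m::{t2_space, second_countable_topology}, 'n::finite) chart set \<Rightarrow> bool" where
  "complex_atlas A \<longleftrightarrow>
     (\<Union>c\<in>A. fst c) = UNIV \<and>
     (\<forall>c\<in>A. open (fst c) \<and> open (chart_image c) \<and>
        homeomorphism (fst c) (chart_image c) (snd c) (chart_inv c)) \<and>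
     (\<forall>c\<in>A. \<forall>d\<in>A. holomorphic_map_on (snd c ` (fst c \<inter> fst d)) (transition c d))"

definition chart_at :: "('m, 'n::finite) chart set \<Rightarrow> 'm \<Rightarrow> ('m, 'n) chart" where
  "chart_at A x = (SOME c. c \<in> A \<and> x \<in> fst c)"

definition smooth_fun :: "('m, 'n::finite) chart set \<Rightarrow> ('m \<Rightarrow> real) \<Rightarrow> bool" where
  "smooth_fun A f \<longleftrightarrow> (\<forall>c\<in>A. smooth_on (chart_image c) (\<lambda>z. f (chart_inv c z)))"

text \<open>
  A Hermitian metric is given by its coefficient matrices $(g_{i\bar j})$ in the charts of the atlas,
  as functions on the chart images, subject to the transformation law on overlaps.
\<close>

type_synonym ('m, 'n) metric =
  "('m, 'n) chart \<Rightarrow> (complex, 'n) vec \<Rightarrow> ((complex, 'n) vec, 'n) vec"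

definition herm_form :: "complex ^ 'n::finite ^ 'n \<Rightarrow> complex ^ 'n \<Rightarrow> complex ^ 'n \<Rightarrow> complex" where
  "herm_form h u v = (\<Sum>i\<in>UNIV. \<Sum>j\<in>UNIV. h $ i $ j * u $ i * cnj (v $ j))"

definition pos_def_hermitian :: "complex ^ 'n::finite ^ 'n \<Rightarrow> bool" where
  "pos_def_hermitian h \<longleftrightarrow>
     (\<forall>i j. h $ j $ i = cnj (h $ i $ j)) \<and> (\<forall>v. v \<noteq> 0 \<longrightarrow> Re (herm_form h v v) > 0)"

definition hermitian_metric :: "('m, 'n::finite) chart set \<Rightarrow> ('m, 'n) metric \<Rightarrow> bool" where
  "hermitian_metric A G \<longleftrightarrow>
     (\<forall>c\<in>A. smooth_on (chart_image c) (G c) \<and> (\<forall>z\<in>chart_image c. pos_def_hermitian (G c z))) \<and>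
     (\<forall>c\<in>A. \<forall>d\<in>A. \<forall>z \<in> snd c ` (fst c \<inter> fst d). \<forall>u v.
        herm_form (G c z) u v =
        herm_form (G d (transition c d z))
          (frechet_derivative (transition c d) (at z) u)
          (frechet_derivative (transition c d) (at z) v))"

text \<open>The metric $e^f \omega$.\<close>

definition conformal :: "('m \<Rightarrow> real) \<Rightarrow> ('m, 'n::finite) metric \<Rightarrow> ('m, 'n) metric" where
  "conformal f G = (\<lambda>c z. exp (f (chart_inv c z)) *\<^sub>R G c z)"

definition conformal_class ::
  "('m, 'n::finite) chart set \<Rightarrow> ('m, 'n) metric \<Rightarrow> ('m, 'n) metric set" where
  "conformal_class A G = {conformal f G | f. smooth_fun A f}"

definition gauduchon :: "('m, 'n::finite) chart set \<Rightarrow> ('m, 'n) metric \<Rightarrow> bool" where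
  "gauduchon A G \<longleftrightarrow>
     (\<forall>c\<in>A. \<forall>z\<in>chart_image c. \<forall>v.
        del_form (2 * (CARD('n) - 1) + 1)
          (delbar_form (2 * (CARD('n) - 1))
            (\<lambda>w. wedge_power 2 (fund_form (G c w)) (CARD('n) - 1))) z v = 0)"


section \<open>Chern scalar curvature\<close>

text \<open>$g^{i\bar j}$, normalised by $g^{i\bar j} g_{k\bar j} = \delta^i_k$.\<close>

definition inv_metric :: "complex ^ 'n::finite ^ 'n \<Rightarrow> 'n \<Rightarrow> 'n \<Rightarrow> complex" where
  "inv_metric h i j = matrix_inv (transpose h) $ i $ j"

text \<open>
  In local coordinates the Chern connection is $\nabla_{\partial_i} \partial_k = \Gamma_{ik}^p
  \partial_p$, $\nabla_{\bar\partial_j} \partial_k = 0$ with $\Gamma_{ik}^p = g^{p\bar q} \partial_i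
  g_{k\bar q}$.
\<close>

definition chern_christoffel ::
  "(complex ^ 'n::finite \<Rightarrow> complex ^ 'n ^ 'n) \<Rightarrow> 'n \<Rightarrow> 'n \<Rightarrow> 'n \<Rightarrow> complex ^ 'n \<Rightarrow> complex" where
  "chern_christoffel h i k p z =
     (\<Sum>q\<in>UNIV. inv_metric (h z) p q * wirt i (\<lambda>w. h w $ k $ q) z)"

text \<open>
  $\Theta_{i\bar jk\bar\ell} = g_{p\bar\ell} \Theta_{i\bar jk}{}^p$ with
  $\Theta_{i\bar jk}{}^p = -\partial_{\bar j} \Gamma_{ik}^p$, i.e.
  $-\partial_i\partial_{\bar j} g_{k\bar\ell}
    + g^{p\bar q} \partial_i g_{k\bar q} \partial_{\bar j} g_{p\bar\ell}$.
\<close>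

definition chern_curvature ::
  "(complex ^ 'n::finite \<Rightarrow> complex ^ 'n ^ 'n) \<Rightarrow> 'n \<Rightarrow> 'n \<Rightarrow> 'n \<Rightarrow> 'n \<Rightarrow> complex ^ 'n \<Rightarrow> complex" where
  "chern_curvature h i j k l z =
     (\<Sum>p\<in>UNIV. h z $ p $ l * (- wirt_bar j (chern_christoffel h i k p) z))"

definition chern_scalar_local ::
  "(complex ^ 'n::finite \<Rightarrow> complex ^ 'n ^ 'n) \<Rightarrow> complex ^ 'n \<Rightarrow> complex" where
  "chern_scalar_local h z =
     (\<Sum>i\<in>UNIV. \<Sum>j\<in>UNIV. \<Sum>k\<in>UNIV. \<Sum>l\<in>UNIV.
        inv_metric (h z) i j * inv_metric (h z) k l * chern_curvature h i j k l z)"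

text \<open>
  The local expression is real-valued and does not depend on the chart, so neither taking the real
  part nor choosing a chart around x loses anything.
\<close>

definition chern_scalar :: "('m, 'n::finite) chart set \<Rightarrow> ('m, 'n) metric \<Rightarrow> 'm \<Rightarrow> real" where
  "chern_scalar A G x =
     Re (chern_scalar_local (G (chart_at A x)) (snd (chart_at A x) x))"


section \<open>Integration and the p-Calabi functional\<close>

text \<open>
  Integration against the volume form $\omega^n / n!$: the unique Borel measure that is given in every
  chart by the density of this form.  Existence follows from the transformation law of the metric,
  uniqueness from the fact that countably many charts cover the manifold.
\<close>

definition vol ::
  "('m::topological_space, 'n::finite) chart set \<Rightarrow> ('m, 'n) metric \<Rightarrow> 'm measure" where
  "vol A G = (THE \<mu>. sets \<mu> = sets borel \<and>
     (\<forall>c\<in>A. \<forall>B\<in>sets borel. B \<subseteq> fst c \<longrightarrow>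
        emeasure \<mu> B = (\<integral>\<^sup>+z \<in> snd c ` B. ennreal (volume_density (G c z)) \<partial>lborel)))"

definition calabi ::
  "('m::topological_space, 'n::finite) chart set \<Rightarrow> real \<Rightarrow> ('m, 'n) metric \<Rightarrow> real" where
  "calabi A p G =
     (\<integral>x. \<bar>chern_scalar A G x\<bar> powr p \<partial>vol A G) *
     (\<integral>x. 1 \<partial>vol A G) powr (- ((real CARD('n) - p) / real CARD('n)))"

definition p_conformal_extremal ::
  "('m::topological_space, 'n::finite) chart set \<Rightarrow> real \<Rightarrow> ('m, 'n) metric \<Rightarrow> bool" where
  "p_conformal_extremal A p G \<longleftrightarrow>
     (\<forall>f. smooth_fun A f \<longrightarrow>
        ((\<lambda>t. calabi A p (conformal (\<lambda>x. t * f x) G)) has_real_derivative 0) (at 0))"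

end

theory Submission
  imports Defs "HOL-Complex_Analysis.Cauchy_Integral_Formula"
begin

text \<open>
  Write \<open>s\<close> for the Chern scalar curvature of the extremal metric, \<open>n\<close> for the dimension and \<open>L f\<close> for
  the trace of the complex Hessian of \<open>f\<close>. Under a conformal change
  \<open>s(e\<^sup>f \<omega>) = e\<^sup>-\<^sup>f (s - n L f)\<close> and the volume scales by the n-th power of the conformal factor, so extremality
  means that \<open>p n \<integral> sgn s |s|\<^sup>p\<^sup>-\<^sup>1 L f = (n - p) \<integral> f (|s|\<^sup>p - a)\<close> for all \<open>f\<close>, where \<open>a\<close> is the mean of
  \<open>|s|\<^sup>p\<close>. Integrating by parts in charts, the metric is Gauduchon iff \<open>\<integral> L f = 0\<close> for all \<open>f\<close>.

  If \<open>s\<close> is a nonzero constant, the right-hand side vanishes, hence so does \<open>\<integral> L f\<close>. If the metric is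
  Gauduchon, take \<open>f = s\<close>: as \<open>\<integral> L |s|\<^sup>p = 0\<close>, the left-hand side is \<open>-n\<close> times the integral of
  \<open>p (p - 1) |s|\<^sup>p\<^sup>-\<^sup>2 |\<partial>s|\<^sup>2\<close>, while the right-hand side is nonnegative by Chebyshev's inequality for
  \<open>|s|\<close> and \<open>|s|\<^sup>p\<close>. So \<open>ds = 0\<close> wherever \<open>s\<close> does not vanish, and \<open>s\<close> is constant by connectedness.
\<close>

text \<open>The sign hypothesis turns (n - p) s into |n - p| |s|; only then does Chebyshev's
  inequality fix the sign of the right-hand side. The function s is smooth and hence an admissible
  variation, but |s|^p with real p \<ge> 2 is in general only of class C^2 at the zeros of s.
  Regularity is therefore tracked by finite orders, and the vanishing of the integral of L f under
  the Gauduchon condition is proved for C^2 functions. The definitions of the volume and of the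
  Gauduchon condition are alternating sums over permutations. They reduce to det g and to the
  functions det g g^{i bar j}: the Gauduchon condition says that the sum of the derivatives d_i
  dbar_j of these functions vanishes, which is what integrating L f by parts produces. Transition
  maps are only assumed to have a complex linear derivative at each point, so their smoothness rests
  on Cauchy's formula. Given that, log det g changes between charts by a pluriharmonic function,
  which makes s a well-defined smooth function on the manifold.\<close>

section \<open>Calculus of $C^k$ maps\<close>

lemma frechet_derivative_works':
  "f differentiable (at x) \<Longrightarrow> (f has_derivative frechet_derivative f (at x)) (at x)"
  by (simp add: frechet_derivative_works)

text \<open>\<open>Ck_on\<close> differentiates with respect to full neighbourhoods, so agreement on
  S passes to the derivatives because S is open.\<close>

lemma Ck_on_cong_imp:
  assumes "open S" "\<And>x. x \<in> S \<Longrightarrow> f x = g x" "Ck_on k S f"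
  shows "Ck_on k S g"
  using assms(2,3)
proof (induction k arbitrary: f g)
  case 0
  then show ?case by (auto cong: continuous_on_cong)
next
  case (Suc k)
  have D: "f differentiable at x" if "x \<in> S" for x using Suc.prems that by auto
  have "g differentiable at x" if "x \<in> S" for x
    using D[OF that] has_derivative_transform_within_open[of f _ x UNIV S g] assms(1) that Suc.prems(1)
    unfolding differentiable_def by auto
  moreover have "frechet_derivative f (at x) v = frechet_derivative g (at x) v" if "x \<in> S" for x v
    using frechet_derivative_transform_within_open[OF D[OF that] assms(1) that Suc.prems(1)] by simp
  moreover have "Ck_on k S (\<lambda>x. frechet_derivative g (at x) v)" for v
    by (rule Suc.IH[of "\<lambda>x. frechet_derivative f (at x) v"]) (use Suc.prems calculation(2) in auto)
  ultimately show ?case by simp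
qed

lemma Ck_on_subset: "Ck_on k S f \<Longrightarrow> T \<subseteq> S \<Longrightarrow> Ck_on k T f"
  by (induction k arbitrary: f) (auto intro: continuous_on_subset)

text \<open>Serves to glue: functions on the manifold and extensions by zero are given by different
  formulas on different open sets.\<close>

lemma Ck_on_local:
  assumes "\<And>x. x \<in> S \<Longrightarrow> \<exists>T. open T \<and> x \<in> T \<and> Ck_on k T f"
  shows "Ck_on k S f"
  using assms
proof (induction k arbitrary: f)
  case 0
  then have "continuous (at x within S) f" if "x \<in> S" for x
    using that by (metis Ck_on.simps(1) continuous_at_imp_continuous_at_within continuous_on_eq_continuous_at)
  then show ?case by (simp add: continuous_on_eq_continuous_within)
next
  case (Suc k)
  show ?case unfolding Ck_on.simps
    using Suc.prems by (auto intro!: Suc.IH simp del: Ck_on.simps) (metis Ck_on.simps(2))+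
qed

lemma Ck_on_frechet: "Ck_on (Suc k) S f \<Longrightarrow> Ck_on k S (\<lambda>x. frechet_derivative f (at x) v)"
  by simp

lemma Ck_on_Suc_lower: "Ck_on (Suc k) S f \<Longrightarrow> Ck_on k S f"
proof (induction k arbitrary: f)
  case 0
  then show ?case
    by (auto intro: differentiable_imp_continuous_within continuous_at_imp_continuous_on)
next
  case (Suc k)
  then show ?case by (metis Ck_on.simps(2))
qed

lemma Ck_on_mono:
  assumes "Ck_on k S f" "j \<le> k"
  shows "Ck_on j S f"
  using assms(2,1) by (induction rule: inc_induct) (blast intro: Ck_on_Suc_lower)+

lemma Ck_on_continuous: "Ck_on k S f \<Longrightarrow> continuous_on S f"
  using Ck_on_mono[of k S f 0] by simp

text \<open>Lets an explicit derivative stand in for \<open>frechet_derivative\<close>. Closure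
  under products, composition and inversion is then an induction on the order in which the matching
  rule of calculus supplies \<open>f'\<close>.\<close>

lemma Ck_on_SucI:
  assumes "open S" "\<And>x. x \<in> S \<Longrightarrow> (f has_derivative f' x) (at x)"
    and "\<And>v. Ck_on k S (\<lambda>x. f' x v)"
  shows "Ck_on (Suc k) S f"
proof -
  have "Ck_on k S (\<lambda>x. frechet_derivative f (at x) v)" for v
    by (rule Ck_on_cong_imp[OF assms(1) _ assms(3)[of v]]) (metis assms(2) frechet_derivative_at)
  then show ?thesis using assms(2) by (auto simp: differentiable_def)
qed

lemma Ck_on_const [simp]: "Ck_on k S (\<lambda>x. c)"
  by (induction k arbitrary: c) auto

lemma Ck_on_bounded_linear:
  assumes "bounded_linear L"
  shows "Ck_on k S L"
proof (cases k)
  case 0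
  then show ?thesis using assms by (simp add: linear_continuous_on)
next
  case (Suc j)
  have "L differentiable at x" for x
    using assms bounded_linear_imp_differentiable by blast
  moreover have "frechet_derivative L (at x) = L" for x
    using assms bounded_linear_imp_has_derivative frechet_derivative_at by metis
  ultimately show ?thesis by (simp add: Suc)
qed

lemma Ck_on_add:
  assumes "open S" "Ck_on k S f" "Ck_on k S g"
  shows "Ck_on k S (\<lambda>x. f x + g x)"
  using assms(2,3)
proof (induction k arbitrary: f g)
  case 0
  then show ?case by (auto intro: continuous_intros)
next
  case (Suc k)
  show ?case
    by (rule Ck_on_SucI[where f' = "\<lambda>x v. frechet_derivative f (at x) v + frechet_derivative g (at x) v"])
       (use Suc assms(1) in \<open>auto intro!: derivative_intros frechet_derivative_works'\<close>)
qed

lemma Ck_on_bounded_linear_compose: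
  assumes "open S" "bounded_linear L" "Ck_on k S f"
  shows "Ck_on k S (\<lambda>x. L (f x))"
  using assms(3)
proof (induction k arbitrary: f)
  case 0
  then show ?case using assms(2) by (auto intro: bounded_linear.continuous_on)
next
  case (Suc k)
  show ?case
    by (rule Ck_on_SucI[where f' = "\<lambda>x v. L (frechet_derivative f (at x) v)"])
       (use Suc assms in \<open>auto intro!: bounded_linear.has_derivative[OF assms(2)] frechet_derivative_works'\<close>)
qed

lemma Ck_on_bilinear:
  assumes "open S" "bounded_bilinear b" "Ck_on k S f" "Ck_on k S g"
  shows "Ck_on k S (\<lambda>x. b (f x) (g x))"
  using assms(3,4)
proof (induction k arbitrary: f g)
  case 0
  then show ?case using assms(2) by (auto intro: bounded_bilinear.continuous_on)
next
  case (Suc k)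
  show ?case
  proof (rule Ck_on_SucI[where f' = "\<lambda>x v. b (f x) (frechet_derivative g (at x) v) +
        b (frechet_derivative f (at x) v) (g x)"])
    fix x assume "x \<in> S"
    then show "((\<lambda>x. b (f x) (g x)) has_derivative (\<lambda>v. b (f x) (frechet_derivative g (at x) v) +
        b (frechet_derivative f (at x) v) (g x))) (at x)"
      using Suc.prems by (intro bounded_bilinear.FDERIV[OF assms(2)] frechet_derivative_works') auto
  next
    fix v
    show "Ck_on k S (\<lambda>x. b (f x) (frechet_derivative g (at x) v) + b (frechet_derivative f (at x) v) (g x))"
      using Suc.prems Ck_on_Suc_lower[OF Suc.prems(1)] Ck_on_Suc_lower[OF Suc.prems(2)]
      by (intro Ck_on_add[OF assms(1)] Suc.IH) auto
  qed (rule assms(1))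
qed

lemmas Ck_on_mult = Ck_on_bilinear[OF _ bounded_bilinear_mult]
  and Ck_on_scaleR = Ck_on_bilinear[OF _ bounded_bilinear_scaleR]
  and Ck_on_inner = Ck_on_bilinear[OF _ bounded_bilinear_inner]
  and Ck_on_minus = Ck_on_bounded_linear_compose[OF _ bounded_linear_minus[OF bounded_linear_ident]]

lemma Ck_on_diff:
  assumes "open S" "Ck_on k S f" "Ck_on k S g"
  shows "Ck_on k S (\<lambda>x. f x - g x)"
  using Ck_on_add[OF assms(1,2) Ck_on_minus[OF assms(1,3)]] by simp

lemma Ck_on_sum:
  assumes "open S" "\<And>i. i \<in> I \<Longrightarrow> Ck_on k S (f i)"
  shows "Ck_on k S (\<lambda>x. \<Sum>i\<in>I. f i x)"
  using assms(2) by (induction I rule: infinite_finite_induct) (auto intro: Ck_on_add[OF assms(1)])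

lemma Ck_on_prod:
  fixes f :: "'i \<Rightarrow> 'a::real_normed_vector \<Rightarrow> 'b::{real_normed_algebra,comm_ring_1}"
  assumes "open S" "\<And>i. i \<in> I \<Longrightarrow> Ck_on k S (f i)"
  shows "Ck_on k S (\<lambda>x. \<Prod>i\<in>I. f i x)"
  using assms(2) by (induction I rule: infinite_finite_induct) (auto intro: Ck_on_mult[OF assms(1)])

lemma linear_eq_sum_Basis:
  fixes D :: "'a::euclidean_space \<Rightarrow> 'b::real_vector"
  assumes "linear D"
  shows "D w = (\<Sum>b\<in>Basis. (w \<bullet> b) *\<^sub>R D b)"
proof -
  have "D w = D (\<Sum>b\<in>Basis. (w \<bullet> b) *\<^sub>R b)" by (simp add: euclidean_representation)
  also have "\<dots> = (\<Sum>b\<in>Basis. (w \<bullet> b) *\<^sub>R D b)"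
    by (simp add: linear_sum[OF assms] linear_scale[OF assms])
  finally show ?thesis .
qed

text \<open>The chain rule evaluates the derivative of f in a direction that moves with the point,
  whereas the induction hypothesis concerns fixed directions. Expanding the moving direction in the
  basis of the intermediate space repairs this, hence the Euclidean type there.\<close>

lemma Ck_on_compose:
  fixes f :: "'b::euclidean_space \<Rightarrow> 'c::real_normed_vector" and g :: "'a::real_normed_vector \<Rightarrow> 'b"
  assumes "open S" "Ck_on k S g" "Ck_on k T f" "\<And>x. x \<in> S \<Longrightarrow> g x \<in> T"
  shows "Ck_on k S (\<lambda>x. f (g x))"
  using assms(2,3)
proof (induction k arbitrary: f)
  case 0
  then show ?case using assms(4) by (auto intro: continuous_on_compose2)
next
  case (Suc k)
  have lin: "linear (frechet_derivative f (at (g x)))" if "x \<in> S" for x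
    using Suc.prems(2) assms(4)[OF that] by (auto intro: linear_frechet_derivative)
  show ?case
  proof (rule Ck_on_SucI[where f' = "\<lambda>x v. \<Sum>b\<in>Basis. (frechet_derivative g (at x) v \<bullet> b) *\<^sub>R
        frechet_derivative f (at (g x)) b"])
    fix x assume x: "x \<in> S"
    have "(f \<circ> g has_derivative (frechet_derivative f (at (g x)) \<circ> frechet_derivative g (at x))) (at x)"
      using Suc.prems assms(4)[OF x] x by (intro diff_chain_at frechet_derivative_works') auto
    then show "((\<lambda>x. f (g x)) has_derivative (\<lambda>v. \<Sum>b\<in>Basis. (frechet_derivative g (at x) v \<bullet> b) *\<^sub>R
        frechet_derivative f (at (g x)) b)) (at x)"
      by (simp add: o_def flip: linear_eq_sum_Basis[OF lin[OF x]])
  next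
    fix v
    show "Ck_on k S (\<lambda>x. \<Sum>b\<in>Basis. (frechet_derivative g (at x) v \<bullet> b) *\<^sub>R
        frechet_derivative f (at (g x)) b)"
      using Suc.prems Ck_on_Suc_lower[OF Suc.prems(1)]
      by (intro Ck_on_sum Ck_on_scaleR Ck_on_inner assms(1) Suc.IH) auto
  qed (rule assms(1))
qed

text \<open>The derivative of \<open>inverse\<close> is a polynomial in \<open>inverse\<close>, so
  each order follows from the one before.\<close>

lemma Ck_on_inverse: "Ck_on k (- {0}) (inverse :: 'a::real_normed_field \<Rightarrow> 'a)"
proof (induction k)
  case 0
  then show ?case by (auto intro: continuous_intros)
next
  case (Suc k)
  have op: "open (- {0::'a})" by auto
  show ?case
    by (rule Ck_on_SucI[OF op has_derivative_inverse']) (auto intro!: Ck_on_minus Ck_on_mult Suc op)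
qed

lemma Ck_on_inverse_compose:
  fixes f :: "'a::real_normed_vector \<Rightarrow> 'b::{real_normed_field,euclidean_space}"
  assumes "open S" "Ck_on k S f" "\<And>x. x \<in> S \<Longrightarrow> f x \<noteq> 0"
  shows "Ck_on k S (\<lambda>x. inverse (f x))"
  by (rule Ck_on_compose[OF assms(1,2) Ck_on_inverse]) (use assms(3) in auto)

lemma Ck_on_divide:
  fixes f :: "'a::real_normed_vector \<Rightarrow> 'b::{real_normed_field,euclidean_space}"
  assumes "open S" "Ck_on k S f" "Ck_on k S g" "\<And>x. x \<in> S \<Longrightarrow> g x \<noteq> 0"
  shows "Ck_on k S (\<lambda>x. f x / g x)"
  unfolding divide_inverse by (intro Ck_on_mult Ck_on_inverse_compose assms)

lemma Ck_on_real_SucI: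
  fixes f :: "real \<Rightarrow> real"
  assumes "open S" "\<And>x. x \<in> S \<Longrightarrow> (f has_real_derivative f' x) (at x)" "Ck_on k S f'"
  shows "Ck_on (Suc k) S f"
  by (rule Ck_on_SucI[OF assms(1), where f' = "\<lambda>x v. f' x * v"])
     (use assms in \<open>auto simp: has_field_derivative_def intro!: Ck_on_mult\<close>)

lemma Ck_on_exp: "Ck_on k S (exp :: real \<Rightarrow> real)"
proof -
  have "Ck_on k UNIV (exp :: real \<Rightarrow> real)"
    by (induction k) (auto simp del: Ck_on.simps(2) intro!: Ck_on_real_SucI[where f' = exp] derivative_eq_intros continuous_intros)
  then show ?thesis by (rule Ck_on_subset) auto
qed

lemma Ck_on_ln: "Ck_on k {0<..} (ln :: real \<Rightarrow> real)"
proof (cases k)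
  case (Suc j)
  have "Ck_on j {0<..} (inverse :: real \<Rightarrow> real)"
    by (rule Ck_on_subset[OF Ck_on_inverse]) auto
  then show ?thesis unfolding Suc
    by (intro Ck_on_real_SucI[where f' = inverse]) (auto intro: DERIV_ln)
qed (auto intro!: continuous_intros)

text \<open>The open sets U and - K cover the space; f is C^k on the first and zero on the
  second.\<close>

lemma Ck_on_extend_zero:
  assumes "open U" "closed K" "K \<subseteq> U" "Ck_on k U f" "\<And>x. x \<notin> K \<Longrightarrow> f x = 0"
  shows "Ck_on k UNIV f"
proof (rule Ck_on_local)
  fix x :: 'a
  show "\<exists>T. open T \<and> x \<in> T \<and> Ck_on k T f"
  proof (cases "x \<in> U")
    case True
    then show ?thesis using assms by auto
  next
    case False
    then have "x \<in> - K" using assms by auto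
    moreover have "Ck_on k (- K) f"
      by (rule Ck_on_cong_imp[of _ "\<lambda>_. 0"]) (use assms in auto)
    ultimately show ?thesis using assms(2) by (meson open_Compl)
  qed
qed

section \<open>Wirtinger derivatives\<close>

lemma has_derivative_cong_open:
  assumes "open S" "z \<in> S" "\<And>x. x \<in> S \<Longrightarrow> f x = g x"
  shows "(f has_derivative D) (at z) \<longleftrightarrow> (g has_derivative D) (at z)"
  using has_derivative_transform_within_open[of f D z UNIV S g]
    has_derivative_transform_within_open[of g D z UNIV S f] assms by auto

lemma frechet_derivative_cong_open:
  assumes "open S" "z \<in> S" "\<And>x. x \<in> S \<Longrightarrow> f x = g x"
  shows "frechet_derivative f (at z) = frechet_derivative g (at z)"
  unfolding frechet_derivative_def using has_derivative_cong_open[OF assms] by auto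

lemma wirt_cong:
  assumes "open S" "z \<in> S" "\<And>x. x \<in> S \<Longrightarrow> F x = G x"
  shows "wirt i F z = wirt i G z" "wirt_bar i F z = wirt_bar i G z"
proof -
  have "frechet_derivative F (at z) = frechet_derivative G (at z)"
    by (rule frechet_derivative_cong_open[OF assms])
  then show "wirt i F z = wirt i G z" "wirt_bar i F z = wirt_bar i G z"
    by (simp_all only: wirt_def wirt_bar_def)
qed

lemma wirt_has_derivative:
  assumes "(F has_derivative D) (at z)"
  shows "wirt i F z = (D (axis i 1) - \<i> * D (axis i \<i>)) / 2"
    and "wirt_bar i F z = (D (axis i 1) + \<i> * D (axis i \<i>)) / 2"
  using frechet_derivative_at[OF assms] by (simp_all add: wirt_def wirt_bar_def)

lemma vec_eq_sum_axis_Re_Im: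
  fixes v :: "complex ^ 'n::finite"
  shows "v = (\<Sum>i\<in>UNIV. Re (v $ i) *\<^sub>R axis i 1 + Im (v $ i) *\<^sub>R axis i \<i>)"
proof -
  have "(\<Sum>i\<in>UNIV. Re (v $ i) *\<^sub>R axis i 1 + Im (v $ i) *\<^sub>R axis i \<i>) $ k
      = (\<Sum>i\<in>UNIV. if i = k then v $ i else 0)" for k
    unfolding sum_component
    by (rule sum.cong) (auto simp: axis_def complex_eq_iff)
  then show ?thesis by (simp add: vec_eq_iff)
qed

lemma linear_eq_sum_axis:
  fixes D :: "complex ^ 'n::finite \<Rightarrow> 'b::real_vector"
  assumes "linear D"
  shows "D v = (\<Sum>i\<in>UNIV. Re (v $ i) *\<^sub>R D (axis i 1) + Im (v $ i) *\<^sub>R D (axis i \<i>))"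
  by (subst vec_eq_sum_axis_Re_Im[of v])
     (simp add: linear_sum[OF assms] linear_add[OF assms] linear_scale[OF assms])

text \<open>Recovers the real differential from the Wirtinger derivatives: if all of them vanish it
  is zero, if the bar derivatives vanish it is complex linear.\<close>

lemma has_derivative_wirt:
  fixes F :: "complex ^ 'n::finite \<Rightarrow> complex"
  assumes D: "(F has_derivative D) (at z)"
  shows "D v = (\<Sum>i\<in>UNIV. wirt i F z * v $ i + wirt_bar i F z * cnj (v $ i))"
proof -
  have "Re x *\<^sub>R a + Im x *\<^sub>R b = (a - \<i> * b) / 2 * x + (a + \<i> * b) / 2 * cnj x" for a b x :: complex
    by (simp add: complex_eq_iff field_simps)
  then show ?thesis
    unfolding linear_eq_sum_axis[OF has_derivative_linear[OF D], of v] wirt_has_derivative[OF D]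
    by simp
qed

lemma wirt_const [simp]: "wirt i (\<lambda>w. c) z = 0" "wirt_bar i (\<lambda>w. c) z = 0"
  by (simp_all add: wirt_has_derivative[OF has_derivative_const])

lemma wirt_add:
  assumes "F differentiable at z" "G differentiable at z"
  shows "wirt i (\<lambda>w. F w + G w) z = wirt i F z + wirt i G z"
    and "wirt_bar i (\<lambda>w. F w + G w) z = wirt_bar i F z + wirt_bar i G z"
  unfolding wirt_has_derivative[OF has_derivative_add[OF assms[THEN frechet_derivative_works']]]
  by (simp_all add: wirt_def wirt_bar_def field_simps)

lemma wirt_mult:
  assumes "F differentiable at z" "G differentiable at z"
  shows "wirt i (\<lambda>w. F w * G w) z = F z * wirt i G z + wirt i F z * G z"
    and "wirt_bar i (\<lambda>w. F w * G w) z = F z * wirt_bar i G z + wirt_bar i F z * G z"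
  unfolding wirt_has_derivative[OF has_derivative_mult[OF assms[THEN frechet_derivative_works']]]
  by (simp_all add: wirt_def wirt_bar_def field_simps)

lemma wirt_cmult:
  assumes "F differentiable at z"
  shows "wirt i (\<lambda>w. c * F w) z = c * wirt i F z"
    and "wirt_bar i (\<lambda>w. c * F w) z = c * wirt_bar i F z"
  using wirt_mult[OF differentiable_const[of c] assms, of i] by simp_all

lemma wirt_sum:
  assumes "\<And>k. k \<in> I \<Longrightarrow> F k differentiable at z"
  shows "wirt i (\<lambda>w. \<Sum>k\<in>I. F k w) z = (\<Sum>k\<in>I. wirt i (F k) z)"
    and "wirt_bar i (\<lambda>w. \<Sum>k\<in>I. F k w) z = (\<Sum>k\<in>I. wirt_bar i (F k) z)"
proof -
  have "((\<lambda>w. \<Sum>k\<in>I. F k w) has_derivative (\<lambda>v. \<Sum>k\<in>I. frechet_derivative (F k) (at z) v)) (at z)"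
    by (intro has_derivative_sum frechet_derivative_works' assms)
  note D = wirt_has_derivative[OF this]
  show "wirt i (\<lambda>w. \<Sum>k\<in>I. F k w) z = (\<Sum>k\<in>I. wirt i (F k) z)"
    "wirt_bar i (\<lambda>w. \<Sum>k\<in>I. F k w) z = (\<Sum>k\<in>I. wirt_bar i (F k) z)"
    unfolding D by (simp_all add: wirt_def wirt_bar_def sum_subtractf sum.distrib
        flip: sum_distrib_left sum_divide_distrib)
qed

lemma wirt_cnj:
  assumes "F differentiable at z"
  shows "wirt i (\<lambda>w. cnj (F w)) z = cnj (wirt_bar i F z)"
    and "wirt_bar i (\<lambda>w. cnj (F w)) z = cnj (wirt i F z)"
  unfolding wirt_has_derivative[OF has_derivative_cnj[OF frechet_derivative_works'[OF assms]]]
  by (simp_all add: wirt_def wirt_bar_def field_simps)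

lemma wirt_real_compose:
  fixes u :: "complex ^ 'n::finite \<Rightarrow> real"
  assumes "u differentiable at z" "(\<phi> has_real_derivative \<phi>') (at (u z))"
  shows "wirt i (\<lambda>w. complex_of_real (\<phi> (u w))) z = of_real \<phi>' * wirt i (\<lambda>w. of_real (u w)) z"
    and "wirt_bar i (\<lambda>w. complex_of_real (\<phi> (u w))) z = of_real \<phi>' * wirt_bar i (\<lambda>w. of_real (u w)) z"
proof -
  let ?D = "frechet_derivative u (at z)"
  have D: "(u has_derivative ?D) (at z)" by (rule frechet_derivative_works'[OF assms(1)])
  have "((\<lambda>w. \<phi> (u w)) has_derivative (\<lambda>v. \<phi>' * ?D v)) (at z)"
    using has_derivative_compose[OF D, of \<phi> "(*) \<phi>'"] assms(2) by (simp add: has_field_derivative_def)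
  from has_derivative_of_real[OF this, where 'a=complex] has_derivative_of_real[OF D, where 'a=complex]
  show "wirt i (\<lambda>w. complex_of_real (\<phi> (u w))) z = of_real \<phi>' * wirt i (\<lambda>w. of_real (u w)) z"
    and "wirt_bar i (\<lambda>w. complex_of_real (\<phi> (u w))) z = of_real \<phi>' * wirt_bar i (\<lambda>w. of_real (u w)) z"
    by (simp_all add: wirt_has_derivative field_simps)
qed

lemma axis_imaginary: "axis i \<i> = \<i> *s axis i (1::complex)"
  by (simp add: vec_eq_iff axis_def)

text \<open>Complex linearity of D means that the components of T have no bar derivatives, so the
  two kinds of derivatives of F do not mix.\<close>

lemma wirt_holomorphic_compose:
  fixes T :: "complex ^ 'n::finite \<Rightarrow> complex ^ 'm::finite"
  assumes F: "F differentiable at (T z)" and T: "(T has_derivative D) (at z)"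
    and lin: "\<And>c v. D (c *s v) = c *s D v"
  shows "wirt i (\<lambda>w. F (T w)) z = (\<Sum>a\<in>UNIV. wirt a F (T z) * D (axis i 1) $ a)"
    and "wirt_bar i (\<lambda>w. F (T w)) z = (\<Sum>a\<in>UNIV. wirt_bar a F (T z) * cnj (D (axis i 1) $ a))"
proof -
  note F' = frechet_derivative_works'[OF F]
  note C = has_derivative_compose[OF T F']
  have ax: "D (axis i \<i>) $ a = \<i> * D (axis i 1) $ a" for a
    by (simp add: axis_imaginary lin)
  show "wirt i (\<lambda>w. F (T w)) z = (\<Sum>a\<in>UNIV. wirt a F (T z) * D (axis i 1) $ a)"
    unfolding wirt_has_derivative[OF C] has_derivative_wirt[OF F'] ax
    by (simp add: sum_distrib_left sum_subtractf[symmetric] sum_divide_distrib)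
       (rule sum.cong, auto simp: algebra_simps)
  show "wirt_bar i (\<lambda>w. F (T w)) z = (\<Sum>a\<in>UNIV. wirt_bar a F (T z) * cnj (D (axis i 1) $ a))"
    unfolding wirt_has_derivative[OF C] has_derivative_wirt[OF F'] ax
    by (simp add: sum_distrib_left sum.distrib[symmetric] sum_divide_distrib)
       (rule sum.cong, auto simp: algebra_simps)
qed

lemma wirt_holomorphic:
  fixes g :: "complex ^ 'n::finite \<Rightarrow> complex"
  assumes "(g has_derivative D) (at z)" "\<And>c v. D (c *s v) = c * D v"
  shows "wirt_bar i g z = 0" "wirt i g z = D (axis i 1)"
  using assms(2)[of \<i> "axis i 1"] by (simp_all add: wirt_has_derivative[OF assms(1)] axis_imaginary)

lemma Ck_on_wirt:
  assumes "open S" "Ck_on (Suc k) S F"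
  shows "Ck_on k S (wirt i F)" "Ck_on k S (wirt_bar i F)"
proof -
  have 1: "Ck_on k S (\<lambda>z. inverse 2 * (frechet_derivative F (at z) (axis i 1) - \<i> * frechet_derivative F (at z) (axis i \<i>)))"
    "Ck_on k S (\<lambda>z. inverse 2 * (frechet_derivative F (at z) (axis i 1) + \<i> * frechet_derivative F (at z) (axis i \<i>)))"
    by (intro Ck_on_mult Ck_on_diff Ck_on_add Ck_on_const Ck_on_frechet assms)+
  have 2: "(a - b) / 2 = inverse 2 * (a - b)" "(a + b) / 2 = inverse 2 * (a + b)" for a b :: complex
    by (simp_all add: field_simps)
  show "Ck_on k S (wirt i F)" "Ck_on k S (wirt_bar i F)"
    unfolding wirt_def[abs_def] wirt_bar_def[abs_def] 2 by (rule 1)+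
qed

section \<open>Symmetry of mixed second derivatives\<close>

lemma has_real_derivative_line:
  fixes f :: "'a::real_normed_vector \<Rightarrow> real"
  assumes "(f has_derivative D) (at (p + t *\<^sub>R u))"
  shows "((\<lambda>t. f (p + t *\<^sub>R u)) has_real_derivative D u) (at t)"
proof -
  have "((\<lambda>t. p + t *\<^sub>R u) has_derivative (\<lambda>h. h *\<^sub>R u)) (at t)"
    by (auto intro!: derivative_eq_intros)
  from has_derivative_compose[OF this assms]
  show ?thesis
    by (simp add: has_field_derivative_def linear_scale[OF has_derivative_linear[OF assms]] mult_commute_abs)
qed

text \<open>The mean value theorem is applied twice: along u to the increment of f in the direction
  v, then along v to the derivative in the direction u. What matters is that the second difference
  on the left is symmetric in u and v.\<close>

lemma second_difference_mean_value:
  fixes f :: "'a::real_normed_vector \<Rightarrow> real"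
  assumes C: "Ck_on 2 (ball z r) f" and s: "0 < s" "s * (norm u + norm v) < r"
  shows "\<exists>y\<in>ball z r. f (z + s *\<^sub>R u + s *\<^sub>R v) - f (z + s *\<^sub>R u) - f (z + s *\<^sub>R v) + f z
     = s\<^sup>2 * frechet_derivative (\<lambda>x. frechet_derivative f (at x) u) (at y) v"
proof -
  have C1: "(f has_derivative frechet_derivative f (at x)) (at x)"
    and C2: "((\<lambda>x. frechet_derivative f (at x) u) has_derivative
        frechet_derivative (\<lambda>x. frechet_derivative f (at x) u) (at x)) (at x)" if "x \<in> ball z r" for x
    using C that by (auto simp: numeral_2_eq_2 intro!: frechet_derivative_works')
  have mem: "z + a *\<^sub>R u + b *\<^sub>R v \<in> ball z r" if "0 \<le> a" "a \<le> s" "0 \<le> b" "b \<le> s" for a b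
  proof -
    have "norm (a *\<^sub>R u + b *\<^sub>R v) \<le> a * norm u + b * norm v"
      using norm_triangle_ineq[of "a *\<^sub>R u" "b *\<^sub>R v"] that by simp
    also have "\<dots> \<le> s * norm u + s * norm v"
      using that by (intro add_mono mult_right_mono) auto
    finally have "norm (a *\<^sub>R u + b *\<^sub>R v) < r" using s by (simp add: algebra_simps)
    moreover have "dist z (z + a *\<^sub>R u + b *\<^sub>R v) = norm (a *\<^sub>R u + b *\<^sub>R v)"
      by (simp add: dist_norm add.assoc del: minus_add_distrib)
    ultimately show ?thesis by simp
  qed
  define g where "g t = f (z + s *\<^sub>R v + t *\<^sub>R u) - f (z + t *\<^sub>R u)" for t
  have "\<exists>\<xi>. 0 < \<xi> \<and> \<xi> < s \<and> g s - g 0 = (s - 0) * (frechet_derivative f (at (z + s *\<^sub>R v + \<xi> *\<^sub>R u)) u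
        - frechet_derivative f (at (z + \<xi> *\<^sub>R u)) u)"
  proof (rule MVT2[OF s(1)])
    fix t assume t: "0 \<le> t" "t \<le> s"
    show "(g has_real_derivative frechet_derivative f (at (z + s *\<^sub>R v + t *\<^sub>R u)) u
        - frechet_derivative f (at (z + t *\<^sub>R u)) u) (at t)"
      unfolding g_def
      using mem[of t s] mem[of t 0] t s(1)
      by (intro DERIV_diff has_real_derivative_line C1) (auto simp: add_ac)
  qed
  then obtain \<xi> where \<xi>: "0 < \<xi>" "\<xi> < s" and 1: "g s - g 0 = s * (frechet_derivative f (at (z + s *\<^sub>R v + \<xi> *\<^sub>R u)) u
        - frechet_derivative f (at (z + \<xi> *\<^sub>R u)) u)" by auto
  define h where "h t = frechet_derivative f (at (z + \<xi> *\<^sub>R u + t *\<^sub>R v)) u" for t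
  have "\<exists>\<eta>. 0 < \<eta> \<and> \<eta> < s \<and> h s - h 0 = (s - 0) *
      frechet_derivative (\<lambda>x. frechet_derivative f (at x) u) (at (z + \<xi> *\<^sub>R u + \<eta> *\<^sub>R v)) v"
  proof (rule MVT2[OF s(1)])
    fix t assume t: "0 \<le> t" "t \<le> s"
    show "(h has_real_derivative frechet_derivative (\<lambda>x. frechet_derivative f (at x) u) (at (z + \<xi> *\<^sub>R u + t *\<^sub>R v)) v) (at t)"
      unfolding h_def using mem[of \<xi> t] t \<xi>
      by (intro has_real_derivative_line[where f = "\<lambda>x. frechet_derivative f (at x) u"] C2) auto
  qed
  then obtain \<eta> where \<eta>: "0 < \<eta>" "\<eta> < s" and 2: "h s - h 0 = s *
      frechet_derivative (\<lambda>x. frechet_derivative f (at x) u) (at (z + \<xi> *\<^sub>R u + \<eta> *\<^sub>R v)) v" by auto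
  have "h s - h 0 = frechet_derivative f (at (z + s *\<^sub>R v + \<xi> *\<^sub>R u)) u - frechet_derivative f (at (z + \<xi> *\<^sub>R u)) u"
    by (simp add: h_def add_ac)
  with 1 2 have "g s - g 0 = s\<^sup>2 * frechet_derivative (\<lambda>x. frechet_derivative f (at x) u) (at (z + \<xi> *\<^sub>R u + \<eta> *\<^sub>R v)) v"
    by (simp add: power2_eq_square)
  moreover have "g s - g 0 = f (z + s *\<^sub>R u + s *\<^sub>R v) - f (z + s *\<^sub>R u) - f (z + s *\<^sub>R v) + f z"
    by (simp add: g_def add_ac)
  ultimately show ?thesis using mem[of \<xi> \<eta>] \<xi> \<eta> by (intro bexI[of _ "z + \<xi> *\<^sub>R u + \<eta> *\<^sub>R v"]) auto
qed

text \<open>If the two mixed derivatives differed at z, continuity would keep a number m strictly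
  between them on a whole ball, while the symmetric second difference produces two points of the
  ball where their values agree.\<close>

lemma second_derivative_symmetric_real:
  fixes f :: "'a::real_normed_vector \<Rightarrow> real"
  assumes S: "open S" "z \<in> S" and C: "Ck_on 2 S f"
  shows "frechet_derivative (\<lambda>x. frechet_derivative f (at x) u) (at z) v =
    frechet_derivative (\<lambda>x. frechet_derivative f (at x) v) (at z) u"
proof -
  define A where "A u v y = frechet_derivative (\<lambda>x. frechet_derivative f (at x) u) (at y) v" for u v y
  have cont: "continuous_on S (A u v)" for u v
    using C by (auto simp: numeral_2_eq_2 A_def[abs_def])
  have le: "\<not> A u v z < A v u z" for u v
  proof
    assume "A u v z < A v u z"
    then obtain m where m: "A u v z < m" "m < A v u z" using dense by blast
    have "\<forall>\<^sub>F y in at z. A u v y < m" "\<forall>\<^sub>F y in at z. m < A v u y"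
      using cont[of u v] cont[of v u] S m
      by (auto simp: continuous_on_eq_continuous_at isCont_def intro: order_tendstoD)
    moreover have "\<forall>\<^sub>F y in at z. y \<in> S" using S by (simp add: eventually_at_in_open')
    ultimately have "\<forall>\<^sub>F y in at z. A u v y < m \<and> m < A v u y \<and> y \<in> S" by eventually_elim auto
    then obtain r where r: "r > 0" "\<And>y. y \<noteq> z \<Longrightarrow> dist y z < r \<Longrightarrow> A u v y < m \<and> m < A v u y \<and> y \<in> S"
      unfolding eventually_at by auto
    have r': "A u v y < m \<and> m < A v u y \<and> y \<in> S" if "y \<in> ball z r" for y
      using r(2)[of y] m S(2) that by (cases "y = z") (auto simp: dist_commute)
    \<comment> \<open>The summand 1 keeps the denominator positive when u and v both vanish.\<close>
    define s where "s = r / (2 * (norm u + norm v + 1))"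
    have pos: "0 < norm u + norm v + 1" by (simp add: add_nonneg_pos)
    have s: "0 < s" using r(1) pos by (simp add: s_def)
    have "s * (norm u + norm v) < s * (2 * (norm u + norm v + 1))"
      using s by (intro mult_strict_left_mono) (auto simp: add_nonneg_pos)
    also have "\<dots> = r" using pos by (simp add: s_def)
    finally have s2: "s * (norm u + norm v) < r" "s * (norm v + norm u) < r" by (simp_all add: add.commute)
    have CB: "Ck_on 2 (ball z r) f" using C r' by (auto elim!: Ck_on_subset)
    obtain y1 y2 where "y1 \<in> ball z r" "y2 \<in> ball z r" "s\<^sup>2 * A u v y1 = s\<^sup>2 * A v u y2"
      using second_difference_mean_value[OF CB s s2(1)] second_difference_mean_value[OF CB s s2(2)]
      unfolding A_def by (smt (verit) add.assoc add.commute)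
    moreover have "s\<^sup>2 \<noteq> 0" using s by simp
    ultimately have "A u v y1 = A v u y2" by (metis mult_left_cancel)
    then show False using r'[OF \<open>y1 \<in> ball z r\<close>] r'[OF \<open>y2 \<in> ball z r\<close>] by simp
  qed
  then show ?thesis using le[of u v] le[of v u] unfolding A_def by linarith
qed

lemma second_derivative_symmetric:
  fixes f :: "'a::real_normed_vector \<Rightarrow> 'b::euclidean_space"
  assumes S: "open S" "z \<in> S" and C: "Ck_on 2 S f"
  shows "frechet_derivative (\<lambda>x. frechet_derivative f (at x) u) (at z) v =
    frechet_derivative (\<lambda>x. frechet_derivative f (at x) v) (at z) u"
proof (rule euclidean_eqI)
  fix b :: 'b
  have C1: "f differentiable at x" and C2: "(\<lambda>x. frechet_derivative f (at x) u) differentiable at x" if "x \<in> S" for x u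
    using C that by (auto simp: numeral_2_eq_2)
  have 1: "frechet_derivative (\<lambda>x. f x \<bullet> b) (at x) u = frechet_derivative f (at x) u \<bullet> b" if "x \<in> S" for x u
    using frechet_derivative_at[OF has_derivative_inner_left[OF frechet_derivative_works'[OF C1[OF that]], of b]] by metis
  have 2: "frechet_derivative (\<lambda>x. frechet_derivative (\<lambda>x. f x \<bullet> b) (at x) u) (at z) v =
     frechet_derivative (\<lambda>x. frechet_derivative f (at x) u) (at z) v \<bullet> b" for u v
    using frechet_derivative_at[OF has_derivative_inner_left[OF frechet_derivative_works'[OF C2[OF S(2), of u]], of b]]
      frechet_derivative_cong_open[OF S, of "\<lambda>x. frechet_derivative (\<lambda>x. f x \<bullet> b) (at x) u" "\<lambda>x. frechet_derivative f (at x) u \<bullet> b"] 1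
    by metis
  show "frechet_derivative (\<lambda>x. frechet_derivative f (at x) u) (at z) v \<bullet> b =
    frechet_derivative (\<lambda>x. frechet_derivative f (at x) v) (at z) u \<bullet> b"
    unfolding 2[symmetric]
    by (rule second_derivative_symmetric_real[OF S Ck_on_inner[OF S(1) C Ck_on_const]])
qed

lemma wirt_wirt_bar_commute:
  assumes S: "open S" "z \<in> S" and C: "Ck_on 2 S F"
  shows "wirt_bar j (wirt i F) z = wirt i (wirt_bar j F) z"
proof -
  define H where "H u v = frechet_derivative (\<lambda>x. frechet_derivative F (at x) u) (at z) v" for u v
  have "(\<lambda>x. frechet_derivative F (at x) u) differentiable at z" for u
    using C S(2) by (simp add: numeral_2_eq_2)
  then have H: "((\<lambda>x. frechet_derivative F (at x) u) has_derivative H u) (at z)" for u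
    unfolding H_def by (rule frechet_derivative_works')
  have "(wirt i F has_derivative (\<lambda>v. (H (axis i 1) v - \<i> * H (axis i \<i>) v) / 2)) (at z)"
    unfolding wirt_def[abs_def] by (intro bounded_linear.has_derivative[OF bounded_linear_divide] has_derivative_diff has_derivative_mult_right H)
  moreover have "(wirt_bar j F has_derivative (\<lambda>v. (H (axis j 1) v + \<i> * H (axis j \<i>) v) / 2)) (at z)"
    unfolding wirt_bar_def[abs_def] by (intro bounded_linear.has_derivative[OF bounded_linear_divide] has_derivative_add has_derivative_mult_right H)
  moreover have "H u v = H v u" for u v
    unfolding H_def by (rule second_derivative_symmetric[OF S C])
  ultimately show ?thesis by (simp add: wirt_has_derivative field_simps)
qed

section \<open>Determinants and Hermitian matrices\<close>

text \<open>If f takes a value twice, swapping the two arguments fixes f and forces \<Phi> f = -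
  \<Phi> f. Otherwise f is a permutation, reached from \<open>id\<close> by transpositions that cost
  a sign each.\<close>

lemma alternating_eq_sign:
  fixes \<Phi> :: "('n::finite \<Rightarrow> 'n) \<Rightarrow> complex"
  assumes alt: "\<And>f i j. i \<noteq> j \<Longrightarrow> \<Phi> (f \<circ> Transposition.transpose i j) = - \<Phi> f"
  shows "\<Phi> f = (if f permutes UNIV then of_int (sign f) * \<Phi> id else 0)"
proof (cases "inj f")
  case False
  then obtain i j where ij: "i \<noteq> j" "f i = f j" by (auto simp: inj_on_def)
  then have "f \<circ> Transposition.transpose i j = f" by (auto simp: fun_eq_iff Transposition.transpose_def)
  then have "\<Phi> f = - \<Phi> f" using alt[OF ij(1), of f] by simp
  then have "\<Phi> f = 0" by simp
  moreover have "\<not> f permutes UNIV" using False permutes_inj by blast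
  ultimately show ?thesis by simp
next
  case True
  then have f: "f permutes UNIV" by (simp add: permutes_def finite_UNIV_inj_surj bij_def flip: bij_iff)
  have "\<Phi> f = of_int (sign f) * \<Phi> id"
    using finite[of "UNIV :: 'n set"] f
  proof (induction rule: permutes_rev_induct)
    case id
    then show ?case by simp
  next
    case (swap a b p)
    have "sign (p \<circ> Transposition.transpose a b) = - sign p"
      using swap permutes_imp_permutation[OF finite[of "UNIV :: 'n set"]]
      by (simp add: sign_compose permutation_swap_id sign_swap_id)
    then show ?case
      by (simp only: alt[OF swap(3)] \<open>sign _ = _\<close> swap.IH of_int_minus mult_minus_left)
  qed
  then show ?thesis using f by simp
qed

lemma sum_alternating_eq_det:
  fixes A :: "complex ^ 'n ^ 'n::finite" and \<Phi> :: "('n \<Rightarrow> 'n) \<Rightarrow> complex"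
  assumes alt: "\<And>f i j. i \<noteq> j \<Longrightarrow> \<Phi> (f \<circ> Transposition.transpose i j) = - \<Phi> f"
  shows "(\<Sum>f\<in>UNIV. (\<Prod>k\<in>UNIV. A $ k $ f k) * \<Phi> f) = det A * \<Phi> id"
proof -
  have "(\<Sum>f\<in>UNIV. (\<Prod>k\<in>UNIV. A $ k $ f k) * \<Phi> f) =
    (\<Sum>f\<in>UNIV. if f permutes UNIV then of_int (sign f) * (\<Prod>k\<in>UNIV. A $ k $ f k) * \<Phi> id else 0)"
    by (rule sum.cong[OF refl], subst alternating_eq_sign[of \<Phi>, OF alt]) simp_all
  also have "\<dots> = (\<Sum>f | f permutes UNIV. of_int (sign f) * (\<Prod>k\<in>UNIV. A $ k $ f k) * \<Phi> id)"
    by (simp add: sum.If_cases)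
  finally show ?thesis by (simp add: det_def sum_distrib_right)
qed

section \<open>Inverse metrics and derivatives of determinants\<close>

lemma matrix_inv:
  fixes A :: "'a::field ^ 'n ^ 'n"
  assumes "invertible A"
  shows "A ** matrix_inv A = mat 1" "matrix_inv A ** A = mat 1"
  using someI_ex[of "\<lambda>B. A ** B = mat 1 \<and> B ** A = mat 1"] assms
  unfolding invertible_def matrix_inv_def by auto

lemma matrix_inv_unique:
  fixes A :: "'a::field ^ 'n ^ 'n"
  assumes "A ** B = mat 1"
  shows "matrix_inv A = B"
proof -
  have "invertible A" using assms matrix_left_right_inverse unfolding invertible_def by blast
  then have "matrix_inv A ** A = mat 1" by (rule matrix_inv)
  then show ?thesis
    by (metis assms matrix_mul_assoc matrix_mul_lid matrix_mul_rid)
qed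

lemma inv_metric_eq:
  assumes "invertible h"
  shows "inv_metric h i j = matrix_inv h $ j $ i"
proof -
  have "transpose h ** transpose (matrix_inv h) = mat 1"
    by (simp add: matrix_inv[OF assms] transpose_mat flip: matrix_transpose_mul)
  then show ?thesis
    by (simp add: inv_metric_def matrix_inv_unique) (simp add: transpose_def)
qed

lemma sum_inv_metric:
  assumes "invertible h"
  shows "(\<Sum>l\<in>UNIV. inv_metric h k l * h $ p $ l) = (if k = p then 1 else 0)"
proof -
  have "(h ** matrix_inv h) $ p $ k = (if k = p then 1 else 0)"
    by (simp add: matrix_inv[OF assms] mat_def)
  then show ?thesis by (simp add: inv_metric_eq[OF assms] matrix_matrix_mult_def mult.commute)
qed

text \<open>Jacobi's formula in algebraic form. Row i of e is a combination of the rows of h, and by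
  Cramer's rule only the multiple of row i of h survives in the i-th determinant.\<close>

lemma sum_det_replace_row:
  fixes h e :: "complex ^ 'n ^ 'n::finite"
  assumes "invertible h"
  shows "(\<Sum>i\<in>UNIV. det (\<chi> k. if k = i then e $ i else h $ k)) =
    det h * (\<Sum>i\<in>UNIV. \<Sum>j\<in>UNIV. inv_metric h i j * e $ i $ j)"
proof -
  \<comment> \<open>The coefficients of the rows of e in terms of the rows of h; the sum of
    determinants is det h times the trace of X.\<close>
  define X where "X = e ** matrix_inv h"
  have e: "e = X ** h"
    by (simp add: X_def matrix_inv[OF assms] flip: matrix_mul_assoc)
  have row: "e $ i = (\<Sum>k\<in>UNIV. (X $ i) $ k *s row k h)" for i
    unfolding e by (simp add: vec_eq_iff matrix_matrix_mult_def row_def sum_component)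
  have "det (\<chi> k. if k = i then e $ i else h $ k) = X $ i $ i * det h" for i
  proof -
    have "(\<chi> k. if k = i then e $ i else h $ k) =
      (\<chi> k. if k = i then (\<Sum>k\<in>UNIV. (X $ i) $ k *s row k h) else row k h)"
      using row[of i] by (simp add: vec_eq_iff row_def)
    then show ?thesis using cramer_lemma_transpose[of i "X $ i" h] by simp
  qed
  moreover have "X $ i $ i = (\<Sum>j\<in>UNIV. inv_metric h i j * e $ i $ j)" for i
    by (simp add: X_def matrix_matrix_mult_def inv_metric_eq[OF assms] mult.commute)
  ultimately show ?thesis by (simp add: sum_distrib_left mult.commute)
qed

lemma has_derivative_det:
  fixes h :: "'a::real_normed_vector \<Rightarrow> complex ^ 'n ^ 'n::finite"
  assumes "(h has_derivative h') (at x)"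
  shows "((\<lambda>x. det (h x)) has_derivative
    (\<lambda>v. \<Sum>i\<in>UNIV. det (\<chi> k. if k = i then h' v $ i else h x $ k))) (at x)"
proof -
  have ent: "((\<lambda>x. h x $ i $ j) has_derivative (\<lambda>v. h' v $ i $ j)) (at x)" for i j
    by (intro bounded_linear.has_derivative[OF bounded_linear_vec_nth] assms)
  have row: "(\<Prod>k\<in>UNIV. (\<chi> k. if k = i then h' v $ i else h x $ k) $ k $ p k) =
     h' v $ i $ p i * (\<Prod>k\<in>UNIV - {i}. h x $ k $ p k)" for i v p
    by (subst prod.remove[of _ i]) (auto intro!: prod.cong)
  have "((\<lambda>x. det (h x)) has_derivative (\<lambda>v. \<Sum>p | p permutes UNIV. of_int (sign p) *
      (\<Sum>i\<in>UNIV. h' v $ i $ p i * (\<Prod>k\<in>UNIV - {i}. h x $ k $ p k)))) (at x)"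
    unfolding det_def
    by (intro has_derivative_sum has_derivative_mult_right has_derivative_prod ent)
  also have "(\<lambda>v. \<Sum>p | p permutes UNIV. of_int (sign p) *
      (\<Sum>i\<in>UNIV. h' v $ i $ p i * (\<Prod>k\<in>UNIV - {i}. h x $ k $ p k))) =
    (\<lambda>v. \<Sum>i\<in>UNIV. det (\<chi> k. if k = i then h' v $ i else h x $ k))"
    unfolding det_def row by (subst sum.swap) (simp add: sum_distrib_left)
  finally show ?thesis .
qed

lemma wirt_det:
  fixes h :: "complex ^ 'n \<Rightarrow> complex ^ 'n ^ 'n::finite"
  assumes "h differentiable at z" "invertible (h z)"
  shows "wirt i (\<lambda>w. det (h w)) z =
    det (h z) * (\<Sum>k\<in>UNIV. \<Sum>q\<in>UNIV. inv_metric (h z) k q * wirt i (\<lambda>w. h w $ k $ q) z)"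
proof -
  note H = frechet_derivative_works'[OF assms(1)]
  have ent: "((\<lambda>w. h w $ k $ q) has_derivative (\<lambda>v. frechet_derivative h (at z) v $ k $ q)) (at z)" for k q
    by (intro bounded_linear.has_derivative[OF bounded_linear_vec_nth] H)
  show ?thesis
    unfolding wirt_has_derivative[OF has_derivative_det[OF H]] wirt_has_derivative[OF ent]
      sum_det_replace_row[OF assms(2)]
    by (simp add: algebra_simps sum_distrib_left sum_subtractf sum_divide_distrib diff_divide_distrib)
qed

lemma Ck_on_vec_nth: "open S \<Longrightarrow> Ck_on k S f \<Longrightarrow> Ck_on k S (\<lambda>x. f x $ i)"
  by (rule Ck_on_bounded_linear_compose[OF _ bounded_linear_vec_nth])

lemma Ck_on_det:
  fixes h :: "'a::real_normed_vector \<Rightarrow> complex ^ 'n ^ 'n::finite"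
  assumes "open S" "\<And>i j. Ck_on k S (\<lambda>x. h x $ i $ j)"
  shows "Ck_on k S (\<lambda>x. det (h x))"
  unfolding det_def by (intro Ck_on_sum Ck_on_mult Ck_on_const Ck_on_prod assms)

lemma cnj_det: "cnj (det h) = det (\<chi> i j. cnj (h $ i $ j))"
  by (simp add: det_def)

text \<open>Cramer's rule. It makes the entries of the inverse rational functions of those of h,
  hence as smooth as these.\<close>

lemma inv_metric_eq_det:
  fixes h :: "complex ^ 'n ^ 'n::finite"
  assumes "invertible h"
  shows "inv_metric h i j = det (\<chi> k. if k = i then axis j 1 else h $ k) / det h"
proof -
  \<comment> \<open>\<open>sum_det_replace_row\<close> is applied to the matrix whose only nonzero
    row is the i-th, equal to \<open>axis j 1\<close>; every other summand has a zero row.\<close>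
  have "(\<Sum>k\<in>UNIV. det (\<chi> l. if l = k then (\<chi> k. if k = i then axis j 1 else 0) $ k else h $ l)) =
     (\<Sum>k\<in>UNIV. if k = i then det (\<chi> l. if l = i then axis j 1 else h $ l) else 0)"
  proof (rule sum.cong)
    fix k :: 'n
    show "det (\<chi> l. if l = k then (\<chi> k. if k = i then axis j 1 else 0) $ k else h $ l) =
      (if k = i then det (\<chi> l. if l = i then axis j 1 else h $ l) else 0)"
      by (cases "k = i") (auto intro!: arg_cong[of _ _ det] det_zero_row[of k] simp: vec_eq_iff row_def)
  qed simp
  also have "\<dots> = det (\<chi> l. if l = i then axis j 1 else h $ l)" by simp
  also have "(\<Sum>k\<in>UNIV. det (\<chi> l. if l = k then (\<chi> k. if k = i then axis j 1 else 0) $ k else h $ l)) =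
     det h * inv_metric h i j"
    unfolding sum_det_replace_row[OF assms]
    by (simp add: if_distrib[where f = "\<lambda>x. x $ _"] axis_def if_distrib[where f = "\<lambda>x. _ * x"] sum.If_cases cong: if_cong)
  finally show ?thesis using assms by (simp add: invertible_det_nz field_simps)
qed

lemma Ck_on_inv_metric:
  fixes h :: "'a::real_normed_vector \<Rightarrow> complex ^ 'n ^ 'n::finite"
  assumes "open S" "\<And>i j. Ck_on k S (\<lambda>x. h x $ i $ j)" "\<And>x. x \<in> S \<Longrightarrow> invertible (h x)"
  shows "Ck_on k S (\<lambda>x. inv_metric (h x) i j)"
proof (rule Ck_on_cong_imp[OF assms(1)])
  show "det (\<chi> k. if k = i then axis j 1 else h x $ k) / det (h x) = inv_metric (h x) i j" if "x \<in> S" for x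
    using inv_metric_eq_det[OF assms(3)[OF that]] by simp
  have ent: "Ck_on k S (\<lambda>x. (\<chi> k. if k = i then axis j 1 else h x $ k) $ a $ b)" for a b
    by (cases "a = i") (simp_all add: assms(2))
  show "Ck_on k S (\<lambda>x. det (\<chi> k. if k = i then axis j 1 else h x $ k) / det (h x))"
    using assms(3) by (intro Ck_on_divide Ck_on_det assms(1,2) ent) (auto simp: invertible_det_nz)
qed

section \<open>Positive definite Hermitian matrices\<close>

lemma herm_form_mult:
  "herm_form h u v = (\<Sum>j\<in>UNIV. (\<Sum>i\<in>UNIV. h $ i $ j * u $ i) * cnj (v $ j))"
  unfolding herm_form_def by (subst sum.swap) (simp add: sum_distrib_right)

lemma pos_def_hermitian_cnj: "pos_def_hermitian h \<Longrightarrow> cnj (h $ i $ j) = h $ j $ i"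
  by (metis pos_def_hermitian_def)

lemma pos_def_hermitian_pos: "pos_def_hermitian h \<Longrightarrow> v \<noteq> 0 \<Longrightarrow> 0 < Re (herm_form h v v)"
  by (simp add: pos_def_hermitian_def)

lemma pos_def_hermitian_invertible:
  fixes h :: "complex ^ 'n ^ 'n::finite"
  assumes "pos_def_hermitian h"
  shows "invertible h"
proof (rule ccontr)
  assume "\<not> invertible h"
  then have "det h = 0" by (simp add: invertible_det_nz)
  then have "\<not> inj ((*v) h)"
    using det_nz_iff_inj_gen[OF matrix_vector_mul_linear_gen, of h] by simp
  then obtain x y where "x \<noteq> y" "h *v x = h *v y" by (auto simp: inj_on_def)
  then have v: "h *v (x - y) = 0" "x - y \<noteq> 0" by (simp_all add: matrix_vector_mult_diff_distrib)
  define v where "v = x - y"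
  \<comment> \<open>\<open>herm_form\<close> conjugates its second argument, so the kernel vector
    has to enter through its conjugate.\<close>
  define u where "u = (\<chi> i. cnj (v $ i))"
  have "u \<noteq> 0" using v(2) by (auto simp: u_def v_def vec_eq_iff)
  moreover have "herm_form h u u = (\<Sum>i\<in>UNIV. u $ i * (h *v v) $ i)"
    by (simp add: herm_form_def u_def matrix_vector_mult_def sum_distrib_left algebra_simps)
  moreover have "h *v v = 0" using v by (simp add: v_def)
  ultimately show False using pos_def_hermitian_pos[OF assms, of u] by simp
qed

lemma pos_def_hermitian_det_real:
  assumes "pos_def_hermitian h"
  shows "Im (det h) = 0"
proof -
  have "(\<chi> i j. cnj (h $ i $ j)) = transpose h"
    by (simp add: vec_eq_iff transpose_def pos_def_hermitian_cnj[OF assms])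
  then have "cnj (det h) = det h" by (simp add: cnj_det)
  then show ?thesis by (simp add: complex_eq_iff)
qed

lemma herm_form_mat_1: "herm_form (mat 1) u v = (\<Sum>i\<in>UNIV. u $ i * cnj (v $ i))"
proof -
  have "mat 1 $ i $ j * u $ i * cnj (v $ j) = (if i = j then u $ i * cnj (v $ j) else 0)" for i j
    by (simp add: mat_def)
  then show ?thesis by (simp add: herm_form_def)
qed

lemma pos_def_hermitian_mat_1: "pos_def_hermitian (mat 1 :: complex ^ 'n ^ 'n::finite)"
proof -
  have "herm_form (mat 1) v v = (\<Sum>i\<in>UNIV. complex_of_real ((cmod (v $ i))\<^sup>2))" for v :: "complex ^ 'n"
    by (simp add: herm_form_mat_1 flip: complex_norm_square)
  then have "Re (herm_form (mat 1) v v) = (\<Sum>i\<in>UNIV. (cmod (v $ i))\<^sup>2)" for v :: "complex ^ 'n"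
    by simp
  moreover have "(\<Sum>i\<in>UNIV. (cmod (v $ i))\<^sup>2) > 0" if v: "v \<noteq> 0" for v :: "complex ^ 'n"
  proof -
    obtain i where "v $ i \<noteq> 0" using v by (auto simp: vec_eq_iff)
    then show ?thesis by (intro sum_pos2[of _ i]) auto
  qed
  ultimately show ?thesis by (auto simp: pos_def_hermitian_def mat_def)
qed

lemma herm_form_add_scale:
  "herm_form (a *\<^sub>R g + b *\<^sub>R h) u v = of_real a * herm_form g u v + of_real b * herm_form h u v"
  by (simp add: herm_form_def scaleR_conv_of_real[where 'a = complex] algebra_simps sum.distrib sum_distrib_left)

text \<open>Keeps the segment from the identity matrix to h among the invertible matrices, which
  decides the sign of the determinant.\<close>

lemma pos_def_hermitian_convex:
  assumes "pos_def_hermitian g" "pos_def_hermitian h" "0 \<le> a" "0 \<le> b" "a + b = 1"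
  shows "pos_def_hermitian (a *\<^sub>R g + b *\<^sub>R h)"
proof -
  have "Re (herm_form (a *\<^sub>R g + b *\<^sub>R h) v v) > 0" if v: "v \<noteq> 0" for v
  proof -
    have "0 < Re (herm_form g v v)" "0 < Re (herm_form h v v)"
      using assms v by (auto intro: pos_def_hermitian_pos)
    moreover have "0 < a \<or> 0 < b" using assms by linarith
    ultimately show ?thesis using assms(3,4)
      by (auto simp: herm_form_add_scale intro: add_pos_nonneg add_nonneg_pos)
  qed
  then show ?thesis
    unfolding pos_def_hermitian_def using assms by (simp add: pos_def_hermitian_cnj)
qed

lemma pos_def_hermitian_scale:
  assumes "pos_def_hermitian h" "0 < r"
  shows "pos_def_hermitian (r *\<^sub>R h)"
  unfolding pos_def_hermitian_def using assms herm_form_add_scale[of r h 0 h]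
  by (auto simp: pos_def_hermitian_cnj pos_def_hermitian_pos)

text \<open>The determinant cannot change sign along the segment from the identity matrix.\<close>

lemma pos_def_hermitian_det_pos:
  fixes h :: "complex ^ 'n ^ 'n::finite"
  assumes "pos_def_hermitian h"
  shows "Re (det h) > 0"
proof (rule ccontr)
  assume neg: "\<not> Re (det h) > 0"
  define d where "d t = Re (det ((1 - t) *\<^sub>R mat 1 + t *\<^sub>R h))" for t :: real
  have "continuous_on {0..1} d"
    unfolding d_def det_def by (intro continuous_intros)
  moreover have "d 0 = 1" "d 1 \<le> 0" using neg by (simp_all add: d_def)
  ultimately obtain t where t: "0 \<le> t" "t \<le> 1" "d t = 0"
    using IVT2'[of d 1 0 0] by auto
  have P: "pos_def_hermitian ((1 - t) *\<^sub>R mat 1 + t *\<^sub>R h)"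
    using t by (intro pos_def_hermitian_convex pos_def_hermitian_mat_1 assms) auto
  then have "det ((1 - t) *\<^sub>R mat 1 + t *\<^sub>R h) = 0"
    using pos_def_hermitian_det_real[OF P] t(3) by (simp add: d_def complex_eq_iff)
  then show False using pos_def_hermitian_invertible[OF P] by (simp add: invertible_det_nz)
qed

lemma pos_def_hermitian_det_of_real:
  assumes "pos_def_hermitian h" shows "det h = of_real (Re (det h))"
  using pos_def_hermitian_det_real[OF assms] by (simp add: complex_eq_iff)

text \<open>The conjugate transpose of the inverse is again an inverse of h, and inverses are
  unique.\<close>

lemma inv_metric_hermitian:
  assumes h: "pos_def_hermitian h"
  shows "inv_metric h j i = cnj (inv_metric h i j)"
proof -
  have inv: "invertible h" by (rule pos_def_hermitian_invertible[OF h])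
  have "h ** (\<chi> i j. cnj (matrix_inv h $ j $ i)) = mat 1"
  proof -
    have "(h ** (\<chi> i j. cnj (matrix_inv h $ j $ i))) $ a $ b = cnj ((matrix_inv h ** h) $ b $ a)" for a b
      by (simp add: matrix_matrix_mult_def pos_def_hermitian_cnj[OF h] mult.commute)
    then show ?thesis by (simp add: vec_eq_iff matrix_inv[OF inv] mat_def)
  qed
  then have "matrix_inv h = (\<chi> i j. cnj (matrix_inv h $ j $ i))" by (rule matrix_inv_unique)
  then have "matrix_inv h $ i $ j = cnj (matrix_inv h $ j $ i)" by (metis vec_lambda_beta)
  then show ?thesis by (simp add: inv_metric_eq[OF inv])
qed

text \<open>The substitution u = h x turns the form of the inverse into the form of h at the
  conjugate of x.\<close>

lemma inv_metric_pos:
  fixes u :: "complex ^ 'n::finite"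
  assumes h: "pos_def_hermitian h" and u: "u \<noteq> 0"
  shows "Re (\<Sum>i\<in>UNIV. \<Sum>j\<in>UNIV. inv_metric h i j * u $ i * cnj (u $ j)) > 0"
proof -
  have inv: "invertible h" by (rule pos_def_hermitian_invertible[OF h])
  define x where "x = matrix_inv h *v u"
  have hx: "h *v x = u" by (simp add: x_def matrix_vector_mul_assoc matrix_inv[OF inv])
  define y where "y = (\<chi> i. cnj (x $ i))"
  have "x \<noteq> 0" using hx u by auto
  then have "y \<noteq> 0" by (simp add: y_def vec_eq_iff)
  then have "Re (herm_form h y y) > 0" by (rule pos_def_hermitian_pos[OF h])
  also have "herm_form h y y = (\<Sum>j\<in>UNIV. x $ j * cnj (u $ j))"
  proof -
    have "herm_form h y y = (\<Sum>j\<in>UNIV. x $ j * cnj (\<Sum>i\<in>UNIV. h $ j $ i * x $ i))"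
      unfolding herm_form_mult y_def
      by (intro sum.cong) (simp_all add: pos_def_hermitian_cnj[OF h] mult.commute)
    also have "\<dots> = (\<Sum>j\<in>UNIV. x $ j * cnj (u $ j))"
      by (simp add: hx[symmetric] matrix_vector_mult_def)
    finally show ?thesis .
  qed
  also have "\<dots> = (\<Sum>i\<in>UNIV. \<Sum>j\<in>UNIV. inv_metric h i j * u $ i * cnj (u $ j))"
    by (subst sum.swap) (simp add: x_def matrix_vector_mult_def inv_metric_eq[OF inv] sum_distrib_right)
  finally show ?thesis .
qed

lemma inv_metric_scale:
  fixes h :: "complex ^ 'n ^ 'n::finite"
  assumes "invertible h" "r \<noteq> 0"
  shows "inv_metric (r *\<^sub>R h) i j = of_real (inverse r) * inv_metric h i j"
proof -
  have 1: "(r *\<^sub>R h) ** (inverse r *\<^sub>R matrix_inv h) = mat 1"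
  proof -
    have "(r *\<^sub>R h) ** (inverse r *\<^sub>R matrix_inv h) = h ** matrix_inv h"
      using assms(2) by (simp add: vec_eq_iff matrix_matrix_mult_def)
    then show ?thesis by (simp add: matrix_inv[OF assms(1)])
  qed
  then have "invertible (r *\<^sub>R h)" using matrix_left_right_inverse unfolding invertible_def by blast
  then show ?thesis
    by (simp add: inv_metric_eq assms(1) matrix_inv_unique[OF 1]) (simp add: scaleR_conv_of_real)
qed

lemma det_scaleR:
  fixes h :: "complex ^ 'n ^ 'n::finite"
  shows "det (r *\<^sub>R h) = of_real r ^ CARD('n) * det h"
  by (simp add: det_def prod.distrib scaleR_conv_of_real[where 'a = complex] sum_distrib_left algebra_simps)

section \<open>Powers of the fundamental form\<close>

text \<open>For fixed \<tau>, the permutation acting as \<tau> on the last l places is absorbed into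
  \<sigma> by right translation. This costs a factor sign \<tau>, which meets the one already
  present, so all \<tau> contribute equally. It is the combinatorial core of the associativity of
  the wedge product.\<close>

lemma sum_permutations_merge:
  fixes F :: "(nat \<Rightarrow> nat) \<Rightarrow> complex"
  shows "(\<Sum>\<sigma> | \<sigma> permutes {..<k + l}. of_int (sign \<sigma>) *
      (\<Sum>\<tau> | \<tau> permutes {..<l}. of_int (sign \<tau>) * F (\<lambda>i. if i < k then \<sigma> i else \<sigma> (k + \<tau> (i - k))))) =
    fact l * (\<Sum>\<sigma> | \<sigma> permutes {..<k + l}. of_int (sign \<sigma>) * F \<sigma>)"
proof -
  define sh where "sh \<tau> = map_permutation {..<l} ((+) k) \<tau>" for \<tau> :: "nat \<Rightarrow> nat"
  have inj: "inj_on ((+) k) {..<l}" by (simp add: inj_on_def)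
  have bij: "bij_betw ((+) k) {..<l} {k..<k + l}"
    by (rule bij_betwI[of _ _ _ "\<lambda>i. i - k"]) auto
  have sh_perm: "sh \<tau> permutes {..<k + l}" if "\<tau> permutes {..<l}" for \<tau>
    using map_permutation_permutes[OF bij that] unfolding sh_def by (rule permutes_subset) auto
  have sh_sign: "sign (sh \<tau>) = sign \<tau>" if "\<tau> permutes {..<l}" for \<tau>
    unfolding sh_def by (rule sign_map_permutation[OF inj that]) simp
  have sh_apply: "(\<lambda>i. if i < k then \<sigma> i else \<sigma> (k + \<tau> (i - k))) = \<sigma> \<circ> sh \<tau>"
    if \<tau>: "\<tau> permutes {..<l}" for \<sigma> \<tau> :: "nat \<Rightarrow> nat"
  proof
    fix i
    consider "i < k" | "k \<le> i" "i < k + l" | "k + l \<le> i" by linarith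
    then show "(if i < k then \<sigma> i else \<sigma> (k + \<tau> (i - k))) = (\<sigma> \<circ> sh \<tau>) i"
    proof cases
      case 1
      then have "sh \<tau> i = i"
        using map_permutation_permutes[OF bij \<tau>] unfolding sh_def by (auto simp: permutes_def)
      then show ?thesis using 1 by simp
    next
      case 2
      then have "sh \<tau> (k + (i - k)) = k + \<tau> (i - k)"
        unfolding sh_def by (intro map_permutation_apply[OF inj]) auto
      then show ?thesis using 2 by simp
    next
      case 3
      then have "sh \<tau> i = i" "\<tau> (i - k) = i - k"
        using map_permutation_permutes[OF bij \<tau>] \<tau> unfolding sh_def by (auto simp: permutes_def)
      then show ?thesis using 3 by simp
    qed
  qed
  have inner: "(\<Sum>\<sigma> | \<sigma> permutes {..<k + l}. of_int (sign \<sigma>) * (of_int (sign \<tau>) * F (\<sigma> \<circ> sh \<tau>))) =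
      (\<Sum>\<sigma> | \<sigma> permutes {..<k + l}. of_int (sign \<sigma>) * F \<sigma>)" if \<tau>: "\<tau> permutes {..<l}" for \<tau>
  proof -
    have "sign (\<sigma> \<circ> sh \<tau>) = sign \<sigma> * sign \<tau>" if "\<sigma> permutes {..<k + l}" for \<sigma>
      using sign_compose[of \<sigma> "sh \<tau>"] permutes_imp_permutation[OF _ that]
        permutes_imp_permutation[OF _ sh_perm[OF \<tau>]] sh_sign[OF \<tau>] by simp
    then show ?thesis
      by (subst (2) sum_permutations_compose_right[OF sh_perm[OF \<tau>]]) (simp add: mult.assoc)
  qed
  have "(\<Sum>\<sigma> | \<sigma> permutes {..<k + l}. of_int (sign \<sigma>) *
      (\<Sum>\<tau> | \<tau> permutes {..<l}. of_int (sign \<tau>) * F (\<lambda>i. if i < k then \<sigma> i else \<sigma> (k + \<tau> (i - k))))) =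
    (\<Sum>\<tau> | \<tau> permutes {..<l}. \<Sum>\<sigma> | \<sigma> permutes {..<k + l}. of_int (sign \<sigma>) * (of_int (sign \<tau>) * F (\<sigma> \<circ> sh \<tau>)))"
    by (subst sum.swap) (simp add: sum_distrib_left sh_apply del: comp_apply)
  also have "\<dots> = (\<Sum>\<tau> | \<tau> permutes {..<l}. \<Sum>\<sigma> | \<sigma> permutes {..<k + l}. of_int (sign \<sigma>) * F \<sigma>)"
    by (rule sum.cong[OF refl]) (simp only: inner mem_Collect_eq)
  also have "\<dots> = fact l * (\<Sum>\<sigma> | \<sigma> permutes {..<k + l}. of_int (sign \<sigma>) * F \<sigma>)"
    using card_permutations[of "{..<l}" l] by simp
  finally show ?thesis .
qed

text \<open>Wedging with an alternated form alternates twice, and the inner alternation contributes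
  exactly the factor l! that \<open>wedge\<close> divides by. The hypothesis on \<alpha> lets the
  remaining arguments be rearranged freely.\<close>

lemma wedge_alternation:
  assumes "\<And>u u'. (\<And>i. i < k \<Longrightarrow> u i = u' i) \<Longrightarrow> \<alpha> u = \<alpha> u'"
  shows "wedge k l \<alpha> (\<lambda>u. \<Sum>\<tau> | \<tau> permutes {..<l}. of_int (sign \<tau>) * B (\<lambda>i. u (\<tau> i))) v =
    (\<Sum>\<sigma> | \<sigma> permutes {..<k + l}. of_int (sign \<sigma>) * (\<alpha> (\<lambda>i. v (\<sigma> i)) * B (\<lambda>i. v (\<sigma> (k + i))))) / fact k"
proof -
  define F where "F \<sigma> = \<alpha> (\<lambda>i. v (\<sigma> i)) * B (\<lambda>i. v (\<sigma> (k + i)))" for \<sigma> :: "nat \<Rightarrow> nat"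
  have "F (\<lambda>i. if i < k then \<sigma> i else \<sigma> (k + \<tau> (i - k))) = \<alpha> (\<lambda>i. v (\<sigma> i)) * B (\<lambda>i. v (\<sigma> (k + \<tau> i)))" for \<sigma> \<tau>
    unfolding F_def using assms[of "\<lambda>i. v (if i < k then \<sigma> i else \<sigma> (k + \<tau> (i - k)))" "\<lambda>i. v (\<sigma> i)"] by simp
  then have "wedge k l \<alpha> (\<lambda>u. \<Sum>\<tau> | \<tau> permutes {..<l}. of_int (sign \<tau>) * B (\<lambda>i. u (\<tau> i))) v =
    (\<Sum>\<sigma> | \<sigma> permutes {..<k + l}. of_int (sign \<sigma>) *
      (\<Sum>\<tau> | \<tau> permutes {..<l}. of_int (sign \<tau>) * F (\<lambda>i. if i < k then \<sigma> i else \<sigma> (k + \<tau> (i - k))))) / (fact k * fact l)"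
    by (simp add: wedge_def sum_distrib_left algebra_simps)
  then show ?thesis unfolding sum_permutations_merge by (simp add: F_def)
qed

lemma permutes_lessThan_2: "{\<sigma>. \<sigma> permutes {..<2::nat}} = {id, Transposition.transpose 0 1}"
proof -
  have "{..<2::nat} = {0, 1}" by auto
  then show ?thesis by (auto simp: permutes_doubleton_iff)
qed

lemma fund_form_eq: "fund_form h v = \<i> * (herm_form h (v 0) (v 1) - herm_form h (v 1) (v 0))"
proof -
  have ne: "id \<noteq> Transposition.transpose (0::nat) 1" by (metis id_apply transpose_apply_first zero_neq_one)
  have "wedge 1 1 (dz i) (dzbar j) v = v 0 $ i * cnj (v 1 $ j) - v 1 $ i * cnj (v 0 $ j)" for i j
    unfolding wedge_def one_add_one permutes_lessThan_2
    using ne by (simp add: dz_def dzbar_def sign_swap_id)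
  then have *: "wedge 1 1 (dz i) (dzbar j) v = v 0 $ i * cnj (v 1 $ j) - v 1 $ i * cnj (v 0 $ j)" for i j .
  show ?thesis
    unfolding fund_form_def * by (simp add: herm_form_def algebra_simps sum_subtractf sum_distrib_left)
qed

text \<open>The integrand of the m-th power of the fundamental form before alternation, up to the
  factor i^m.\<close>

definition herm_prod :: "nat \<Rightarrow> complex ^ 'n ^ 'n::finite \<Rightarrow> (nat \<Rightarrow> complex ^ 'n) \<Rightarrow> complex" where
  "herm_prod m h u = (\<Prod>k<m. herm_form h (u (2 * k)) (u (2 * k + 1)))"

lemma wedge_power_fund_form:
  "wedge_power 2 (fund_form h) m v =
    (\<Sum>\<sigma> | \<sigma> permutes {..<2 * m}. of_int (sign \<sigma>) * (\<i> ^ m * herm_prod m h (\<lambda>i. v (\<sigma> i))))"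
proof (induction m arbitrary: v)
  case 0
  then show ?case by (simp add: herm_prod_def)
next
  case (Suc m)
  let ?P = "{\<sigma>. \<sigma> permutes {..<2 + 2 * m}}"
  define G where "G \<sigma> = herm_form h (v (\<sigma> 0)) (v (\<sigma> 1)) * herm_prod m h (\<lambda>i. v (\<sigma> (2 + i)))" for \<sigma>
  define t where "t = Transposition.transpose (0::nat) 1"
  have t: "t permutes {..<2 + 2 * m}" unfolding t_def by (rule permutes_swap_id) auto
  have tval: "t 0 = 1" "t (Suc 0) = 0" "\<And>i. t (Suc (Suc i)) = Suc (Suc i)"
    by (simp_all add: t_def Transposition.transpose_def)
  have sgn: "sign (\<sigma> \<circ> t) = - sign \<sigma>" if "\<sigma> permutes {..<2 + 2 * m}" for \<sigma>
    using that by (simp add: t_def sign_compose permutes_imp_permutation[OF finite_lessThan] permutation_swap_id sign_swap_id)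
  \<comment> \<open>The two terms of \<open>fund_form_eq\<close> differ by exchanging the first two
    arguments, so after alternation they contribute equally; the resulting factor 2 cancels
    \<open>fact 2\<close>.\<close>
  have swap: "(\<Sum>\<sigma>\<in>?P. of_int (sign \<sigma>) * (herm_form h (v (\<sigma> 1)) (v (\<sigma> 0)) * herm_prod m h (\<lambda>i. v (\<sigma> (2 + i))))) =
      - (\<Sum>\<sigma>\<in>?P. of_int (sign \<sigma>) * G \<sigma>)"
    by (subst sum_permutations_compose_right[OF t])
       (simp add: sgn G_def tval sum_negf del: comp_apply add: comp_apply[of _ t])
  have step: "wedge_power 2 (fund_form h) (Suc m) v =
     (\<Sum>\<sigma>\<in>?P. of_int (sign \<sigma>) * (fund_form h (\<lambda>i. v (\<sigma> i)) * (\<i> ^ m * herm_prod m h (\<lambda>i. v (\<sigma> (2 + i)))))) / fact 2"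
    unfolding wedge_power.simps Suc.IH[abs_def]
    by (rule wedge_alternation[where B = "\<lambda>u. \<i> ^ m * herm_prod m h u"]) (simp add: fund_form_eq)
  have "(\<Sum>\<sigma>\<in>?P. of_int (sign \<sigma>) * (fund_form h (\<lambda>i. v (\<sigma> i)) * (\<i> ^ m * herm_prod m h (\<lambda>i. v (\<sigma> (2 + i))))))
      = \<i> ^ Suc m * ((\<Sum>\<sigma>\<in>?P. of_int (sign \<sigma>) * G \<sigma>) -
        (\<Sum>\<sigma>\<in>?P. of_int (sign \<sigma>) * (herm_form h (v (\<sigma> 1)) (v (\<sigma> 0)) * herm_prod m h (\<lambda>i. v (\<sigma> (2 + i))))))"
    unfolding fund_form_eq G_def sum_subtractf[symmetric] sum_distrib_left
    by (rule sum.cong) (auto simp: algebra_simps)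
  also have "\<dots> = 2 * (\<i> ^ Suc m * (\<Sum>\<sigma>\<in>?P. of_int (sign \<sigma>) * G \<sigma>))"
    unfolding swap by simp
  finally have "wedge_power 2 (fund_form h) (Suc m) v = \<i> ^ Suc m * (\<Sum>\<sigma>\<in>?P. of_int (sign \<sigma>) * G \<sigma>)"
    unfolding step by (simp add: fact_2)
  moreover have "G \<sigma> = herm_prod (Suc m) h (\<lambda>i. v (\<sigma> i))" for \<sigma>
    unfolding G_def herm_prod_def by (subst prod.lessThan_Suc_shift) simp
  ultimately show ?case by (simp add: sum_distrib_left mult.left_commute)
qed

section \<open>Forms of top degree and determinants\<close>

abbreviation idx :: "'n::finite \<Rightarrow> nat" where "idx \<equiv> to_nat_on UNIV"

lemma bij_idx: "bij_betw (idx :: 'n::finite \<Rightarrow> nat) UNIV {..<CARD('n)}"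
  by (rule to_nat_on_finite) simp

lemma idx_less [simp]: "idx (a :: 'n::finite) < CARD('n)"
  using bij_idx by (auto simp: bij_betw_def)

lemma idx_eq_iff [simp]: "idx (a :: 'n::finite) = idx b \<longleftrightarrow> a = b"
  using bij_idx by (auto simp: bij_betw_def inj_on_def)

lemma prod_lessThan_CARD: "(\<Prod>k<CARD('n::finite). g k) = (\<Prod>a\<in>(UNIV::'n set). g (idx a))"
  by (rule prod.reindex_bij_betw[OF bij_idx, symmetric])

lemma prod_sum_UNIV:
  fixes F :: "'n::finite \<Rightarrow> 'm::finite \<Rightarrow> 'a::comm_semiring_1"
  shows "(\<Prod>k\<in>UNIV. \<Sum>j\<in>UNIV. F k j) = (\<Sum>f\<in>UNIV. \<Prod>k\<in>UNIV. F k (f k))"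
  using prod_sum_PiE[of "UNIV :: 'n set" "\<lambda>_. UNIV :: 'm set" F] by (simp add: PiE_def)

text \<open>The wedge product of all dz_(f a) and dzbar_(g a), with a running through the index type
  in the order of \<open>idx\<close>; \<open>top_form id id\<close> is the standard form of top
  degree.\<close>

definition top_form :: "('n::finite \<Rightarrow> 'n) \<Rightarrow> ('n \<Rightarrow> 'n) \<Rightarrow> (nat \<Rightarrow> complex ^ 'n) \<Rightarrow> complex" where
  "top_form f g v = (\<Sum>\<sigma> | \<sigma> permutes {..<2 * CARD('n)}. of_int (sign \<sigma>) *
     (\<Prod>a\<in>UNIV. v (\<sigma> (2 * idx a)) $ f a * cnj (v (\<sigma> (2 * idx a + 1)) $ g a)))"

text \<open>Exchanging two values of f amounts to exchanging two even slots of \<sigma>, exchanging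
  two values of g to exchanging two odd ones; either changes the sign of \<sigma>.\<close>

lemma top_form_alternating:
  fixes f g :: "'n::finite \<Rightarrow> 'n"
  assumes "i \<noteq> j"
  shows "top_form (f \<circ> Transposition.transpose i j) g v = - top_form f g v"
    and "top_form f (g \<circ> Transposition.transpose i j) v = - top_form f g v"
proof -
  define s where "s = Transposition.transpose i j"
  have s: "bij s" by (simp add: s_def)
  have *: "(\<Sum>\<sigma> | \<sigma> permutes {..<2 * CARD('n)}. of_int (sign \<sigma>) * X (\<sigma> \<circ> Transposition.transpose p q)) =
     - (\<Sum>\<sigma> | \<sigma> permutes {..<2 * CARD('n)}. of_int (sign \<sigma>) * X \<sigma>)"
    if pq: "p < 2 * CARD('n)" "q < 2 * CARD('n)" "p \<noteq> q" for p q and X :: "(nat \<Rightarrow> nat) \<Rightarrow> complex"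
  proof -
    have "Transposition.transpose p q permutes {..<2 * CARD('n)}"
      using pq by (intro permutes_swap_id) auto
    moreover have "sign (\<sigma> \<circ> Transposition.transpose p q) = - sign \<sigma>" if "\<sigma> permutes {..<2 * CARD('n)}" for \<sigma>
      using that pq by (simp add: sign_compose permutes_imp_permutation[OF finite_lessThan] permutation_swap_id sign_swap_id)
    ultimately show ?thesis
      by (subst (2) sum_permutations_compose_right) (assumption, simp add: sum_negf del: comp_apply)
  qed
  have lt: "2 * idx i < 2 * CARD('n)" "2 * idx j < 2 * CARD('n)" "2 * idx i + 1 < 2 * CARD('n)" "2 * idx j + 1 < 2 * CARD('n)"
    using idx_less[of i] idx_less[of j] by linarith+
  have neq: "Suc (2 * x) \<noteq> 2 * y" "2 * y \<noteq> Suc (2 * x)" for x y :: nat by presburger+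
  have even: "Transposition.transpose (2 * idx i) (2 * idx j) (2 * idx a) = 2 * idx (s a)"
    "Transposition.transpose (2 * idx i) (2 * idx j) (2 * idx a + 1) = 2 * idx a + 1" for a
    by (auto simp: Transposition.transpose_def s_def neq)
  have odd: "Transposition.transpose (2 * idx i + 1) (2 * idx j + 1) (2 * idx a + 1) = 2 * idx (s a) + 1"
    "Transposition.transpose (2 * idx i + 1) (2 * idx j + 1) (2 * idx a) = 2 * idx a" for a
    by (auto simp: Transposition.transpose_def s_def neq)
  have ss: "s (s a) = a" for a by (simp add: s_def)
  have 1: "(\<Prod>a\<in>UNIV. v (\<sigma> (2 * idx a)) $ (f \<circ> s) a * cnj (v (\<sigma> (2 * idx a + 1)) $ g a)) =
    (\<Prod>a\<in>UNIV. v ((\<sigma> \<circ> Transposition.transpose (2 * idx i) (2 * idx j)) (2 * idx a)) $ f a *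
      cnj (v ((\<sigma> \<circ> Transposition.transpose (2 * idx i) (2 * idx j)) (2 * idx a + 1)) $ g a))" for \<sigma>
  proof -
    have "(\<Prod>a\<in>UNIV. v (\<sigma> (2 * idx a)) $ f (s a)) = (\<Prod>a\<in>UNIV. v (\<sigma> (2 * idx (s a))) $ f a)"
      using prod.reindex_bij_betw[OF s, of "\<lambda>a. v (\<sigma> (2 * idx (s a))) $ f a"] by (simp add: ss)
    then show ?thesis unfolding prod.distrib comp_apply even by simp
  qed
  have 2: "(\<Prod>a\<in>UNIV. v (\<sigma> (2 * idx a)) $ f a * cnj (v (\<sigma> (2 * idx a + 1)) $ (g \<circ> s) a)) =
    (\<Prod>a\<in>UNIV. v ((\<sigma> \<circ> Transposition.transpose (2 * idx i + 1) (2 * idx j + 1)) (2 * idx a)) $ f a *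
      cnj (v ((\<sigma> \<circ> Transposition.transpose (2 * idx i + 1) (2 * idx j + 1)) (2 * idx a + 1)) $ g a))" for \<sigma>
  proof -
    have "(\<Prod>a\<in>UNIV. cnj (v (\<sigma> (2 * idx a + 1)) $ g (s a))) = (\<Prod>a\<in>UNIV. cnj (v (\<sigma> (2 * idx (s a) + 1)) $ g a))"
      using prod.reindex_bij_betw[OF s, of "\<lambda>a. cnj (v (\<sigma> (2 * idx (s a) + 1)) $ g a)"] by (simp add: ss)
    then show ?thesis unfolding prod.distrib comp_apply odd by simp
  qed
  show "top_form (f \<circ> Transposition.transpose i j) g v = - top_form f g v"
    unfolding top_form_def s_def[symmetric] 1
    by (rule *[where X = "\<lambda>\<sigma>. \<Prod>a\<in>UNIV. v (\<sigma> (2 * idx a)) $ f a * cnj (v (\<sigma> (2 * idx a + 1)) $ g a)"])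
       (use lt assms in auto)
  show "top_form f (g \<circ> Transposition.transpose i j) v = - top_form f g v"
    unfolding top_form_def s_def[symmetric] 2
    by (rule *[where X = "\<lambda>\<sigma>. \<Prod>a\<in>UNIV. v (\<sigma> (2 * idx a)) $ f a * cnj (v (\<sigma> (2 * idx a + 1)) $ g a)"])
       (use lt assms in auto)
qed

text \<open>Expanding the product over entries, the sums over g and f collapse because
  \<open>top_form\<close> alternates in both. The factor that remains is n! times the mixed
  discriminant of the matrices. Admitting different matrices gives access to omega^(n-1) wedged with
  a (1,1)-form.\<close>

lemma alternated_herm_form:
  fixes hs :: "'n::finite \<Rightarrow> complex ^ 'n ^ 'n"
  shows "(\<Sum>\<sigma> | \<sigma> permutes {..<2 * CARD('n)}. of_int (sign \<sigma>) *
      (\<Prod>a\<in>UNIV. herm_form (hs a) (v (\<sigma> (2 * idx a))) (v (\<sigma> (2 * idx a + 1))))) =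
    top_form id id v * (\<Sum>f | f permutes (UNIV :: 'n set). of_int (sign f) * det (\<chi> a. hs a $ f a))"
proof -
  have "(\<Prod>a\<in>UNIV. herm_form (hs a) (x a) (y a)) =
    (\<Sum>f\<in>UNIV. \<Sum>g\<in>UNIV. (\<Prod>a\<in>UNIV. hs a $ f a $ g a) * (\<Prod>a\<in>UNIV. x a $ f a * cnj (y a $ g a)))" for x y :: "'n \<Rightarrow> complex ^ 'n"
    unfolding herm_form_def prod_sum_UNIV by (simp add: prod.distrib mult.assoc)
  then have "(\<Sum>\<sigma> | \<sigma> permutes {..<2 * CARD('n)}. of_int (sign \<sigma>) *
      (\<Prod>a\<in>UNIV. herm_form (hs a) (v (\<sigma> (2 * idx a))) (v (\<sigma> (2 * idx a + 1))))) =
     (\<Sum>\<sigma> | \<sigma> permutes {..<2 * CARD('n)}. \<Sum>f\<in>UNIV. \<Sum>g\<in>UNIV. (\<Prod>a\<in>UNIV. hs a $ f a $ g a) *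
        (of_int (sign \<sigma>) * (\<Prod>a\<in>UNIV. v (\<sigma> (2 * idx a)) $ f a * cnj (v (\<sigma> (2 * idx a + 1)) $ g a))))"
    by (simp add: sum_distrib_left mult.left_commute)
  also have "\<dots> = (\<Sum>f\<in>UNIV. \<Sum>\<sigma> | \<sigma> permutes {..<2 * CARD('n)}. \<Sum>g\<in>UNIV. (\<Prod>a\<in>UNIV. hs a $ f a $ g a) *
        (of_int (sign \<sigma>) * (\<Prod>a\<in>UNIV. v (\<sigma> (2 * idx a)) $ f a * cnj (v (\<sigma> (2 * idx a + 1)) $ g a))))"
    by (rule sum.swap)
  also have "\<dots> = (\<Sum>f\<in>UNIV. \<Sum>g\<in>UNIV. (\<Prod>a\<in>UNIV. hs a $ f a $ g a) * top_form f g v)"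
    unfolding top_form_def by (rule sum.cong[OF refl], subst sum.swap) (simp add: sum_distrib_left)
  also have "\<dots> = (\<Sum>f\<in>UNIV. det (\<chi> a. hs a $ f a) * top_form f id v)"
    using sum_alternating_eq_det[of "\<lambda>g. top_form f g v" "\<chi> a. hs a $ f a" for f, OF top_form_alternating(2)]
    by simp
  also have "\<dots> = (\<Sum>f\<in>UNIV. if f permutes UNIV then top_form id id v * (of_int (sign f) * det (\<chi> a. hs a $ f a)) else 0)"
    by (rule sum.cong[OF refl], subst alternating_eq_sign[of "\<lambda>f. top_form f id v", OF top_form_alternating(1)]) simp_all
  finally show ?thesis by (simp add: sum.If_cases sum_distrib_left)
qed

lemma alternated_herm_form_const:
  fixes h :: "complex ^ 'n ^ 'n::finite"
  shows "(\<Sum>\<sigma> | \<sigma> permutes {..<2 * CARD('n)}. of_int (sign \<sigma>) * herm_prod CARD('n) h (\<lambda>i. v (\<sigma> i))) =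
    fact CARD('n) * det h * top_form id id v"
proof -
  have "of_int (sign f) * det (\<chi> a. h $ f a) = det h" if "f permutes (UNIV :: 'n set)" for f
    using det_permute_rows[OF that, of h] by (simp flip: mult.assoc of_int_mult)
  then show ?thesis
    unfolding herm_prod_def prod_lessThan_CARD alternated_herm_form[of "\<lambda>_. h"]
    by (simp add: card_permutations)
qed

text \<open>Composing with the transposition of a and l matches the permutations that fix a with
  those sending a to l, so each value of f a occurs equally often.\<close>

lemma sum_permutes_apply:
  fixes g :: "'n::finite \<Rightarrow> complex"
  obtains N :: nat where "0 < N" "\<And>g :: 'n \<Rightarrow> complex. (\<Sum>f | f permutes (UNIV :: 'n set). g (f a)) = of_nat N * (\<Sum>l\<in>UNIV. g l)"
proof -
  define N where "N = card {f. f permutes (UNIV :: 'n set) \<and> f a = a}"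
  have card: "card {f. f permutes (UNIV :: 'n set) \<and> f a = l} = N" for l
    unfolding N_def
    by (rule bij_betw_same_card[of "(\<circ>) (Transposition.transpose l a)"], rule bij_betwI[of _ _ _ "(\<circ>) (Transposition.transpose l a)"])
       (auto simp: fun_eq_iff intro!: permutes_compose permutes_swap_id)
  have "0 < N" unfolding N_def by (auto simp: card_gt_0_iff intro!: exI[of _ id] permutes_id)
  moreover have "(\<Sum>f | f permutes (UNIV :: 'n set). g (f a)) = of_nat N * (\<Sum>l\<in>UNIV. g l)" for g :: "'n \<Rightarrow> complex"
  proof -
    have "(\<Sum>f | f permutes (UNIV :: 'n set). g (f a)) =
      (\<Sum>l\<in>UNIV. \<Sum>f\<in>{f \<in> {f. f permutes (UNIV :: 'n set)}. f a = l}. g (f a))"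
      by (rule sum.group[symmetric]) auto
    also have "\<dots> = (\<Sum>l\<in>UNIV. of_nat N * g l)"
      by (rule sum.cong) (simp_all add: card)
    finally show ?thesis by (simp add: sum_distrib_left)
  qed
  ultimately show ?thesis using that by blast
qed

text \<open>The polarised form of Jacobi's formula: one factor h is replaced by e, and summing over
  the permutations spreads the replaced row evenly over all rows.\<close>

lemma alternated_herm_form_mixed:
  fixes a :: "'n::finite"
  shows "\<exists>N :: nat. 0 < N \<and> (\<forall>h (e :: complex ^ 'n ^ 'n) v. invertible h \<longrightarrow>
    (\<Sum>\<sigma> | \<sigma> permutes {..<2 * CARD('n)}. of_int (sign \<sigma>) *
      (\<Prod>b\<in>UNIV. herm_form (if b = a then e else h) (v (\<sigma> (2 * idx b))) (v (\<sigma> (2 * idx b + 1))))) =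
    of_nat N * det h * (\<Sum>i\<in>UNIV. \<Sum>j\<in>UNIV. inv_metric h i j * e $ i $ j) * top_form id id v)"
proof -
  obtain N :: nat where N: "0 < N" "\<And>g :: 'n \<Rightarrow> complex. (\<Sum>f | f permutes (UNIV :: 'n set). g (f a)) = of_nat N * (\<Sum>l\<in>UNIV. g l)"
    using sum_permutes_apply by metis
  have "(\<Sum>\<sigma> | \<sigma> permutes {..<2 * CARD('n)}. of_int (sign \<sigma>) *
      (\<Prod>b\<in>UNIV. herm_form (if b = a then e else h) (v (\<sigma> (2 * idx b))) (v (\<sigma> (2 * idx b + 1))))) =
    of_nat N * det h * (\<Sum>i\<in>UNIV. \<Sum>j\<in>UNIV. inv_metric h i j * e $ i $ j) * top_form id id v"
    if h: "invertible h" for h e and v :: "nat \<Rightarrow> complex ^ 'n"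
  proof -
    have "of_int (sign f) * det (\<chi> b. (if b = a then e else h) $ f b) =
        det (\<chi> k. if k = f a then e $ f a else h $ k)" if f: "f permutes UNIV" for f
    proof -
      have "(\<chi> b. (if b = a then e else h) $ f b) = (\<chi> b. (\<chi> k. if k = f a then e $ f a else h $ k) $ f b)"
        using permutes_inj[OF f] by (auto simp: vec_eq_iff inj_eq)
      then show ?thesis using det_permute_rows[OF f, of "\<chi> k. if k = f a then e $ f a else h $ k"]
        by (simp flip: mult.assoc of_int_mult)
    qed
    then have "(\<Sum>f | f permutes (UNIV :: 'n set). of_int (sign f) * det (\<chi> b. (if b = a then e else h) $ f b)) =
       (\<Sum>f | f permutes (UNIV :: 'n set). det (\<chi> k. if k = f a then e $ f a else h $ k))"
      by simp
    also have "\<dots> = of_nat N * (\<Sum>l\<in>UNIV. det (\<chi> k. if k = l then e $ l else h $ k))"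
      by (rule N(2))
    finally show ?thesis
      unfolding alternated_herm_form[of "\<lambda>b. if b = a then e else h"] sum_det_replace_row[OF h]
      by simp
  qed
  then show ?thesis using N(1) by blast
qed

section \<open>The standard frame and the volume density\<close>

lemma from_nat_into_idx [simp]: "from_nat_into UNIV (idx (a :: 'n::finite)) = a"
  by (simp add: from_nat_into_to_nat_on)

lemma idx_surj: "k < CARD('n::finite) \<Longrightarrow> \<exists>a :: 'n. idx a = k"
  using bij_betw_imp_surj_on[OF bij_idx[where 'n = 'n]] by (metis imageE lessThan_iff)

lemma div_2_cases:
  fixes x k :: nat
  assumes "x div 2 = k"
  shows "x \<noteq> 2 * k \<Longrightarrow> x = Suc (2 * k)" "x \<noteq> Suc (2 * k) \<Longrightarrow> x = 2 * k"
  using assms by presburger+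

lemma real_frame_even [simp]: "real_frame (2 * idx (a :: 'n::finite)) = axis a 1"
  by (simp add: real_frame_def)

lemma real_frame_odd [simp]: "real_frame (Suc (2 * idx (a :: 'n::finite))) = axis a \<i>"
  by (simp add: real_frame_def)

lemma nat_less_double_cases:
  assumes "k < 2 * CARD('n::finite)"
  obtains a :: "'n::finite" where "k = 2 * idx a" | a :: "'n::finite" where "k = Suc (2 * idx a)"
proof -
  have "k div 2 < CARD('n)" using assms by auto
  then obtain a :: 'n where "idx a = k div 2" using idx_surj by blast
  then have "k = 2 * idx a \<or> k = Suc (2 * idx a)" using div_2_cases(1)[of k "idx a"] by auto
  then show thesis using that by blast
qed

lemma real_frame_nth:
  assumes "k < 2 * CARD('n::finite)"
  shows "real_frame k $ (a :: 'n::finite) = (if k div 2 = idx a then if even k then 1 else \<i> else 0)"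
  using nat_less_double_cases[OF assms] by cases (auto simp: axis_def)

text \<open>Only permutations preserving all pairs \<open>{2k, 2k+1}\<close> contribute to the value of a top form on
  the standard frame.  Swapping one pair flips both the sign and the product, so all contribute equally.\<close>

lemma top_form_term:
  fixes \<sigma> :: "nat \<Rightarrow> nat"
  defines "n \<equiv> CARD('n::finite)"
  assumes \<sigma>: "\<sigma> permutes {..<2 * n}"
    and good: "\<And>a :: 'n::finite. \<sigma> (2 * idx a) div 2 = idx a \<and> \<sigma> (Suc (2 * idx a)) div 2 = idx a"
  shows "of_int (sign \<sigma>) * (\<Prod>a\<in>(UNIV :: 'n::finite set). real_frame (\<sigma> (2 * idx a)) $ a * cnj (real_frame (\<sigma> (Suc (2 * idx a))) $ a)) = (- \<i>) ^ n"
  using \<sigma> good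
proof (induction "card {a :: 'n. \<sigma> (2 * idx a) \<noteq> 2 * idx a}" arbitrary: \<sigma>)
  case 0
  then have even: "\<sigma> (2 * idx a) = 2 * idx a" for a :: 'n by simp
  have odd: "\<sigma> (Suc (2 * idx a)) = Suc (2 * idx a)" for a :: 'n
  proof -
    have "\<sigma> (Suc (2 * idx a)) \<noteq> \<sigma> (2 * idx a)"
      using inj_eq[OF permutes_inj[OF "0.prems"(1)]] by simp
    then show ?thesis using div_2_cases(1)[of "\<sigma> (Suc (2 * idx a))" "idx a"] "0.prems"(2)[of a] even[of a] by simp
  qed
  have "\<sigma> k = k" for k
  proof (cases "k < 2 * n")
    case True
    then show ?thesis unfolding n_def by (cases rule: nat_less_double_cases) (simp_all add: even odd)
  next
    case False
    then show ?thesis using "0.prems"(1) by (simp add: permutes_def)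
  qed
  then have "\<sigma> = id" by auto
  then show ?case by (simp add: axis_def n_def)
next
  case (Suc m)
  then have "{a :: 'n. \<sigma> (2 * idx a) \<noteq> 2 * idx a} \<noteq> {}" by (metis card.empty nat.distinct(1))
  then obtain a :: 'n where a: "\<sigma> (2 * idx a) \<noteq> 2 * idx a" by blast
  define t where "t = Transposition.transpose (2 * idx a) (Suc (2 * idx a))"
  have lt: "2 * idx a < 2 * n" "Suc (2 * idx a) < 2 * n" using idx_less[of a] unfolding n_def by linarith+
  have t: "t permutes {..<2 * n}" unfolding t_def using lt by (intro permutes_swap_id) auto
  have neq: "Suc (2 * x) \<noteq> 2 * y" "2 * y \<noteq> Suc (2 * x)" for x y :: nat by presburger+
  have ta: "t (2 * idx a) = Suc (2 * idx a)" "t (Suc (2 * idx a)) = 2 * idx a" by (simp_all add: t_def)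
  have tb: "t (2 * idx b) = 2 * idx b" "t (Suc (2 * idx b)) = Suc (2 * idx b)" if "b \<noteq> a" for b :: 'n
    using that by (simp_all add: t_def Transposition.transpose_def neq)
  have \<sigma>a: "\<sigma> (2 * idx a) = Suc (2 * idx a)" using div_2_cases(1)[of "\<sigma> (2 * idx a)" "idx a"] Suc.prems(2)[of a] a by simp
  have "\<sigma> (Suc (2 * idx a)) \<noteq> \<sigma> (2 * idx a)"
    using inj_eq[OF permutes_inj[OF Suc.prems(1)]] by simp
  then have \<sigma>a': "\<sigma> (Suc (2 * idx a)) = 2 * idx a" using div_2_cases(2)[of "\<sigma> (Suc (2 * idx a))" "idx a"] Suc.prems(2)[of a] \<sigma>a by simp
  have seteq: "{b. (\<sigma> \<circ> t) (2 * idx b) \<noteq> 2 * idx b} = {b. \<sigma> (2 * idx b) \<noteq> 2 * idx b} - {a}"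
  proof (rule set_eqI)
    fix b show "b \<in> {b. (\<sigma> \<circ> t) (2 * idx b) \<noteq> 2 * idx b} \<longleftrightarrow> b \<in> {b. \<sigma> (2 * idx b) \<noteq> 2 * idx b} - {a}"
      by (cases "b = a") (simp_all add: ta \<sigma>a' tb)
  qed
  have m: "m = card {b :: 'n. (\<sigma> \<circ> t) (2 * idx b) \<noteq> 2 * idx b}"
    unfolding seteq using Suc.hyps(2)[symmetric] a by simp
  have good: "(\<sigma> \<circ> t) (2 * idx b) div 2 = idx b \<and> (\<sigma> \<circ> t) (Suc (2 * idx b)) div 2 = idx b" for b :: 'n
    using Suc.prems(2)[of b] by (cases "b = a") (auto simp: ta tb \<sigma>a \<sigma>a')
  let ?f = "\<lambda>\<sigma> (b :: 'n). real_frame (\<sigma> (2 * idx b)) $ b * cnj (real_frame (\<sigma> (Suc (2 * idx b))) $ b)"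
  have IH: "of_int (sign (\<sigma> \<circ> t)) * (\<Prod>b\<in>UNIV. ?f (\<sigma> \<circ> t) b) = (- \<i>) ^ n"
    by (rule Suc.hyps(1)[OF m permutes_compose[OF t Suc.prems(1)] good])
  have "?f \<sigma> a = - ?f (\<sigma> \<circ> t) a" by (simp add: ta \<sigma>a \<sigma>a' axis_def)
  moreover have "(\<Prod>b\<in>UNIV - {a}. ?f (\<sigma> \<circ> t) b) = (\<Prod>b\<in>UNIV - {a}. ?f \<sigma> b)"
    by (rule prod.cong) (simp_all add: tb)
  ultimately have "(\<Prod>b\<in>UNIV. ?f \<sigma> b) = - (\<Prod>b\<in>UNIV. ?f (\<sigma> \<circ> t) b)"
    by (subst (1 2) prod.remove[of UNIV a]) simp_all
  moreover have "sign (\<sigma> \<circ> t) = - sign \<sigma>"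
    using Suc.prems(1) by (simp add: t_def sign_compose permutes_imp_permutation[OF finite_lessThan] permutation_swap_id sign_swap_id)
  ultimately show ?case using IH by (simp del: comp_apply)
qed

text \<open>N counts the pair-preserving permutations. Each contributes (- i)^n, which the factor
  i^n cancels, so the value on the frame is in particular nonzero.\<close>

lemma top_form_real_frame:
  obtains N :: nat where "0 < N" "\<i> ^ CARD('n) * top_form id id (real_frame :: nat \<Rightarrow> complex ^ 'n::finite) = of_nat N"
proof -
  define n where "n = CARD('n)"
  define good where "good \<sigma> \<longleftrightarrow> (\<forall>a :: 'n. \<sigma> (2 * idx a) div 2 = idx a \<and> \<sigma> (Suc (2 * idx a)) div 2 = idx a)" for \<sigma> :: "nat \<Rightarrow> nat"
  define P where "P = {\<sigma>. \<sigma> permutes {..<2 * n} \<and> good \<sigma>}"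
  have P: "finite P" "id \<in> P"
    unfolding P_def by (auto simp: good_def intro: finite_subset[OF _ finite_permutations[of "{..<2 * n}"]])
  have zero: "(\<Prod>a\<in>(UNIV :: 'n set). real_frame (\<sigma> (2 * idx a)) $ a * cnj (real_frame (\<sigma> (Suc (2 * idx a))) $ a)) = 0"
    if \<sigma>: "\<sigma> permutes {..<2 * n}" "\<not> good \<sigma>" for \<sigma>
  proof -
    obtain a :: 'n where a: "\<sigma> (2 * idx a) div 2 \<noteq> idx a \<or> \<sigma> (Suc (2 * idx a)) div 2 \<noteq> idx a"
      using \<sigma>(2) by (auto simp: good_def)
    have "2 * idx a < 2 * n" "Suc (2 * idx a) < 2 * n" using idx_less[of a] unfolding n_def by linarith+
    then have "\<sigma> (2 * idx a) < 2 * n" "\<sigma> (Suc (2 * idx a)) < 2 * n"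
      using permutes_in_image[OF \<sigma>(1)] by (metis lessThan_iff)+
    then have "real_frame (\<sigma> (2 * idx a)) $ a * cnj (real_frame (\<sigma> (Suc (2 * idx a))) $ a) = 0"
      using a unfolding n_def by (auto simp: real_frame_nth)
    then show ?thesis by (intro prod_zero) auto
  qed
  have "top_form id id (real_frame :: nat \<Rightarrow> complex ^ 'n) = (\<Sum>\<sigma>\<in>P. of_int (sign \<sigma>) *
     (\<Prod>a\<in>(UNIV :: 'n set). real_frame (\<sigma> (2 * idx a)) $ a * cnj (real_frame (\<sigma> (Suc (2 * idx a))) $ a)))"
    unfolding top_form_def n_def[symmetric]
    by (rule sum.mono_neutral_cong_right) (auto simp: P_def zero finite_permutations)
  also have "\<dots> = (\<Sum>\<sigma>\<in>P. (- \<i>) ^ n)"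
    by (rule sum.cong[OF refl]) (use top_form_term[where 'n = 'n] in \<open>auto simp: P_def good_def n_def\<close>)
  also have "\<dots> = of_nat (card P) * (- \<i>) ^ n" by simp
  finally have "\<i> ^ n * top_form id id (real_frame :: nat \<Rightarrow> complex ^ 'n) = of_nat (card P) * (\<i> ^ n * (- \<i>) ^ n)"
    by simp
  also have "\<i> ^ n * (- \<i>) ^ n = 1" unfolding power_mult_distrib[symmetric] by simp
  finally have "\<i> ^ n * top_form id id (real_frame :: nat \<Rightarrow> complex ^ 'n) = of_nat (card P)"
    by (simp only: mult_1_right)
  moreover have "0 < card P" using P by (auto simp: card_gt_0_iff)
  ultimately show thesis using that unfolding n_def by blast
qed

lemma top_form_real_frame_nonzero: "top_form id id (real_frame :: nat \<Rightarrow> complex ^ 'n::finite) \<noteq> 0"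
  using top_form_real_frame[where 'n = 'n] by (metis mult_zero_right of_nat_eq_0_iff less_numeral_extra(3))

text \<open>By \<open>alternated_herm_form_const\<close> the metric enters omega^n through det h
  alone; N absorbs the value of the top form on the frame and is therefore the same for all
  h.\<close>

lemma volume_density_eq_det:
  obtains N :: nat where "0 < N" "\<And>h :: complex ^ 'n ^ 'n::finite. volume_density h = real N * Re (det h)"
proof -
  obtain N :: nat where N: "0 < N" "\<i> ^ CARD('n) * top_form id id (real_frame :: nat \<Rightarrow> complex ^ 'n) = of_nat N"
    using top_form_real_frame by blast
  have "volume_density h = real N * Re (det h)" for h :: "complex ^ 'n ^ 'n"
  proof -
    have "wedge_power 2 (fund_form h) CARD('n) real_frame = \<i> ^ CARD('n) *
       (fact CARD('n) * det h * top_form id id (real_frame :: nat \<Rightarrow> complex ^ 'n))"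
      unfolding wedge_power_fund_form alternated_herm_form_const[symmetric] by (simp add: sum_distrib_left mult.left_commute)
    also have "\<dots> = of_real (fact CARD('n)) * of_nat N * det h"
      unfolding N(2)[symmetric] by simp
    finally show ?thesis by (simp add: volume_density_def)
  qed
  then show thesis using that N(1) by blast
qed

text \<open>Pulling the standard metric back by M gives the Gram matrix H, with determinant |det
  M|^2; comparing the top powers of the two metrics gives the factor.\<close>

lemma top_form_complex_linear:
  fixes M :: "complex ^ 'n ^ 'n::finite"
  shows "top_form id id (\<lambda>i. M *v v i) = of_real ((cmod (det M))\<^sup>2) * top_form id id v"
proof -
  define H where "H = (\<chi> i j. \<Sum>k\<in>UNIV. M $ k $ i * cnj (M $ k $ j))"
  have H: "H = transpose M ** (\<chi> i j. cnj (M $ i $ j))"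
    by (simp add: H_def vec_eq_iff matrix_matrix_mult_def transpose_def)
  have detH: "det H = of_real ((cmod (det M))\<^sup>2)"
    unfolding H det_mul det_transpose cnj_det[symmetric] by (simp add: complex_norm_square del: of_real_power)
  have "herm_form (mat 1) (M *v u) (M *v w) = herm_form H u w" for u w
  proof -
    have "herm_form (mat 1) (M *v u) (M *v w) = (\<Sum>k\<in>UNIV. \<Sum>i\<in>UNIV. \<Sum>j\<in>UNIV. M $ k $ i * u $ i * (cnj (M $ k $ j) * cnj (w $ j)))"
      by (simp add: herm_form_mat_1 matrix_vector_mult_def sum_product)
    also have "\<dots> = (\<Sum>i\<in>UNIV. \<Sum>j\<in>UNIV. \<Sum>k\<in>UNIV. M $ k $ i * u $ i * (cnj (M $ k $ j) * cnj (w $ j)))"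
      by (subst sum.swap, rule sum.cong[OF refl], rule sum.swap)
    also have "\<dots> = herm_form H u w"
      by (simp add: herm_form_def H_def sum_distrib_left sum_distrib_right algebra_simps)
    finally show ?thesis .
  qed
  then have "herm_prod CARD('n) (mat 1) (\<lambda>i. M *v v (\<sigma> i)) = herm_prod CARD('n) H (\<lambda>i. v (\<sigma> i))" for \<sigma>
    by (simp add: herm_prod_def)
  then have "(\<Sum>\<sigma> | \<sigma> permutes {..<2 * CARD('n)}. of_int (sign \<sigma>) * herm_prod CARD('n) (mat 1) (\<lambda>i. M *v v (\<sigma> i))) =
     (\<Sum>\<sigma> | \<sigma> permutes {..<2 * CARD('n)}. of_int (sign \<sigma>) * herm_prod CARD('n) H (\<lambda>i. v (\<sigma> i)))"
    by simp
  then have "fact CARD('n) * det (mat 1 :: complex ^ 'n ^ 'n) * top_form id id (\<lambda>i. M *v v i) = fact CARD('n) * det H * top_form id id v"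
    using alternated_herm_form_const[of "mat 1" "\<lambda>i. M *v v i"] alternated_herm_form_const[of H v] by simp
  then show ?thesis by (simp add: detH)
qed

section \<open>The real determinant of a complex linear map\<close>

lemma prod_lessThan_double: "(\<Prod>j<2 * n. g j) = (\<Prod>k<n. g (2 * k) * g (Suc (2 * k)))"
  for g :: "nat \<Rightarrow> 'a::comm_monoid_mult"
  by (induction n) (simp_all add: mult.assoc)

lemma det_idx:
  "det (\<chi> a b. X (idx a) (idx b) :: complex ^ 'k ^ 'k::finite) =
    (\<Sum>\<sigma> | \<sigma> permutes {..<CARD('k)}. of_int (sign \<sigma>) * (\<Prod>j<CARD('k). X j (\<sigma> j)))"
proof -
  let ?f = "map_permutation (UNIV :: 'k set) idx"
  have img: "range (idx :: 'k \<Rightarrow> nat) = {..<CARD('k)}" and inj: "inj (idx :: 'k \<Rightarrow> nat)"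
    using bij_idx by (auto simp: bij_betw_def)
  have "?f = (\<lambda>\<pi> x. if x \<in> {..<CARD('k)} then idx (\<pi> (inv_into UNIV idx x)) else x)"
    by (simp add: map_permutation_def restrict_id_def img fun_eq_iff)
  then have bij: "bij_betw ?f {\<pi>. \<pi> permutes UNIV} {\<pi>. \<pi> permutes {..<CARD('k)}}"
    using bij_betw_permutations[OF bij_idx[where 'n = 'k]] by simp
  have "of_int (sign (?f p)) * (\<Prod>j<CARD('k). X j (?f p j)) =
     of_int (sign p) * (\<Prod>a\<in>UNIV. X (idx a) (idx (p a)))" if "p permutes UNIV" for p
    using sign_map_permutation[OF inj that] map_permutation_apply[OF inj]
    by (simp add: prod_lessThan_CARD)
  then show ?thesis
    unfolding sum.reindex_bij_betw[OF bij, symmetric] by (simp add: det_def)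
qed

text \<open>The j-th covector in the order dz, dzbar, dz, dzbar, and so on, parallel to
  \<open>real_frame\<close>.\<close>

definition frame_coord :: "nat \<Rightarrow> complex ^ 'n::finite \<Rightarrow> complex" where
  "frame_coord j u = (if even j then u $ from_nat_into UNIV (j div 2) else cnj (u $ from_nat_into UNIV (j div 2)))"

lemma linear_frame_coord: "linear (frame_coord j)"
  by (rule linearI) (simp_all add: frame_coord_def scaleR_conv_of_real[where 'a = complex])

lemma card_bit0': "CARD('n::finite bit0) = 2 * CARD('n)" by simp

text \<open>With dz and dzbar listed alternately, the top form is an ordinary determinant of size
  2n; \<open>'n bit0\<close> serves as an index type with 2n elements.\<close>

lemma top_form_eq_det:
  fixes v :: "nat \<Rightarrow> complex ^ 'n::finite"
  shows "top_form id id v = det (\<chi> a b. frame_coord (idx a) (v (idx b)) :: complex ^ 'n bit0 ^ 'n bit0)"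
proof -
  have "(\<Prod>a\<in>UNIV. v (\<sigma> (2 * idx a)) $ id a * cnj (v (\<sigma> (2 * idx a + 1)) $ id a)) =
    (\<Prod>j<2 * CARD('n). frame_coord j (v (\<sigma> j)))" for \<sigma>
    unfolding prod_lessThan_double prod_lessThan_CARD by (simp add: frame_coord_def)
  then show ?thesis
    unfolding det_idx[where 'k = "'n bit0" and X = "\<lambda>i j. frame_coord i (v j)"] card_bit0' top_form_def by simp
qed

definition frame_basis :: "'n::finite bit0 \<Rightarrow> complex ^ 'n" where
  "frame_basis q = real_frame (idx q)"

lemma bij_frame_basis: "bij_betw (frame_basis :: 'n::finite bit0 \<Rightarrow> complex ^ 'n) UNIV Basis"
proof (rule bij_betw_imageI)
  have lt: "idx q < 2 * CARD('n)" for q :: "'n bit0" using idx_less[of q] by simp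
  have neq: "Suc (2 * x) \<noteq> 2 * y" "2 * y \<noteq> Suc (2 * x)" for x y :: nat by presburger+
  show "inj (frame_basis :: 'n bit0 \<Rightarrow> complex ^ 'n)"
  proof (rule injI)
    fix p q :: "'n bit0" assume "(frame_basis p :: complex ^ 'n) = frame_basis q"
    then have eq: "(real_frame (idx p) :: complex ^ 'n) = real_frame (idx q)" by (simp add: frame_basis_def)
    obtain a :: 'n where a: "idx p = 2 * idx a \<or> idx p = Suc (2 * idx a)"
      using nat_less_double_cases[OF lt[of p]] by metis
    obtain b :: 'n where b: "idx q = 2 * idx b \<or> idx q = Suc (2 * idx b)"
      using nat_less_double_cases[OF lt[of q]] by metis
    have "x = y" if "x = 2 * idx a \<or> x = Suc (2 * idx a)" "y = 2 * idx b \<or> y = Suc (2 * idx b)"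
      "(real_frame x :: complex ^ 'n) = real_frame y" for x y
      using that by (auto simp: axis_eq_axis complex_eq_iff)
    then have "idx p = idx q" using a b eq by blast
    then show "p = q" by simp
  qed
  show "range (frame_basis :: 'n bit0 \<Rightarrow> complex ^ 'n) = Basis"
  proof (intro set_eqI iffI)
    fix x :: "complex ^ 'n" assume "x \<in> range frame_basis"
    then obtain q :: "'n bit0" where "x = real_frame (idx q)" by (auto simp: frame_basis_def)
    moreover obtain a :: 'n where "idx q = 2 * idx a \<or> idx q = Suc (2 * idx a)"
      using nat_less_double_cases[OF lt[of q]] by metis
    ultimately show "x \<in> Basis" by (auto simp: Basis_vec_def Basis_complex_def)
  next
    fix x :: "complex ^ 'n" assume "x \<in> Basis"
    then obtain a where "x = axis a 1 \<or> x = axis a \<i>" by (auto simp: Basis_vec_def Basis_complex_def)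
    then have x: "x = real_frame (2 * idx a) \<or> x = real_frame (Suc (2 * idx a))" by simp
    have "\<exists>q :: 'n bit0. idx q = 2 * idx a" "\<exists>q :: 'n bit0. idx q = Suc (2 * idx a)"
      using idx_less[of a] by (intro idx_surj; unfold card_bit0'; linarith)+
    with x show "x \<in> range frame_basis" unfolding frame_basis_def by (metis rangeI)
  qed
qed

lemma sum_frame_basis:
  fixes u :: "complex ^ 'n::finite"
  shows "u = (\<Sum>q\<in>UNIV. (u \<bullet> frame_basis q) *\<^sub>R frame_basis q)"
proof -
  have "(\<Sum>q\<in>UNIV. (u \<bullet> frame_basis q) *\<^sub>R frame_basis q) = (\<Sum>b\<in>Basis. (u \<bullet> b) *\<^sub>R b)"
    by (rule sum.reindex_bij_betw[OF bij_frame_basis])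
  then show ?thesis by (simp add: euclidean_representation)
qed

text \<open>The top form on the image of the frame is computed twice: complex linearity gives the
  factor |det M|^2, multiplicativity of determinants gives the real determinant. The value on the
  frame itself is nonzero and cancels.\<close>

lemma det_real_of_complex_linear:
  fixes M :: "complex ^ 'n ^ 'n::finite"
  shows "det (\<chi> s q. (M *v frame_basis q) \<bullet> frame_basis s :: real ^ 'n bit0 ^ 'n bit0) = (cmod (det M))\<^sup>2"
proof -
  define R :: "real ^ 'n bit0 ^ 'n bit0" where "R = (\<chi> s q. (M *v frame_basis q) \<bullet> frame_basis s)"
  define \<Lambda> :: "complex ^ 'n bit0 ^ 'n bit0" where "\<Lambda> = (\<chi> a b. frame_coord (idx a) (real_frame (idx b) :: complex ^ 'n))"
  have entry: "frame_coord (idx a) (M *v real_frame (idx q)) = (\<Sum>s\<in>UNIV. \<Lambda> $ a $ s * of_real (R $ s $ q))" for a q :: "'n bit0"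
  proof -
    have "M *v real_frame (idx q) = (\<Sum>s\<in>UNIV. (R $ s $ q) *\<^sub>R real_frame (idx s))"
      using sum_frame_basis[of "M *v frame_basis q"] by (simp add: R_def frame_basis_def)
    then have "frame_coord (idx a) (M *v real_frame (idx q)) = (\<Sum>s\<in>UNIV. (R $ s $ q) *\<^sub>R frame_coord (idx a) (real_frame (idx s)  :: complex ^ 'n))"
      by (simp add: linear_sum[OF linear_frame_coord] linear_scale[OF linear_frame_coord])
    then show ?thesis by (simp add: \<Lambda>_def scaleR_conv_of_real mult.commute)
  qed
  have "top_form id id (\<lambda>i. M *v real_frame i) = det (\<Lambda> ** (\<chi> s q. of_real (R $ s $ q)))"
    unfolding top_form_eq_det entry by (simp add: matrix_matrix_mult_def)
  also have "\<dots> = det \<Lambda> * det (\<chi> s q. complex_of_real (R $ s $ q))" by (rule det_mul)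
  also have "det \<Lambda> = top_form id id (real_frame :: nat \<Rightarrow> complex ^ 'n)"
    unfolding top_form_eq_det \<Lambda>_def ..
  also have "det (\<chi> s q. complex_of_real (R $ s $ q)) = of_real (det R)" by (simp add: det_def)
  finally have E: "top_form id id (\<lambda>i. M *v real_frame i) =
      top_form id id (real_frame :: nat \<Rightarrow> complex ^ 'n) * of_real (det R)" .
  have "of_real ((cmod (det M))\<^sup>2) * top_form id id (real_frame :: nat \<Rightarrow> complex ^ 'n) =
      of_real (det R) * top_form id id (real_frame :: nat \<Rightarrow> complex ^ 'n)"
    unfolding top_form_complex_linear[symmetric] E by (rule mult.commute)
  then have "complex_of_real ((cmod (det M))\<^sup>2) = of_real (det R)"
    by (simp only: mult_right_cancel[OF top_form_real_frame_nonzero])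
  then show ?thesis unfolding R_def of_real_eq_iff by simp
qed

text \<open>This is, up to the volume density, the formal adjoint of the trace of the complex Hessian applied to 1.\<close>

definition gauduchon_local :: "(complex ^ 'n::finite \<Rightarrow> complex ^ 'n ^ 'n) \<Rightarrow> complex ^ 'n \<Rightarrow> complex" where
  "gauduchon_local g z = (\<Sum>i\<in>UNIV. \<Sum>j\<in>UNIV. wirt i (wirt_bar j (\<lambda>w. det (g w) * inv_metric (g w) i j)) z)"

section \<open>Applying del and delbar to powers of the fundamental form\<close>

lemma Ck_on_herm_prod:
  fixes g :: "complex ^ 'n \<Rightarrow> complex ^ 'n ^ 'n::finite"
  assumes "open U" "\<And>i j. Ck_on k U (\<lambda>w. g w $ i $ j)"
  shows "Ck_on k U (\<lambda>w. herm_prod m (g w) u)"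
  unfolding herm_prod_def herm_form_def by (intro Ck_on_prod Ck_on_sum Ck_on_mult Ck_on_const assms)

text \<open>Each derivative prepends one covector to an alternating sum, and
  \<open>wedge_alternation\<close> merges the two alternations into one. In the result the slots 0
  and 1 carry dz_i and dzbar_j, and the power of omega occupies the rest.\<close>

lemma del_delbar_wedge_power:
  fixes g :: "complex ^ 'n \<Rightarrow> complex ^ 'n ^ 'n::finite"
  assumes U: "open U" "z \<in> U" and g: "\<And>i j. Ck_on 2 U (\<lambda>w. g w $ i $ j)"
  shows "del_form (2 * m + 1) (delbar_form (2 * m) (\<lambda>w. wedge_power 2 (fund_form (g w)) m)) z v =
    \<i> ^ m * (\<Sum>i\<in>UNIV. \<Sum>j\<in>UNIV. wirt i (wirt_bar j (\<lambda>w.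
      \<Sum>\<sigma> | \<sigma> permutes {..<2 * Suc m}. of_int (sign \<sigma>) *
        (v (\<sigma> 0) $ i * cnj (v (\<sigma> 1) $ j) * herm_prod m (g w) (\<lambda>k. v (\<sigma> (2 + k)))))) z)"
proof -
  define P where "P u w = herm_prod m (g w) u" for u w
  have P2: "Ck_on 2 U (P u)" for u unfolding P_def[abs_def] by (rule Ck_on_herm_prod[OF U(1) g])
  have P1: "Ck_on 1 U (wirt_bar j (P u))" for u j
    using Ck_on_wirt(2)[OF U(1), of 1 "P u"] P2[of u] by (simp add: numeral_2_eq_2)
  have dP: "P u differentiable at w" if "w \<in> U" for u w using P2[of u] that by (simp add: numeral_2_eq_2)
  have dP1: "wirt_bar j (P u) differentiable at w" if "w \<in> U" for u w j using P1[of j u] that by simp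
  \<comment> \<open>The integrand of delbar omega^m before alternation, in the role that
    \<open>herm_prod\<close> plays for omega^m.\<close>
  define B where "B w u = (\<Sum>j\<in>UNIV. cnj (u 0 $ j) * (\<i> ^ m * wirt_bar j (P (\<lambda>i. u (1 + i))) w))" for w and u :: "nat \<Rightarrow> complex ^ 'n"
  have delbar: "delbar_form (2 * m) (\<lambda>w. wedge_power 2 (fund_form (g w)) m) w =
      (\<lambda>u. \<Sum>\<tau> | \<tau> permutes {..<1 + 2 * m}. of_int (sign \<tau>) * B w (\<lambda>i. u (\<tau> i)))" if w: "w \<in> U" for w
  proof
    fix u :: "nat \<Rightarrow> complex ^ 'n"
    have "wirt_bar j (\<lambda>w. wedge_power 2 (fund_form (g w)) m u) w =
       (\<Sum>\<sigma> | \<sigma> permutes {..<2 * m}. of_int (sign \<sigma>) * (\<i> ^ m * wirt_bar j (P (\<lambda>i. u (\<sigma> i))) w))" for j u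
      unfolding wedge_power_fund_form P_def[symmetric]
      using dP[OF w] by (subst wirt_sum) (auto simp: wirt_cmult)
    then have "delbar_form (2 * m) (\<lambda>w. wedge_power 2 (fund_form (g w)) m) w u =
       (\<Sum>j\<in>UNIV. wedge 1 (2 * m) (dzbar j) (\<lambda>u. \<Sum>\<sigma> | \<sigma> permutes {..<2 * m}. of_int (sign \<sigma>) * (\<i> ^ m * wirt_bar j (P (\<lambda>i. u (\<sigma> i))) w)) u)"
      by (simp add: delbar_form_def)
    also have "\<dots> = (\<Sum>j\<in>UNIV. \<Sum>\<tau> | \<tau> permutes {..<1 + 2 * m}. of_int (sign \<tau>) *
        (cnj (u (\<tau> 0) $ j) * (\<i> ^ m * wirt_bar j (P (\<lambda>i. u (\<tau> (1 + i)))) w)))"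
      by (subst wedge_alternation[where B = "\<lambda>u. \<i> ^ m * wirt_bar j (P u) w" for j]) (simp_all add: dzbar_def)
    also have "\<dots> = (\<Sum>\<tau> | \<tau> permutes {..<1 + 2 * m}. of_int (sign \<tau>) * B w (\<lambda>i. u (\<tau> i)))"
      by (subst sum.swap) (simp add: B_def sum_distrib_left)
    finally show "delbar_form (2 * m) (\<lambda>w. wedge_power 2 (fund_form (g w)) m) w u =
       (\<Sum>\<tau> | \<tau> permutes {..<1 + 2 * m}. of_int (sign \<tau>) * B w (\<lambda>i. u (\<tau> i)))" .
  qed
  have wB: "wirt i (\<lambda>w. B w u) z = (\<Sum>j\<in>UNIV. cnj (u 0 $ j) * (\<i> ^ m * wirt i (wirt_bar j (P (\<lambda>i. u (1 + i)))) z))" for i u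
    unfolding B_def using dP1[OF U(2)] by (subst wirt_sum) (auto simp: wirt_cmult)
  have dB: "(\<lambda>w. B w u) differentiable at z" for u
    unfolding B_def by (intro differentiable_sum ballI differentiable_mult differentiable_const dP1[OF U(2)] finite)
  have collect: "(\<Sum>\<sigma> | \<sigma> permutes {..<2 * Suc m}. of_int (sign \<sigma>) *
      (v (\<sigma> 0) $ i * cnj (v (\<sigma> 1) $ j) * wirt i (wirt_bar j (P (\<lambda>k. v (\<sigma> (2 + k))))) z)) =
      wirt i (wirt_bar j (\<lambda>w. \<Sum>\<sigma> | \<sigma> permutes {..<2 * Suc m}. of_int (sign \<sigma>) *
        (v (\<sigma> 0) $ i * cnj (v (\<sigma> 1) $ j) * P (\<lambda>k. v (\<sigma> (2 + k))) w))) z" for i j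
  proof -
    have "wirt_bar j (\<lambda>w. \<Sum>\<sigma> | \<sigma> permutes {..<2 * Suc m}. of_int (sign \<sigma>) *
        (v (\<sigma> 0) $ i * cnj (v (\<sigma> 1) $ j) * P (\<lambda>k. v (\<sigma> (2 + k))) w)) w =
       (\<Sum>\<sigma> | \<sigma> permutes {..<2 * Suc m}. of_int (sign \<sigma>) *
        (v (\<sigma> 0) $ i * cnj (v (\<sigma> 1) $ j) * wirt_bar j (P (\<lambda>k. v (\<sigma> (2 + k)))) w))" if "w \<in> U" for w
      using dP[OF that] by (subst wirt_sum) (auto simp: wirt_cmult)
    then have "wirt i (wirt_bar j (\<lambda>w. \<Sum>\<sigma> | \<sigma> permutes {..<2 * Suc m}. of_int (sign \<sigma>) *
        (v (\<sigma> 0) $ i * cnj (v (\<sigma> 1) $ j) * P (\<lambda>k. v (\<sigma> (2 + k))) w))) z =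
      wirt i (\<lambda>w. \<Sum>\<sigma> | \<sigma> permutes {..<2 * Suc m}. of_int (sign \<sigma>) *
        (v (\<sigma> 0) $ i * cnj (v (\<sigma> 1) $ j) * wirt_bar j (P (\<lambda>k. v (\<sigma> (2 + k)))) w)) z"
      by (rule wirt_cong(1)[OF U])
    also have "\<dots> = (\<Sum>\<sigma> | \<sigma> permutes {..<2 * Suc m}. of_int (sign \<sigma>) *
        (v (\<sigma> 0) $ i * cnj (v (\<sigma> 1) $ j) * wirt i (wirt_bar j (P (\<lambda>k. v (\<sigma> (2 + k))))) z))"
      using dP1[OF U(2)] by (subst wirt_sum) (auto simp: wirt_cmult)
    finally show ?thesis by simp
  qed
  have "wirt i (\<lambda>w. delbar_form (2 * m) (\<lambda>w. wedge_power 2 (fund_form (g w)) m) w u) z =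
     (\<Sum>\<tau> | \<tau> permutes {..<1 + 2 * m}. of_int (sign \<tau>) * wirt i (\<lambda>w. B w (\<lambda>i. u (\<tau> i))) z)" for i u
  proof -
    have "wirt i (\<lambda>w. delbar_form (2 * m) (\<lambda>w. wedge_power 2 (fund_form (g w)) m) w u) z =
      wirt i (\<lambda>w. \<Sum>\<tau> | \<tau> permutes {..<1 + 2 * m}. of_int (sign \<tau>) * B w (\<lambda>i. u (\<tau> i))) z"
      by (rule wirt_cong(1)[OF U]) (simp add: delbar)
    also have "\<dots> = (\<Sum>\<tau> | \<tau> permutes {..<1 + 2 * m}. of_int (sign \<tau>) * wirt i (\<lambda>w. B w (\<lambda>i. u (\<tau> i))) z)"
      using dB by (subst wirt_sum) (auto simp: wirt_cmult)
    finally show ?thesis .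
  qed
  then have "del_form (2 * m + 1) (delbar_form (2 * m) (\<lambda>w. wedge_power 2 (fund_form (g w)) m)) z v =
     (\<Sum>i\<in>UNIV. wedge 1 (1 + 2 * m) (dz i) (\<lambda>u. \<Sum>\<tau> | \<tau> permutes {..<1 + 2 * m}. of_int (sign \<tau>) * wirt i (\<lambda>w. B w (\<lambda>i. u (\<tau> i))) z) v)"
    by (simp add: del_form_def)
  also have "\<dots> = (\<Sum>i\<in>UNIV. \<Sum>\<sigma> | \<sigma> permutes {..<1 + (1 + 2 * m)}. of_int (sign \<sigma>) *
      (v (\<sigma> 0) $ i * wirt i (\<lambda>w. B w (\<lambda>k. v (\<sigma> (1 + k)))) z))"
    by (subst wedge_alternation[where B = "\<lambda>u. wirt i (\<lambda>w. B w u) z" for i]) (simp_all add: dz_def)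
  also have "\<dots> = (\<Sum>i\<in>UNIV. \<Sum>\<sigma> | \<sigma> permutes {..<2 * Suc m}. \<Sum>j\<in>UNIV. \<i> ^ m * (of_int (sign \<sigma>) *
      (v (\<sigma> 0) $ i * cnj (v (\<sigma> 1) $ j) * wirt i (wirt_bar j (P (\<lambda>k. v (\<sigma> (2 + k))))) z)))"
    unfolding wB by (simp add: sum_distrib_left algebra_simps)
  also have "\<dots> = (\<Sum>i\<in>UNIV. \<Sum>j\<in>UNIV. \<i> ^ m * (\<Sum>\<sigma> | \<sigma> permutes {..<2 * Suc m}. of_int (sign \<sigma>) *
      (v (\<sigma> 0) $ i * cnj (v (\<sigma> 1) $ j) * wirt i (wirt_bar j (P (\<lambda>k. v (\<sigma> (2 + k))))) z)))"
    unfolding sum_distrib_left by (intro sum.cong[OF refl] sum.swap)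
  also have "\<dots> = \<i> ^ m * (\<Sum>i\<in>UNIV. \<Sum>j\<in>UNIV. wirt i (wirt_bar j (\<lambda>w. \<Sum>\<sigma> | \<sigma> permutes {..<2 * Suc m}. of_int (sign \<sigma>) *
        (v (\<sigma> 0) $ i * cnj (v (\<sigma> 1) $ j) * P (\<lambda>k. v (\<sigma> (2 + k))) w))) z)"
    unfolding collect sum_distrib_left ..
  finally show ?thesis unfolding P_def .
qed

lemma gauduchon_form_eq:
  assumes n: "CARD('n::finite) \<ge> 1"
  shows "\<exists>c. c \<noteq> 0 \<and> (\<forall>(g :: complex ^ 'n \<Rightarrow> complex ^ 'n ^ 'n) U z v. open U \<longrightarrow> z \<in> U \<longrightarrow>
    (\<forall>i j. Ck_on 2 U (\<lambda>w. g w $ i $ j)) \<longrightarrow> (\<forall>w\<in>U. invertible (g w)) \<longrightarrow>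
    del_form (2 * (CARD('n) - 1) + 1) (delbar_form (2 * (CARD('n) - 1))
      (\<lambda>w. wedge_power 2 (fund_form (g w)) (CARD('n) - 1))) z v =
    c * top_form id id v * gauduchon_local g z)"
proof -
  \<comment> \<open>The pair of slots with index 0 belongs to the two covectors that del and delbar
    put in front.\<close>
  obtain a :: 'n where a: "idx a = 0" using idx_surj[of 0, where 'n = 'n] n by auto
  obtain N :: nat where N: "0 < N" "\<forall>h (e :: complex ^ 'n ^ 'n) v. invertible h \<longrightarrow>
    (\<Sum>\<sigma> | \<sigma> permutes {..<2 * CARD('n)}. of_int (sign \<sigma>) *
      (\<Prod>b\<in>UNIV. herm_form (if b = a then e else h) (v (\<sigma> (2 * idx b))) (v (\<sigma> (2 * idx b + 1))))) =
    of_nat N * det h * (\<Sum>i\<in>UNIV. \<Sum>j\<in>UNIV. inv_metric h i j * e $ i $ j) * top_form id id v"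
    using alternated_herm_form_mixed[of a] by blast
  define m where "m = CARD('n) - 1"
  have m: "CARD('n) = Suc m" using n by (simp add: m_def)
  have inner: "(\<Sum>\<sigma> | \<sigma> permutes {..<2 * Suc m}. of_int (sign \<sigma>) *
        (v (\<sigma> 0) $ i * cnj (v (\<sigma> 1) $ j) * herm_prod m h (\<lambda>k. v (\<sigma> (2 + k))))) =
      of_nat N * top_form id id v * (det h * inv_metric h i j)" if h: "invertible h" for h :: "complex ^ 'n ^ 'n" and v i j
  proof -
    \<comment> \<open>The matrix unit, whose Hermitian form is dz_i tensor dzbar_j; in the mixed
      formula it isolates one entry of the inverse metric.\<close>
    define e :: "complex ^ 'n ^ 'n" where "e = (\<chi> k l. if k = i then if l = j then 1 else 0 else 0)"
    have e: "herm_form e u w = u $ i * cnj (w $ j)" for u w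
    proof -
      have "e $ k $ l * u $ k * cnj (w $ l) = (if l = j then if k = i then u $ k * cnj (w $ l) else 0 else 0)" for k l
        by (simp add: e_def)
      then show ?thesis by (simp add: herm_form_def)
    qed
    have tr: "(\<Sum>k\<in>UNIV. \<Sum>l\<in>UNIV. inv_metric h k l * e $ k $ l) = inv_metric h i j"
    proof -
      have "inv_metric h k l * e $ k $ l = (if l = j then if k = i then inv_metric h k l else 0 else 0)" for k l
        by (simp add: e_def)
      then show ?thesis by simp
    qed
    have "(\<Prod>b\<in>(UNIV :: 'n set). herm_form (if b = a then e else h) (v (\<sigma> (2 * idx b))) (v (\<sigma> (2 * idx b + 1)))) =
       v (\<sigma> 0) $ i * cnj (v (\<sigma> 1) $ j) * herm_prod m h (\<lambda>k. v (\<sigma> (2 + k)))" for \<sigma>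
    proof -
      have "(\<Prod>b\<in>(UNIV :: 'n set). herm_form (if b = a then e else h) (v (\<sigma> (2 * idx b))) (v (\<sigma> (2 * idx b + 1)))) =
        (\<Prod>b\<in>(UNIV :: 'n set). herm_form (if idx b = 0 then e else h) (v (\<sigma> (2 * idx b))) (v (\<sigma> (2 * idx b + 1))))"
        using a by (intro prod.cong) (auto simp flip: a)
      also have "\<dots> = (\<Prod>k<Suc m. herm_form (if k = 0 then e else h) (v (\<sigma> (2 * k))) (v (\<sigma> (2 * k + 1))))"
        unfolding m[symmetric] prod_lessThan_CARD ..
      finally show ?thesis by (subst (asm) prod.lessThan_Suc_shift) (simp add: e herm_prod_def)
    qed
    then show ?thesis using N(2)[rule_format, OF h, where e = e and v = v] unfolding tr m by (simp add: algebra_simps)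
  qed
  have "del_form (2 * m + 1) (delbar_form (2 * m) (\<lambda>w. wedge_power 2 (fund_form (g w)) m)) z v =
    (\<i> ^ m * of_nat N) * top_form id id v * gauduchon_local g z"
    if U: "open U" "z \<in> U" and g: "\<And>i j. Ck_on 2 U (\<lambda>w. g w $ i $ j)" and inv: "\<And>w. w \<in> U \<Longrightarrow> invertible (g w)"
    for g :: "complex ^ 'n \<Rightarrow> complex ^ 'n ^ 'n" and U z v
  proof -
    let ?a = "\<lambda>i j w. det (g w) * inv_metric (g w) i j"
    have a2: "Ck_on 2 U (?a i j)" for i j
      by (intro Ck_on_mult Ck_on_det Ck_on_inv_metric U(1) g inv)
    have a1: "Ck_on 1 U (wirt_bar j (?a i j))" for i j
      using Ck_on_wirt(2)[OF U(1), of 1 "?a i j"] a2[of i j] by (simp add: numeral_2_eq_2)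
    have "wirt i (wirt_bar j (\<lambda>w. \<Sum>\<sigma> | \<sigma> permutes {..<2 * Suc m}. of_int (sign \<sigma>) *
        (v (\<sigma> 0) $ i * cnj (v (\<sigma> 1) $ j) * herm_prod m (g w) (\<lambda>k. v (\<sigma> (2 + k)))))) z =
       (of_nat N * top_form id id v) * wirt i (wirt_bar j (?a i j)) z" for i j
    proof -
      have "wirt_bar j (\<lambda>w. \<Sum>\<sigma> | \<sigma> permutes {..<2 * Suc m}. of_int (sign \<sigma>) *
        (v (\<sigma> 0) $ i * cnj (v (\<sigma> 1) $ j) * herm_prod m (g w) (\<lambda>k. v (\<sigma> (2 + k))))) w =
         (of_nat N * top_form id id v) * wirt_bar j (?a i j) w" if w: "w \<in> U" for w
      proof -
        have "wirt_bar j (\<lambda>w. \<Sum>\<sigma> | \<sigma> permutes {..<2 * Suc m}. of_int (sign \<sigma>) *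
          (v (\<sigma> 0) $ i * cnj (v (\<sigma> 1) $ j) * herm_prod m (g w) (\<lambda>k. v (\<sigma> (2 + k))))) w =
          wirt_bar j (\<lambda>w. (of_nat N * top_form id id v) * ?a i j w) w"
          by (rule wirt_cong(2)[OF U(1) w]) (rule inner, rule inv)
        then show ?thesis using a2[of i j] w wirt_cmult(2)[of "?a i j" w] by (simp add: numeral_2_eq_2)
      qed
      then have "wirt i (wirt_bar j (\<lambda>w. \<Sum>\<sigma> | \<sigma> permutes {..<2 * Suc m}. of_int (sign \<sigma>) *
        (v (\<sigma> 0) $ i * cnj (v (\<sigma> 1) $ j) * herm_prod m (g w) (\<lambda>k. v (\<sigma> (2 + k)))))) z =
        wirt i (\<lambda>w. (of_nat N * top_form id id v) * wirt_bar j (?a i j) w) z"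
        by (rule wirt_cong(1)[OF U])
      then show ?thesis using a1[of j i] U(2) wirt_cmult(1)[of "wirt_bar j (?a i j)" z] by simp
    qed
    then show ?thesis
      unfolding del_delbar_wedge_power[OF U g] gauduchon_local_def by (simp add: sum_distrib_left algebra_simps)
  qed
  then show ?thesis using N(1) unfolding m_def[symmetric] by (intro exI[of _ "\<i> ^ m * of_nat N"]) simp
qed

section \<open>Smoothness of holomorphic maps\<close>

text \<open>A complex linear derivative at each point, without any continuity of that derivative;
  regularity has to come from Cauchy's formula.\<close>

definition holo_on :: "(complex ^ 'n::finite) set \<Rightarrow> (complex ^ 'n \<Rightarrow> complex) \<Rightarrow> bool" where
  "holo_on S F \<longleftrightarrow> (\<forall>z\<in>S. \<exists>D. (F has_derivative D) (at z) \<and> (\<forall>c v. D (c *s v) = c * D v))"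

lemma holo_on_frechet:
  assumes "holo_on S F" "z \<in> S"
  shows "(F has_derivative frechet_derivative F (at z)) (at z)"
    and "frechet_derivative F (at z) (c *s v) = c * frechet_derivative F (at z) v"
proof -
  obtain D where D: "(F has_derivative D) (at z)" "\<forall>c v. D (c *s v) = c * D v"
    using assms unfolding holo_on_def by blast
  have "frechet_derivative F (at z) = D" using frechet_derivative_at[OF D(1)] by simp
  then show "(F has_derivative frechet_derivative F (at z)) (at z)"
    "frechet_derivative F (at z) (c *s v) = c * frechet_derivative F (at z) v" using D by auto
qed

text \<open>Parametrising the circle by the unit interval makes the Leibniz rule for integrals over
  a box applicable.\<close>

lemma Cauchy_derivative_interval:
  assumes "continuous_on (cball 0 \<rho>) g" "g holomorphic_on ball 0 \<rho>" "0 < \<rho>"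
  shows "(g has_field_derivative integral {0..1} (\<lambda>t. g (\<rho> * exp (2 * of_real pi * \<i> * of_real t)) /
    (\<rho> * exp (2 * of_real pi * \<i> * of_real t)))) (at 0)"
proof -
  let ?e = "\<lambda>t. \<rho> * exp (2 * of_real pi * \<i> * of_real t) :: complex"
  have "(g has_field_derivative 1 / (2 * of_real pi * \<i>) *
      contour_integral (circlepath 0 \<rho>) (\<lambda>u. g u / (u - 0)\<^sup>2)) (at 0)"
    by (rule Cauchy_derivative_integral_circlepath(2)[OF assms(1,2)]) (use assms(3) in simp)
  also have "contour_integral (circlepath 0 \<rho>) (\<lambda>u. g u / (u - 0)\<^sup>2) =
      integral {0..1} (\<lambda>t. (2 * of_real pi * \<i>) * (g (?e t) / ?e t))"
    unfolding contour_integral_integral vector_derivative_circlepath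
    by (rule integral_cong) (use assms(3) in \<open>simp add: circlepath field_simps power2_eq_square\<close>)
  also have "\<dots> = (2 * of_real pi * \<i>) * integral {0..1} (\<lambda>t. g (?e t) / ?e t)"
    by (rule integral_mult_right)
  finally show ?thesis by simp
qed

lemma continuous_on_holo: "holo_on S F \<Longrightarrow> continuous_on S F"
  by (meson continuous_at_imp_continuous_on has_derivative_continuous holo_on_frechet(1))

lemma has_derivative_complex_line:
  "((\<lambda>\<zeta>. z + \<zeta> *s (v :: complex ^ 'n::finite)) has_derivative (\<lambda>\<zeta>. \<zeta> *s v)) (at \<zeta>)"
proof -
  have "linear (\<lambda>\<zeta>. \<zeta> *s v)"
    by (rule linearI) (simp_all add: vec_eq_iff algebra_simps)
  then have "bounded_linear (\<lambda>\<zeta>. \<zeta> *s v)" by (simp add: linear_conv_bounded_linear)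
  then have "((\<lambda>\<zeta>. \<zeta> *s v) has_derivative (\<lambda>\<zeta>. \<zeta> *s v)) (at \<zeta>)" by (rule bounded_linear_imp_has_derivative)
  then show ?thesis by (auto intro!: derivative_eq_intros)
qed

lemma norm_vector_smult: "norm (c *s (v :: complex ^ 'n::finite)) = cmod c * norm v"
  by (simp add: norm_vec_def L2_set_def norm_mult power_mult_distrib real_sqrt_mult flip: sum_distrib_left)

lemma continuous_on_vector_smult:
  assumes "continuous_on S f" "continuous_on S g"
  shows "continuous_on S (\<lambda>x. f x *s (g x :: complex ^ 'n::finite))"
proof -
  have "f x *s g x = (\<chi> i. f x * g x $ i)" for x by (simp add: vec_eq_iff)
  then show ?thesis by (simp add: continuous_on_vec_lambda continuous_on_mult continuous_on_component assms)
qed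

text \<open>Cauchy's formula on a complex line exhibits the directional derivative as an integral with
  parameter; differentiating under the integral sign shows that it is holomorphic again.\<close>

lemma holo_on_directional_derivative:
  assumes U: "open U" and F: "holo_on U F"
  shows "holo_on U (\<lambda>z. frechet_derivative F (at z) v)"
proof -
  note DF = holo_on_frechet[OF F]
  define e where "e t = exp (2 * of_real pi * \<i> * of_real t)" for t :: real
  have e: "cmod (e t) = 1" "e t \<noteq> 0" for t by (simp_all add: e_def)
  have e_cont: "continuous_on S e" for S unfolding e_def by (intro continuous_intros)
  \<comment> \<open>The radii are chosen such that every disc of radius \<rho> in the direction w,
    centred in the ball of radius r around z0, stays in U.\<close>
  have local: "\<exists>r (\<rho> :: real). 0 < r \<and> 0 < \<rho> \<and> ball z0 r \<subseteq> U \<and> (\<forall>z\<in>ball z0 r. \<forall>t. z + (complex_of_real \<rho> * e t) *s w \<in> U) \<and>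
      (\<forall>z\<in>ball z0 r. frechet_derivative F (at z) w = integral (cbox 0 1) (\<lambda>t. F (z + (complex_of_real \<rho> * e t) *s w) / (complex_of_real \<rho> * e t)))"
    if z0: "z0 \<in> U" for z0 w
  proof -
    obtain s where s: "0 < s" "ball z0 s \<subseteq> U" using U z0 open_contains_ball by blast
    define r where "r = s / 2"
    define \<rho> where "\<rho> = r / (norm w + 1)"
    have pos: "0 < norm w + 1" by (simp add: add_nonneg_pos)
    have r: "0 < r" "0 < \<rho>" using s pos by (simp_all add: r_def \<rho>_def)
    have \<rho>: "\<rho> * norm w < r" using r pos by (simp add: \<rho>_def field_simps)
    have mem: "z + \<zeta> *s w \<in> U" if z: "z \<in> ball z0 r" and \<zeta>: "cmod \<zeta> \<le> \<rho>" for z \<zeta>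
    proof -
      have "dist z0 (z + \<zeta> *s w) \<le> dist z0 z + norm (\<zeta> *s w)"
        using norm_triangle_ineq4[of "z0 - z" "\<zeta> *s w"] by (simp add: dist_norm algebra_simps)
      also have "norm (\<zeta> *s w) \<le> \<rho> * norm w" unfolding norm_vector_smult using \<zeta> by (rule mult_right_mono) simp
      finally have "dist z0 (z + \<zeta> *s w) < s" using z \<rho> by (simp add: r_def)
      then show ?thesis using s by auto
    qed
    have "frechet_derivative F (at z) w = integral (cbox 0 1) (\<lambda>t. F (z + (complex_of_real \<rho> * e t) *s w) / (complex_of_real \<rho> * e t))"
      if z: "z \<in> ball z0 r" for z
    proof -
      define g where "g \<zeta> = F (z + \<zeta> *s w)" for \<zeta>
      have g: "(g has_field_derivative frechet_derivative F (at (z + \<zeta> *s w)) w) (at \<zeta>)" if "cmod \<zeta> \<le> \<rho>" for \<zeta>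
        using has_derivative_compose[OF has_derivative_complex_line DF(1)[OF mem[OF z that]]]
        by (simp add: g_def[abs_def] has_field_derivative_def DF(2)[OF mem[OF z that]] mult.commute[of _ "frechet_derivative F _ w"] mult_commute_abs)
      have "(g has_field_derivative integral {0..1} (\<lambda>t. g (complex_of_real \<rho> * e t) / (complex_of_real \<rho> * e t))) (at 0)"
        unfolding e_def
      proof (rule Cauchy_derivative_interval[OF _ _ r(2)])
        show "continuous_on (cball 0 \<rho>) g"
          by (intro continuous_at_imp_continuous_on) (auto intro: DERIV_isCont[OF g])
        show "g holomorphic_on ball 0 \<rho>"
          unfolding holomorphic_on_open[OF open_ball] by (meson g less_imp_le mem_ball_0)
      qed
      moreover have "(g has_field_derivative frechet_derivative F (at z) w) (at 0)"
        using g[of 0] r by simp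
      ultimately show ?thesis using DERIV_unique unfolding g_def by fastforce
    qed
    moreover have "ball z0 r \<subseteq> U" using s by (auto simp: r_def)
    ultimately show ?thesis
      by (rule_tac exI[of _ r], rule_tac exI[of _ \<rho>]) (use r mem e in \<open>auto simp: norm_mult\<close>)
  qed
  \<comment> \<open>Continuity is established for all directions first, since the Leibniz rule needs
    the derivative of the integrand to be jointly continuous.\<close>
  have cont: "continuous_on U (\<lambda>z. frechet_derivative F (at z) w)" for w
    unfolding continuous_on_eq_continuous_at[OF U]
  proof
    fix z0 assume z0U: "z0 \<in> U"
    obtain r and \<rho> :: real where r: "0 < r" "0 < \<rho>" "\<forall>z\<in>ball z0 r. \<forall>t. z + (complex_of_real \<rho> * e t) *s w \<in> U"
      "\<forall>z\<in>ball z0 r. frechet_derivative F (at z) w = integral (cbox 0 1) (\<lambda>t. F (z + (complex_of_real \<rho> * e t) *s w) / (complex_of_real \<rho> * e t))"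
      using local[OF z0U, of w] by blast
    have "continuous_on (ball z0 r \<times> cbox 0 1) (\<lambda>(z, t). F (z + (complex_of_real \<rho> * e t) *s w) / (complex_of_real \<rho> * e t))"
      unfolding case_prod_beta using r e
      by (intro continuous_on_divide continuous_on_compose2[OF continuous_on_holo[OF F]] continuous_on_add continuous_on_vector_smult
          continuous_on_mult continuous_on_fst continuous_on_id continuous_on_const continuous_on_compose2[OF e_cont[of UNIV]] continuous_on_snd) auto
    from integral_continuous_on_param[OF this]
    have "continuous_on (ball z0 r) (\<lambda>z. frechet_derivative F (at z) w)"
      by (rule continuous_on_eq) (use r(4) in simp)
    then show "isCont (\<lambda>z. frechet_derivative F (at z) w) z0"
      using r(1) continuous_on_eq_continuous_at[OF open_ball] by (metis centre_in_ball)
  qed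
  show ?thesis unfolding holo_on_def
  proof
    fix z0 assume z0U: "z0 \<in> U"
    obtain r and \<rho> :: real where r: "0 < r" "0 < \<rho>" "\<forall>z\<in>ball z0 r. \<forall>t. z + (complex_of_real \<rho> * e t) *s v \<in> U"
      and eq: "\<forall>z\<in>ball z0 r. frechet_derivative F (at z) v = integral (cbox 0 1) (\<lambda>t. F (z + (complex_of_real \<rho> * e t) *s v) / (complex_of_real \<rho> * e t))"
      using local[OF z0U, of v] by blast
    \<comment> \<open>The derivative of the integrand as a bounded operator, the shape in which
      \<open>leibniz_rule\<close> expects it.\<close>
    define fx where "fx z t = Blinfun (\<lambda>w. frechet_derivative F (at (z + (complex_of_real \<rho> * e t) *s v)) w / (complex_of_real \<rho> * e t))" for z t
    have fx: "blinfun_apply (fx z t) = (\<lambda>w. frechet_derivative F (at (z + (complex_of_real \<rho> * e t) *s v)) w / (complex_of_real \<rho> * e t))"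
      if "z \<in> ball z0 r" for z t
    proof -
      have "bounded_linear (frechet_derivative F (at (z + (complex_of_real \<rho> * e t) *s v)))"
        using DF(1) r(3) that has_derivative_bounded_linear by blast
      then show ?thesis unfolding fx_def
        by (intro bounded_linear_Blinfun_apply bounded_linear_compose[OF bounded_linear_divide])
    qed
    have cont1: "continuous_on (ball z0 r \<times> cbox 0 1) (\<lambda>(z, t). G (z + (complex_of_real \<rho> * e t) *s v) / (complex_of_real \<rho> * e t))"
      if "continuous_on U G" for G :: "complex ^ 'a \<Rightarrow> complex"
      unfolding case_prod_beta using r e
      by (intro continuous_on_divide continuous_on_compose2[OF that] continuous_on_add continuous_on_vector_smult
          continuous_on_mult continuous_on_fst continuous_on_id continuous_on_const continuous_on_compose2[OF e_cont[of UNIV]] continuous_on_snd) auto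
    have cont2: "continuous_on (cbox 0 1) (\<lambda>t. G (z + (complex_of_real \<rho> * e t) *s v) / (complex_of_real \<rho> * e t))"
      if "continuous_on U G" "z \<in> ball z0 r" for G :: "complex ^ 'a \<Rightarrow> complex" and z
      using continuous_on_compose2[OF cont1[OF that(1)], of "cbox 0 1" "\<lambda>t. (z, t)"] that(2)
      by (simp add: continuous_on_Pair image_subset_iff)
    have cont_fx: "continuous_on (ball z0 r \<times> cbox 0 1) (\<lambda>(z, t). fx z t)"
    proof (rule continuous_on_blinfun_componentwise)
      fix i :: "complex ^ 'a"
      show "continuous_on (ball z0 r \<times> cbox 0 1) (\<lambda>x. blinfun_apply (case x of (z, t) \<Rightarrow> fx z t) i)"
        by (rule continuous_on_eq[OF cont1[OF cont[of i]]]) (auto simp: fx)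
    qed
    have D: "((\<lambda>z. integral (cbox 0 1) (\<lambda>t. F (z + (complex_of_real \<rho> * e t) *s v) / (complex_of_real \<rho> * e t))) has_derivative
        integral (cbox 0 1) (fx z0)) (at z0 within ball z0 r)"
    proof (rule leibniz_rule[OF _ _ cont_fx])
      fix z t assume z: "z \<in> ball z0 r" "t \<in> cbox 0 (1 :: real)"
      have "((\<lambda>z. z + (complex_of_real \<rho> * e t) *s v) has_derivative (\<lambda>w. w)) (at z within ball z0 r)"
        by (auto intro!: derivative_eq_intros)
      from has_derivative_compose[OF this DF(1)] r(3) z
      have "((\<lambda>z. F (z + (complex_of_real \<rho> * e t) *s v)) has_derivative frechet_derivative F (at (z + (complex_of_real \<rho> * e t) *s v))) (at z within ball z0 r)"
        by blast
      from bounded_linear.has_derivative[OF bounded_linear_divide this]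
      show "((\<lambda>z. F (z + (complex_of_real \<rho> * e t) *s v) / (complex_of_real \<rho> * e t)) has_derivative blinfun_apply (fx z t)) (at z within ball z0 r)"
        by (simp add: fx[OF z(1)])
    next
      fix z assume "z \<in> ball z0 r"
      then show "(\<lambda>t. F (z + (complex_of_real \<rho> * e t) *s v) / (complex_of_real \<rho> * e t)) integrable_on cbox 0 1"
        by (intro integrable_continuous cont2 continuous_on_holo F)
    qed (use r in auto)
    have z0: "z0 \<in> ball z0 r" using r by simp
    have "((\<lambda>z. frechet_derivative F (at z) v) has_derivative integral (cbox 0 1) (fx z0)) (at z0)"
      using D eq z0 has_derivative_transform_within_open[OF _ open_ball z0, of "\<lambda>z. integral (cbox 0 1) (\<lambda>t. F (z + (complex_of_real \<rho> * e t) *s v) / (complex_of_real \<rho> * e t))" _ UNIV]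
      by (simp add: at_within_open[OF z0 open_ball])
    moreover have "blinfun_apply (integral (cbox 0 1) (fx z0)) (c *s w) = c * blinfun_apply (integral (cbox 0 1) (fx z0)) w" for c w
    proof -
      have "continuous_on (cbox 0 1) (fx z0)"
        using continuous_on_compose2[OF cont_fx, of "cbox 0 1" "\<lambda>t. (z0, t)"] z0
        by (simp add: continuous_on_Pair image_subset_iff)
      then have "fx z0 integrable_on cbox 0 1" by (rule integrable_continuous)
      moreover have "blinfun_apply (fx z0 t) (c *s w) = c * blinfun_apply (fx z0 t) w" for t
        using r(3) z0 by (simp add: fx DF(2))
      ultimately show ?thesis by (simp add: blinfun_apply_integral integral_mult_right)
    qed
    ultimately show "\<exists>D. ((\<lambda>z. frechet_derivative F (at z) v) has_derivative D) (at z0) \<and> (\<forall>c v. D (c *s v) = c * D v)"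
      by blast
  qed
qed

lemma Ck_on_holo:
  assumes "open U" "holo_on U F"
  shows "Ck_on k U F"
  using assms(2)
proof (induction k arbitrary: F)
  case 0
  then show ?case by (simp add: continuous_on_holo)
next
  case (Suc k)
  then show ?case
    using holo_on_frechet(1)[OF Suc.prems] Suc.IH[OF holo_on_directional_derivative[OF assms(1) Suc.prems]]
    by (auto simp: differentiable_def)
qed

lemma holo_on_component:
  assumes "holomorphic_map_on S T"
  shows "holo_on S (\<lambda>z. T z $ a)"
  unfolding holo_on_def
proof
  fix z assume "z \<in> S"
  then obtain D where D: "(T has_derivative D) (at z)" "\<forall>c v. D (c *s v) = c *s D v"
    using assms unfolding holomorphic_map_on_def by blast
  have "((\<lambda>z. T z $ a) has_derivative (\<lambda>v. D v $ a)) (at z)"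
    by (rule bounded_linear.has_derivative[OF bounded_linear_vec_nth D(1)])
  then show "\<exists>D. ((\<lambda>z. T z $ a) has_derivative D) (at z) \<and> (\<forall>c v. D (c *s v) = c * D v)"
    using D(2) by (intro exI[of _ "\<lambda>v. D v $ a"]) simp
qed

lemma Ck_on_vecI:
  fixes f :: "'a::real_normed_vector \<Rightarrow> complex ^ 'm::finite"
  assumes "open S" "\<And>i. Ck_on k S (\<lambda>x. f x $ i)"
  shows "Ck_on k S f"
proof -
  have lin: "bounded_linear (axis i :: complex \<Rightarrow> complex ^ 'm)" for i
    by (simp add: linear_linear linearI axis_def vec_eq_iff)
  have "f = (\<lambda>x. \<Sum>i\<in>UNIV. axis i (f x $ i))"
    by (simp add: fun_eq_iff vec_eq_iff axis_def sum_component if_distrib cong: if_cong)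
  moreover have "Ck_on k S (\<lambda>x. \<Sum>i\<in>UNIV. axis i (f x $ i))"
    by (intro Ck_on_sum Ck_on_bounded_linear_compose[OF assms(1) lin] assms)
  ultimately show ?thesis by simp
qed

lemma Ck_on_holomorphic_map:
  assumes "open S" "holomorphic_map_on S T"
  shows "Ck_on k S T"
  by (intro Ck_on_vecI assms Ck_on_holo holo_on_component)

section \<open>Change of variables\<close>

lemma nn_integral_finite_has_integral:
  fixes h :: "'a::euclidean_space \<Rightarrow> real"
  assumes "h \<in> borel_measurable borel" "\<And>x. 0 \<le> h x" "(\<integral>\<^sup>+x. h x \<partial>lborel) < \<infinity>"
  obtains b where "0 \<le> b" "(\<integral>\<^sup>+x. h x \<partial>lborel) = ennreal b" "(h has_integral b) UNIV"
proof -
  obtain b where "0 \<le> b" "(\<integral>\<^sup>+x. h x \<partial>lborel) = ennreal b"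
    using assms(3) by (cases "\<integral>\<^sup>+x. h x \<partial>lborel" rule: ennreal_cases) auto
  then show thesis using that nn_integral_has_integral[OF assms(1,2)] by blast
qed

text \<open>The theorem behind it speaks of absolutely integrable functions. For nonnegative ones it
  transfers finite integrals in both directions, so the two extended integrals are finite and equal
  or both infinite.\<close>

lemma nn_integral_change_of_variables_cart:
  fixes g :: "real ^ 'k::{finite,wellorder} \<Rightarrow> real ^ 'k::_" and f :: "real ^ 'k::_ \<Rightarrow> real"
  assumes S: "S \<in> sets borel" and inj: "inj_on g S"
    and der: "\<And>x. x \<in> S \<Longrightarrow> (g has_derivative g' x) (at x)"
    and nonneg: "\<And>y. y \<in> g ` S \<Longrightarrow> 0 \<le> f y"
    and m1: "(\<lambda>x. indicator S x * (\<bar>det (matrix (g' x))\<bar> * f (g x))) \<in> borel_measurable borel"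
    and m2: "(\<lambda>y. indicator (g ` S) y * f y) \<in> borel_measurable borel"
  shows "(\<integral>\<^sup>+x. ennreal (indicator S x * (\<bar>det (matrix (g' x))\<bar> * f (g x))) \<partial>lborel) =
    (\<integral>\<^sup>+y. ennreal (indicator (g ` S) y * f y) \<partial>lborel)" (is "?L = ?R")
proof -
  let ?h1 = "\<lambda>x. \<bar>det (matrix (g' x))\<bar> * f (g x)"
  have h1: "0 \<le> indicator S x * ?h1 x" for x using nonneg by (auto simp: indicator_def)
  have h2: "0 \<le> indicator (g ` S) y * f y" for y using nonneg by (auto simp: indicator_def)
  have ind: "(\<lambda>x. indicator T x * u x) = (\<lambda>x. if x \<in> T then u x else 0)" for T and u :: "real ^ 'k::_ \<Rightarrow> real"
    by (auto simp: indicator_def)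
  \<comment> \<open>The theorem takes functions with values in a real vector type;
    \<open>real ^ 1\<close> makes it applicable to scalars.\<close>
  have "(\<lambda>x. \<bar>det (matrix (g' x))\<bar> *\<^sub>R (vec (f (g x)) :: real ^ 1)) absolutely_integrable_on S \<and>
      integral S (\<lambda>x. \<bar>det (matrix (g' x))\<bar> *\<^sub>R (vec (f (g x)) :: real ^ 1)) = vec b \<longleftrightarrow>
      (\<lambda>x. vec (f x) :: real ^ 1) absolutely_integrable_on g ` S \<and> integral (g ` S) (\<lambda>x. vec (f x) :: real ^ 1) = vec b" for b
    by (rule has_absolute_integral_change_of_variables)
       (use S inj der in \<open>auto intro: has_derivative_at_withinI\<close>)
  then have cov: "(?h1 absolutely_integrable_on S \<and> integral S ?h1 = b) \<longleftrightarrow>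
      (f absolutely_integrable_on g ` S \<and> integral (g ` S) f = b)" for b
    unfolding absolutely_integrable_on_1_iff integral_on_1_eq
    by (simp add: vec_eq_iff)
  have "?h1 absolutely_integrable_on S \<longleftrightarrow> ?h1 integrable_on S"
    by (rule absolutely_integrable_on_iff_nonneg) (use nonneg in auto)
  moreover have "f absolutely_integrable_on g ` S \<longleftrightarrow> f integrable_on g ` S"
    by (rule absolutely_integrable_on_iff_nonneg) (use nonneg in auto)
  ultimately have "(?h1 has_integral b) S \<longleftrightarrow> (f has_integral b) (g ` S)" for b
    using cov by (simp add: has_integral_iff)
  then have iff: "((\<lambda>x. indicator S x * ?h1 x) has_integral b) UNIV \<longleftrightarrow>
      ((\<lambda>y. indicator (g ` S) y * f y) has_integral b) UNIV" for b
    unfolding ind has_integral_restrict_UNIV .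
  show ?thesis
  proof (cases "?L < \<infinity>")
    case True
    obtain b where b: "?L = ennreal b" "((\<lambda>x. indicator S x * ?h1 x) has_integral b) UNIV"
      by (rule nn_integral_finite_has_integral[OF m1 h1 True])
    then show ?thesis using nn_integral_has_integral_lborel[OF m2 h2] iff by simp
  next
    case L: False
    show ?thesis
    proof (cases "?R < \<infinity>")
      case True
      obtain b where b: "?R = ennreal b" "((\<lambda>y. indicator (g ` S) y * f y) has_integral b) UNIV"
        by (rule nn_integral_finite_has_integral[OF m2 h2 True])
      then show ?thesis using nn_integral_has_integral_lborel[OF m1 h1] iff by simp
    next
      case False
      then show ?thesis using L by (simp add: less_top[symmetric])
    qed
  qed
qed

section \<open>Real coordinates on complex n-space\<close>

definition to_real_vec :: "complex ^ 'n::finite \<Rightarrow> real ^ 'n bit0" where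
  "to_real_vec u = (\<chi> q. u \<bullet> frame_basis q)"

definition of_real_vec :: "real ^ 'n::finite bit0 \<Rightarrow> complex ^ 'n" where
  "of_real_vec x = (\<Sum>q\<in>UNIV. x $ q *\<^sub>R frame_basis q)"

lemma inner_frame_basis:
  "(frame_basis p :: complex ^ 'n::finite) \<bullet> frame_basis q = (if p = q then 1 else 0)"
proof -
  have "frame_basis p \<in> (Basis :: (complex ^ 'n) set)" "frame_basis q \<in> (Basis :: (complex ^ 'n) set)"
    and "(frame_basis p :: complex ^ 'n) = frame_basis q \<longleftrightarrow> p = q"
    using bij_frame_basis[where 'n = 'n] by (auto simp: bij_betw_def inj_on_def)
  then show ?thesis by (simp add: inner_Basis)
qed

lemma of_to_real_vec [simp]: "of_real_vec (to_real_vec u) = u"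
  using sum_frame_basis[of u] by (simp add: of_real_vec_def to_real_vec_def)

lemma to_of_real_vec [simp]: "to_real_vec (of_real_vec x) = x"
  by (simp add: of_real_vec_def to_real_vec_def vec_eq_iff inner_sum_left inner_frame_basis if_distrib cong: if_cong)

lemma bounded_linear_to_real_vec: "bounded_linear to_real_vec"
  by (intro linear_conv_bounded_linear[THEN iffD1] linearI) (simp_all add: to_real_vec_def vec_eq_iff inner_add_left)

lemma bounded_linear_of_real_vec: "bounded_linear of_real_vec"
  by (intro linear_conv_bounded_linear[THEN iffD1] linearI)
     (simp_all add: of_real_vec_def algebra_simps sum.distrib scaleR_sum_right)

lemma continuous_of_real_vec: "continuous_on S of_real_vec"
  by (rule linear_continuous_on[OF bounded_linear_of_real_vec])

lemma borel_of_real_vec [measurable]: "of_real_vec \<in> borel_measurable borel"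
  by (rule borel_measurable_continuous_onI[OF continuous_of_real_vec])

lemma bij_cart_basis: "bij_betw (\<lambda>q. axis q 1 :: real ^ 'k::finite) UNIV Basis"
  by (rule bij_betw_imageI) (auto simp: inj_on_def axis_eq_axis Basis_vec_def)

text \<open>Lebesgue measure is determined by the volumes of boxes. The frame enumerates the
  standard basis, so boxes pull back to boxes with the same side lengths.\<close>

lemma lborel_of_real_vec:
  "(lborel :: (complex ^ 'n::finite) measure) = distr lborel borel of_real_vec"
proof (rule lborel_eqI)
  fix l u :: "complex ^ 'n" assume le: "\<And>b. b \<in> Basis \<Longrightarrow> l \<bullet> b \<le> u \<bullet> b"
  have basis: "frame_basis q \<in> (Basis :: (complex ^ 'n) set)" for q
    using bij_frame_basis[where 'n = 'n] by (auto simp: bij_betw_def)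
  have range: "(\<forall>b\<in>Basis. P b) \<longleftrightarrow> (\<forall>q. P (frame_basis q))" for P :: "complex ^ 'n \<Rightarrow> bool"
    using bij_betw_imp_surj_on[OF bij_frame_basis[where 'n = 'n]] by (metis imageE rangeI)
  have coord: "of_real_vec x \<bullet> frame_basis q = x $ q" for x :: "real ^ 'n bit0" and q
    using arg_cong[OF to_of_real_vec[of x], of "\<lambda>y. y $ q"] by (simp add: to_real_vec_def)
  have "of_real_vec x \<in> box l u \<longleftrightarrow> (\<forall>q. l \<bullet> frame_basis q < x $ q \<and> x $ q < u \<bullet> frame_basis q)" for x
    by (simp add: mem_box range coord)
  moreover have "x \<in> box (to_real_vec l) (to_real_vec u) \<longleftrightarrow> (\<forall>q. l \<bullet> frame_basis q < x $ q \<and> x $ q < u \<bullet> frame_basis q)" for x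
    by (simp add: mem_box_cart(1) to_real_vec_def)
  ultimately have "of_real_vec -` box l u = box (to_real_vec l) (to_real_vec u)" by auto
  then have "emeasure (distr lborel borel of_real_vec) (box l u) = emeasure lborel (box (to_real_vec l) (to_real_vec u))"
    by (simp add: emeasure_distr)
  also have "\<dots> = (\<Prod>b\<in>Basis. (to_real_vec u - to_real_vec l) \<bullet> b)"
    by (rule emeasure_lborel_box) (use le basis in \<open>auto simp: Basis_vec_def inner_axis to_real_vec_def\<close>)
  also have "(\<Prod>b\<in>Basis. (to_real_vec u - to_real_vec l) \<bullet> b) = (\<Prod>q\<in>UNIV. (u - l) \<bullet> frame_basis q)"
    unfolding prod.reindex_bij_betw[OF bij_cart_basis, symmetric]
    by (simp add: inner_axis to_real_vec_def inner_diff_left)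
  also have "\<dots> = (\<Prod>b\<in>Basis. (u - l) \<bullet> b)"
    by (rule prod.reindex_bij_betw[OF bij_frame_basis])
  finally show "emeasure (distr lborel borel of_real_vec) (box l u) = (\<Prod>b\<in>Basis. (u - l) \<bullet> b)" .
qed simp

lemma nn_integral_of_real_vec:
  fixes f :: "complex ^ 'n::finite \<Rightarrow> ennreal"
  assumes "f \<in> borel_measurable borel"
  shows "(\<integral>\<^sup>+z. f z \<partial>lborel) = (\<integral>\<^sup>+x. f (of_real_vec x) \<partial>lborel)"
  by (subst lborel_of_real_vec) (use assms in \<open>simp add: nn_integral_distr\<close>)

text \<open>The real Jacobian of T is |det M|^2. The real theorem asks for a finite well-ordered
  index type, which \<open>'n bit0\<close> provides.\<close>

lemma nn_integral_change_of_variables_holomorphic: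
  fixes T :: "complex ^ 'n::finite \<Rightarrow> complex ^ 'n" and f :: "complex ^ 'n \<Rightarrow> real"
  assumes S: "S \<in> sets borel" and inj: "inj_on T S"
    and der: "\<And>z. z \<in> S \<Longrightarrow> (T has_derivative (*v) (M z)) (at z)"
    and nonneg: "\<And>w. w \<in> T ` S \<Longrightarrow> 0 \<le> f w"
    and m1: "(\<lambda>z. indicator S z * ((cmod (det (M z)))\<^sup>2 * f (T z))) \<in> borel_measurable borel"
    and m2: "(\<lambda>w. indicator (T ` S) w * f w) \<in> borel_measurable borel"
  shows "(\<integral>\<^sup>+z. ennreal (indicator S z * ((cmod (det (M z)))\<^sup>2 * f (T z))) \<partial>lborel) =
    (\<integral>\<^sup>+w. ennreal (indicator (T ` S) w * f w) \<partial>lborel)"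
proof -
  define S' where "S' = of_real_vec -` S"
  define g where "g x = to_real_vec (T (of_real_vec x))" for x
  define g' where "g' x v = to_real_vec (M (of_real_vec x) *v of_real_vec v)" for x v
  have S': "S' \<in> sets borel" unfolding S'_def using measurable_sets_borel[OF borel_of_real_vec S] by simp
  have inj': "inj_on g S'"
  proof (rule inj_onI)
    fix x y assume *: "x \<in> S'" "y \<in> S'" "g x = g y"
    then have "T (of_real_vec x) = T (of_real_vec y)" unfolding g_def by (metis of_to_real_vec)
    then have "of_real_vec x = of_real_vec y" using * inj by (auto simp: S'_def inj_on_def)
    then show "x = y" by (metis to_of_real_vec)
  qed
  have der': "(g has_derivative g' x) (at x)" if "x \<in> S'" for x
  proof -
    have "(of_real_vec has_derivative of_real_vec) (at x)"
      by (rule bounded_linear_imp_has_derivative[OF bounded_linear_of_real_vec])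
    from has_derivative_compose[OF this der] that
    have "((\<lambda>x. T (of_real_vec x)) has_derivative (\<lambda>v. M (of_real_vec x) *v of_real_vec v)) (at x)"
      by (simp add: S'_def)
    from bounded_linear.has_derivative[OF bounded_linear_to_real_vec this]
    show ?thesis by (simp add: g_def[abs_def] g'_def[abs_def])
  qed
  have ax: "of_real_vec (axis q 1) = frame_basis q" for q :: "'n bit0"
  proof -
    have "axis q 1 $ p *\<^sub>R frame_basis p = (if p = q then frame_basis p else (0 :: complex ^ 'n))" for p
      by (simp add: axis_def)
    then show ?thesis by (simp add: of_real_vec_def)
  qed
  have "matrix (g' x) = (\<chi> s q. (M (of_real_vec x) *v frame_basis q) \<bullet> frame_basis s)" for x
    by (simp add: matrix_def g'_def ax to_real_vec_def)
  then have det: "det (matrix (g' x)) = (cmod (det (M (of_real_vec x))))\<^sup>2" for x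
    by (simp add: det_real_of_complex_linear)
  have img: "y \<in> g ` S' \<longleftrightarrow> of_real_vec y \<in> T ` S" for y
  proof
    assume "y \<in> g ` S'"
    then show "of_real_vec y \<in> T ` S" by (auto simp: g_def S'_def)
  next
    assume "of_real_vec y \<in> T ` S"
    then obtain z where z: "z \<in> S" "of_real_vec y = T z" by blast
    then have "y = g (to_real_vec z)" "to_real_vec z \<in> S'"
      by (simp_all add: g_def S'_def) (metis to_of_real_vec)
    then show "y \<in> g ` S'" by blast
  qed
  have ind: "indicator S' x = (indicator S (of_real_vec x) :: real)" "indicator (g ` S') x = (indicator (T ` S) (of_real_vec x) :: real)" for x
    unfolding indicator_def img by (simp_all add: S'_def)
  have "(\<integral>\<^sup>+x. ennreal (indicator S' x * (\<bar>det (matrix (g' x))\<bar> * f (of_real_vec (g x)))) \<partial>lborel) =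
    (\<integral>\<^sup>+y. ennreal (indicator (g ` S') y * f (of_real_vec y)) \<partial>lborel)"
  proof (rule nn_integral_change_of_variables_cart[OF S' inj' der'])
    show "0 \<le> f (of_real_vec y)" if "y \<in> g ` S'" for y using that nonneg by (simp add: img)
    show "(\<lambda>x. indicator S' x * (\<bar>det (matrix (g' x))\<bar> * f (of_real_vec (g x)))) \<in> borel_measurable borel"
      using measurable_compose[OF borel_of_real_vec m1] by (simp add: ind det g_def)
    show "(\<lambda>y. indicator (g ` S') y * f (of_real_vec y)) \<in> borel_measurable borel"
      using measurable_compose[OF borel_of_real_vec m2] by (simp add: ind)
  qed
  then show ?thesis
    unfolding ind det
    by (subst (1 2) nn_integral_of_real_vec) (use m1 m2 in \<open>simp_all add: g_def measurable_compose[OF _ measurable_ennreal]\<close>)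
qed

section \<open>The trace of the complex Hessian\<close>

lemma holo_on_wirt_bar: "holo_on S F \<Longrightarrow> z \<in> S \<Longrightarrow> wirt_bar j F z = 0"
  using wirt_holomorphic(1)[OF holo_on_frechet(1)] holo_on_frechet(2) by blast

lemma differentiable_bounded_linear:
  "bounded_linear L \<Longrightarrow> f differentiable at x \<Longrightarrow> (\<lambda>x. L (f x)) differentiable at x"
  using bounded_linear.has_derivative unfolding differentiable_def by blast

lemma holo_on_cong:
  assumes "open S" "\<And>z. z \<in> S \<Longrightarrow> F z = G z" "holo_on S F"
  shows "holo_on S G"
  unfolding holo_on_def
proof
  fix z assume z: "z \<in> S"
  then obtain D where D: "(F has_derivative D) (at z)" "\<forall>c v. D (c *s v) = c * D v"
    using assms(3) unfolding holo_on_def by blast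
  have "(G has_derivative D) (at z)"
    using has_derivative_cong_open[of S z F G D, OF assms(1) z] assms(2) D(1) by simp
  then show "\<exists>D. (G has_derivative D) (at z) \<and> (\<forall>c v. D (c *s v) = c * D v)" using D(2) by blast
qed

lemma holo_on_wirt:
  assumes "open S" "holo_on S F"
  shows "holo_on S (wirt i F)"
proof -
  have eq: "wirt i F z = frechet_derivative F (at z) (axis i 1)" if "z \<in> S" for z
    using wirt_holomorphic(2)[OF holo_on_frechet(1)[OF assms(2) that]] holo_on_frechet(2)[OF assms(2) that] by blast
  show ?thesis
    by (rule holo_on_cong[OF assms(1) eq[symmetric] holo_on_directional_derivative[OF assms]])
qed

lemma holo_on_differentiable: "holo_on S F \<Longrightarrow> z \<in> S \<Longrightarrow> F differentiable at z"
  using holo_on_frechet(1) differentiable_def by blast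

text \<open>By \<open>has_derivative_wirt\<close> a differential without bar part is complex linear.
  Closure under sums and products thereby reduces to the rules for \<open>wirt_bar\<close>.\<close>

lemma holo_onI:
  assumes "\<And>z. z \<in> S \<Longrightarrow> F differentiable at z" "\<And>z j. z \<in> S \<Longrightarrow> wirt_bar j F z = 0"
  shows "holo_on S F"
  unfolding holo_on_def
proof
  fix z assume z: "z \<in> S"
  have D: "(F has_derivative frechet_derivative F (at z)) (at z)"
    using assms(1)[OF z] by (rule frechet_derivative_works')
  moreover have "frechet_derivative F (at z) (c *s v) = c * frechet_derivative F (at z) v" for c v
    unfolding has_derivative_wirt[OF D] assms(2)[OF z] by (simp add: sum_distrib_left algebra_simps)
  ultimately show "\<exists>D. (F has_derivative D) (at z) \<and> (\<forall>c v. D (c *s v) = c * D v)" by blast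
qed

lemma holo_on_mult:
  assumes "holo_on S F" "holo_on S G" shows "holo_on S (\<lambda>z. F z * G z)"
  by (rule holo_onI)
     (use assms in \<open>simp_all add: wirt_mult holo_on_differentiable holo_on_wirt_bar\<close>)

lemma holo_on_sum:
  assumes "\<And>k. k \<in> I \<Longrightarrow> holo_on S (F k)" shows "holo_on S (\<lambda>z. \<Sum>k\<in>I. F k z)"
proof (cases "finite I")
  case True
  show ?thesis
  proof (rule holo_onI)
    fix z assume z: "z \<in> S"
    show "(\<lambda>z. \<Sum>k\<in>I. F k z) differentiable at z"
      using True assms z by (intro differentiable_sum) (auto intro: holo_on_differentiable)
    show "wirt_bar j (\<lambda>z. \<Sum>k\<in>I. F k z) z = 0" for j
      using assms z
      by (subst wirt_sum) (auto intro: holo_on_differentiable intro!: sum.neutral holo_on_wirt_bar[of S])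
  qed
qed (auto simp: holo_on_def intro!: exI[of _ "\<lambda>_. 0"])

lemma holo_on_const: "holo_on S (\<lambda>z. c)"
  by (rule holo_onI) auto

lemma holo_on_prod:
  assumes "\<And>k. k \<in> I \<Longrightarrow> holo_on S (F k)" shows "holo_on S (\<lambda>z. \<Prod>k\<in>I. F k z)"
  using assms by (induction I rule: infinite_finite_induct) (auto intro: holo_on_mult holo_on_const)

text \<open>The derivative d_i ln |F|^2 equals d_i F / F, which is holomorphic again. This is why
  Jacobians of coordinate changes drop out of the curvature.\<close>

lemma pluriharmonic_ln_norm:
  assumes S: "open S" "z \<in> S" and F: "holo_on S F" "\<And>w. w \<in> S \<Longrightarrow> F w \<noteq> 0"
  shows "wirt_bar j (wirt i (\<lambda>w. of_real (ln ((cmod (F w))\<^sup>2)))) z = 0"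
proof -
  have FC: "Ck_on 1 S F" by (rule Ck_on_holo[OF S(1) F(1)])
  have WC: "Ck_on 1 S (wirt i F)" by (rule Ck_on_holo[OF S(1) holo_on_wirt[OF S(1) F(1)]])
  define q where "q w = wirt i F w / F w" for w
  have q: "wirt i (\<lambda>w. of_real (ln ((cmod (F w))\<^sup>2))) w = q w" if w: "w \<in> S" for w
  proof -
    have d: "F differentiable at w" by (rule holo_on_differentiable[OF F(1) w])
    have "(\<lambda>w. Re (F w * cnj (F w))) differentiable at w"
      using differentiable_bounded_linear[OF bounded_linear_Re]
        differentiable_mult[OF d differentiable_bounded_linear[OF bounded_linear_cnj d]] by blast
    then have dn: "(\<lambda>w. (cmod (F w))\<^sup>2) differentiable at w"
      by (simp add: complex_mult_cnj cmod_power2)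
    have "(ln has_real_derivative 1 / (cmod (F w))\<^sup>2) (at ((cmod (F w))\<^sup>2))"
      using F(2)[OF w] by (intro DERIV_ln_divide) simp
    from wirt_real_compose(1)[OF dn this]
    have "wirt i (\<lambda>w. of_real (ln ((cmod (F w))\<^sup>2))) w =
        of_real (1 / (cmod (F w))\<^sup>2) * wirt i (\<lambda>w. F w * cnj (F w)) w"
      by (simp add: complex_norm_square del: of_real_power of_real_divide)
    also have "wirt i (\<lambda>w. F w * cnj (F w)) w = wirt i F w * cnj (F w)"
      using wirt_mult(1)[OF d differentiable_bounded_linear[OF bounded_linear_cnj d], of i] wirt_cnj(1)[OF d, of i]
      by (simp add: holo_on_wirt_bar[OF F(1) w])
    also have "of_real (1 / (cmod (F w))\<^sup>2) * (wirt i F w * cnj (F w)) = q w"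
    proof -
      have "complex_of_real (1 / (cmod (F w))\<^sup>2) = 1 / (F w * cnj (F w))"
        unfolding of_real_divide complex_norm_square by simp
      then show ?thesis using F(2)[OF w] by (simp add: q_def)
    qed
    finally show ?thesis .
  qed
  have "Ck_on 1 S q" unfolding q_def[abs_def]
    by (rule Ck_on_divide[OF S(1) WC FC F(2)])
  then have dq: "q differentiable at z" using S(2) by simp
  \<comment> \<open>Differentiating q F = d_i F and cancelling F replaces a quotient rule.\<close>
  have "wirt_bar j (\<lambda>w. q w * F w) z = wirt_bar j (wirt i F) z"
    by (rule wirt_cong(2)[OF S]) (simp add: q_def F(2))
  also have "\<dots> = 0" by (rule holo_on_wirt_bar[OF holo_on_wirt[OF S(1) F(1)] S(2)])
  finally have "wirt_bar j q z * F z = 0"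
    using wirt_mult(2)[OF dq holo_on_differentiable[OF F(1) S(2)], of j] by (simp add: holo_on_wirt_bar[OF F(1) S(2)])
  then have "wirt_bar j q z = 0" using F(2)[OF S(2)] by simp
  then show ?thesis using wirt_cong(2)[OF S q] by simp
qed

definition lap :: "(complex ^ 'n::finite \<Rightarrow> complex ^ 'n ^ 'n) \<Rightarrow> (complex ^ 'n \<Rightarrow> complex) \<Rightarrow> complex ^ 'n \<Rightarrow> complex" where
  "lap h \<phi> z = (\<Sum>i\<in>UNIV. \<Sum>j\<in>UNIV. inv_metric (h z) i j * wirt_bar j (wirt i \<phi>) z)"

lemma lap_cong:
  assumes "open S" "z \<in> S" "\<And>w. w \<in> S \<Longrightarrow> \<phi> w = \<psi> w"
  shows "lap h \<phi> z = lap h \<psi> z"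
proof -
  have "wirt_bar j (wirt i \<phi>) z = wirt_bar j (wirt i \<psi>) z" for i j
    by (rule wirt_cong(2)[OF assms(1,2)], rule wirt_cong(1)[OF assms(1)]) (auto intro: assms(3))
  then show ?thesis by (simp add: lap_def)
qed

lemma wirt_wirt_bar_add:
  assumes "open S" "z \<in> S" "Ck_on 2 S \<phi>" "Ck_on 2 S \<psi>"
  shows "wirt_bar j (wirt i (\<lambda>w. \<phi> w + \<psi> w)) z = wirt_bar j (wirt i \<phi>) z + wirt_bar j (wirt i \<psi>) z"
proof -
  have "wirt_bar j (wirt i (\<lambda>w. \<phi> w + \<psi> w)) z = wirt_bar j (\<lambda>w. wirt i \<phi> w + wirt i \<psi> w) z"
    by (rule wirt_cong(2)[OF assms(1,2)], rule wirt_add) (use assms in \<open>auto simp: numeral_2_eq_2\<close>)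
  also have "\<dots> = wirt_bar j (wirt i \<phi>) z + wirt_bar j (wirt i \<psi>) z"
    using Ck_on_wirt(1)[OF assms(1), of 1] assms by (intro wirt_add) (auto simp: numeral_2_eq_2)
  finally show ?thesis .
qed

lemma wirt_wirt_bar_cmult:
  assumes "open S" "z \<in> S" "Ck_on 2 S \<phi>"
  shows "wirt_bar j (wirt i (\<lambda>w. c * \<phi> w)) z = c * wirt_bar j (wirt i \<phi>) z"
proof -
  have "wirt_bar j (wirt i (\<lambda>w. c * \<phi> w)) z = wirt_bar j (\<lambda>w. c * wirt i \<phi> w) z"
    by (rule wirt_cong(2)[OF assms(1,2)], rule wirt_cmult) (use assms in \<open>auto simp: numeral_2_eq_2\<close>)
  also have "\<dots> = c * wirt_bar j (wirt i \<phi>) z"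
    using Ck_on_wirt(1)[OF assms(1), of 1] assms by (intro wirt_cmult) (auto simp: numeral_2_eq_2)
  finally show ?thesis .
qed

lemma lap_add:
  assumes "open S" "z \<in> S" "Ck_on 2 S \<phi>" "Ck_on 2 S \<psi>"
  shows "lap h (\<lambda>w. \<phi> w + \<psi> w) z = lap h \<phi> z + lap h \<psi> z"
  unfolding lap_def wirt_wirt_bar_add[OF assms] by (simp add: algebra_simps sum.distrib)

lemma lap_cmult:
  assumes "open S" "z \<in> S" "Ck_on 2 S \<phi>"
  shows "lap h (\<lambda>w. c * \<phi> w) z = c * lap h \<phi> z"
  unfolding lap_def wirt_wirt_bar_cmult[OF assms] by (simp add: algebra_simps sum_distrib_left)

section \<open>Holomorphic changes of coordinates\<close>

definition jac :: "(complex ^ 'n \<Rightarrow> complex ^ 'n) \<Rightarrow> complex ^ 'n \<Rightarrow> complex ^ 'n ^ 'n::finite" where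
  "jac T z = (\<chi> a i. frechet_derivative T (at z) (axis i 1) $ a)"

lemma holomorphic_map_on_frechet:
  assumes "holomorphic_map_on S T" "z \<in> S"
  shows "(T has_derivative frechet_derivative T (at z)) (at z)"
    and "frechet_derivative T (at z) (c *s v) = c *s frechet_derivative T (at z) v"
proof -
  obtain D where D: "(T has_derivative D) (at z)" "\<forall>c v. D (c *s v) = c *s D v"
    using assms unfolding holomorphic_map_on_def by blast
  have "frechet_derivative T (at z) = D" using frechet_derivative_at[OF D(1)] by simp
  then show "(T has_derivative frechet_derivative T (at z)) (at z)"
    "frechet_derivative T (at z) (c *s v) = c *s frechet_derivative T (at z) v" using D by auto
qed

lemma frechet_derivative_jac:
  assumes "holomorphic_map_on S T" "z \<in> S"
  shows "frechet_derivative T (at z) = (*v) (jac T z)"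
proof
  fix v :: "complex ^ 'a"
  let ?D = "frechet_derivative T (at z)"
  have lin: "linear ?D" using holomorphic_map_on_frechet(1)[OF assms] has_derivative_linear by blast
  have "v = (\<Sum>i\<in>UNIV. v $ i *s axis i 1)"
    by (simp add: vec_eq_iff axis_def sum_component if_distrib cong: if_cong)
  then have "?D v = (\<Sum>i\<in>UNIV. v $ i *s ?D (axis i 1))"
    by (metis (no_types, lifting) linear_sum[OF lin] holomorphic_map_on_frechet(2)[OF assms] sum.cong)
  then show "?D v = jac T z *v v"
    by (simp add: vec_eq_iff matrix_vector_mult_def jac_def mult.commute)
qed

lemma has_derivative_jac:
  assumes "holomorphic_map_on S T" "z \<in> S"
  shows "(T has_derivative (*v) (jac T z)) (at z)"
  using holomorphic_map_on_frechet(1)[OF assms] frechet_derivative_jac[OF assms] by simp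

lemma holo_on_jac:
  assumes S: "open S" and T: "holomorphic_map_on S T"
  shows "holo_on S (\<lambda>z. jac T z $ a $ i)"
proof -
  have c: "holo_on S (\<lambda>z. T z $ a)" by (rule holo_on_component[OF T])
  have H: "holo_on S (\<lambda>z. frechet_derivative (\<lambda>z. T z $ a) (at z) (axis i 1))"
    by (rule holo_on_directional_derivative[OF S c])
  have eq: "frechet_derivative (\<lambda>z. T z $ a) (at z) (axis i 1) = jac T z $ a $ i" if "z \<in> S" for z
    using frechet_derivative_at[OF bounded_linear.has_derivative[OF bounded_linear_vec_nth holomorphic_map_on_frechet(1)[OF T that]]]
    by (simp add: jac_def) metis
  show ?thesis by (rule holo_on_cong[OF S eq H])
qed

lemma holo_on_det_jac:
  assumes "open S" "holomorphic_map_on S T"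
  shows "holo_on S (\<lambda>z. det (jac T z))"
  unfolding det_def by (intro holo_on_sum holo_on_mult holo_on_const holo_on_prod holo_on_jac assms)

text \<open>The entries of the Jacobian are holomorphic, so \<open>wirt_bar\<close> does not see
  them and no first derivative of \<phi> appears: the complex Hessian transforms as a
  tensor.\<close>

lemma wirt_wirt_bar_holomorphic_compose:
  fixes T :: "complex ^ 'n \<Rightarrow> complex ^ 'n::finite"
  assumes S: "open S" "z \<in> S" and T: "holomorphic_map_on S T"
    and V: "open V" "\<And>w. w \<in> S \<Longrightarrow> T w \<in> V" and \<phi>: "Ck_on 2 V \<phi>"
  shows "wirt_bar j (wirt i (\<lambda>w. \<phi> (T w))) z =
    (\<Sum>a\<in>UNIV. \<Sum>b\<in>UNIV. wirt_bar b (wirt a \<phi>) (T z) * cnj (jac T z $ b $ j) * jac T z $ a $ i)"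
proof -
  note J = has_derivative_jac[OF T]
  have mv: "jac T w *v (c *s v) = c *s (jac T w *v v)" for w c v
    by (simp add: vec_eq_iff matrix_vector_mult_def sum_distrib_left algebra_simps)
  have ax: "(jac T w *v axis i 1) $ a = jac T w $ a $ i" for w i a
    by (simp add: matrix_vector_mult_def axis_def if_distrib cong: if_cong)
  have d\<phi>: "\<phi> differentiable at w" if "w \<in> V" for w using \<phi> that by (simp add: numeral_2_eq_2)
  have dw: "wirt a \<phi> differentiable at w" if "w \<in> V" for a w
    using Ck_on_wirt(1)[OF V(1), of 1 \<phi> a] \<phi> that by (simp add: numeral_2_eq_2)
  have 1: "wirt i (\<lambda>w. \<phi> (T w)) w = (\<Sum>a\<in>UNIV. wirt a \<phi> (T w) * jac T w $ a $ i)" if "w \<in> S" for w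
    using wirt_holomorphic_compose(1)[OF d\<phi>[OF V(2)[OF that]] J[OF that] mv] by (simp add: ax)
  have dT: "T differentiable at z" using J[OF S(2)] by (auto simp: differentiable_def)
  have d1: "(\<lambda>w. wirt a \<phi> (T w)) differentiable at z" for a
    using differentiable_chain_at[OF dT dw[OF V(2)[OF S(2)]]] by (simp add: o_def)
  have d2: "(\<lambda>w. jac T w $ a $ i) differentiable at z" for a
    by (rule holo_on_differentiable[OF holo_on_jac[OF S(1) T] S(2)])
  have "wirt_bar j (wirt i (\<lambda>w. \<phi> (T w))) z = wirt_bar j (\<lambda>w. \<Sum>a\<in>UNIV. wirt a \<phi> (T w) * jac T w $ a $ i) z"
    by (rule wirt_cong(2)[OF S 1])
  also have "\<dots> = (\<Sum>a\<in>UNIV. wirt_bar j (\<lambda>w. wirt a \<phi> (T w)) z * jac T z $ a $ i)"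
    using d1 d2 by (subst wirt_sum) (auto simp: wirt_mult holo_on_wirt_bar[OF holo_on_jac[OF S(1) T] S(2)])
  also have "\<dots> = (\<Sum>a\<in>UNIV. (\<Sum>b\<in>UNIV. wirt_bar b (wirt a \<phi>) (T z) * cnj (jac T z $ b $ j)) * jac T z $ a $ i)"
    using wirt_holomorphic_compose(2)[OF dw[OF V(2)[OF S(2)]] J[OF S(2)] mv] by (simp add: ax)
  finally show ?thesis by (simp add: sum_distrib_right)
qed

text \<open>The Jacobian factors of the Hessian are those by which the inverse metric transforms;
  the rest is a reordering of four sums.\<close>

lemma lap_holomorphic_compose:
  fixes T :: "complex ^ 'n \<Rightarrow> complex ^ 'n::finite"
  assumes "open S" "z \<in> S" "holomorphic_map_on S T"
    and "open V" "\<And>w. w \<in> S \<Longrightarrow> T w \<in> V" "Ck_on 2 V \<phi>"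
    and inv: "\<And>a b. inv_metric (k (T z)) a b = (\<Sum>i\<in>UNIV. \<Sum>j\<in>UNIV. jac T z $ a $ i * cnj (jac T z $ b $ j) * inv_metric (h z) i j)"
  shows "lap h (\<lambda>w. \<phi> (T w)) z = lap k \<phi> (T z)"
proof -
  have E: "wirt_bar j (wirt i (\<lambda>w. \<phi> (T w))) z =
    (\<Sum>a\<in>UNIV. \<Sum>b\<in>UNIV. wirt_bar b (wirt a \<phi>) (T z) * cnj (jac T z $ b $ j) * jac T z $ a $ i)" for i j
    by (rule wirt_wirt_bar_holomorphic_compose[OF assms(1-6)])
  have "lap h (\<lambda>w. \<phi> (T w)) z = (\<Sum>i\<in>UNIV. \<Sum>j\<in>UNIV. \<Sum>a\<in>UNIV. \<Sum>b\<in>UNIV.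
      jac T z $ a $ i * cnj (jac T z $ b $ j) * inv_metric (h z) i j * wirt_bar b (wirt a \<phi>) (T z))"
    unfolding lap_def E sum_distrib_left
    by (simp add: algebra_simps)
  also have "\<dots> = (\<Sum>i\<in>UNIV. \<Sum>a\<in>UNIV. \<Sum>b\<in>UNIV. \<Sum>j\<in>UNIV.
      jac T z $ a $ i * cnj (jac T z $ b $ j) * inv_metric (h z) i j * wirt_bar b (wirt a \<phi>) (T z))"
    by (rule sum.cong[OF refl], subst sum.swap, rule sum.cong[OF refl], rule sum.swap)
  also have "\<dots> = (\<Sum>a\<in>UNIV. \<Sum>b\<in>UNIV. \<Sum>i\<in>UNIV. \<Sum>j\<in>UNIV.
      jac T z $ a $ i * cnj (jac T z $ b $ j) * inv_metric (h z) i j * wirt_bar b (wirt a \<phi>) (T z))"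
    by (subst sum.swap, rule sum.cong[OF refl], rule sum.swap)
  finally show ?thesis unfolding lap_def inv by (simp add: sum_distrib_right)
qed

text \<open>Contracting over k and l cancels the metric against its inverse and leaves the trace of
  the Christoffel symbols over k = p, which Jacobi's formula identifies with d_i log det h.\<close>

lemma chern_scalar_local_eq_lap:
  fixes h :: "complex ^ 'n \<Rightarrow> complex ^ 'n ^ 'n::finite"
  assumes S: "open S" "z \<in> S" and h: "Ck_on 2 S h" and pd: "\<And>w. w \<in> S \<Longrightarrow> pos_def_hermitian (h w)"
  shows "chern_scalar_local h z = - lap h (\<lambda>w. of_real (ln (Re (det (h w))))) z"
proof -
  have inv: "invertible (h w)" if "w \<in> S" for w by (rule pos_def_hermitian_invertible[OF pd[OF that]])
  have ent: "Ck_on 2 S (\<lambda>w. h w $ i $ j)" for i j by (intro Ck_on_vec_nth S h)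
  have dh: "h differentiable at w" if "w \<in> S" for w using h that by (simp add: numeral_2_eq_2)
  have \<Gamma>1: "Ck_on 1 S (chern_christoffel h i k p)" for i k p
  proof -
    have "Ck_on 1 S (\<lambda>w. h w $ i $ j)" for i j by (rule Ck_on_mono[OF ent]) simp
    moreover have "Ck_on 1 S (wirt i (\<lambda>w. h w $ k $ q))" for q
      using Ck_on_wirt(1)[OF S(1), of 1 "\<lambda>w. h w $ k $ q"] ent by (simp add: numeral_2_eq_2)
    ultimately show ?thesis
      unfolding chern_christoffel_def[abs_def]
      by (intro Ck_on_sum S(1) Ck_on_mult Ck_on_inv_metric inv)
  qed
  have trace: "(\<Sum>k\<in>UNIV. chern_christoffel h i k k w) = wirt i (\<lambda>w. of_real (ln (Re (det (h w))))) w" if w: "w \<in> S" for i w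
  proof -
    have C: "Ck_on 2 S (\<lambda>w. det (h w))" by (rule Ck_on_det[OF S(1) ent])
    have d: "(\<lambda>w. Re (det (h w))) differentiable at w"
      using C w by (intro differentiable_bounded_linear[OF bounded_linear_Re]) (simp add: numeral_2_eq_2)
    have pos: "Re (det (h w)) > 0" by (rule pos_def_hermitian_det_pos[OF pd[OF w]])
    have "wirt i (\<lambda>w. of_real (ln (Re (det (h w))))) w = of_real (1 / Re (det (h w))) * wirt i (\<lambda>w. of_real (Re (det (h w)))) w"
      by (rule wirt_real_compose(1)[OF d DERIV_ln_divide[OF pos]])
    also have "wirt i (\<lambda>w. of_real (Re (det (h w)))) w = wirt i (\<lambda>w. det (h w)) w"
      by (rule wirt_cong(1)[OF S(1) w]) (simp add: pos_def_hermitian_det_of_real[OF pd, symmetric])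
    also have "of_real (1 / Re (det (h w))) * wirt i (\<lambda>w. det (h w)) w =
        (\<Sum>k\<in>UNIV. \<Sum>q\<in>UNIV. inv_metric (h w) k q * wirt i (\<lambda>w. h w $ k $ q) w)"
      unfolding wirt_det[OF dh[OF w] inv[OF w]]
      using pos pos_def_hermitian_det_of_real[OF pd[OF w]] by (metis (no_types, lifting) nonzero_of_real_divide
          less_numeral_extra(3) mult.assoc mult_1 nonzero_eq_divide_eq of_real_1 of_real_eq_0_iff times_divide_eq_left)
    finally show ?thesis by (simp add: chern_christoffel_def)
  qed
  have "(\<Sum>k\<in>UNIV. \<Sum>l\<in>UNIV. inv_metric (h z) k l * chern_curvature h i j k l z) =
      - wirt_bar j (wirt i (\<lambda>w. of_real (ln (Re (det (h w)))))) z" for i j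
  proof -
    have "(\<Sum>k\<in>UNIV. \<Sum>l\<in>UNIV. inv_metric (h z) k l * chern_curvature h i j k l z) =
      (\<Sum>k\<in>UNIV. \<Sum>l\<in>UNIV. \<Sum>p\<in>UNIV. inv_metric (h z) k l * h z $ p $ l * (- wirt_bar j (chern_christoffel h i k p) z))"
      by (simp add: chern_curvature_def sum_distrib_left mult.assoc)
    also have "\<dots> = (\<Sum>k\<in>UNIV. \<Sum>p\<in>UNIV. (\<Sum>l\<in>UNIV. inv_metric (h z) k l * h z $ p $ l) * (- wirt_bar j (chern_christoffel h i k p) z))"
      by (rule sum.cong[OF refl], subst sum.swap) (simp add: sum_distrib_right sum_negf)
    also have "\<dots> = (\<Sum>k\<in>UNIV. \<Sum>p\<in>UNIV. if p = k then - wirt_bar j (chern_christoffel h i k p) z else 0)"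
      unfolding sum_inv_metric[OF inv[OF S(2)]] by (intro sum.cong refl) auto
    also have "\<dots> = - (\<Sum>k\<in>UNIV. wirt_bar j (chern_christoffel h i k k) z)"
      by (simp add: sum_negf)
    also have "(\<Sum>k\<in>UNIV. wirt_bar j (chern_christoffel h i k k) z) = wirt_bar j (\<lambda>w. \<Sum>k\<in>UNIV. chern_christoffel h i k k w) z"
      using \<Gamma>1 S(2) by (subst wirt_sum) auto
    also have "\<dots> = wirt_bar j (wirt i (\<lambda>w. of_real (ln (Re (det (h w)))))) z"
      by (rule wirt_cong(2)[OF S trace])
    finally show ?thesis .
  qed
  then have "chern_scalar_local h z = (\<Sum>i\<in>UNIV. \<Sum>j\<in>UNIV. inv_metric (h z) i j * (- wirt_bar j (wirt i (\<lambda>w. of_real (ln (Re (det (h w)))))) z))"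
    unfolding chern_scalar_local_def by (simp add: mult.assoc flip: sum_distrib_left)
  then show ?thesis by (simp add: lap_def sum_negf)
qed

section \<open>Hermitian metrics on complex manifolds\<close>

lemma chart_inv_mem: "z \<in> chart_image c \<Longrightarrow> chart_inv c z \<in> fst c"
  unfolding chart_image_def chart_inv_def by (rule inv_into_into)

lemma chart_chart_inv: "z \<in> chart_image c \<Longrightarrow> snd c (chart_inv c z) = z"
  unfolding chart_image_def chart_inv_def by (rule f_inv_into_f)

lemma herm_form_axis: "herm_form h (axis i 1) (axis j 1) = h $ i $ j"
proof -
  have "h $ k $ l * axis i 1 $ k * cnj (axis j 1 $ l) = (if l = j then if k = i then h $ k $ l else 0 else 0)" for k l
    by (simp add: axis_def)
  then show ?thesis by (simp add: herm_form_def)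
qed

lemma herm_form_scaleR: "herm_form (r *\<^sub>R h) u v = of_real r * herm_form h u v"
  using herm_form_add_scale[of r h 0 h] by simp

definition overlap :: "('m, 'n::finite) chart \<Rightarrow> ('m, 'n) chart \<Rightarrow> (complex, 'n) vec set" where
  "overlap c d = snd c ` (fst c \<inter> fst d)"

locale complex_manifold =
  fixes A :: "('m::{t2_space, second_countable_topology}, 'n::finite) chart set"
  assumes atlas: "complex_atlas A"
begin

lemma open_domain: "c \<in> A \<Longrightarrow> open (fst c)"
  and open_image: "c \<in> A \<Longrightarrow> open (chart_image c)"
  and homeo: "c \<in> A \<Longrightarrow> homeomorphism (fst c) (chart_image c) (snd c) (chart_inv c)"
  and holo_transition: "c \<in> A \<Longrightarrow> d \<in> A \<Longrightarrow> holomorphic_map_on (overlap c d) (transition c d)"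
  using atlas unfolding complex_atlas_def overlap_def by blast+

lemma chart_inv_chart: "c \<in> A \<Longrightarrow> x \<in> fst c \<Longrightarrow> chart_inv c (snd c x) = x"
  using homeo unfolding homeomorphism_def by blast

lemma chart_mem: "x \<in> fst c \<Longrightarrow> snd c x \<in> chart_image c"
  by (simp add: chart_image_def)

lemma continuous_chart: "c \<in> A \<Longrightarrow> continuous_on (fst c) (snd c)"
  and continuous_chart_inv: "c \<in> A \<Longrightarrow> continuous_on (chart_image c) (chart_inv c)"
  using homeo unfolding homeomorphism_def by blast+

lemma chart_at_props: "chart_at A x \<in> A" "x \<in> fst (chart_at A x)"
proof -
  have "\<exists>c. c \<in> A \<and> x \<in> fst c" using atlas unfolding complex_atlas_def by blast
  then have "chart_at A x \<in> A \<and> x \<in> fst (chart_at A x)" unfolding chart_at_def by (rule someI_ex)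
  then show "chart_at A x \<in> A" "x \<in> fst (chart_at A x)" by auto
qed

lemma overlap_iff:
  assumes "c \<in> A"
  shows "z \<in> overlap c d \<longleftrightarrow> z \<in> chart_image c \<and> chart_inv c z \<in> fst d"
proof
  assume "z \<in> overlap c d"
  then obtain x where "x \<in> fst c" "x \<in> fst d" "z = snd c x" unfolding overlap_def by blast
  then show "z \<in> chart_image c \<and> chart_inv c z \<in> fst d"
    by (simp add: chart_inv_chart[OF assms] chart_mem)
next
  assume z: "z \<in> chart_image c \<and> chart_inv c z \<in> fst d"
  then have "chart_inv c z \<in> fst c \<inter> fst d" "z = snd c (chart_inv c z)"
    by (simp_all add: chart_inv_mem chart_chart_inv)
  then show "z \<in> overlap c d" unfolding overlap_def by (metis imageI)
qed

lemma open_overlap: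
  assumes "c \<in> A" "d \<in> A" shows "open (overlap c d)"
proof -
  have "overlap c d = chart_image c \<inter> chart_inv c -` fst d"
    by (rule set_eqI) (simp add: overlap_iff[OF assms(1)])
  then show ?thesis
    using continuous_open_preimage[OF continuous_chart_inv[OF assms(1)] open_image[OF assms(1)] open_domain[OF assms(2)]] by simp
qed

lemma overlap_mem: "z \<in> overlap c d \<Longrightarrow> c \<in> A \<Longrightarrow> z \<in> chart_image c"
  by (simp add: overlap_iff)

lemma transition_props:
  assumes "c \<in> A" "d \<in> A" "z \<in> overlap c d"
  shows "transition c d z \<in> overlap d c" "chart_inv d (transition c d z) = chart_inv c z"
    "transition d c (transition c d z) = z"
proof -
  have z: "z \<in> chart_image c" "chart_inv c z \<in> fst d" using overlap_iff[OF assms(1)] assms(3) by auto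
  show 1: "chart_inv d (transition c d z) = chart_inv c z"
    unfolding transition_def by (rule chart_inv_chart[OF assms(2) z(2)])
  show "transition c d z \<in> overlap d c"
    unfolding overlap_def transition_def using z chart_inv_mem by blast
  show "transition d c (transition c d z) = z"
    unfolding transition_def[of d c] 1 by (rule chart_chart_inv[OF z(1)])
qed

abbreviation J where "J c d z \<equiv> jac (transition c d) z"

lemma jac_transition_inverse:
  assumes "c \<in> A" "d \<in> A" "z \<in> overlap c d"
  shows "J d c (transition c d z) ** J c d z = mat 1"
proof -
  have op: "open (overlap c d)" by (rule open_overlap[OF assms(1,2)])
  have "((\<lambda>w. transition d c (transition c d w)) has_derivative (\<lambda>v. J d c (transition c d z) *v (J c d z *v v))) (at z)"
    by (rule has_derivative_compose[OF has_derivative_jac[OF holo_transition[OF assms(1,2)] assms(3)]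
          has_derivative_jac[OF holo_transition[OF assms(2,1)] transition_props(1)[OF assms]]])
  then have "((\<lambda>w. w) has_derivative (\<lambda>v. J d c (transition c d z) *v (J c d z *v v))) (at z)"
    using has_derivative_cong_open[OF op assms(3), of "\<lambda>w. transition d c (transition c d w)" "\<lambda>w. w"]
      transition_props(3)[OF assms(1,2)] by simp
  then have "(\<lambda>v. J d c (transition c d z) *v (J c d z *v v)) = (\<lambda>v. v)"
    using has_derivative_unique has_derivative_ident by blast
  then show ?thesis
    by (metis matrix_eq matrix_vector_mul_assoc matrix_vector_mul_lid)
qed

lemma det_jac_transition:
  assumes "c \<in> A" "d \<in> A" "z \<in> overlap c d"
  shows "det (J c d z) \<noteq> 0"
  using arg_cong[OF jac_transition_inverse[OF assms], of det] by (auto simp: det_mul)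

definition Ck_fun :: "nat \<Rightarrow> ('m \<Rightarrow> real) \<Rightarrow> bool" where
  "Ck_fun k u \<longleftrightarrow> (\<forall>c\<in>A. Ck_on k (chart_image c) (\<lambda>z. u (chart_inv c z)))"

lemma Ck_fun_mono: "Ck_fun k u \<Longrightarrow> j \<le> k \<Longrightarrow> Ck_fun j u"
  unfolding Ck_fun_def using Ck_on_mono by blast

lemma smooth_fun_Ck: "smooth_fun A u \<longleftrightarrow> (\<forall>k. Ck_fun k u)"
  by (auto simp: smooth_fun_def smooth_on_def Ck_fun_def)

text \<open>The chart at x is an arbitrary choice; \<open>laplace_chart\<close> shows that every
  chart gives the same value for C^2 functions.\<close>

definition laplace :: "('m, 'n) metric \<Rightarrow> ('m \<Rightarrow> real) \<Rightarrow> 'm \<Rightarrow> real" where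
  "laplace G u x = Re (lap (G (chart_at A x)) (\<lambda>w. of_real (u (chart_inv (chart_at A x) w))) (snd (chart_at A x) x))"

lemma Ck_on_of_real: "open S \<Longrightarrow> Ck_on k S f \<Longrightarrow> Ck_on k S (\<lambda>z. complex_of_real (f z))"
  by (rule Ck_on_bounded_linear_compose[OF _ bounded_linear_of_real])

lemma Ck_fun_complex:
  "c \<in> A \<Longrightarrow> Ck_fun k u \<Longrightarrow> Ck_on k (chart_image c) (\<lambda>z. complex_of_real (u (chart_inv c z)))"
  unfolding Ck_fun_def by (intro Ck_on_of_real open_image) auto

end

locale hermitian_manifold = complex_manifold A
  for A :: "('m::{t2_space, second_countable_topology}, 'n::finite) chart set" +
  fixes G :: "('m, 'n) metric"
  assumes metric: "hermitian_metric A G"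
begin

lemma Ck_metric: "c \<in> A \<Longrightarrow> Ck_on k (chart_image c) (G c)"
  and pos_def: "c \<in> A \<Longrightarrow> z \<in> chart_image c \<Longrightarrow> pos_def_hermitian (G c z)"
  using metric unfolding hermitian_metric_def smooth_on_def by blast+

lemma inv_G: "c \<in> A \<Longrightarrow> z \<in> chart_image c \<Longrightarrow> invertible (G c z)"
  by (rule pos_def_hermitian_invertible[OF pos_def])

lemma Ck_metric_entry: "c \<in> A \<Longrightarrow> Ck_on k (chart_image c) (\<lambda>z. G c z $ i $ j)"
  by (intro Ck_on_vec_nth open_image Ck_metric)

lemma metric_transition:
  assumes "c \<in> A" "d \<in> A" "z \<in> overlap c d"
  shows "G c z = transpose (J c d z) ** G d (transition c d z) ** (\<chi> a i. cnj (J c d z $ a $ i))"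
proof -
  have ax: "(J c d z *v axis i 1) $ a = J c d z $ a $ i" for i a
    by (simp add: matrix_vector_mult_def axis_def if_distrib cong: if_cong)
  have "G c z $ i $ j = (\<Sum>a\<in>UNIV. \<Sum>b\<in>UNIV. G d (transition c d z) $ a $ b * J c d z $ a $ i * cnj (J c d z $ b $ j))" for i j
  proof -
    have "herm_form (G c z) (axis i 1) (axis j 1) = herm_form (G d (transition c d z))
        (frechet_derivative (transition c d) (at z) (axis i 1)) (frechet_derivative (transition c d) (at z) (axis j 1))"
      using metric assms unfolding hermitian_metric_def overlap_def by blast
    then show ?thesis
      unfolding herm_form_axis frechet_derivative_jac[OF holo_transition[OF assms(1,2)] assms(3)]
      by (simp add: herm_form_def ax)
  qed
  also have "(\<Sum>a\<in>UNIV. \<Sum>b\<in>UNIV. G d (transition c d z) $ a $ b * J c d z $ a $ i * cnj (J c d z $ b $ j)) =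
     (transpose (J c d z) ** G d (transition c d z) ** (\<chi> a i. cnj (J c d z $ a $ i))) $ i $ j" for i j
    by (subst sum.swap) (simp add: matrix_matrix_mult_def transpose_def sum_distrib_left sum_distrib_right algebra_simps)
  finally show ?thesis by (simp add: vec_eq_iff)
qed

lemma det_transition:
  assumes "c \<in> A" "d \<in> A" "z \<in> overlap c d"
  shows "det (G c z) = of_real ((cmod (det (J c d z)))\<^sup>2) * det (G d (transition c d z))"
  by (subst metric_transition[OF assms])
     (simp add: det_mul complex_norm_square flip: cnj_det del: of_real_power)

lemma inv_metric_transition:
  assumes "c \<in> A" "d \<in> A" "z \<in> overlap c d"
  shows "inv_metric (G d (transition c d z)) a b =
    (\<Sum>i\<in>UNIV. \<Sum>j\<in>UNIV. J c d z $ a $ i * cnj (J c d z $ b $ j) * inv_metric (G c z) i j)"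
proof -
  define P where "P = J c d z"
  define Q where "Q = (\<chi> a i. cnj (P $ a $ i))"
  define H where "H = G d (transition c d z)"
  define K where "K = matrix_inv (G c z)"
  have z: "z \<in> chart_image c" "transition c d z \<in> chart_image d"
    using assms transition_props(1)[OF assms] by (auto intro: overlap_mem)
  have gc: "G c z = transpose P ** H ** Q"
    unfolding P_def Q_def H_def by (rule metric_transition[OF assms])
  have inv: "G c z ** K = mat 1" "K ** G c z = mat 1" unfolding K_def using matrix_inv inv_G assms(1) z(1) by blast+
  have "det (transpose P) \<noteq> 0" using det_jac_transition[OF assms] by (simp add: P_def)
  then have "invertible (transpose P)" by (simp add: invertible_det_nz)
  then obtain X where X: "X ** transpose P = mat 1" "transpose P ** X = mat 1" unfolding invertible_def by blast
  \<comment> \<open>Conjugating G K = 1 by the transpose of P exhibits Q K P^T as the inverse of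
    H.\<close>
  have "transpose P ** (H ** (Q ** K ** transpose P)) ** X = mat 1"
  proof -
    have "transpose P ** (H ** (Q ** K ** transpose P)) ** X = (G c z ** K) ** (transpose P ** X)"
      unfolding gc by (simp add: matrix_mul_assoc)
    then show ?thesis by (simp add: inv X)
  qed
  then have "X ** (transpose P ** (H ** (Q ** K ** transpose P)) ** X) ** transpose P = X ** transpose P"
    by (simp add: matrix_mul_assoc)
  then have "H ** (Q ** K ** transpose P) = mat 1"
    by (metis X(1) matrix_mul_assoc matrix_mul_lid matrix_mul_rid)
  then have "matrix_inv H = Q ** K ** transpose P" by (rule matrix_inv_unique)
  then have "inv_metric H a b = (Q ** K ** transpose P) $ b $ a"
    unfolding H_def using inv_metric_eq[OF inv_G[OF assms(2) z(2)]] by simp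
  also have "\<dots> = (\<Sum>i\<in>UNIV. \<Sum>j\<in>UNIV. P $ a $ i * cnj (P $ b $ j) * K $ j $ i)"
    by (simp add: matrix_matrix_mult_def transpose_def Q_def sum_distrib_left sum_distrib_right algebra_simps)
  finally show ?thesis unfolding H_def P_def K_def inv_metric_eq[OF inv_G[OF assms(1) z(1)]] .
qed

lemma lap_transition:
  assumes "c \<in> A" "d \<in> A" "z \<in> overlap c d" "open V" "V \<subseteq> overlap d c" "transition c d z \<in> V" "Ck_on 2 V \<phi>"
  shows "lap (G c) (\<lambda>w. \<phi> (transition c d w)) z = lap (G d) \<phi> (transition c d z)"
proof -
  define S where "S = overlap c d \<inter> transition c d -` V"
  have "continuous_on (overlap c d) (transition c d)"
    using Ck_on_continuous[OF Ck_on_holomorphic_map[OF open_overlap holo_transition]] assms(1,2) by blast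
  then have S: "open S" unfolding S_def
    by (intro continuous_open_preimage open_overlap assms)
  have "holomorphic_map_on S (transition c d)"
    using holo_transition[OF assms(1,2)] unfolding holomorphic_map_on_def S_def by blast
  then show ?thesis
    by (intro lap_holomorphic_compose[OF S, where V = V] inv_metric_transition assms) (use assms in \<open>auto simp: S_def\<close>)
qed

lemma laplace_chart:
  assumes "c \<in> A" "z \<in> chart_image c" "Ck_fun 2 u"
  shows "laplace G u (chart_inv c z) = Re (lap (G c) (\<lambda>w. of_real (u (chart_inv c w))) z)"
proof -
  define x where "x = chart_inv c z"
  define d where "d = chart_at A x"
  have d: "d \<in> A" "x \<in> fst d" using chart_at_props[of x] by (simp_all add: d_def)
  have zo: "z \<in> overlap c d" using assms d by (simp add: overlap_iff x_def)
  have "lap (G c) (\<lambda>w. of_real (u (chart_inv c w))) z = lap (G c) (\<lambda>w. of_real (u (chart_inv d (transition c d w)))) z"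
    by (rule lap_cong[OF open_overlap[OF assms(1) d(1)] zo]) (simp add: transition_props(2)[OF assms(1) d(1)])
  also have "\<dots> = lap (G d) (\<lambda>w. of_real (u (chart_inv d w))) (transition c d z)"
  proof (rule lap_transition[OF assms(1) d(1) zo open_overlap[OF d(1) assms(1)] subset_refl transition_props(1)[OF assms(1) d(1) zo]])
    show "Ck_on 2 (overlap d c) (\<lambda>w. complex_of_real (u (chart_inv d w)))"
      using Ck_fun_complex[OF d(1) assms(3)] by (rule Ck_on_subset) (auto intro: overlap_mem d)
  qed
  also have "transition c d z = snd d x" by (simp add: transition_def x_def)
  finally show ?thesis by (simp add: laplace_def x_def d_def)
qed

definition logdet :: "('m, 'n) chart \<Rightarrow> complex ^ 'n \<Rightarrow> complex" where
  "logdet c z = of_real (ln (Re (det (G c z))))"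

lemma Ck_logdet: "c \<in> A \<Longrightarrow> Ck_on k (chart_image c) (logdet c)"
proof -
  assume c: "c \<in> A"
  have "Ck_on k (chart_image c) (\<lambda>z. Re (det (G c z)))"
    by (intro Ck_on_bounded_linear_compose[OF _ bounded_linear_Re] Ck_on_det Ck_metric_entry open_image c)
  then have "Ck_on k (chart_image c) (\<lambda>z. ln (Re (det (G c z))))"
    by (rule Ck_on_compose[OF open_image[OF c] _ Ck_on_ln])
       (simp add: pos_def_hermitian_det_pos[OF pos_def[OF c]])
  then show "Ck_on k (chart_image c) (logdet c)"
    unfolding logdet_def[abs_def] by (intro Ck_on_of_real open_image c)
qed

lemma chern_local_eq:
  assumes "c \<in> A" "z \<in> chart_image c"
  shows "chern_scalar_local (G c) z = - lap (G c) (logdet c) z"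
  unfolding logdet_def[abs_def]
  by (rule chern_scalar_local_eq_lap[OF open_image assms(2) Ck_metric]) (use assms pos_def in auto)

text \<open>Between charts log det G changes by ln |det J|^2, which is pluriharmonic, and
  \<open>lap\<close> is invariant. This is the chart independence of the scalar curvature.\<close>

lemma lap_logdet_transition:
  assumes c: "c \<in> A" "d \<in> A" "z \<in> overlap c d"
  shows "lap (G c) (logdet c) z = lap (G d) (logdet d) (transition c d z)"
proof -
  let ?S = "overlap c d"
  let ?q = "\<lambda>w. complex_of_real (ln ((cmod (det (J c d w)))\<^sup>2))"
  have op: "open ?S" by (rule open_overlap[OF c(1,2)])
  have hd: "holo_on ?S (\<lambda>w. det (J c d w))" by (rule holo_on_det_jac[OF op holo_transition[OF c(1,2)]])
  have split: "logdet c w = ?q w + logdet d (transition c d w)" if w: "w \<in> ?S" for w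
  proof -
    have "Re (det (G d (transition c d w))) > 0"
      by (intro pos_def_hermitian_det_pos pos_def c overlap_mem[OF transition_props(1)[OF c(1,2) w]])
    then show ?thesis
      unfolding logdet_def det_transition[OF c(1,2) w]
      using det_jac_transition[OF c(1,2) w] by (simp add: ln_mult)
  qed
  have C1: "Ck_on 2 ?S ?q"
  proof -
    have F: "Ck_on 2 ?S (\<lambda>w. det (J c d w))" by (rule Ck_on_holo[OF op hd])
    have "Ck_on 2 ?S (\<lambda>w. Re (det (J c d w) * cnj (det (J c d w))))"
      by (intro Ck_on_bounded_linear_compose[OF op bounded_linear_Re] Ck_on_mult Ck_on_bounded_linear_compose[OF op bounded_linear_cnj] op F)
    then have "Ck_on 2 ?S (\<lambda>w. (cmod (det (J c d w)))\<^sup>2)" by (simp add: complex_mult_cnj cmod_power2)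
    then show ?thesis
      using det_jac_transition[OF c(1,2)] by (intro Ck_on_of_real op Ck_on_compose[OF op _ Ck_on_ln]) auto
  qed
  have C2: "Ck_on 2 ?S (\<lambda>w. logdet d (transition c d w))"
    by (rule Ck_on_compose[OF op Ck_on_holomorphic_map[OF op holo_transition[OF c(1,2)]] Ck_logdet[OF c(2)]])
       (intro overlap_mem[OF transition_props(1)[OF c(1,2)]] c)
  have "lap (G c) (logdet c) z = lap (G c) (\<lambda>w. ?q w + logdet d (transition c d w)) z"
    by (rule lap_cong[OF op c(3) split])
  also have "\<dots> = lap (G c) ?q z + lap (G c) (\<lambda>w. logdet d (transition c d w)) z"
    by (rule lap_add[OF op c(3) C1 C2])
  also have "lap (G c) ?q z = 0"
    unfolding lap_def using pluriharmonic_ln_norm[OF op c(3) hd det_jac_transition[OF c(1,2)]] by simp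
  also have "lap (G c) (\<lambda>w. logdet d (transition c d w)) z = lap (G d) (logdet d) (transition c d z)"
  proof (rule lap_transition[OF c open_overlap[OF c(2,1)] subset_refl transition_props(1)[OF c]])
    show "Ck_on 2 (overlap d c) (logdet d)"
      using Ck_logdet[OF c(2)] by (rule Ck_on_subset) (auto intro: overlap_mem c)
  qed
  finally show ?thesis by simp
qed

lemma chern_scalar_chart:
  assumes "c \<in> A" "z \<in> chart_image c"
  shows "chern_scalar A G (chart_inv c z) = - Re (lap (G c) (logdet c) z)"
proof -
  define x where "x = chart_inv c z"
  define d where "d = chart_at A x"
  have d: "d \<in> A" "x \<in> fst d" using chart_at_props[of x] by (simp_all add: d_def)
  have zo: "z \<in> overlap c d" using assms d by (simp add: overlap_iff x_def)
  have "transition c d z = snd d x" by (simp add: transition_def x_def)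
  then show ?thesis
    unfolding lap_logdet_transition[OF assms(1) d(1) zo] x_def[symmetric] chern_scalar_def d_def[symmetric]
    using chern_local_eq[OF d(1) chart_mem[OF d(2)]] by simp
qed

lemma Ck_lap:
  assumes c: "c \<in> A" and \<phi>: "Ck_on (Suc (Suc k)) (chart_image c) \<phi>"
  shows "Ck_on k (chart_image c) (lap (G c) \<phi>)"
  unfolding lap_def[abs_def]
  by (intro Ck_on_sum Ck_on_mult open_image Ck_on_inv_metric Ck_metric_entry inv_G Ck_on_wirt c \<phi>)

lemma smooth_chern_scalar: "smooth_fun A (chern_scalar A G)"
  unfolding smooth_fun_def smooth_on_def
proof (intro ballI allI)
  fix c k assume c: "c \<in> A"
  have "Ck_on k (chart_image c) (\<lambda>z. - Re (lap (G c) (logdet c) z))"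
    by (intro Ck_on_minus Ck_on_bounded_linear_compose[OF _ bounded_linear_Re] Ck_lap Ck_logdet open_image c)
  then show "Ck_on k (chart_image c) (\<lambda>z. chern_scalar A G (chart_inv c z))"
    by (rule Ck_on_cong_imp[OF open_image[OF c], rotated]) (simp add: chern_scalar_chart[OF c])
qed

lemma Ck_laplace:
  assumes "Ck_fun (Suc (Suc k)) u"
  shows "Ck_fun k (laplace G u)"
  unfolding Ck_fun_def
proof
  fix c assume c: "c \<in> A"
  have u2: "Ck_fun 2 u" by (rule Ck_fun_mono[OF assms]) simp
  have "Ck_on k (chart_image c) (\<lambda>z. Re (lap (G c) (\<lambda>w. of_real (u (chart_inv c w))) z))"
    by (intro Ck_on_bounded_linear_compose[OF _ bounded_linear_Re] Ck_lap Ck_fun_complex open_image c assms)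
  then show "Ck_on k (chart_image c) (\<lambda>z. laplace G u (chart_inv c z))"
    by (rule Ck_on_cong_imp[OF open_image[OF c], rotated]) (simp add: laplace_chart[OF c _ u2])
qed

lemma hermitian_metric_conformal:
  assumes "smooth_fun A u"
  shows "hermitian_metric A (conformal u G)"
  unfolding hermitian_metric_def
proof (intro conjI ballI allI)
  fix c assume c: "c \<in> A"
  have u: "Ck_on k (chart_image c) (\<lambda>z. u (chart_inv c z))" for k
    using assms c unfolding smooth_fun_def smooth_on_def by blast
  show "smooth_on (chart_image c) (conformal u G c)"
    unfolding smooth_on_def conformal_def
    by (intro allI Ck_on_scaleR open_image c Ck_metric Ck_on_compose[OF _ u Ck_on_exp]) auto
  show "pos_def_hermitian (conformal u G c z)" if "z \<in> chart_image c" for z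
    unfolding conformal_def by (intro pos_def_hermitian_scale pos_def c that) simp
next
  fix c d z v w assume cd: "c \<in> A" "d \<in> A" "z \<in> snd c ` (fst c \<inter> fst d)"
  have "chart_inv d (transition c d z) = chart_inv c z"
    by (rule transition_props(2)[OF cd(1,2)]) (use cd(3) in \<open>simp add: overlap_def\<close>)
  moreover have "herm_form (G c z) v w = herm_form (G d (transition c d z))
      (frechet_derivative (transition c d) (at z) v) (frechet_derivative (transition c d) (at z) w)"
    using metric cd unfolding hermitian_metric_def by blast
  ultimately show "herm_form (conformal u G c z) v w = herm_form (conformal u G d (transition c d z))
      (frechet_derivative (transition c d) (at z) v) (frechet_derivative (transition c d) (at z) w)"
    by (simp add: conformal_def herm_form_scaleR)
qed

text \<open>The conformal factor adds n u to log det and multiplies the inverse metric by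
  e^(-u).\<close>

lemma chern_scalar_conformal:
  assumes "smooth_fun A u"
  shows "chern_scalar A (conformal u G) x = exp (- u x) * (chern_scalar A G x - CARD('n) * laplace G u x)"
proof -
  interpret C: hermitian_manifold A "conformal u G"
    by unfold_locales (rule hermitian_metric_conformal[OF assms])
  define c where "c = chart_at A x"
  define z where "z = snd c x"
  have c: "c \<in> A" "x \<in> fst c" using chart_at_props[of x] by (simp_all add: c_def)
  have z: "z \<in> chart_image c" "chart_inv c z = x"
    using c by (simp_all add: z_def chart_mem chart_inv_chart)
  have u2: "Ck_fun 2 u" using assms smooth_fun_Ck by blast
  let ?u = "\<lambda>w. complex_of_real (u (chart_inv c w))"
  have uC: "Ck_on 2 (chart_image c) ?u" by (rule Ck_fun_complex[OF c(1) u2])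
  have op: "open (chart_image c)" by (rule open_image[OF c(1)])
  have ld: "C.logdet c w = of_nat CARD('n) * ?u w + logdet c w" if w: "w \<in> chart_image c" for w
  proof -
    have "det (conformal u G c w) = of_real (exp (real CARD('n) * u (chart_inv c w))) * det (G c w)"
      by (simp add: conformal_def det_scaleR exp_of_nat_mult flip: of_real_power)
    then show ?thesis
      using pos_def_hermitian_det_pos[OF pos_def[OF c(1) w]] by (simp add: C.logdet_def logdet_def ln_mult)
  qed
  have sc: "inv_metric (exp (u x) *\<^sub>R G c z) i j = of_real (inverse (exp (u x))) * inv_metric (G c z) i j" for i j
    by (rule inv_metric_scale[OF inv_G[OF c(1) z(1)]]) simp
  have "lap (conformal u G c) \<phi> z = of_real (exp (- u x)) * lap (G c) \<phi> z" for \<phi>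
    unfolding lap_def conformal_def z(2) sc by (simp add: sum_distrib_left exp_minus mult.assoc)
  moreover have "lap (G c) (C.logdet c) z = of_nat CARD('n) * lap (G c) ?u z + lap (G c) (logdet c) z"
  proof -
    have "lap (G c) (C.logdet c) z = lap (G c) (\<lambda>w. of_nat CARD('n) * ?u w + logdet c w) z"
      by (rule lap_cong[OF op z(1) ld])
    also have "\<dots> = lap (G c) (\<lambda>w. of_nat CARD('n) * ?u w) z + lap (G c) (logdet c) z"
      by (rule lap_add[OF op z(1) Ck_on_mult[OF op Ck_on_const uC] Ck_logdet[OF c(1)]])
    finally show ?thesis by (simp only: lap_cmult[OF op z(1) uC])
  qed
  ultimately have "chern_scalar A (conformal u G) (chart_inv c z) =
      - Re (of_real (exp (- u x)) * (of_nat CARD('n) * lap (G c) ?u z + lap (G c) (logdet c) z))"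
    using C.chern_scalar_chart[OF c(1) z(1)] by simp
  also have "\<dots> = exp (- u x) * (chern_scalar A G (chart_inv c z) - CARD('n) * laplace G u (chart_inv c z))"
    unfolding chern_scalar_chart[OF c(1) z(1)] laplace_chart[OF c(1) z(1) u2] by (simp add: algebra_simps)
  finally show ?thesis by (simp add: z)
qed

end

section \<open>The volume measure\<close>

context complex_manifold
begin

lemma chart_inv_measurable: "c \<in> A \<Longrightarrow> chart_inv c \<in> borel_measurable (restrict_space borel (chart_image c))"
  by (rule borel_measurable_continuous_on_restrict[OF continuous_chart_inv])

text \<open>The image of B under the chart is its preimage under the continuous inverse
  chart.\<close>

lemma chart_image_borel:
  assumes "c \<in> A" "B \<in> sets borel" "B \<subseteq> fst c"
  shows "snd c ` B \<in> sets borel"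
proof -
  have im: "chart_image c \<in> sets borel" using open_image[OF assms(1)] by simp
  have "snd c ` B = chart_inv c -` B \<inter> space (restrict_space borel (chart_image c))"
  proof (intro set_eqI iffI)
    fix z assume "z \<in> snd c ` B"
    then show "z \<in> chart_inv c -` B \<inter> space (restrict_space borel (chart_image c))"
      using assms by (auto simp: space_restrict_space chart_inv_chart chart_mem subset_iff)
  next
    fix z assume "z \<in> chart_inv c -` B \<inter> space (restrict_space borel (chart_image c))"
    then have "chart_inv c z \<in> B" "z = snd c (chart_inv c z)" by (auto simp: space_restrict_space chart_chart_inv)
    then show "z \<in> snd c ` B" by blast
  qed
  also have "\<dots> \<in> sets (restrict_space borel (chart_image c))"
    using measurable_sets[OF chart_inv_measurable[OF assms(1)] assms(2)] .
  finally show ?thesis using im by (simp add: sets_restrict_space_iff)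
qed

lemma Ck_fun_continuous:
  assumes "Ck_fun k u" shows "continuous_on UNIV u"
proof -
  have "continuous_on (fst c) u" if c: "c \<in> A" for c
  proof (rule continuous_on_eq)
    have "continuous_on (chart_image c) (\<lambda>z. u (chart_inv c z))"
      using assms c unfolding Ck_fun_def by (blast intro: Ck_on_continuous)
    then show "continuous_on (fst c) (\<lambda>x. u (chart_inv c (snd c x)))"
      by (rule continuous_on_compose2[OF _ continuous_chart[OF c]]) (auto simp: chart_mem)
  qed (simp add: chart_inv_chart[OF c])
  then have "continuous_on (\<Union>c\<in>A. fst c) u"
    using open_domain by (intro continuous_on_open_UN) auto
  then show ?thesis using atlas unfolding complex_atlas_def by simp
qed

lemma Ck_fun_measurable: "Ck_fun k u \<Longrightarrow> u \<in> borel_measurable borel"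
  by (rule borel_measurable_continuous_onI[OF Ck_fun_continuous])

lemma image_transition:
  assumes "c \<in> A" "d \<in> A" "B \<subseteq> fst c \<inter> fst d"
  shows "snd c ` B \<subseteq> overlap c d" "transition c d ` snd c ` B = snd d ` B" "inj_on (transition c d) (snd c ` B)"
proof -
  show "snd c ` B \<subseteq> overlap c d" using assms(3) unfolding overlap_def by blast
  have "transition c d (snd c x) = snd d x" if "x \<in> B" for x
    using assms that by (auto simp: transition_def chart_inv_chart)
  then show "transition c d ` snd c ` B = snd d ` B" by (auto simp: image_image)
  show "inj_on (transition c d) (snd c ` B)"
    using transition_props(3)[OF assms(1,2)] \<open>snd c ` B \<subseteq> overlap c d\<close> by (metis inj_onI subsetD)
qed

end

context hermitian_manifold
begin

definition dens :: "('m, 'n) chart \<Rightarrow> complex ^ 'n \<Rightarrow> real" where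
  "dens c z = volume_density (G c z)"

lemma dens_pos: "c \<in> A \<Longrightarrow> z \<in> chart_image c \<Longrightarrow> 0 < dens c z"
proof -
  assume c: "c \<in> A" "z \<in> chart_image c"
  obtain N :: nat where N: "0 < N" "\<And>h :: complex ^ 'n ^ 'n. volume_density h = real N * Re (det h)"
    using volume_density_eq_det by blast
  show "0 < dens c z" using pos_def_hermitian_det_pos[OF pos_def[OF c]] N by (simp add: dens_def)
qed

lemma Ck_dens: "c \<in> A \<Longrightarrow> Ck_on k (chart_image c) (dens c)"
proof -
  assume c: "c \<in> A"
  obtain N :: nat where N: "0 < N" "\<And>h :: complex ^ 'n ^ 'n. volume_density h = real N * Re (det h)"
    using volume_density_eq_det by blast
  show "Ck_on k (chart_image c) (dens c)" unfolding dens_def[abs_def] N(2)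
    by (intro Ck_on_mult Ck_on_const Ck_on_bounded_linear_compose[OF _ bounded_linear_Re] Ck_on_det Ck_metric_entry open_image c)
qed

lemma dens_transition:
  assumes "c \<in> A" "d \<in> A" "z \<in> overlap c d"
  shows "dens c z = (cmod (det (J c d z)))\<^sup>2 * dens d (transition c d z)"
proof -
  obtain N :: nat where N: "0 < N" "\<And>h :: complex ^ 'n ^ 'n. volume_density h = real N * Re (det h)"
    using volume_density_eq_det by blast
  show ?thesis unfolding dens_def N(2) det_transition[OF assms] by (simp del: of_real_power)
qed

lemma dens_continuous: "c \<in> A \<Longrightarrow> S \<subseteq> chart_image c \<Longrightarrow> continuous_on S (dens c)"
  using Ck_on_continuous[OF Ck_dens[of c 0]] continuous_on_subset by blast

lemma dens_indicator_measurable: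
  assumes "c \<in> A" "S \<in> sets borel" "S \<subseteq> chart_image c"
  shows "(\<lambda>z. indicator S z * dens c z) \<in> borel_measurable borel"
  using borel_measurable_continuous_on_indicator[OF assms(2) dens_continuous[OF assms(1,3)]] by simp

lemma ennreal_mult_indicator: "ennreal x * indicator S z = ennreal (indicator S z * x)"
  by (simp add: indicator_def)

text \<open>The density changes by the factor |det J|^2, which is exactly the real Jacobian of the
  transition map.\<close>

lemma nn_integral_chart_change:
  assumes c: "c \<in> A" "d \<in> A" and B: "B \<in> sets borel" "B \<subseteq> fst c \<inter> fst d"
  shows "(\<integral>\<^sup>+z\<in>snd c ` B. ennreal (dens c z) \<partial>lborel) = (\<integral>\<^sup>+z\<in>snd d ` B. ennreal (dens d z) \<partial>lborel)"
proof -
  let ?S = "snd c ` B"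
  note T = image_transition[OF c B(2)]
  have S: "?S \<in> sets borel" "snd d ` B \<in> sets borel" using B by (auto intro!: chart_image_borel c)
  have sub: "?S \<subseteq> chart_image c" "snd d ` B \<subseteq> chart_image d" using B(2) by (auto simp: chart_mem)
  have eq: "indicator ?S z * ((cmod (det (J c d z)))\<^sup>2 * dens d (transition c d z)) = indicator ?S z * dens c z" for z
    using dens_transition[OF c] T(1) by (auto simp: indicator_def)
  have "(\<integral>\<^sup>+z. ennreal (indicator ?S z * ((cmod (det (J c d z)))\<^sup>2 * dens d (transition c d z))) \<partial>lborel) =
    (\<integral>\<^sup>+w. ennreal (indicator (transition c d ` ?S) w * dens d w) \<partial>lborel)"
  proof (rule nn_integral_change_of_variables_holomorphic[OF S(1) T(3)])
    show "(transition c d has_derivative (*v) (J c d z)) (at z)" if "z \<in> ?S" for z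
      using that T(1) by (intro has_derivative_jac[OF holo_transition[OF c]]) auto
    show "0 \<le> dens d w" if "w \<in> transition c d ` ?S" for w
      using that sub dens_pos[OF c(2), of w] unfolding T(2) by (auto intro: less_imp_le)
    show "(\<lambda>z. indicator ?S z * ((cmod (det (J c d z)))\<^sup>2 * dens d (transition c d z))) \<in> borel_measurable borel"
      unfolding eq by (rule dens_indicator_measurable[OF c(1) S(1) sub(1)])
    show "(\<lambda>w. indicator (transition c d ` ?S) w * dens d w) \<in> borel_measurable borel"
      unfolding T(2) by (rule dens_indicator_measurable[OF c(2) S(2) sub(2)])
  qed
  then show ?thesis unfolding eq T(2) by (simp add: ennreal_mult_indicator)
qed

definition chart_measure :: "('m, 'n) chart \<Rightarrow> 'm measure" where
  "chart_measure c = distr (density (restrict_space lborel (chart_image c)) (\<lambda>z. ennreal (dens c z))) borel (chart_inv c)"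

lemma dens_measurable: "c \<in> A \<Longrightarrow> (\<lambda>z. ennreal (dens c z)) \<in> borel_measurable (restrict_space lborel (chart_image c))"
  using borel_measurable_continuous_on_restrict[OF dens_continuous[OF _ subset_refl]]
  by (simp add: measurable_cong_sets[OF sets_restrict_space_cong[OF sets_lborel] refl])

lemma chart_inv_measurable': "c \<in> A \<Longrightarrow> chart_inv c \<in> measurable (density (restrict_space lborel (chart_image c)) f) borel"
  using chart_inv_measurable
  by (simp add: measurable_cong_sets[OF sets_restrict_space_cong[OF sets_lborel] refl])

lemma sets_chart_measure [simp]: "sets (chart_measure c) = sets borel"
  and space_chart_measure [simp]: "space (chart_measure c) = UNIV"
  by (simp_all add: chart_measure_def)

lemma nn_integral_chart_measure:
  assumes c: "c \<in> A" and f: "f \<in> borel_measurable borel"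
  shows "(\<integral>\<^sup>+x. f x \<partial>chart_measure c) =
    (\<integral>\<^sup>+z. ennreal (dens c z) * f (chart_inv c z) * indicator (chart_image c) z \<partial>lborel)"
proof -
  have m: "(\<lambda>z. f (chart_inv c z)) \<in> borel_measurable (restrict_space lborel (chart_image c))"
    using measurable_compose[OF chart_inv_measurable'[OF c, of "\<lambda>_. 1"] f] by simp
  have "(\<integral>\<^sup>+x. f x \<partial>chart_measure c) = (\<integral>\<^sup>+z. ennreal (dens c z) * f (chart_inv c z) \<partial>restrict_space lborel (chart_image c))"
    unfolding chart_measure_def
    by (simp add: nn_integral_distr[OF chart_inv_measurable'[OF c]] f nn_integral_density[OF dens_measurable[OF c] m])
  also have "\<dots> = (\<integral>\<^sup>+z. ennreal (dens c z) * f (chart_inv c z) * indicator (chart_image c) z \<partial>lborel)"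
    using open_image[OF c] by (subst nn_integral_restrict_space) auto
  finally show ?thesis .
qed

lemma emeasure_chart_measure:
  assumes c: "c \<in> A" and B: "B \<in> sets borel"
  shows "emeasure (chart_measure c) B = (\<integral>\<^sup>+z\<in>snd c ` (B \<inter> fst c). ennreal (dens c z) \<partial>lborel)"
proof -
  have "indicator B (chart_inv c z) * indicator (chart_image c) z = (indicator (snd c ` (B \<inter> fst c)) z :: ennreal)" for z
  proof -
    have "chart_inv c z \<in> B \<and> z \<in> chart_image c \<longleftrightarrow> z \<in> snd c ` (B \<inter> fst c)"
      by (metis (no_types, lifting) IntE IntI chart_chart_inv chart_inv_chart[OF c] chart_inv_mem chart_mem imageE imageI)
    then show ?thesis by (auto simp: indicator_def)
  qed
  then show ?thesis
    using nn_integral_chart_measure[OF c, of "indicator B"] B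
    by (simp add: mult.assoc)
qed

lemma emeasure_chart_measure_change:
  assumes "c \<in> A" "d \<in> A" "B \<in> sets borel" "B \<subseteq> fst c" "B \<subseteq> fst d"
  shows "emeasure (chart_measure c) B = emeasure (chart_measure d) B"
proof -
  have "B \<inter> fst c = B" "B \<inter> fst d = B" using assms by auto
  then show ?thesis using assms nn_integral_chart_change[of c d B] by (simp add: emeasure_chart_measure)
qed

text \<open>The condition in the definition of \<open>vol\<close>, phrased through
  \<open>chart_measure\<close> so that different charts are compared as measures;
  \<open>is_volume_iff\<close> restores the original wording.\<close>

definition is_volume :: "'m measure \<Rightarrow> bool" where
  "is_volume \<mu> \<longleftrightarrow> sets \<mu> = sets borel \<and>
    (\<forall>c\<in>A. \<forall>B\<in>sets borel. B \<subseteq> fst c \<longrightarrow> emeasure \<mu> B = emeasure (chart_measure c) B)"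

lemma is_volume_iff: "is_volume \<mu> \<longleftrightarrow> sets \<mu> = sets borel \<and>
    (\<forall>c\<in>A. \<forall>B\<in>sets borel. B \<subseteq> fst c \<longrightarrow>
      emeasure \<mu> B = (\<integral>\<^sup>+z\<in>snd c ` B. ennreal (volume_density (G c z)) \<partial>lborel))"
proof -
  have "emeasure (chart_measure c) B = (\<integral>\<^sup>+z\<in>snd c ` B. ennreal (volume_density (G c z)) \<partial>lborel)"
    if "c \<in> A" "B \<in> sets borel" "B \<subseteq> fst c" for c B
    using emeasure_chart_measure[OF that(1,2)] that(3) by (simp add: Int_absorb2 dens_def)
  then show ?thesis unfolding is_volume_def by auto
qed

end

section \<open>Existence, uniqueness and conformal change of the volume\<close>

locale compact_hermitian_manifold = hermitian_manifold A G
  for A :: "('m::{t2_space, second_countable_topology}, 'n::finite) chart set" and G :: "('m, 'n) metric" +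
  assumes compact_space: "compact (UNIV :: 'm set)"
begin

text \<open>Subtracting from each member of a finite subcover the earlier members makes the pieces
  disjoint, so measures can be compared and glued by finite sums.\<close>

lemma finite_partition:
  "\<exists>(K :: nat) (cs :: nat \<Rightarrow> ('m, 'n) chart) (D :: nat \<Rightarrow> 'm set).
    (\<forall>k<K. cs k \<in> A \<and> D k \<subseteq> fst (cs k)) \<and> (\<forall>k. D k \<in> sets borel) \<and>
    disjoint_family_on D {..<K} \<and> (\<Union>k<K. D k) = UNIV"
proof -
  have cover: "UNIV \<subseteq> (\<Union>c\<in>A. fst c)" using atlas unfolding complex_atlas_def by auto
  obtain C where C: "C \<subseteq> A" "finite C" "UNIV \<subseteq> (\<Union>c\<in>C. fst c)"
    using compactE_image[OF compact_space open_domain cover] by blast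
  obtain l where l: "set l = C" using finite_list[OF C(2)] by blast
  define D where "D k = (if k < length l then fst (l ! k) - (\<Union>j<k. fst (l ! j)) else {})" for k
  have "D k \<in> sets borel" for k
  proof (cases "k < length l")
    case True
    then have "\<And>j. j \<le> k \<Longrightarrow> open (fst (l ! j))" using C l by (auto intro!: open_domain)
    then show ?thesis using True by (auto simp: D_def)
  qed (simp add: D_def)
  moreover have "disjoint_family_on D {..<length l}"
  proof -
    have "D i \<inter> D j = {}" if "i < j" "j < length l" for i j using that by (auto simp: D_def)
    then show ?thesis unfolding disjoint_family_on_def by (metis Int_commute lessThan_iff nat_neq_iff)
  qed
  moreover have "(\<Union>k<length l. D k) = UNIV"
  proof -
    have "\<exists>k<length l. x \<in> D k" for x
    proof -
      obtain k where k: "k < length l" "x \<in> fst (l ! k)" using C(3) l by (metis UN_E UNIV_I in_set_conv_nth subsetD)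
      define m where "m = (LEAST k. k < length l \<and> x \<in> fst (l ! k))"
      have "m < length l \<and> x \<in> fst (l ! m)" unfolding m_def by (rule LeastI[of _ k]) (use k in auto)
      moreover have "x \<notin> fst (l ! j)" if "j < m" for j
        using not_less_Least[of j "\<lambda>k. k < length l \<and> x \<in> fst (l ! k)"] that calculation unfolding m_def by auto
      ultimately show ?thesis by (intro exI[of _ m]) (auto simp: D_def)
    qed
    then show ?thesis by auto
  qed
  moreover have "l ! k \<in> A" "D k \<subseteq> fst (l ! k)" if "k < length l" for k
    using that C l by (auto simp: D_def)
  ultimately show ?thesis by (intro exI[of _ "length l"] exI[of _ "(!) l"] exI[of _ D]) blast
qed

lemma is_volume_unique:
  assumes "is_volume \<mu>" "is_volume \<nu>" shows "\<mu> = \<nu>"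
proof (rule measure_eqI)
  show sets: "sets \<mu> = sets \<nu>" using assms unfolding is_volume_def by simp
  fix B assume "B \<in> sets \<mu>"
  then have B: "B \<in> sets borel" using assms unfolding is_volume_def by simp
  obtain K :: nat and cs :: "nat \<Rightarrow> ('m, 'n) chart" and D :: "nat \<Rightarrow> 'm set"
    where cs: "\<forall>k<K. cs k \<in> A \<and> D k \<subseteq> fst (cs k)" "\<forall>k. D k \<in> sets borel"
      and D4: "disjoint_family_on D {..<K}" "(\<Union>k<K. D k) = UNIV"
    using finite_partition by blast
  have D: "k < K \<Longrightarrow> cs k \<in> A" "k < K \<Longrightarrow> D k \<subseteq> fst (cs k)" "D k \<in> sets borel" "disjoint_family_on D {..<K}" "(\<Union>k<K. D k) = UNIV" for k
    using cs D4 by auto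
  have disj: "disjoint_family_on (\<lambda>k. B \<inter> D k) {..<K}" for B
    using D4(1) unfolding disjoint_family_on_def by blast
  have "emeasure m B = (\<Sum>k<K. emeasure (chart_measure (cs k)) (B \<inter> D k))" if m: "is_volume m" for m
  proof -
    have "(\<Sum>k<K. emeasure m (B \<inter> D k)) = emeasure m (\<Union>k<K. B \<inter> D k)"
      using B D(3) m disj unfolding is_volume_def by (intro sum_emeasure) auto
    also have "(\<Union>k<K. B \<inter> D k) = B" using D(5) by auto
    finally have "emeasure m B = (\<Sum>k<K. emeasure m (B \<inter> D k))" by simp
    also have "\<dots> = (\<Sum>k<K. emeasure (chart_measure (cs k)) (B \<inter> D k))"
    proof (rule sum.cong[OF refl])
      fix k assume "k \<in> {..<K}"
      then have "cs k \<in> A" "B \<inter> D k \<in> sets borel" "B \<inter> D k \<subseteq> fst (cs k)" using B D by auto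
      then show "emeasure m (B \<inter> D k) = emeasure (chart_measure (cs k)) (B \<inter> D k)"
        using m unfolding is_volume_def by blast
    qed
    finally show ?thesis .
  qed
  then show "emeasure \<mu> B = emeasure \<nu> B" using assms by simp
qed

lemma is_volume_exists: "\<exists>\<mu>. is_volume \<mu>"
proof -
  obtain K :: nat and cs :: "nat \<Rightarrow> ('m, 'n) chart" and D :: "nat \<Rightarrow> 'm set"
    where cs: "\<forall>k<K. cs k \<in> A \<and> D k \<subseteq> fst (cs k)" "\<forall>k. D k \<in> sets borel"
      and D4: "disjoint_family_on D {..<K}" "(\<Union>k<K. D k) = UNIV"
    using finite_partition by blast
  have D: "k < K \<Longrightarrow> cs k \<in> A" "k < K \<Longrightarrow> D k \<subseteq> fst (cs k)" "D k \<in> sets borel" "disjoint_family_on D {..<K}" "(\<Union>k<K. D k) = UNIV" for k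
    using cs D4 by auto
  have disj: "disjoint_family_on (\<lambda>k. B \<inter> D k) {..<K}" for B
    using D4(1) unfolding disjoint_family_on_def by blast
  \<comment> \<open>The glued measure: a Borel set is cut into its pieces, each measured in the
    chart that contains it.\<close>
  define \<nu> where "\<nu> B = (\<Sum>k<K. emeasure (chart_measure (cs k)) (B \<inter> D k))" for B
  define \<mu> where "\<mu> = measure_of UNIV (sets borel) \<nu>"
  have sig: "sigma_algebra UNIV (sets (borel :: 'm measure))"
    using sets.sigma_algebra_axioms[of "borel :: 'm measure"] by simp
  have sets: "sets \<mu> = sets borel" unfolding \<mu>_def using sigma_algebra.sets_measure_of_eq[OF sig] by simp
  have pos: "positive (sets borel) \<nu>" by (simp add: positive_def \<nu>_def)
  have add: "countably_additive (sets borel) \<nu>"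
  proof (rule countably_additiveI)
    fix E :: "nat \<Rightarrow> 'm set" assume E: "range E \<subseteq> sets borel" "disjoint_family E" "\<Union> (range E) \<in> sets borel"
    have "(\<Sum>i. \<nu> (E i)) = (\<Sum>k<K. \<Sum>i. emeasure (chart_measure (cs k)) (E i \<inter> D k))"
      unfolding \<nu>_def by (rule suminf_sum) simp
    also have "\<dots> = (\<Sum>k<K. emeasure (chart_measure (cs k)) (\<Union>i. E i \<inter> D k))"
      using E D(3) by (intro sum.cong refl suminf_emeasure) (auto simp: disjoint_family_on_def)
    finally show "(\<Sum>i. \<nu> (E i)) = \<nu> (\<Union> (range E))" by (simp add: \<nu>_def Int_UN_distrib2)
  qed
  have em: "emeasure \<mu> B = \<nu> B" if "B \<in> sets borel" for B
    using emeasure_measure_of_sigma[OF sig pos add that] by (simp add: \<mu>_def)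
  have "emeasure \<mu> B = emeasure (chart_measure c) B" if c: "c \<in> A" "B \<in> sets borel" "B \<subseteq> fst c" for c B
  proof -
    \<comment> \<open>Each piece of B lies in both c and \<open>cs k\<close>, where the two chart
      measures agree.\<close>
    have "emeasure \<mu> B = (\<Sum>k<K. emeasure (chart_measure c) (B \<inter> D k))"
      unfolding em[OF c(2)] \<nu>_def
      using c D by (intro sum.cong refl emeasure_chart_measure_change) auto
    also have "\<dots> = emeasure (chart_measure c) (\<Union>k<K. B \<inter> D k)"
      using c D(3) disj[of B] by (intro sum_emeasure) auto
    also have "(\<Union>k<K. B \<inter> D k) = B" using D(5) by auto
    finally show ?thesis .
  qed
  then show ?thesis using sets unfolding is_volume_def by blast
qed

lemma is_volume_vol: "is_volume (vol A G)"
proof -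
  have "\<exists>!\<mu>. is_volume \<mu>" using is_volume_exists is_volume_unique by blast
  then show ?thesis unfolding vol_def is_volume_iff[symmetric] by (rule theI')
qed

lemma vol_eqI: "is_volume \<mu> \<Longrightarrow> vol A G = \<mu>"
  using is_volume_unique[OF is_volume_vol] by blast

lemma sets_vol [simp]: "sets (vol A G) = sets borel"
  using is_volume_vol unfolding is_volume_def by blast

lemma space_vol [simp]: "space (vol A G) = UNIV"
  using sets_eq_imp_space_eq[OF sets_vol] by simp

lemma emeasure_vol: "c \<in> A \<Longrightarrow> B \<in> sets borel \<Longrightarrow> B \<subseteq> fst c \<Longrightarrow> emeasure (vol A G) B = emeasure (chart_measure c) B"
  using is_volume_vol unfolding is_volume_def by blast

text \<open>On a chart domain the volume, known only through a unique description, becomes the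
  push-forward of an explicit density, to which the transfer rules for integrals apply.\<close>

lemma density_vol_chart: "c \<in> A \<Longrightarrow> density (vol A G) (indicator (fst c)) = chart_measure c"
proof (rule measure_eqI)
  assume c: "c \<in> A"
  fix B assume "B \<in> sets (density (vol A G) (indicator (fst c)))"
  then have B: "B \<in> sets borel" by simp
  have op: "fst c \<in> sets borel" using open_domain[OF c] by simp
  have "emeasure (density (vol A G) (indicator (fst c))) B = (\<integral>\<^sup>+x. indicator (fst c) x * indicator B x \<partial>vol A G)"
    using B op by (intro emeasure_density) (auto simp: measurable_cong_sets[OF sets_vol refl])
  also have "\<dots> = (\<integral>\<^sup>+x. indicator (B \<inter> fst c) x \<partial>vol A G)"
    by (intro nn_integral_cong) (auto simp: indicator_def)
  also have "\<dots> = emeasure (vol A G) (B \<inter> fst c)" using B op by (simp add: sets.Int)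
  also have "\<dots> = emeasure (chart_measure c) (B \<inter> fst c)" using B op by (intro emeasure_vol c) auto
  also have "\<dots> = emeasure (chart_measure c) B"
    using B op by (simp add: emeasure_chart_measure c sets.Int Int_assoc)
  finally show "emeasure (density (vol A G) (indicator (fst c))) B = emeasure (chart_measure c) B" .
qed simp

lemma measurable_vol: "measurable (vol A G) M = measurable borel M"
  by (rule measurable_cong_sets[OF sets_vol refl])

lemma nn_integral_vol_chart:
  assumes c: "c \<in> A" and f: "f \<in> borel_measurable borel" "\<And>x. x \<notin> fst c \<Longrightarrow> f x = 0"
  shows "(\<integral>\<^sup>+x. f x \<partial>vol A G) = (\<integral>\<^sup>+x. f x \<partial>chart_measure c)"
proof -
  have "(\<integral>\<^sup>+x. f x \<partial>vol A G) = (\<integral>\<^sup>+x. indicator (fst c) x * f x \<partial>vol A G)"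
    using f(2) by (intro nn_integral_cong) (auto simp: indicator_def)
  also have "\<dots> = (\<integral>\<^sup>+x. f x \<partial>density (vol A G) (indicator (fst c)))"
    using open_domain[OF c] f(1) by (intro nn_integral_density[symmetric]) (auto simp: measurable_vol)
  finally show ?thesis by (simp add: density_vol_chart[OF c])
qed

lemma integral_vol_chart:
  fixes f :: "'m \<Rightarrow> real"
  assumes c: "c \<in> A" and f: "f \<in> borel_measurable borel" "\<And>x. x \<notin> fst c \<Longrightarrow> f x = 0"
  shows "(\<integral>x. f x \<partial>vol A G) = (\<integral>z. indicator (chart_image c) z * (dens c z * f (chart_inv c z)) \<partial>lborel)"
proof -
  have op: "fst c \<in> sets borel" using open_domain[OF c] by simp
  have "(\<integral>x. f x \<partial>vol A G) = (\<integral>x. indicator (fst c) x *\<^sub>R f x \<partial>vol A G)"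
    using f(2) by (intro Bochner_Integration.integral_cong) (auto simp: indicator_def)
  also have "\<dots> = (\<integral>x. f x \<partial>density (vol A G) (\<lambda>x. ennreal (indicator (fst c) x)))"
    using op f(1) by (intro integral_density[symmetric]) (auto simp: measurable_vol)
  also have "density (vol A G) (\<lambda>x. ennreal (indicator (fst c) x)) = chart_measure c"
    using density_vol_chart[OF c] by (simp add: ennreal_indicator)
  also have "(\<integral>x. f x \<partial>chart_measure c) = (\<integral>z. f (chart_inv c z) \<partial>density (restrict_space lborel (chart_image c)) (\<lambda>z. ennreal (dens c z)))"
    unfolding chart_measure_def by (rule integral_distr[OF chart_inv_measurable'[OF c] f(1)])
  also have "\<dots> = (\<integral>z. dens c z *\<^sub>R f (chart_inv c z) \<partial>restrict_space lborel (chart_image c))"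
  proof (rule integral_density)
    show "(\<lambda>z. f (chart_inv c z)) \<in> borel_measurable (restrict_space lborel (chart_image c))"
      using measurable_compose[OF chart_inv_measurable'[OF c, of "\<lambda>_. 1"] f(1)] by simp
    show "dens c \<in> borel_measurable (restrict_space lborel (chart_image c))"
      using borel_measurable_continuous_on_restrict[OF dens_continuous[OF c subset_refl]]
      by (simp add: measurable_cong_sets[OF sets_restrict_space_cong[OF sets_lborel] refl])
    show "AE z in restrict_space lborel (chart_image c). 0 \<le> dens c z"
      using dens_pos[OF c] by (intro AE_I2) (auto simp: space_restrict_space intro: less_imp_le)
  qed
  also have "\<dots> = (\<integral>z. indicator (chart_image c) z *\<^sub>R (dens c z *\<^sub>R f (chart_inv c z)) \<partial>lborel)"
    using open_image[OF c] by (intro integral_restrict_space) auto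
  finally show ?thesis by simp
qed

text \<open>By uniqueness the claim can be checked in each chart, where the determinant scales by
  the n-th power of e^u.\<close>

lemma vol_conformal:
  fixes u :: "'m \<Rightarrow> real"
  assumes "smooth_fun A u"
  shows "vol A (conformal u G) = density (vol A G) (\<lambda>x. ennreal (exp (CARD('n) * u x)))"
proof -
  interpret C: compact_hermitian_manifold A "conformal u G"
    by unfold_locales (rule hermitian_metric_conformal[OF assms], rule compact_space)
  obtain N :: nat where N: "0 < N" "\<And>h :: complex ^ 'n ^ 'n. volume_density h = real N * Re (det h)"
    using volume_density_eq_det by blast
  have dens: "C.dens c z = exp (CARD('n) * u (chart_inv c z)) * dens c z" for c z
    unfolding C.dens_def dens_def N(2)
    by (simp add: conformal_def det_scaleR exp_of_nat_mult flip: of_real_power)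
  have um: "u \<in> borel_measurable borel"
    using assms Ck_fun_measurable unfolding smooth_fun_Ck by blast
  show ?thesis
  proof (rule C.vol_eqI, unfold C.is_volume_def, intro conjI ballI impI)
    fix c B assume c: "c \<in> A" and B: "B \<in> sets borel" "B \<subseteq> fst c"
    have "emeasure (density (vol A G) (\<lambda>x. ennreal (exp (CARD('n) * u x)))) B =
      (\<integral>\<^sup>+x. ennreal (exp (CARD('n) * u x)) * indicator B x \<partial>vol A G)"
      using B um by (intro emeasure_density) (auto simp: measurable_vol)
    also have "\<dots> = (\<integral>\<^sup>+x. ennreal (exp (CARD('n) * u x)) * indicator B x \<partial>chart_measure c)"
      using B um by (intro nn_integral_vol_chart c) (auto simp: indicator_def)
    also have "\<dots> = (\<integral>\<^sup>+z. ennreal (dens c z) * (ennreal (exp (CARD('n) * u (chart_inv c z))) * indicator B (chart_inv c z)) * indicator (chart_image c) z \<partial>lborel)"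
      using B um by (intro nn_integral_chart_measure c) auto
    also have "\<dots> = (\<integral>\<^sup>+z. ennreal (C.dens c z) * indicator B (chart_inv c z) * indicator (chart_image c) z \<partial>lborel)"
    proof (rule nn_integral_cong)
      fix z
      have "ennreal (C.dens c z) = ennreal (exp (CARD('n) * u (chart_inv c z))) * ennreal (dens c z)"
        unfolding dens by (rule ennreal_mult') simp
      then show "ennreal (dens c z) * (ennreal (exp (CARD('n) * u (chart_inv c z))) * indicator B (chart_inv c z)) * indicator (chart_image c) z =
          ennreal (C.dens c z) * indicator B (chart_inv c z) * indicator (chart_image c) z"
        by (simp only: mult_ac)
    qed
    also have "\<dots> = (\<integral>\<^sup>+x. indicator B x \<partial>C.chart_measure c)"
      using B by (intro C.nn_integral_chart_measure[symmetric] c) auto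
    also have "\<dots> = emeasure (C.chart_measure c) B" using B by simp
    finally show "emeasure (density (vol A G) (\<lambda>x. ennreal (exp (CARD('n) * u x)))) B = emeasure (C.chart_measure c) B" .
  qed simp
qed

end

section \<open>Integration by parts\<close>

lemma integrable_compact_support:
  fixes f :: "'a::euclidean_space \<Rightarrow> 'b::{banach,second_countable_topology}"
  assumes "continuous_on U f" "compact K" "K \<subseteq> U" "\<And>z. z \<in> U \<Longrightarrow> z \<notin> K \<Longrightarrow> f z = 0"
  shows "integrable lborel (\<lambda>z. indicator U z *\<^sub>R f z)"
proof -
  have "(\<lambda>z. indicator U z *\<^sub>R f z) = (\<lambda>z. indicator K z *\<^sub>R f z)"
    using assms(3,4) by (auto simp: fun_eq_iff indicator_def)
  then show ?thesis
    using borel_integrable_compact[OF assms(2) continuous_on_subset[OF assms(1,3)]] by simp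
qed

lemma frechet_derivative_eq_0_open:
  assumes "open S" "z \<in> S" "\<And>x. x \<in> S \<Longrightarrow> f x = 0"
  shows "frechet_derivative f (at z) v = 0"
proof -
  have "frechet_derivative f (at z) = frechet_derivative (\<lambda>_. 0) (at z)"
    by (rule frechet_derivative_cong_open[OF assms])
  then show ?thesis by simp
qed

text \<open>The integral of the difference quotients vanishes by translation invariance.\<close>

lemma integral_directional_derivative_real:
  fixes \<psi> :: "'a::euclidean_space \<Rightarrow> real"
  assumes C: "Ck_on 1 UNIV \<psi>" and K: "compact K" "\<And>x. x \<notin> K \<Longrightarrow> \<psi> x = 0"
  shows "(\<integral>x. frechet_derivative \<psi> (at x) v \<partial>lborel) = 0"
proof -
  let ?D = "\<lambda>x. frechet_derivative \<psi> (at x)"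
  have D: "(\<psi> has_derivative ?D x) (at x)" for x using C by (auto intro: frechet_derivative_works')
  have Dc: "continuous_on UNIV (\<lambda>x. ?D x v)" using C by simp
  have cont: "continuous_on UNIV \<psi>" using C by (rule Ck_on_continuous)
  have D0: "?D x v = 0" if "x \<notin> K" for x
    using frechet_derivative_eq_0_open[OF open_Compl[OF compact_imp_closed[OF K(1)]], of x \<psi>] that K(2) by auto
  obtain R where R: "K \<subseteq> cball 0 R" using compact_imp_bounded[OF K(1)] unfolding bounded_iff by (metis mem_cball_0 subsetI)
  obtain B where B: "\<And>x. \<bar>?D x v\<bar> \<le> B" "0 \<le> B"
  proof -
    have comp: "compact ((\<lambda>x. ?D x v) ` K)"
      by (rule compact_continuous_image[OF continuous_on_subset[OF Dc] K(1)]) simp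
    obtain b where "\<forall>y\<in>(\<lambda>x. ?D x v) ` K. norm y \<le> b"
      using compact_imp_bounded[OF comp] unfolding bounded_iff by (elim exE)
    then have b: "\<And>x. x \<in> K \<Longrightarrow> \<bar>?D x v\<bar> \<le> b" by simp
    have "\<bar>?D x v\<bar> \<le> max b 0" for x using b[of x] D0[of x] by (cases "x \<in> K") auto
    then show thesis using that[of "max b 0"] by simp
  qed
  \<comment> \<open>Steps of length at most 1 keep the supports of all difference quotients in the
    ball of radius R + |v|.\<close>
  define t where "t n = inverse (real (Suc n))" for n
  have t: "0 < t n" "t n \<le> 1" for n by (simp_all add: t_def field_simps)
  have t0: "t \<longlonglongrightarrow> 0" unfolding t_def by (rule LIMSEQ_inverse_real_of_nat)
  define q where "q n x = (\<psi> (t n *\<^sub>R v + x) - \<psi> x) / t n" for n x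
  have int\<psi>: "integrable lborel \<psi>"
    using integrable_compact_support[OF cont K(1), of] K(2) by simp
  have shift: "integrable lborel (\<lambda>x. \<psi> (a + x))" "(\<integral>x. \<psi> (a + x) \<partial>lborel) = (\<integral>x. \<psi> x \<partial>lborel)" for a
  proof -
    have m: "\<psi> \<in> borel_measurable borel" using cont by (rule borel_measurable_continuous_onI)
    have "integrable (distr lborel borel ((+) a)) \<psi>" using int\<psi> by (simp add: lborel_distr_plus)
    then show "integrable lborel (\<lambda>x. \<psi> (a + x))" by (subst (asm) integrable_distr_eq) (use m in auto)
    have "(\<integral>x. \<psi> x \<partial>distr lborel borel ((+) a)) = (\<integral>x. \<psi> (a + x) \<partial>lborel)"
      by (rule integral_distr) (use m in auto)
    then show "(\<integral>x. \<psi> (a + x) \<partial>lborel) = (\<integral>x. \<psi> x \<partial>lborel)" by (simp add: lborel_distr_plus)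
  qed
  have q0: "(\<integral>x. q n x \<partial>lborel) = 0" for n
    unfolding q_def using shift int\<psi> by simp
  have qm: "q n \<in> borel_measurable lborel" for n
    unfolding q_def using shift(1)[of "t n *\<^sub>R v"] int\<psi> by (auto dest: borel_measurable_integrable)
  have lim: "(\<lambda>n. q n x) \<longlonglongrightarrow> ?D x v" for x
  proof -
    have "((\<lambda>s. \<psi> (x + s *\<^sub>R v)) has_real_derivative ?D x v) (at 0)"
      by (rule has_real_derivative_line) (simp add: D)
    then have "((\<lambda>s. (\<psi> (x + s *\<^sub>R v) - \<psi> x) / s) \<longlongrightarrow> ?D x v) (at 0)"
      by (simp add: has_field_derivative_iff)
    moreover have "filterlim t (at 0) sequentially"
      using t0 t(1) by (simp add: filterlim_at less_imp_neq[symmetric] eventually_sequentially)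
    ultimately have "(\<lambda>n. (\<psi> (x + t n *\<^sub>R v) - \<psi> x) / t n) \<longlonglongrightarrow> ?D x v"
      by (rule filterlim_compose)
    then show ?thesis by (simp add: q_def add.commute)
  qed
  have bound: "norm (q n x) \<le> B * indicator (cball 0 (R + norm v)) x" for n x
  proof (cases "x \<in> cball 0 (R + norm v)")
    case True
    \<comment> \<open>Each quotient is a value of the derivative, hence bounded by B uniformly in n;
      this yields the dominating function.\<close>
    obtain s where s: "\<psi> (x + t n *\<^sub>R v) - \<psi> (x + 0 *\<^sub>R v) = (t n - 0) * ?D (x + s *\<^sub>R v) v"
      using MVT2[OF t(1)[of n], of "\<lambda>s. \<psi> (x + s *\<^sub>R v)" "\<lambda>s. ?D (x + s *\<^sub>R v) v", OF has_real_derivative_line[OF D]] by blast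
    then have "q n x = ?D (x + s *\<^sub>R v) v" using t(1)[of n] by (simp add: q_def add.commute)
    then show ?thesis using B True by simp
  next
    case False
    have "x \<notin> K"
    proof
      assume "x \<in> K"
      then have "norm x \<le> R" using R by auto
      then show False using False norm_ge_zero[of v] by simp
    qed
    moreover have "t n *\<^sub>R v + x \<notin> K"
    proof
      assume "t n *\<^sub>R v + x \<in> K"
      then have "norm (t n *\<^sub>R v + x) \<le> R" using R by auto
      moreover have "norm x \<le> norm (t n *\<^sub>R v + x) + norm (t n *\<^sub>R v)"
        using norm_triangle_ineq4[of "t n *\<^sub>R v + x" "t n *\<^sub>R v"] by simp
      moreover have "norm (t n *\<^sub>R v) \<le> norm v" using t[of n] by (simp add: mult_left_le_one_le)
      ultimately show False using False by simp
    qed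
    ultimately show ?thesis using B(2) by (simp add: q_def K(2))
  qed
  have "(\<lambda>n. \<integral>x. q n x \<partial>lborel) \<longlonglongrightarrow> (\<integral>x. ?D x v \<partial>lborel)"
  proof (rule integral_dominated_convergence[where w = "\<lambda>x. B * indicator (cball 0 (R + norm v)) x"])
    show "(\<lambda>x. ?D x v) \<in> borel_measurable lborel"
      using borel_measurable_continuous_onI[OF Dc] by simp
    show "integrable lborel (\<lambda>x :: 'a. B * indicator (cball 0 (R + norm v)) x :: real)"
      using emeasure_lborel_cball_finite[of "0::'a" "R + norm v"]
      by (intro integrable_mult_right integrable_real_indicator) (auto simp: top.not_eq_extremum)
    show "q n \<in> borel_measurable lborel" for n by (rule qm)
    show "AE x in lborel. (\<lambda>n. q n x) \<longlonglongrightarrow> ?D x v" by (rule AE_I2) (rule lim)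
    show "AE x in lborel. norm (q n x) \<le> B * indicator (cball 0 (R + norm v)) x" for n by (rule AE_I2) (rule bound)
  qed
  then show ?thesis unfolding q0 by (simp add: LIMSEQ_const_iff)
qed

lemma integral_directional_derivative:
  fixes \<psi> :: "'a::euclidean_space \<Rightarrow> complex"
  assumes C: "Ck_on 1 UNIV \<psi>" and K: "compact K" "\<And>x. x \<notin> K \<Longrightarrow> \<psi> x = 0"
  shows "integrable lborel (\<lambda>x. frechet_derivative \<psi> (at x) v)"
    and "(\<integral>x. frechet_derivative \<psi> (at x) v \<partial>lborel) = 0"
proof -
  let ?D = "\<lambda>x. frechet_derivative \<psi> (at x) v"
  have D: "(\<psi> has_derivative frechet_derivative \<psi> (at x)) (at x)" for x using C by (auto intro: frechet_derivative_works')
  have D0: "?D x = 0" if "x \<notin> K" for x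
    using frechet_derivative_eq_0_open[OF open_Compl[OF compact_imp_closed[OF K(1)]], of x \<psi>] that K(2) by auto
  show int: "integrable lborel ?D"
    using integrable_compact_support[of UNIV ?D K] C K(1) D0 by simp
  have *: "(\<integral>x. L (?D x) \<partial>lborel) = 0" if L: "bounded_linear L" for L :: "complex \<Rightarrow> real"
  proof -
    have "Ck_on 1 UNIV (\<lambda>x. L (\<psi> x))" by (rule Ck_on_bounded_linear_compose[OF open_UNIV L C])
    moreover have "L (\<psi> x) = 0" if "x \<notin> K" for x using K(2)[OF that] linear_0[OF bounded_linear.linear[OF L]] by simp
    ultimately have "(\<integral>x. frechet_derivative (\<lambda>x. L (\<psi> x)) (at x) v \<partial>lborel) = 0"
      using K(1) by (intro integral_directional_derivative_real)
    moreover have "frechet_derivative (\<lambda>x. L (\<psi> x)) (at x) v = L (?D x)" for x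
      using frechet_derivative_at[OF bounded_linear.has_derivative[OF L D]] by metis
    ultimately show ?thesis by simp
  qed
  show "(\<integral>x. ?D x \<partial>lborel) = 0"
    using *[OF bounded_linear_Re] *[OF bounded_linear_Im] int by (simp add: complex_eq_iff)
qed

lemma integral_wirt:
  fixes \<psi> :: "complex ^ 'n::finite \<Rightarrow> complex"
  assumes "Ck_on 1 UNIV \<psi>" "compact K" "\<And>x. x \<notin> K \<Longrightarrow> \<psi> x = 0"
  shows "integrable lborel (wirt i \<psi>)" "(\<integral>z. wirt i \<psi> z \<partial>lborel) = 0"
    "integrable lborel (wirt_bar i \<psi>)" "(\<integral>z. wirt_bar i \<psi> z \<partial>lborel) = 0"
proof -
  note I = integral_directional_derivative[OF assms]
  show "integrable lborel (wirt i \<psi>)" "integrable lborel (wirt_bar i \<psi>)"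
    unfolding wirt_def[abs_def] wirt_bar_def[abs_def] by (auto intro!: integrable_divide I)
  show "(\<integral>z. wirt i \<psi> z \<partial>lborel) = 0" "(\<integral>z. wirt_bar i \<psi> z \<partial>lborel) = 0"
    unfolding wirt_def[abs_def] wirt_bar_def[abs_def] using I by simp_all
qed

lemma wirt_eq_0_open:
  assumes "open S" "z \<in> S" "\<And>x. x \<in> S \<Longrightarrow> f x = 0"
  shows "wirt i f z = 0" "wirt_bar i f z = 0"
  using wirt_cong[of S z f "\<lambda>_. 0", OF assms] by simp_all

lemma integration_by_parts_hessian:
  fixes a \<phi> :: "complex ^ 'n::finite \<Rightarrow> complex"
  assumes U: "open U" "compact K" "K \<subseteq> U" and a: "Ck_on 2 U a" and \<phi>: "Ck_on 2 U \<phi>"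
    and \<phi>0: "\<And>z. z \<in> U \<Longrightarrow> z \<notin> K \<Longrightarrow> \<phi> z = 0"
  shows "integrable lborel (\<lambda>z. indicator U z *\<^sub>R (a z * wirt_bar j (wirt i \<phi>) z))"
    and "integrable lborel (\<lambda>z. indicator U z *\<^sub>R (wirt i (wirt_bar j a) z * \<phi> z))"
    and "(\<integral>z. indicator U z *\<^sub>R (a z * wirt_bar j (wirt i \<phi>) z) \<partial>lborel) =
      (\<integral>z. indicator U z *\<^sub>R (wirt i (wirt_bar j a) z * \<phi> z) \<partial>lborel)"
proof -
  have UK: "open (U - K)" using U by (simp add: open_Diff compact_imp_closed)
  have K0: "wirt i \<phi> z = 0" if "z \<in> U - K" for z by (rule wirt_eq_0_open(1)[OF UK that]) (use \<phi>0 in auto)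
  have K00: "wirt_bar j (wirt i \<phi>) z = 0" if "z \<in> U - K" for z by (rule wirt_eq_0_open(2)[OF UK that K0])
  have a1: "Ck_on 1 U a" and \<phi>1: "Ck_on 1 U \<phi>" using Ck_on_mono[OF a, of 1] Ck_on_mono[OF \<phi>, of 1] by (simp_all del: Ck_on.simps)
  have wa: "Ck_on 1 U (wirt_bar j a)" using Ck_on_wirt(2)[OF U(1), of 1 a] a by (simp add: numeral_2_eq_2)
  have w\<phi>: "Ck_on 1 U (wirt i \<phi>)" using Ck_on_wirt(1)[OF U(1), of 1 \<phi>] \<phi> by (simp add: numeral_2_eq_2)
  have cont: "continuous_on U (wirt_bar j (wirt i \<phi>))" "continuous_on U (wirt i (wirt_bar j a))"
    using Ck_on_wirt(2)[OF U(1), of 0 "wirt i \<phi>"] Ck_on_wirt(1)[OF U(1), of 0 "wirt_bar j a"] wa w\<phi> by simp_all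
  show int1: "integrable lborel (\<lambda>z. indicator U z *\<^sub>R (a z * wirt_bar j (wirt i \<phi>) z))"
    using K00 by (intro integrable_compact_support[OF _ U(2,3)] continuous_on_mult cont Ck_on_continuous[OF a]) auto
  show int2: "integrable lborel (\<lambda>z. indicator U z *\<^sub>R (wirt i (wirt_bar j a) z * \<phi> z))"
    using \<phi>0 by (intro integrable_compact_support[OF _ U(2,3)] continuous_on_mult cont Ck_on_continuous[OF \<phi>]) auto
  \<comment> \<open>The difference of the two integrands is a derivative of \<psi>1 minus a
    derivative of \<psi>2: the cross term, dbar_j a times d_i \<phi>, occurs in both and cancels.
    Extension by zero preserves C^1 because \<phi> vanishes off the compact set K.\<close>
  define \<psi>1 where "\<psi>1 z = (if z \<in> U then a z * wirt i \<phi> z else 0)" for z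
  define \<psi>2 where "\<psi>2 z = (if z \<in> U then wirt_bar j a z * \<phi> z else 0)" for z
  have z1: "\<psi>1 z = 0" and z2: "\<psi>2 z = 0" if "z \<notin> K" for z
    using that K0 \<phi>0 by (auto simp: \<psi>1_def \<psi>2_def)
  have "Ck_on 1 U \<psi>1"
    by (rule Ck_on_cong_imp[OF U(1) _ Ck_on_mult[OF U(1) a1 w\<phi>]]) (simp add: \<psi>1_def)
  then have C1: "Ck_on 1 UNIV \<psi>1"
    using Ck_on_extend_zero[OF U(1) compact_imp_closed[OF U(2)] U(3)] z1 by blast
  have "Ck_on 1 U \<psi>2"
    by (rule Ck_on_cong_imp[OF U(1) _ Ck_on_mult[OF U(1) wa \<phi>1]]) (simp add: \<psi>2_def)
  then have C2: "Ck_on 1 UNIV \<psi>2"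
    using Ck_on_extend_zero[OF U(1) compact_imp_closed[OF U(2)] U(3)] z2 by blast
  have "indicator U z *\<^sub>R (a z * wirt_bar j (wirt i \<phi>) z) - indicator U z *\<^sub>R (wirt i (wirt_bar j a) z * \<phi> z) =
      wirt_bar j \<psi>1 z - wirt i \<psi>2 z" for z
  proof (cases "z \<in> U")
    case True
    have "wirt_bar j \<psi>1 z = wirt_bar j (\<lambda>z. a z * wirt i \<phi> z) z"
      by (rule wirt_cong(2)[OF U(1) True]) (simp add: \<psi>1_def)
    also have "\<dots> = a z * wirt_bar j (wirt i \<phi>) z + wirt_bar j a z * wirt i \<phi> z"
      using a1 w\<phi> True by (intro wirt_mult) auto
    finally have 1: "wirt_bar j \<psi>1 z = a z * wirt_bar j (wirt i \<phi>) z + wirt_bar j a z * wirt i \<phi> z" .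
    have "wirt i \<psi>2 z = wirt i (\<lambda>z. wirt_bar j a z * \<phi> z) z"
      by (rule wirt_cong(1)[OF U(1) True]) (simp add: \<psi>2_def)
    also have "\<dots> = wirt_bar j a z * wirt i \<phi> z + wirt i (wirt_bar j a) z * \<phi> z"
      using wa \<phi>1 True by (intro wirt_mult) auto
    finally show ?thesis using 1 True by simp
  next
    case False
    then have "z \<in> - K" "open (- K)" using U by (auto simp: compact_imp_closed)
    then have "wirt_bar j \<psi>1 z = 0" "wirt i \<psi>2 z = 0"
      using wirt_eq_0_open[of "- K" z] z1 z2 by auto
    then show ?thesis using False by simp
  qed
  then have "(\<integral>z. indicator U z *\<^sub>R (a z * wirt_bar j (wirt i \<phi>) z) - indicator U z *\<^sub>R (wirt i (wirt_bar j a) z * \<phi> z) \<partial>lborel) =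
     (\<integral>z. wirt_bar j \<psi>1 z - wirt i \<psi>2 z \<partial>lborel)" by simp
  also have "\<dots> = 0"
    using integral_wirt[OF C1 U(2) z1] integral_wirt[OF C2 U(2) z2] by simp
  finally show "(\<integral>z. indicator U z *\<^sub>R (a z * wirt_bar j (wirt i \<phi>) z) \<partial>lborel) =
      (\<integral>z. indicator U z *\<^sub>R (wirt i (wirt_bar j a) z * \<phi> z) \<partial>lborel)"
    using int1 int2 by simp
qed

section \<open>Bump functions\<close>

text \<open>The powers make the family closed under differentiation: the derivative of the k-th member is the
  (k + 2)-nd minus k times the (k + 1)-st.\<close>

definition flat_exp :: "nat \<Rightarrow> real \<Rightarrow> real" where
  "flat_exp k x = (if 0 < x then exp (- inverse x) * inverse x ^ k else 0)"

lemma flat_exp_tendsto_0: "(flat_exp k \<longlongrightarrow> 0) (at 0)"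
proof -
  have "((\<lambda>y :: real. y ^ k / exp y) \<longlongrightarrow> 0) at_top" by (rule tendsto_power_div_exp_0)
  then have "((\<lambda>x. inverse x ^ k / exp (inverse x)) \<longlongrightarrow> (0::real)) (at_right 0)"
    by (rule filterlim_compose[OF _ filterlim_inverse_at_top_right])
  moreover have "\<forall>\<^sub>F x in at_right 0. inverse x ^ k / exp (inverse x) = flat_exp k x"
    by (simp add: eventually_at_filter flat_exp_def exp_minus divide_inverse mult.commute)
  ultimately have R: "(flat_exp k \<longlongrightarrow> 0) (at_right 0)" by (rule Lim_transform_eventually)
  have "\<forall>\<^sub>F x in at_left 0. 0 = flat_exp k x"
    by (simp add: eventually_at_filter flat_exp_def)
  then have "(flat_exp k \<longlongrightarrow> 0) (at_left 0)" by (rule Lim_transform_eventually[OF tendsto_const])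
  with R show ?thesis by (simp add: filterlim_split_at)
qed

lemma flat_exp_derivative:
  "(flat_exp k has_real_derivative (flat_exp (Suc (Suc k)) x - k * flat_exp (Suc k) x)) (at x)"
proof -
  consider "x < 0" | "x = 0" | "0 < x" by linarith
  then show ?thesis
  proof cases
    case 1
    have "((\<lambda>_. 0) has_real_derivative 0) (at x)" by simp
    then have "(flat_exp k has_real_derivative 0) (at x)"
      by (rule has_field_derivative_transform_within_open[of _ _ _ "{..<0}"]) (use 1 in \<open>auto simp: flat_exp_def\<close>)
    then show ?thesis using 1 by (simp add: flat_exp_def)
  next
    case 2
    \<comment> \<open>At zero the difference quotient of one member is the next member, which tends
      to 0.\<close>
    have "(flat_exp k y - flat_exp k 0) / (y - 0) = flat_exp (Suc k) y" for y
      by (simp add: flat_exp_def field_simps)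
    moreover have "flat_exp (Suc (Suc k)) 0 - k * flat_exp (Suc k) 0 = 0"
      by (simp add: flat_exp_def)
    ultimately show ?thesis
      unfolding 2 has_field_derivative_iff by (simp only: flat_exp_tendsto_0)
  next
    case 3
    let ?y = "inverse x"
    have inv: "(inverse has_real_derivative - (?y ^ 2)) (at x)"
      using DERIV_inverse[of x] 3 by (simp add: numeral_2_eq_2)
    have "((\<lambda>x. inverse x ^ k) has_real_derivative - (k * ?y ^ Suc k)) (at x)"
      using DERIV_power[OF inv, of k] by (cases k) (simp_all add: power2_eq_square mult_ac)
    from DERIV_mult[OF DERIV_chain2[OF DERIV_exp DERIV_minus[OF inv]] this]
    have "((\<lambda>x. exp (- inverse x) * inverse x ^ k) has_real_derivative
        (flat_exp (Suc (Suc k)) x - k * flat_exp (Suc k) x)) (at x)"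
      by (rule DERIV_cong) (use 3 in \<open>simp add: flat_exp_def power2_eq_square algebra_simps\<close>)
    then show ?thesis
      by (rule has_field_derivative_transform_within_open[of _ _ _ "{0<..}"]) (use 3 in \<open>auto simp: flat_exp_def\<close>)
  qed
qed

lemma Ck_on_flat_exp: "Ck_on n UNIV (flat_exp k)"
proof (induction n arbitrary: k)
  case 0
  have "isCont (flat_exp k) x" for x by (rule DERIV_isCont[OF flat_exp_derivative])
  then show ?case by (simp add: continuous_at_imp_continuous_on)
next
  case (Suc n)
  show ?case
    by (rule Ck_on_real_SucI[OF open_UNIV flat_exp_derivative])
       (intro Ck_on_diff Ck_on_mult Ck_on_const Suc open_UNIV)
qed

text \<open>The squares keep the argument smooth at the centre.\<close>

definition bump :: "'a::euclidean_space \<Rightarrow> real \<Rightarrow> 'a \<Rightarrow> real" where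
  "bump z0 r z = flat_exp 0 (r\<^sup>2 - (dist z0 z)\<^sup>2)"

lemma bump_pos_iff:
  assumes "0 < r" shows "0 < bump z0 r z \<longleftrightarrow> z \<in> ball z0 r"
proof -
  have "0 < flat_exp 0 x \<longleftrightarrow> 0 < x" for x by (simp add: flat_exp_def)
  moreover have "(dist z0 z)\<^sup>2 < r\<^sup>2 \<longleftrightarrow> dist z0 z < r"
  proof
    show "(dist z0 z)\<^sup>2 < r\<^sup>2 \<Longrightarrow> dist z0 z < r"
      by (rule power2_less_imp_less) (use assms in auto)
    show "dist z0 z < r \<Longrightarrow> (dist z0 z)\<^sup>2 < r\<^sup>2"
      by (rule power_strict_mono) auto
  qed
  ultimately show ?thesis by (simp add: bump_def)
qed

lemma bump_nonneg: "0 \<le> bump z0 r z"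
  by (simp add: bump_def flat_exp_def)

lemma Ck_on_bump: "Ck_on k UNIV (bump z0 r)"
proof -
  have "Ck_on k UNIV (\<lambda>z. r\<^sup>2 - (z0 - z) \<bullet> (z0 - z))"
    by (intro Ck_on_diff Ck_on_inner Ck_on_const open_UNIV Ck_on_bounded_linear[OF bounded_linear_ident])
  then have "Ck_on k UNIV (\<lambda>z. flat_exp 0 (r\<^sup>2 - (z0 - z) \<bullet> (z0 - z)))"
    by (rule Ck_on_compose[OF open_UNIV _ Ck_on_flat_exp]) simp
  then show ?thesis
    by (simp add: bump_def[abs_def] dist_norm power2_norm_eq_inner)
qed

section \<open>The Laplacian and the volume measure\<close>

lemma open_lborel_pos:
  fixes S :: "'a::euclidean_space set"
  assumes "open S" "S \<noteq> {}" shows "emeasure lborel S \<noteq> 0"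
proof
  assume "emeasure lborel S = 0"
  then have "S \<in> null_sets lborel" using assms(1) by (simp add: null_sets_def)
  then have "S \<in> null_sets lebesgue" by (rule null_sets_completionI)
  then show False using open_not_negligible[OF assms] by (simp add: negligible_iff_null_sets)
qed

lemma integral_lborel_neq_0:
  fixes f :: "'a::euclidean_space \<Rightarrow> real"
  assumes "integrable lborel f" "\<And>x. 0 \<le> f x" "open S" "S \<noteq> {}" "\<And>x. x \<in> S \<Longrightarrow> 0 < f x"
  shows "(\<integral>x. f x \<partial>lborel) \<noteq> 0"
proof
  assume "(\<integral>x. f x \<partial>lborel) = 0"
  then have "AE x in lborel. f x = 0"
    using integral_nonneg_eq_0_iff_AE[OF assms(1)] assms(2) by simp
  then have "AE x in lborel. x \<notin> S" by eventually_elim (use assms(5) in force)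
  then have "emeasure lborel S = 0"
    using AE_iff_measurable[of S lborel "\<lambda>x. x \<notin> S"] assms(3) by simp
  then show False using open_lborel_pos[OF assms(3,4)] by simp
qed

lemma integral_Re_double_sum:
  fixes f :: "'i::finite \<Rightarrow> 'j::finite \<Rightarrow> 'a \<Rightarrow> complex"
  assumes "\<And>i j. integrable M (f i j)"
  shows "(\<integral>z. r * Re (\<Sum>i\<in>UNIV. \<Sum>j\<in>UNIV. f i j z) \<partial>M) = r * Re (\<Sum>i\<in>UNIV. \<Sum>j\<in>UNIV. \<integral>z. f i j z \<partial>M)"
proof -
  have int: "integrable M (\<lambda>z. \<Sum>j\<in>UNIV. f i j z)" for i
    by (intro Bochner_Integration.integrable_sum assms)
  have int2: "integrable M (\<lambda>z. \<Sum>i\<in>UNIV. \<Sum>j\<in>UNIV. f i j z)"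
    by (intro Bochner_Integration.integrable_sum int)
  have "(\<integral>z. r * Re (\<Sum>i\<in>UNIV. \<Sum>j\<in>UNIV. f i j z) \<partial>M) = r * (\<integral>z. Re (\<Sum>i\<in>UNIV. \<Sum>j\<in>UNIV. f i j z) \<partial>M)"
    by (rule integral_mult_right_zero)
  also have "(\<integral>z. Re (\<Sum>i\<in>UNIV. \<Sum>j\<in>UNIV. f i j z) \<partial>M) = Re (\<integral>z. (\<Sum>i\<in>UNIV. \<Sum>j\<in>UNIV. f i j z) \<partial>M)"
    by (rule integral_Re[OF int2])
  also have "(\<integral>z. (\<Sum>i\<in>UNIV. \<Sum>j\<in>UNIV. f i j z) \<partial>M) = (\<Sum>i\<in>UNIV. \<integral>z. (\<Sum>j\<in>UNIV. f i j z) \<partial>M)"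
    by (rule Bochner_Integration.integral_sum) (rule int)
  also have "\<dots> = (\<Sum>i\<in>UNIV. \<Sum>j\<in>UNIV. \<integral>z. f i j z \<partial>M)"
    by (rule sum.cong[OF refl], rule Bochner_Integration.integral_sum) (rule assms)
  finally show ?thesis .
qed

section \<open>Functions supported in a chart\<close>

context complex_manifold
begin

text \<open>The image of K in the manifold is compact, hence closed by the Hausdorff property, and
  the extension vanishes off it. This settles the points outside the domain of c, including those on
  its boundary.\<close>

lemma Ck_fun_extend:
  fixes g :: "complex ^ 'n \<Rightarrow> real"
  assumes c: "c \<in> A" and g: "Ck_on k (chart_image c) g" and K: "compact K" "K \<subseteq> chart_image c"
    and g0: "\<And>z. z \<in> chart_image c \<Longrightarrow> z \<notin> K \<Longrightarrow> g z = 0"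
  shows "Ck_fun k (\<lambda>x. if x \<in> fst c then g (snd c x) else 0)"
  unfolding Ck_fun_def
proof
  fix d assume d: "d \<in> A"
  let ?u = "\<lambda>x. if x \<in> fst c then g (snd c x) else 0"
  let ?L = "chart_inv c ` K"
  have "compact ?L"
    by (rule compact_continuous_image[OF continuous_on_subset[OF continuous_chart_inv[OF c] K(2)] K(1)])
  then have L: "closed ?L" by (rule compact_imp_closed)
  have Lsub: "?L \<subseteq> fst c" using K(2) chart_inv_mem by blast
  have u0: "?u x = 0" if "x \<notin> ?L" for x
  proof (cases "x \<in> fst c")
    case True
    then have "snd c x \<notin> K" using that chart_inv_chart[OF c True] by (metis imageI)
    then show ?thesis using g0[OF chart_mem[OF True]] by simp
  qed simp
  show "Ck_on k (chart_image d) (\<lambda>z. ?u (chart_inv d z))"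
  proof (rule Ck_on_local)
    fix w assume w: "w \<in> chart_image d"
    show "\<exists>T. open T \<and> w \<in> T \<and> Ck_on k T (\<lambda>z. ?u (chart_inv d z))"
    proof (cases "chart_inv d w \<in> fst c")
      case True
      have op: "open (overlap d c)" by (rule open_overlap[OF d c])
      have "Ck_on k (overlap d c) (\<lambda>z. g (transition d c z))"
        by (rule Ck_on_compose[OF op Ck_on_holomorphic_map[OF op holo_transition[OF d c]] g])
           (intro overlap_mem[OF transition_props(1)[OF d c]] c)
      then have "Ck_on k (overlap d c) (\<lambda>z. ?u (chart_inv d z))"
        by (rule Ck_on_cong_imp[OF op, rotated]) (simp add: overlap_iff[OF d] transition_def)
      then show ?thesis using op True w by (intro exI[of _ "overlap d c"]) (simp add: overlap_iff[OF d])
    next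
      case False
      define T where "T = chart_image d \<inter> chart_inv d -` (- ?L)"
      have "open T" unfolding T_def
        using L by (intro continuous_open_preimage continuous_chart_inv open_image d) auto
      moreover have "w \<in> T" using False w Lsub by (auto simp: T_def)
      moreover have "Ck_on k T (\<lambda>z. ?u (chart_inv d z))"
        by (rule Ck_on_cong_imp[OF \<open>open T\<close> _ Ck_on_const[of _ _ 0]]) (use u0 in \<open>simp add: T_def\<close>)
      ultimately show ?thesis by blast
    qed
  qed
qed

lemma Ck_fun_const: "Ck_fun k (\<lambda>x. a)" by (simp add: Ck_fun_def)

lemma Ck_fun_mult: "Ck_fun k u \<Longrightarrow> Ck_fun k v \<Longrightarrow> Ck_fun k (\<lambda>x. u x * v x)"
  unfolding Ck_fun_def by (auto intro: Ck_on_mult open_image)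

lemma Ck_fun_sum: "(\<And>i. i \<in> I \<Longrightarrow> Ck_fun k (u i)) \<Longrightarrow> Ck_fun k (\<lambda>x. \<Sum>i\<in>I. u i x)"
  unfolding Ck_fun_def by (auto intro: Ck_on_sum open_image)

lemma Ck_fun_divide: "Ck_fun k u \<Longrightarrow> Ck_fun k v \<Longrightarrow> (\<And>x. v x \<noteq> 0) \<Longrightarrow> Ck_fun k (\<lambda>x. u x / v x)"
  unfolding Ck_fun_def by (auto intro: Ck_on_divide open_image)

lemma Ck_fun_compose:
  assumes "Ck_fun k u" "Ck_on k UNIV \<phi>" shows "Ck_fun k (\<lambda>x. \<phi> (u x))"
  using assms unfolding Ck_fun_def by (auto intro!: Ck_on_compose[OF _ _ assms(2)] open_image)

lemma chart_ball:
  obtains c r where "c \<in> A" "x \<in> fst c" "0 < r" "cball (snd c x) r \<subseteq> chart_image c"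
proof -
  have c: "chart_at A x \<in> A" "x \<in> fst (chart_at A x)" by (rule chart_at_props)+
  obtain r where "0 < r" "cball (snd (chart_at A x) x) r \<subseteq> chart_image (chart_at A x)"
    using open_image[OF c(1)] chart_mem[OF c(2)] open_contains_cball by blast
  then show thesis using that c by blast
qed

definition cutoff :: "('m, 'n) chart \<Rightarrow> complex ^ 'n \<Rightarrow> real \<Rightarrow> 'm \<Rightarrow> real" where
  "cutoff c z0 r x = (if x \<in> fst c then bump z0 r (snd c x) else 0)"

lemma cutoff_props:
  assumes "c \<in> A" "0 < r" "cball z0 r \<subseteq> chart_image c"
  shows "Ck_fun k (cutoff c z0 r)" "0 \<le> cutoff c z0 r x"
    and "x \<notin> chart_inv c ` cball z0 r \<Longrightarrow> cutoff c z0 r x = 0"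
    and "x \<in> fst c \<Longrightarrow> snd c x \<in> ball z0 r \<Longrightarrow> 0 < cutoff c z0 r x"
proof -
  have b0: "bump z0 r z = 0" if "z \<notin> cball z0 r" for z
    using that bump_pos_iff[OF assms(2), of z0 z] bump_nonneg[of z0 r z] by fastforce
  show "Ck_fun k (cutoff c z0 r)"
    unfolding cutoff_def[abs_def]
    by (rule Ck_fun_extend[OF assms(1) _ compact_cball assms(3) b0]) (auto intro: Ck_on_subset[OF Ck_on_bump])
  show "0 \<le> cutoff c z0 r x" by (simp add: cutoff_def bump_nonneg)
  show "cutoff c z0 r x = 0" if "x \<notin> chart_inv c ` cball z0 r"
  proof (cases "x \<in> fst c")
    case True
    then have "snd c x \<notin> cball z0 r" using that chart_inv_chart[OF assms(1) True] by (metis imageI)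
    then show ?thesis using b0 by (simp add: cutoff_def)
  qed (simp add: cutoff_def)
  show "0 < cutoff c z0 r x" if "x \<in> fst c" "snd c x \<in> ball z0 r"
    using that bump_pos_iff[OF assms(2), of z0 "snd c x"] by (simp add: cutoff_def)
qed

lemma open_chart_ball:
  assumes "c \<in> A" shows "open {x \<in> fst c. snd c x \<in> ball z0 r}"
proof -
  have "{x \<in> fst c. snd c x \<in> ball z0 r} = fst c \<inter> snd c -` ball z0 r" by auto
  then show ?thesis
    using continuous_open_preimage[OF continuous_chart[OF assms] open_domain[OF assms] open_ball] by metis
qed

end

section \<open>Locality of the Laplacian and the Gauduchon condition in coordinates\<close>

context hermitian_manifold
begin

lemma laplace_add:
  assumes "Ck_fun 2 u" "Ck_fun 2 v"
  shows "laplace G (\<lambda>x. u x + v x) x = laplace G u x + laplace G v x"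
proof -
  define c where "c = chart_at A x"
  have c: "c \<in> A" "x \<in> fst c" using chart_at_props[of x] by (simp_all add: c_def)
  show ?thesis unfolding laplace_def c_def[symmetric]
    using lap_add[OF open_image[OF c(1)] chart_mem[OF c(2)] Ck_fun_complex[OF c(1) assms(1)] Ck_fun_complex[OF c(1) assms(2)]]
    by simp
qed

lemma laplace_cmult:
  assumes "Ck_fun 2 u"
  shows "laplace G (\<lambda>x. a * u x) x = a * laplace G u x"
proof -
  define c where "c = chart_at A x"
  have c: "c \<in> A" "x \<in> fst c" using chart_at_props[of x] by (simp_all add: c_def)
  show ?thesis unfolding laplace_def c_def[symmetric]
    using lap_cmult[OF open_image[OF c(1)] chart_mem[OF c(2)] Ck_fun_complex[OF c(1) assms], of _ "of_real a"]
    by simp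
qed

lemma laplace_zero: "laplace G (\<lambda>x. 0) x = 0"
  using laplace_cmult[OF Ck_fun_const, of 0 0] by simp

lemma laplace_sum:
  assumes "finite I" "\<And>i. i \<in> I \<Longrightarrow> Ck_fun 2 (u i)"
  shows "laplace G (\<lambda>x. \<Sum>i\<in>I. u i x) x = (\<Sum>i\<in>I. laplace G (u i) x)"
  using assms
proof (induction I rule: finite_induct)
  case (insert i I)
  then show ?case using laplace_add[of "u i" "\<lambda>x. \<Sum>i\<in>I. u i x" x] Ck_fun_sum[of I 2 u] by simp
qed (simp add: laplace_zero)

lemma laplace_eq_0:
  assumes "Ck_fun 2 u" "open W" "x \<in> W" "\<And>y. y \<in> W \<Longrightarrow> u y = 0"
  shows "laplace G u x = 0"
proof -
  define c where "c = chart_at A x"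
  have c: "c \<in> A" "x \<in> fst c" using chart_at_props[of x] by (simp_all add: c_def)
  define T where "T = chart_image c \<inter> chart_inv c -` W"
  have T: "open T" unfolding T_def
    by (intro continuous_open_preimage continuous_chart_inv open_image c assms)
  have "snd c x \<in> T" using c assms(3) by (simp add: T_def chart_mem chart_inv_chart)
  then have "lap (G c) (\<lambda>w. of_real (u (chart_inv c w))) (snd c x) = lap (G c) (\<lambda>w. 0) (snd c x)"
    by (intro lap_cong[OF T]) (auto simp: T_def assms(4))
  moreover have "wirt i (\<lambda>w. 0) = (\<lambda>_. 0)" for i :: 'n by (rule ext) simp
  ultimately show ?thesis by (simp add: laplace_def c_def[symmetric]) (simp add: lap_def)
qed

abbreviation coef :: "('m, 'n) chart \<Rightarrow> 'n \<Rightarrow> 'n \<Rightarrow> complex ^ 'n \<Rightarrow> complex" where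
  "coef c i j w \<equiv> det (G c w) * inv_metric (G c w) i j"

lemma Ck_coef: "c \<in> A \<Longrightarrow> Ck_on k (chart_image c) (coef c i j)"
  by (intro Ck_on_mult Ck_on_det Ck_on_inv_metric open_image Ck_metric_entry inv_G)

lemma Ck_gauduchon_local: "c \<in> A \<Longrightarrow> Ck_on k (chart_image c) (gauduchon_local (G c))"
  unfolding gauduchon_local_def[abs_def] by (intro Ck_on_sum Ck_on_wirt Ck_coef open_image)

text \<open>From left to right the form is evaluated on the standard frame, where the top form does
  not vanish.\<close>

lemma gauduchon_iff: "gauduchon A G \<longleftrightarrow> (\<forall>c\<in>A. \<forall>z\<in>chart_image c. gauduchon_local (G c) z = 0)"
proof -
  have n1: "CARD('n) \<ge> 1" by (simp add: Suc_leI)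
  obtain \<gamma> :: complex where \<gamma>: "\<gamma> \<noteq> 0" "\<forall>(g :: complex ^ 'n \<Rightarrow> complex ^ 'n ^ 'n) U z v. open U \<longrightarrow> z \<in> U \<longrightarrow>
    (\<forall>i j. Ck_on 2 U (\<lambda>w. g w $ i $ j)) \<longrightarrow> (\<forall>w\<in>U. invertible (g w)) \<longrightarrow>
    del_form (2 * (CARD('n) - 1) + 1) (delbar_form (2 * (CARD('n) - 1))
      (\<lambda>w. wedge_power 2 (fund_form (g w)) (CARD('n) - 1))) z v =
    \<gamma> * top_form id id v * gauduchon_local g z"
    using gauduchon_form_eq[where 'n = 'n, OF n1] by blast
  have eq: "del_form (2 * (CARD('n) - 1) + 1) (delbar_form (2 * (CARD('n) - 1))
      (\<lambda>w. wedge_power 2 (fund_form (G c w)) (CARD('n) - 1))) z v = \<gamma> * top_form id id v * gauduchon_local (G c) z"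
    if c: "c \<in> A" "z \<in> chart_image c" for c z v
    by (rule \<gamma>(2)[rule_format, OF open_image[OF c(1)] c(2) Ck_metric_entry[OF c(1)] inv_G[OF c(1)]])
  show ?thesis
  proof
    assume gG: "gauduchon A G"
    show "\<forall>c\<in>A. \<forall>z\<in>chart_image c. gauduchon_local (G c) z = 0"
    proof (intro ballI)
      fix c z assume c: "c \<in> A" "z \<in> chart_image c"
      have "del_form (2 * (CARD('n) - 1) + 1) (delbar_form (2 * (CARD('n) - 1))
        (\<lambda>w. wedge_power 2 (fund_form (G c w)) (CARD('n) - 1))) z (real_frame :: nat \<Rightarrow> complex ^ 'n) = 0"
        by (rule gG[unfolded gauduchon_def, rule_format, OF c])
      then show "gauduchon_local (G c) z = 0"
        unfolding eq[OF c] mult_eq_0_iff using \<gamma>(1) top_form_real_frame_nonzero[where 'n = 'n] by argo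
    qed
  next
    assume "\<forall>c\<in>A. \<forall>z\<in>chart_image c. gauduchon_local (G c) z = 0"
    then show "gauduchon A G" unfolding gauduchon_def by (intro ballI allI) (simp only: eq mult_zero_right)
  qed
qed

text \<open>The coefficients det g g^{i bar j} form a Hermitian matrix and mixed derivatives
  commute, so conjugation only exchanges i and j. The integrals below see the real part alone and
  thus determine the whole expression.\<close>

lemma gauduchon_local_real:
  assumes c: "c \<in> A" "z \<in> chart_image c"
  shows "Im (gauduchon_local (G c) z) = 0"
proof -
  have op: "open (chart_image c)" by (rule open_image[OF c(1)])
  have herm: "coef c i j w = cnj (coef c j i w)" if "w \<in> chart_image c" for i j w
    using inv_metric_hermitian[OF pos_def[OF c(1) that], of i j] pos_def_hermitian_det_of_real[OF pos_def[OF c(1) that]]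
    by (metis complex_cnj_complex_of_real complex_cnj_mult)
  have d: "coef c i j differentiable at w" "wirt i' (coef c i j) differentiable at w" if "w \<in> chart_image c" for i j i' w
    using Ck_coef[OF c(1), of 1 i j] Ck_on_wirt(1)[OF op Ck_coef[OF c(1), of "Suc 1" i j], of i'] that by simp_all
  have swap: "wirt i (wirt_bar j (coef c i j)) z = cnj (wirt j (wirt_bar i (coef c j i)) z)" for i j
  proof -
    have "wirt i (wirt_bar j (coef c i j)) z = wirt i (\<lambda>w. cnj (wirt j (coef c j i) w)) z"
    proof (rule wirt_cong(1)[OF op c(2)])
      fix w assume w: "w \<in> chart_image c"
      have "wirt_bar j (coef c i j) w = wirt_bar j (\<lambda>w. cnj (coef c j i w)) w"
        by (rule wirt_cong(2)[OF op w herm])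
      then show "wirt_bar j (coef c i j) w = cnj (wirt j (coef c j i) w)" using wirt_cnj(2)[OF d(1)[OF w]] by simp
    qed
    also have "\<dots> = cnj (wirt_bar i (wirt j (coef c j i)) z)" by (rule wirt_cnj(1)[OF d(2)[OF c(2)]])
    finally show ?thesis using wirt_wirt_bar_commute[OF op c(2) Ck_coef[OF c(1)]] by simp
  qed
  have "gauduchon_local (G c) z = (\<Sum>i\<in>UNIV. \<Sum>j\<in>UNIV. cnj (wirt j (wirt_bar i (coef c j i)) z))"
    unfolding gauduchon_local_def by (intro sum.cong refl swap)
  also have "\<dots> = cnj (gauduchon_local (G c) z)"
    by (subst sum.swap) (simp add: gauduchon_local_def)
  finally show ?thesis by (simp add: complex_eq_iff)
qed

end

section \<open>Integrals over the manifold\<close>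

context compact_hermitian_manifold
begin

text \<open>Since the volume density is N det g, the integrand is a sum of det g g^{i bar j} times
  second derivatives of u, and both derivatives can be moved to the coefficients.\<close>

lemma integral_laplace_compact_support:
  assumes N: "\<And>h :: complex ^ 'n ^ 'n. volume_density h = real N * Re (det h)"
    and c: "c \<in> A" and u: "Ck_fun 2 u" and K: "compact K" "K \<subseteq> chart_image c"
    and u0: "\<And>x. x \<notin> chart_inv c ` K \<Longrightarrow> u x = 0"
  shows "(\<integral>x. laplace G u x \<partial>vol A G) =
    real N * (\<integral>z. indicator (chart_image c) z * (Re (gauduchon_local (G c) z) * u (chart_inv c z)) \<partial>lborel)"
proof -
  let ?U = "chart_image c"
  let ?\<phi> = "\<lambda>z. complex_of_real (u (chart_inv c z))"
  have op: "open ?U" by (rule open_image[OF c])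
  have "compact (chart_inv c ` K)"
    by (rule compact_continuous_image[OF continuous_on_subset[OF continuous_chart_inv[OF c] K(2)] K(1)])
  then have cl: "open (- (chart_inv c ` K))" by (simp add: compact_imp_closed open_Compl)
  have sub: "chart_inv c ` K \<subseteq> fst c" using K(2) chart_inv_mem by blast
  have L0: "laplace G u x = 0" if "x \<notin> fst c" for x
    by (rule laplace_eq_0[OF u cl]) (use that sub u0 in auto)
  have "Ck_fun 0 (laplace G u)" using Ck_laplace[of 0 u] u by (simp add: numeral_2_eq_2)
  then have Lm: "laplace G u \<in> borel_measurable borel" by (rule Ck_fun_measurable)
  have \<phi>0: "?\<phi> z = 0" if z: "z \<in> ?U" "z \<notin> K" for z
  proof -
    have "chart_inv c z \<notin> chart_inv c ` K"
    proof
      assume "chart_inv c z \<in> chart_inv c ` K"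
      then obtain w where w: "w \<in> K" "chart_inv c z = chart_inv c w" by blast
      then have "z = w" using chart_chart_inv[OF z(1)] chart_chart_inv[of w c] K(2) by (metis subsetD)
      then show False using w z by simp
    qed
    then show ?thesis by (simp add: u0)
  qed
  note IBP = integration_by_parts_hessian[OF op K Ck_coef[OF c] Ck_fun_complex[OF c u] \<phi>0]
  have "(\<integral>x. laplace G u x \<partial>vol A G) = (\<integral>z. indicator ?U z * (dens c z * laplace G u (chart_inv c z)) \<partial>lborel)"
    by (rule integral_vol_chart[OF c Lm L0])
  also have "\<dots> = (\<integral>z. real N * Re (\<Sum>i\<in>UNIV. \<Sum>j\<in>UNIV. indicator ?U z *\<^sub>R (coef c i j z * wirt_bar j (wirt i ?\<phi>) z)) \<partial>lborel)"
  proof (rule Bochner_Integration.integral_cong[OF refl])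
    fix z
    show "indicator ?U z * (dens c z * laplace G u (chart_inv c z)) =
      real N * Re (\<Sum>i\<in>UNIV. \<Sum>j\<in>UNIV. indicator ?U z *\<^sub>R (coef c i j z * wirt_bar j (wirt i ?\<phi>) z))"
    proof (cases "z \<in> ?U")
      case True
      have "(\<Sum>i\<in>UNIV. \<Sum>j\<in>UNIV. coef c i j z * wirt_bar j (wirt i ?\<phi>) z) = det (G c z) * lap (G c) ?\<phi> z"
        by (simp add: lap_def sum_distrib_left mult.assoc)
      moreover have "Re (det (G c z) * lap (G c) ?\<phi> z) = Re (det (G c z)) * Re (lap (G c) ?\<phi> z)"
        using pos_def_hermitian_det_real[OF pos_def[OF c True]] by simp
      ultimately have "Re (\<Sum>i\<in>UNIV. \<Sum>j\<in>UNIV. indicator ?U z *\<^sub>R (coef c i j z * wirt_bar j (wirt i ?\<phi>) z)) =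
          Re (det (G c z)) * laplace G u (chart_inv c z)"
        by (simp only: indicator_simps(1)[OF True] scaleR_one laplace_chart[OF c True u])
      then show ?thesis by (simp only: indicator_simps(1)[OF True] dens_def N mult_1_left mult.assoc)
    qed simp
  qed
  also have "\<dots> = real N * Re (\<Sum>i\<in>UNIV. \<Sum>j\<in>UNIV. \<integral>z. indicator ?U z *\<^sub>R (coef c i j z * wirt_bar j (wirt i ?\<phi>) z) \<partial>lborel)"
    by (rule integral_Re_double_sum) (rule IBP(1))
  also have "\<dots> = real N * Re (\<Sum>i\<in>UNIV. \<Sum>j\<in>UNIV. \<integral>z. indicator ?U z *\<^sub>R (wirt i (wirt_bar j (coef c i j)) z * ?\<phi> z) \<partial>lborel)"
    by (intro arg_cong[of _ _ "\<lambda>s. real N * Re s"] sum.cong refl IBP(3))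
  also have "\<dots> = (\<integral>z. real N * Re (\<Sum>i\<in>UNIV. \<Sum>j\<in>UNIV. indicator ?U z *\<^sub>R (wirt i (wirt_bar j (coef c i j)) z * ?\<phi> z)) \<partial>lborel)"
    by (rule integral_Re_double_sum[symmetric]) (rule IBP(2))
  also have "\<dots> = (\<integral>z. real N * (indicator ?U z * (Re (gauduchon_local (G c) z) * u (chart_inv c z))) \<partial>lborel)"
  proof (rule Bochner_Integration.integral_cong[OF refl])
    fix z
    have "(\<Sum>i\<in>UNIV. \<Sum>j\<in>UNIV. wirt i (wirt_bar j (coef c i j)) z * ?\<phi> z) = gauduchon_local (G c) z * ?\<phi> z"
      by (simp add: gauduchon_local_def sum_distrib_right)
    then show "real N * Re (\<Sum>i\<in>UNIV. \<Sum>j\<in>UNIV. indicator ?U z *\<^sub>R (wirt i (wirt_bar j (coef c i j)) z * ?\<phi> z)) =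
       real N * (indicator ?U z * (Re (gauduchon_local (G c) z) * u (chart_inv c z)))"
      by (simp del: Re_sum flip: scaleR_sum_right)
  qed
  finally show ?thesis by simp
qed

text \<open>Finitely many coordinate balls cover the manifold, and the density is bounded on each of
  their closures.\<close>

lemma finite_vol: "finite_measure (vol A G)"
proof
  have "\<exists>W. open W \<and> x \<in> W \<and> emeasure (vol A G) W < \<infinity>" for x
  proof -
    obtain c r where c: "c \<in> A" "x \<in> fst c" "0 < r" "cball (snd c x) r \<subseteq> chart_image c" by (rule chart_ball)
    define z0 where "z0 = snd c x"
    define W where "W = {y \<in> fst c. snd c y \<in> ball z0 r}"
    have W: "open W" "x \<in> W" "W \<subseteq> fst c" using c open_chart_ball[OF c(1)] by (auto simp: W_def z0_def)
    have img: "snd c ` W = ball z0 r"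
    proof -
      have "z \<in> snd c ` W" if z: "z \<in> ball z0 r" for z
      proof -
        have zc: "z \<in> chart_image c" using z c(4) by (auto simp: z0_def)
        have "chart_inv c z \<in> W" unfolding W_def using z chart_inv_mem[OF zc] chart_chart_inv[OF zc] by simp
        then show ?thesis using chart_chart_inv[OF zc] by (metis imageI)
      qed
      then show ?thesis by (auto simp: W_def)
    qed
    have cont: "continuous_on (cball z0 r) (dens c)" by (rule dens_continuous[OF c(1)]) (use c(4) z0_def in simp)
    have ne: "cball z0 r \<noteq> {}" using c(3) by simp
    obtain B where B: "\<forall>z\<in>cball z0 r. dens c z \<le> B"
      using continuous_attains_sup[OF compact_cball ne cont] by blast
    have "emeasure (vol A G) W = (\<integral>\<^sup>+z\<in>ball z0 r. ennreal (dens c z) \<partial>lborel)"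
      using emeasure_vol[OF c(1) _ W(3)] emeasure_chart_measure[OF c(1), of W] W img by (simp add: Int_absorb2)
    also have "\<dots> \<le> (\<integral>\<^sup>+z\<in>ball z0 r. ennreal B \<partial>lborel)"
      using B by (intro nn_integral_mono) (auto simp: indicator_def intro!: ennreal_leI)
    also have "\<dots> = ennreal B * emeasure lborel (ball z0 r)" by (simp add: nn_integral_cmult_indicator)
    also have "\<dots> < \<infinity>" using emeasure_lborel_ball_finite[of z0 r] by (simp add: ennreal_mult_less_top)
    finally show ?thesis using W by blast
  qed
  then obtain W where W: "\<And>x. open (W x)" "\<And>x. x \<in> W x" "\<And>x. emeasure (vol A G) (W x) < \<infinity>" by metis
  have cov: "UNIV \<subseteq> (\<Union>x\<in>UNIV. W x)" using W(2) by blast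
  obtain X where X: "finite X" "UNIV \<subseteq> (\<Union>x\<in>X. W x)"
    using compactE_image[OF compact_space W(1) cov] by (metis subset_UNIV)
  have "emeasure (vol A G) UNIV \<le> emeasure (vol A G) (\<Union>x\<in>X. W x)"
    using X W(1) by (intro emeasure_mono) (auto intro!: borel_open open_UN)
  also have "\<dots> \<le> (\<Sum>x\<in>X. emeasure (vol A G) (W x))"
    using X W(1) by (intro emeasure_subadditive_finite) auto
  also have "\<dots> < \<infinity>" using W(3) X(1) by simp
  finally show "emeasure (vol A G) (space (vol A G)) \<noteq> \<infinity>" by simp
qed

lemma continuous_bounded:
  fixes f :: "'m \<Rightarrow> real"
  assumes "continuous_on UNIV f" shows "\<exists>B. \<forall>x. \<bar>f x\<bar> \<le> B"
proof -
  have "compact (range f)" by (rule compact_continuous_image[OF assms compact_space])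
  from compact_imp_bounded[OF this] show ?thesis unfolding bounded_iff by simp
qed

lemma integrable_continuous_vol:
  fixes f :: "'m \<Rightarrow> real"
  assumes "continuous_on UNIV f" shows "integrable (vol A G) f"
proof -
  obtain B where "\<forall>x. \<bar>f x\<bar> \<le> B" using continuous_bounded[OF assms] by blast
  then show ?thesis
    using borel_measurable_continuous_onI[OF assms]
    by (intro finite_measure.integrable_const_bound[OF finite_vol, of f B]) (auto simp: measurable_vol)
qed

text \<open>A positive value of f persists on an open set inside a chart. The density is positive
  there, and a nonempty open set has positive Lebesgue measure.\<close>

lemma integral_vol_eq_0:
  fixes f :: "'m \<Rightarrow> real"
  assumes f: "continuous_on UNIV f" "\<And>x. 0 \<le> f x" "(\<integral>x. f x \<partial>vol A G) = 0"
  shows "f x = 0"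
proof (rule ccontr)
  assume x: "f x \<noteq> 0"
  obtain c r where c: "c \<in> A" "x \<in> fst c" "0 < r" "cball (snd c x) r \<subseteq> chart_image c" by (rule chart_ball)
  define W where "W = fst c \<inter> f -` {0<..}"
  have W: "open W" "x \<in> W" "W \<subseteq> fst c"
    using continuous_open_preimage[OF continuous_on_subset[OF f(1)] open_domain[OF c(1)]] x f(2)[of x] c(2)
    by (auto simp: W_def)
  have "AE y in vol A G. f y = 0"
    using integral_nonneg_eq_0_iff_AE[OF integrable_continuous_vol[OF f(1)]] f by simp
  then have "AE y in vol A G. y \<notin> W" by eventually_elim (simp add: W_def)
  then have "emeasure (vol A G) W = 0"
    using AE_iff_measurable[of W "vol A G" "\<lambda>y. y \<notin> W"] W(1) by simp
  then have "(\<integral>\<^sup>+z\<in>snd c ` W. ennreal (dens c z) \<partial>lborel) = 0"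
    using emeasure_vol[OF c(1) _ W(3)] emeasure_chart_measure[OF c(1), of W] W by (simp add: Int_absorb2)
  moreover have img: "snd c ` W \<in> sets borel" using W(1,3) by (intro chart_image_borel[OF c(1)]) simp_all
  moreover have "(\<lambda>z. ennreal (dens c z) * indicator (snd c ` W) z) \<in> borel_measurable lborel"
  proof -
    have "snd c ` W \<subseteq> chart_image c" unfolding chart_image_def by (rule image_mono[OF W(3)])
    from measurable_compose[OF dens_indicator_measurable[OF c(1) img this] measurable_ennreal]
    show ?thesis by (simp add: ennreal_mult_indicator)
  qed
  ultimately have AE0: "AE z in lborel. ennreal (dens c z) * indicator (snd c ` W) z = 0"
    using nn_integral_0_iff_AE[of "\<lambda>z. ennreal (dens c z) * indicator (snd c ` W) z" lborel] by simp
  have "AE z in lborel. z \<notin> snd c ` W"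
  proof (rule AE_mp[OF AE0 AE_I2], rule impI, rule notI)
    fix z assume *: "ennreal (dens c z) * indicator (snd c ` W) z = 0" "z \<in> snd c ` W"
    then obtain y where "y \<in> W" "z = snd c y" by (rule_tac imageE)
    then have "z \<in> chart_image c" using W(3) chart_mem[of y c] by blast
    then have "0 < dens c z" by (rule dens_pos[OF c(1)])
    then show False using * by (simp add: ennreal_eq_0_iff)
  qed
  then have "emeasure lborel (snd c ` W) = 0"
    using AE_iff_measurable[of "snd c ` W" lborel "\<lambda>z. z \<notin> snd c ` W"] img by simp
  moreover have "open (snd c ` W)"
  proof -
    have "snd c ` W = chart_image c \<inter> chart_inv c -` W"
    proof (intro set_eqI iffI)
      fix z assume "z \<in> chart_image c \<inter> chart_inv c -` W"
      then have "chart_inv c z \<in> W" "z = snd c (chart_inv c z)" by (simp_all add: chart_chart_inv)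
      then show "z \<in> snd c ` W" by blast
    next
      fix z assume "z \<in> snd c ` W"
      then obtain y where y: "y \<in> W" "z = snd c y" by (rule imageE) blast
      then have "y \<in> fst c" using W(3) by blast
      then show "z \<in> chart_image c \<inter> chart_inv c -` W"
        using y chart_mem[of y c] chart_inv_chart[OF c(1), of y] by simp
    qed
    then show ?thesis
      using continuous_open_preimage[OF continuous_chart_inv[OF c(1)] open_image[OF c(1)] W(1)] by simp
  qed
  moreover have "snd c ` W \<noteq> {}" using W(2) by blast
  ultimately show False using open_lborel_pos[of "snd c ` W"] by simp
qed

text \<open>Only positivity of the sum is asked for; normalising the functions to a partition of
  unity is left to the application.\<close>

lemma partition_functions:
  "\<exists>(X :: 'm set) b. finite X \<and> (\<forall>x\<in>X. (\<forall>k. Ck_fun k (b x)) \<and> (\<forall>y. 0 \<le> b x y) \<and>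
    (\<exists>c K. c \<in> A \<and> compact K \<and> K \<subseteq> chart_image c \<and> (\<forall>y. y \<notin> chart_inv c ` K \<longrightarrow> b x y = 0))) \<and>
    (\<forall>y. \<exists>x\<in>X. 0 < (b x y :: real))"
proof -
  have "\<exists>f W. open W \<and> x \<in> W \<and> (\<forall>y\<in>W. 0 < f y) \<and> (\<forall>k. Ck_fun k f) \<and> (\<forall>y. 0 \<le> f y) \<and>
    (\<exists>c K. c \<in> A \<and> compact K \<and> K \<subseteq> chart_image c \<and> (\<forall>y. y \<notin> chart_inv c ` K \<longrightarrow> f y = (0 :: real)))" for x
  proof -
    obtain c r where c: "c \<in> A" "x \<in> fst c" "0 < r" "cball (snd c x) r \<subseteq> chart_image c" by (rule chart_ball)
    note P = cutoff_props[OF c(1,3,4)]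
    show ?thesis
      using c P open_chart_ball[OF c(1)]
      by (intro exI[of _ "cutoff c (snd c x) r"] exI[of _ "{y \<in> fst c. snd c y \<in> ball (snd c x) r}"] conjI exI[of _ c]
          exI[of _ "cball (snd c x) r"]) auto
  qed
  then obtain b W where bW: "\<And>x. open (W x)" "\<And>x. x \<in> W x" "\<And>x. \<forall>y\<in>W x. 0 < b x y" "\<And>x. \<forall>k. Ck_fun k (b x)"
    "\<And>x. \<forall>y. 0 \<le> b x y"
    "\<And>x. \<exists>c K. c \<in> A \<and> compact K \<and> K \<subseteq> chart_image c \<and> (\<forall>y. y \<notin> chart_inv c ` K \<longrightarrow> b x y = (0 :: real))"
    by metis
  have cov: "UNIV \<subseteq> (\<Union>x\<in>UNIV. W x)" using bW(2) by blast
  obtain X where X: "finite X" "UNIV \<subseteq> (\<Union>x\<in>X. W x)"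
    using compactE_image[OF compact_space bW(1) cov] by (metis subset_UNIV)
  have pos: "\<exists>x\<in>X. 0 < b x y" for y
  proof -
    obtain x where "x \<in> X" "y \<in> W x" using X(2) by blast
    then show ?thesis using bW(3)[rule_format, of y x] by (intro bexI)
  qed
  show ?thesis
    by (intro exI[of _ X] exI[of _ b] conjI ballI allI) (rule X(1) bW(4)[rule_format] bW(5)[rule_format] bW(6) pos)+
qed

lemma integral_laplace_gauduchon:
  assumes "gauduchon A G" and H: "Ck_fun 2 H"
  shows "(\<integral>x. laplace G H x \<partial>vol A G) = 0"
proof -
  obtain N :: nat where N: "0 < N" "\<And>h :: complex ^ 'n ^ 'n. volume_density h = real N * Re (det h)"
    using volume_density_eq_det by blast
  obtain X :: "'m set" and b :: "'m \<Rightarrow> 'm \<Rightarrow> real" where X: "finite X" and b: "\<forall>x\<in>X. (\<forall>k. Ck_fun k (b x)) \<and> (\<forall>y. 0 \<le> b x y) \<and>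
    (\<exists>c K. c \<in> A \<and> compact K \<and> K \<subseteq> chart_image c \<and> (\<forall>y. y \<notin> chart_inv c ` K \<longrightarrow> b x y = 0))"
    "\<forall>y. \<exists>x\<in>X. 0 < b x y"
    using partition_functions by (elim exE conjE) (rule that)
  define S where "S y = (\<Sum>x\<in>X. b x y)" for y
  have S: "0 < S y" for y
  proof -
    obtain x where "x \<in> X" "0 < b x y" using b(2) by blast
    then show ?thesis unfolding S_def using b(1) X by (intro sum_pos2[of _ x]) auto
  qed
  have CS: "Ck_fun 2 S" unfolding S_def[abs_def] using b(1) by (intro Ck_fun_sum) auto
  \<comment> \<open>Division by S normalises the cutoffs, so H splits into pieces each supported in
    one chart.\<close>
  define h where "h x y = b x y * (H y / S y)" for x y
  have Ch: "Ck_fun 2 (h x)" if "x \<in> X" for x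
    unfolding h_def[abs_def] using b(1) that S
    by (intro Ck_fun_mult Ck_fun_divide H CS) (auto simp: less_imp_neq[symmetric])
  have zero: "(\<integral>y. laplace G (h x) y \<partial>vol A G) = 0" if x: "x \<in> X" for x
  proof -
    obtain c K where c: "c \<in> A" "compact K" "K \<subseteq> chart_image c" "\<forall>y. y \<notin> chart_inv c ` K \<longrightarrow> b x y = 0"
      using b(1)[rule_format, OF x] by (elim exE conjE) (rule that)
    have "(\<integral>y. laplace G (h x) y \<partial>vol A G) =
      real N * (\<integral>z. indicator (chart_image c) z * (Re (gauduchon_local (G c) z) * h x (chart_inv c z)) \<partial>lborel)"
      by (rule integral_laplace_compact_support[OF N(2) c(1) Ch[OF x] c(2,3)]) (use c(4) in \<open>simp add: h_def\<close>)
    also have "(\<lambda>z. indicator (chart_image c) z * (Re (gauduchon_local (G c) z) * h x (chart_inv c z))) = (\<lambda>z. 0)"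
      using assms(1) c(1) unfolding gauduchon_iff by (auto simp: fun_eq_iff indicator_def)
    finally show ?thesis by simp
  qed
  have "(\<Sum>x\<in>X. h x y) = S y * (H y / S y)" for y
    unfolding h_def S_def by (simp only: sum_distrib_right)
  then have "H y = (\<Sum>x\<in>X. h x y)" for y using S[of y] by simp
  then have Heq: "H = (\<lambda>y. \<Sum>x\<in>X. h x y)" by (rule ext)
  have "laplace G H y = (\<Sum>x\<in>X. laplace G (h x) y)" for y
    by (subst Heq) (rule laplace_sum[OF X Ch])
  then have "(\<integral>x. laplace G H x \<partial>vol A G) = (\<integral>y. (\<Sum>x\<in>X. laplace G (h x) y) \<partial>vol A G)" by simp
  also have "\<dots> = (\<Sum>x\<in>X. \<integral>y. laplace G (h x) y \<partial>vol A G)"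
  proof (rule Bochner_Integration.integral_sum)
    fix x assume "x \<in> X"
    then have "Ck_fun 0 (laplace G (h x))" using Ck_laplace[of 0 "h x"] Ch by (simp add: numeral_2_eq_2)
    then show "integrable (vol A G) (laplace G (h x))" by (intro integrable_continuous_vol Ck_fun_continuous)
  qed
  finally show ?thesis using zero by simp
qed

text \<open>The fundamental lemma of the calculus of variations: where the local expression is
  nonzero, a bump of small support gives an integral of definite sign.\<close>

lemma gauduchon_if_integral_laplace:
  assumes I: "\<And>f. smooth_fun A f \<Longrightarrow> (\<integral>x. laplace G f x \<partial>vol A G) = 0"
  shows "gauduchon A G"
  unfolding gauduchon_iff
proof (intro ballI, rule ccontr)
  fix c z0 assume c: "c \<in> A" "z0 \<in> chart_image c" and nz: "gauduchon_local (G c) z0 \<noteq> 0"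
  obtain N :: nat where N: "0 < N" "\<And>h :: complex ^ 'n ^ 'n. volume_density h = real N * Re (det h)"
    using volume_density_eq_det by blast
  define g where "g z = Re (gauduchon_local (G c) z)" for z
  \<comment> \<open>Multiplying by \<sigma> reduces to an expression that is positive at z0.\<close>
  define \<sigma> where "\<sigma> = sgn (g z0)"
  have g0: "g z0 \<noteq> 0" using nz gauduchon_local_real[OF c] by (auto simp: g_def complex_eq_iff)
  have gc: "continuous_on (chart_image c) g"
    using Ck_on_continuous[OF Ck_gauduchon_local[OF c(1), of 0]] unfolding g_def by (intro continuous_intros)
  have \<sigma>g: "continuous_on (chart_image c) (\<lambda>z. \<sigma> * g z)" by (intro continuous_intros gc)
  define V where "V = chart_image c \<inter> (\<lambda>z. \<sigma> * g z) -` {0<..}"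
  have V: "open V" "z0 \<in> V"
    using continuous_open_preimage[OF \<sigma>g open_image[OF c(1)]] c(2) g0
    by (auto simp: V_def \<sigma>_def sgn_mult_self_eq abs_sgn[symmetric] mult.commute[of "sgn _"])
  obtain r where r: "0 < r" "cball z0 r \<subseteq> V" using V open_contains_cball by blast
  have sub: "cball z0 r \<subseteq> chart_image c" using r(2) by (auto simp: V_def)
  define f where "f = cutoff c z0 r"
  note P = cutoff_props[OF c(1) r(1) sub, folded f_def]
  have "(\<integral>x. laplace G f x \<partial>vol A G) = 0" by (rule I) (simp add: smooth_fun_Ck P(1))
  moreover have "(\<integral>x. laplace G f x \<partial>vol A G) =
      real N * (\<integral>z. indicator (chart_image c) z * (g z * f (chart_inv c z)) \<partial>lborel)"
    unfolding g_def by (rule integral_laplace_compact_support[OF N(2) c(1) P(1) compact_cball sub P(3)])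
  ultimately have "(\<integral>z. indicator (chart_image c) z * (g z * f (chart_inv c z)) \<partial>lborel) = 0" using N(1) by simp
  then have I0: "(\<integral>z. \<sigma> * (indicator (chart_image c) z * (g z * f (chart_inv c z))) \<partial>lborel) = 0" by simp
  have f_chart: "f (chart_inv c z) = bump z0 r z" if "z \<in> chart_image c" for z
    using that by (simp add: f_def cutoff_def chart_inv_mem chart_chart_inv)
  have b0: "bump z0 r z = 0" if "z \<notin> cball z0 r" for z
    using that bump_pos_iff[OF r(1), of z0 z] bump_nonneg[of z0 r z] by fastforce
  have pos: "0 < \<sigma> * g z" "z \<in> chart_image c" if "z \<in> cball z0 r" for z
    using r(2) that by (auto simp: V_def)
  have "(\<integral>z. \<sigma> * (indicator (chart_image c) z * (g z * f (chart_inv c z))) \<partial>lborel) \<noteq> 0"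
  proof (rule integral_lborel_neq_0[OF _ _ open_ball[of z0 r]])
    have eq: "\<sigma> * (indicator (chart_image c) z * (g z * f (chart_inv c z))) =
        indicator (chart_image c) z *\<^sub>R (\<sigma> * g z * bump z0 r z)" for z
      using f_chart[of z] by (auto simp: indicator_def)
    have bc: "continuous_on (chart_image c) (bump z0 r)"
      using Ck_on_continuous[OF Ck_on_bump[of 0 z0 r]] by (rule continuous_on_subset) simp
    show "integrable lborel (\<lambda>z. \<sigma> * (indicator (chart_image c) z * (g z * f (chart_inv c z))))"
      unfolding eq by (rule integrable_compact_support[OF continuous_on_mult[OF \<sigma>g bc] compact_cball sub]) (simp add: b0)
    show "0 \<le> \<sigma> * (indicator (chart_image c) z * (g z * f (chart_inv c z)))" for z
      unfolding eq using pos(1)[of z] b0[of z] bump_nonneg[of z0 r z]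
      by (cases "z \<in> cball z0 r") (auto intro!: mult_nonneg_nonneg less_imp_le)
    show "ball z0 r \<noteq> {}" using r(1) by simp
    show "0 < \<sigma> * (indicator (chart_image c) z * (g z * f (chart_inv c z)))" if "z \<in> ball z0 r" for z
    proof -
      have "z \<in> cball z0 r" using that by simp
      then show ?thesis unfolding eq using pos[of z] bump_pos_iff[OF r(1), of z0 z] that by simp
    qed
  qed
  then show False using I0 by simp
qed

end

section \<open>Powers of the absolute value\<close>

lemma continuous_on_abs_powr:
  assumes "0 < r" shows "continuous_on UNIV (\<lambda>x :: real. \<bar>x\<bar> powr r)"
  using assms by (intro continuous_on_powr' continuous_intros) auto

lemma abs_powr_tendsto_0:
  assumes "0 < r" shows "(\<lambda>x :: real. \<bar>x\<bar> powr r) \<midarrow>0\<rightarrow> 0"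
proof -
  have "isCont (\<lambda>x :: real. \<bar>x\<bar> powr r) 0"
    using continuous_on_abs_powr[OF assms] by (simp add: continuous_on_eq_continuous_at)
  then show ?thesis by (simp add: isCont_def)
qed

text \<open>Away from zero these are derivatives of powers. At zero both difference quotients have
  absolute value |h|^(q-1), which tends to 0 because q > 1.\<close>

lemma has_real_derivative_abs_powr:
  assumes "1 < q"
  shows "((\<lambda>x. \<bar>x\<bar> powr q) has_real_derivative q * (sgn x * \<bar>x\<bar> powr (q - 1))) (at x)"
    and "((\<lambda>x. sgn x * \<bar>x\<bar> powr q) has_real_derivative q * \<bar>x\<bar> powr (q - 1)) (at x)"
proof -
  consider "x < 0" | "x = 0" | "0 < x" by linarith
  then have "((\<lambda>x. \<bar>x\<bar> powr q) has_real_derivative q * (sgn x * \<bar>x\<bar> powr (q - 1))) (at x) \<and>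
    ((\<lambda>x. sgn x * \<bar>x\<bar> powr q) has_real_derivative q * \<bar>x\<bar> powr (q - 1)) (at x)"
  proof cases
    case 1
    have D: "((\<lambda>x. (- x) powr q) has_real_derivative - (q * (- x) powr (q - 1))) (at x)"
      by (rule DERIV_cong[OF DERIV_fun_powr[OF DERIV_minus[OF DERIV_ident]]]) (use 1 in simp_all)
    show ?thesis
    proof
      show "((\<lambda>x. \<bar>x\<bar> powr q) has_real_derivative q * (sgn x * \<bar>x\<bar> powr (q - 1))) (at x)"
        by (rule has_field_derivative_transform_within_open[of _ _ _ "{..<0}"])
           (use 1 D in \<open>auto simp: sgn_if abs_if\<close>)
      show "((\<lambda>x. sgn x * \<bar>x\<bar> powr q) has_real_derivative q * \<bar>x\<bar> powr (q - 1)) (at x)"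
        by (rule has_field_derivative_transform_within_open[of _ _ _ "{..<0}"])
           (use 1 DERIV_minus[OF D] in \<open>auto simp: sgn_if abs_if\<close>)
    qed
  next
    case 2
    have q1: "\<bar>h\<bar> powr q / \<bar>h\<bar> = \<bar>h\<bar> powr (q - 1)" for h :: real
      by (simp add: powr_diff)
    have lim: "(\<lambda>h. \<bar>h\<bar> powr (q - 1)) \<midarrow>0\<rightarrow> (0 :: real)"
      by (rule abs_powr_tendsto_0) (use assms in simp)
    have "(\<lambda>h. \<bar>h\<bar> powr q / h) \<midarrow>0\<rightarrow> 0" "(\<lambda>h. sgn h * \<bar>h\<bar> powr q / h) \<midarrow>0\<rightarrow> 0"
      by (rule Lim_null_comparison[OF always_eventually lim];
          simp add: abs_divide abs_mult q1 abs_sgn_eq)+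
    then show ?thesis using 2 assms by (simp add: has_field_derivative_iff)
  next
    case 3
    have D: "((\<lambda>x. x powr q) has_real_derivative q * x powr (q - 1)) (at x)"
      by (rule has_real_derivative_powr[OF 3])
    show ?thesis
    proof
      show "((\<lambda>x. \<bar>x\<bar> powr q) has_real_derivative q * (sgn x * \<bar>x\<bar> powr (q - 1))) (at x)"
        by (rule has_field_derivative_transform_within_open[of _ _ _ "{0<..}"])
           (use 3 D in auto)
      show "((\<lambda>x. sgn x * \<bar>x\<bar> powr q) has_real_derivative q * \<bar>x\<bar> powr (q - 1)) (at x)"
        by (rule has_field_derivative_transform_within_open[of _ _ _ "{0<..}"])
           (use 3 D in auto)
    qed
  qed
  then show "((\<lambda>x. \<bar>x\<bar> powr q) has_real_derivative q * (sgn x * \<bar>x\<bar> powr (q - 1))) (at x)"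
    "((\<lambda>x. sgn x * \<bar>x\<bar> powr q) has_real_derivative q * \<bar>x\<bar> powr (q - 1)) (at x)" by auto
qed

text \<open>The case distinction is needed because 0 powr 0 = 0.\<close>

definition abs_powr_deriv2 :: "real \<Rightarrow> real \<Rightarrow> real" where
  "abs_powr_deriv2 p x = (if p = 2 then 2 else p * ((p - 1) * \<bar>x\<bar> powr (p - 2)))"

lemma abs_powr_deriv2:
  assumes "2 \<le> p"
  shows "((\<lambda>x. p * (sgn x * \<bar>x\<bar> powr (p - 1))) has_real_derivative abs_powr_deriv2 p x) (at x)"
    and "continuous_on UNIV (abs_powr_deriv2 p)"
    and "0 \<le> abs_powr_deriv2 p x" and "x \<noteq> 0 \<Longrightarrow> 0 < abs_powr_deriv2 p x"
proof -
  show "((\<lambda>x. p * (sgn x * \<bar>x\<bar> powr (p - 1))) has_real_derivative abs_powr_deriv2 p x) (at x)"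
  proof (cases "p = 2")
    case True
    have "(\<lambda>x :: real. p * (sgn x * \<bar>x\<bar> powr (p - 1))) = (\<lambda>x. 2 * x)"
      by (rule ext) (simp add: True sgn_mult_abs)
    then show ?thesis by (auto simp: True abs_powr_deriv2_def intro!: derivative_eq_intros)
  next
    case False
    have "((\<lambda>x. p * (sgn x * \<bar>x\<bar> powr (p - 1))) has_real_derivative p * ((p - 1) * \<bar>x\<bar> powr (p - 1 - 1))) (at x)"
      by (intro DERIV_cmult has_real_derivative_abs_powr(2)) (use assms False in simp)
    then show ?thesis using False by (simp add: abs_powr_deriv2_def)
  qed
  show "continuous_on UNIV (abs_powr_deriv2 p)"
    unfolding abs_powr_deriv2_def[abs_def]
    using assms continuous_on_abs_powr[of "p - 2"] by (cases "p = 2") (auto intro!: continuous_intros)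
qed (use assms in \<open>auto simp: abs_powr_deriv2_def\<close>)

lemma Ck_on_abs_powr:
  assumes "2 \<le> p" shows "Ck_on 2 UNIV (\<lambda>x :: real. \<bar>x\<bar> powr p)"
proof -
  have "Ck_on (Suc (Suc 0)) UNIV (\<lambda>x :: real. \<bar>x\<bar> powr p)"
  proof (rule Ck_on_real_SucI[OF open_UNIV])
    show "((\<lambda>x. \<bar>x\<bar> powr p) has_real_derivative p * (sgn x * \<bar>x\<bar> powr (p - 1))) (at x)" for x
      by (rule has_real_derivative_abs_powr(1)) (use assms in simp)
    show "Ck_on (Suc 0) UNIV (\<lambda>x. p * (sgn x * \<bar>x\<bar> powr (p - 1)))"
      by (rule Ck_on_real_SucI[OF open_UNIV abs_powr_deriv2(1)[OF assms]]) (simp add: abs_powr_deriv2(2)[OF assms])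
  qed
  then show ?thesis by (simp only: numeral_2_eq_2)
qed

lemma continuous_on_sgn_abs_powr:
  assumes "0 < q" shows "continuous_on UNIV (\<lambda>x :: real. sgn x * \<bar>x\<bar> powr q)"
proof -
  have "isCont (\<lambda>x :: real. sgn x * \<bar>x\<bar> powr q) x" for x
  proof (cases "x = 0")
    case True
    have "(\<lambda>h :: real. sgn h * \<bar>h\<bar> powr q) \<midarrow>0\<rightarrow> 0"
      by (rule Lim_null_comparison[OF always_eventually abs_powr_tendsto_0[OF assms]]) (simp add: abs_mult abs_sgn_eq)
    then show ?thesis by (simp add: True isCont_def)
  next
    case False
    have "isCont (\<lambda>x :: real. \<bar>x\<bar> powr q) x"
      using continuous_on_abs_powr[OF assms] by (simp add: continuous_on_eq_continuous_at)
    then show ?thesis using False by (intro continuous_mult isCont_sgn continuous_ident) auto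
  qed
  then show ?thesis by (simp add: continuous_at_imp_continuous_on)
qed

text \<open>With c = a^(1/p) this says that (|s| - c) (|s|^p - c^p) is nonnegative, which holds
  because y^p increases with y \<ge> 0. If a is the mean of |s|^p, the left-hand side integrates to
  zero.\<close>

lemma abs_powr_chebyshev:
  fixes s :: real
  assumes "0 < p" "0 \<le> a"
  shows "a powr (1 / p) * (\<bar>s\<bar> powr p - a) \<le> \<bar>s\<bar> * (\<bar>s\<bar> powr p - a)"
proof -
  define c where "c = a powr (1 / p)"
  have c: "0 \<le> c" "c powr p = a" using assms by (simp_all add: c_def powr_powr)
  have "0 \<le> (\<bar>s\<bar> - c) * (\<bar>s\<bar> powr p - c powr p)"
  proof (cases "c \<le> \<bar>s\<bar>")
    case True
    then show ?thesis using c assms by (intro mult_nonneg_nonneg) (auto intro: powr_mono2)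
  next
    case False
    then show ?thesis using c assms by (intro mult_nonpos_nonpos) (auto intro: powr_mono2)
  qed
  then show ?thesis unfolding c_def[symmetric] c(2) by (simp add: algebra_simps)
qed

section \<open>The Euler--Lagrange equation of the Calabi functional\<close>

lemma has_real_derivative_integral:
  fixes F F' :: "real \<Rightarrow> 'a \<Rightarrow> real"
  assumes "finite_measure M" and int: "\<And>t. integrable M (F t)" and meas: "F' 0 \<in> borel_measurable M"
    and D: "\<And>t x. ((\<lambda>t. F t x) has_real_derivative F' t x) (at t)"
    and B: "\<And>t x. \<bar>t\<bar> \<le> 1 \<Longrightarrow> \<bar>F' t x\<bar> \<le> B"
  shows "((\<lambda>t. \<integral>x. F t x \<partial>M) has_real_derivative (\<integral>x. F' 0 x \<partial>M)) (at 0)"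
  unfolding has_field_derivative_iff tendsto_at_iff_sequentially
proof (intro allI impI)
  interpret finite_measure M by fact
  fix X :: "nat \<Rightarrow> real" assume X: "\<forall>i. X i \<in> UNIV - {0}" "X \<longlonglongrightarrow> 0"
  have nz: "X i \<noteq> 0" for i using X(1) by blast
  have "\<forall>\<^sub>F i in sequentially. dist (X i) 0 < 1" using X(2) by (rule tendstoD) simp
  then obtain N where N: "\<And>i. N \<le> i \<Longrightarrow> \<bar>X i\<bar> \<le> 1" unfolding eventually_sequentially by fastforce
  \<comment> \<open>The mean value inequality bounds the difference quotients by B, the dominating
    constant for the limit.\<close>
  have bound: "\<bar>(F t x - F 0 x) / t\<bar> \<le> B" if t: "\<bar>t\<bar> \<le> 1" "t \<noteq> 0" for t x
  proof -
    have "norm (F t x - F 0 x) \<le> B * norm (t - 0)"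
      by (rule field_differentiable_bound[of "{-1..1}" "\<lambda>t. F t x" "\<lambda>t. F' t x"])
         (use t B D in \<open>auto intro: has_field_derivative_at_within simp: abs_le_iff\<close>)
    then show ?thesis using t by (simp add: abs_divide divide_le_eq)
  qed
  \<comment> \<open>The shift by N discards the finitely many steps that may exceed 1 in absolute
    value, to which the bound does not extend.\<close>
  have "(\<lambda>i. \<integral>x. (F (X (i + N)) x - F 0 x) / X (i + N) \<partial>M) \<longlonglongrightarrow> (\<integral>x. F' 0 x \<partial>M)"
  proof (rule integral_dominated_convergence[where w = "\<lambda>_. B"])
    show "AE x in M. (\<lambda>i. (F (X (i + N)) x - F 0 x) / X (i + N)) \<longlonglongrightarrow> F' 0 x"
    proof (rule AE_I2)
      fix x
      have "(\<lambda>t. (F t x - F 0 x) / (t - 0)) \<midarrow>0\<rightarrow> F' 0 x" using D[of x 0] unfolding has_field_derivative_iff .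
      from filterlim_compose[OF this filterlim_atI[OF LIMSEQ_ignore_initial_segment[OF X(2), of N]]]
      show "(\<lambda>i. (F (X (i + N)) x - F 0 x) / X (i + N)) \<longlonglongrightarrow> F' 0 x" using nz by simp
    qed
    show "AE x in M. norm ((F (X (i + N)) x - F 0 x) / X (i + N)) \<le> B" for i
      using bound[OF N nz] by (intro AE_I2) simp
  qed (use meas int in \<open>auto intro!: borel_measurable_diff borel_measurable_divide\<close>)
  moreover have "(\<integral>x. (F t x - F 0 x) / t \<partial>M) = ((\<integral>x. F t x \<partial>M) - (\<integral>x. F 0 x \<partial>M)) / (t - 0)" for t
    using int by (simp add: Bochner_Integration.integral_diff)
  ultimately have "(\<lambda>i. ((\<lambda>t. ((\<integral>x. F t x \<partial>M) - (\<integral>x. F 0 x \<partial>M)) / (t - 0)) \<circ> X) (i + N)) \<longlonglongrightarrow> (\<integral>x. F' 0 x \<partial>M)"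
    by (simp only: o_def)
  then show "((\<lambda>t. ((\<integral>x. F t x \<partial>M) - (\<integral>x. F 0 x \<partial>M)) / (t - 0)) \<circ> X) \<longlonglongrightarrow> (\<integral>x. F' 0 x \<partial>M)"
    by (rule LIMSEQ_offset)
qed

context compact_hermitian_manifold
begin

text \<open>Compactness of the product of [-1, 1] with the manifold supplies the uniform bound on
  the derivative in t.\<close>

lemma has_real_derivative_integral_vol:
  fixes F F' :: "real \<Rightarrow> 'm \<Rightarrow> real"
  assumes F: "continuous_on UNIV (\<lambda>z. F (fst z) (snd z))" and F': "continuous_on UNIV (\<lambda>z. F' (fst z) (snd z))"
    and D: "\<And>t x. ((\<lambda>t. F t x) has_real_derivative F' t x) (at t)"
  shows "((\<lambda>t. \<integral>x. F t x \<partial>vol A G) has_real_derivative (\<integral>x. F' 0 x \<partial>vol A G)) (at 0)"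
proof -
  have slice: "continuous_on UNIV (H t)" if "continuous_on UNIV (\<lambda>z. H (fst z) (snd z))" for H :: "real \<Rightarrow> 'm \<Rightarrow> real" and t
    using continuous_on_compose2[OF that, of UNIV "\<lambda>x. (t, x)"] by (simp add: continuous_on_Pair continuous_on_id)
  have "compact ({-1..1 :: real} \<times> (UNIV :: 'm set))" by (intro compact_Times compact_Icc compact_space)
  then have "bounded ((\<lambda>z. F' (fst z) (snd z)) ` ({-1..1} \<times> UNIV))"
    by (intro compact_imp_bounded compact_continuous_image continuous_on_subset[OF F']) auto
  then obtain B where B: "\<forall>z\<in>{-1..1} \<times> UNIV. \<bar>F' (fst z) (snd z)\<bar> \<le> B"
    unfolding bounded_iff by auto
  show ?thesis
  proof (rule has_real_derivative_integral[OF finite_vol _ _ D])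
    show "integrable (vol A G) (F t)" for t by (rule integrable_continuous_vol[OF slice[OF F]])
    show "F' 0 \<in> borel_measurable (vol A G)"
      unfolding measurable_vol by (rule borel_measurable_continuous_onI[OF slice[OF F']])
    show "\<bar>F' t x\<bar> \<le> B" if "\<bar>t\<bar> \<le> 1" for t x using bspec[OF B, of "(t, x)"] that by (simp add: abs_le_iff)
  qed
qed

text \<open>The factor e^(n t f) of the volume meets e^(- p t f) from the p-th power of the
  curvature, which leaves the exponent n - p. All integrals now refer to the fixed measure
  \<open>vol A G\<close>.\<close>

lemma calabi_conformal:
  fixes f :: "'m \<Rightarrow> real" and t p :: real
  assumes f: "smooth_fun A f"
  shows "calabi A p (conformal (\<lambda>x. t * f x) G) =
    (\<integral>x. \<bar>chern_scalar A G x - t * (CARD('n) * laplace G f x)\<bar> powr p * exp (t * ((CARD('n) - p) * f x)) \<partial>vol A G) *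
    (\<integral>x. exp (t * (CARD('n) * f x)) \<partial>vol A G) powr (- ((CARD('n) - p) / CARD('n)))"
proof -
  let ?n = "real CARD('n)"
  have f2: "Ck_fun 2 f" using f smooth_fun_Ck by blast
  have tf: "smooth_fun A (\<lambda>x. t * f x)"
    using f unfolding smooth_fun_Ck by (intro allI Ck_fun_mult Ck_fun_const) blast
  have cs: "chern_scalar A (conformal (\<lambda>x. t * f x) G) x = exp (- (t * f x)) * (chern_scalar A G x - t * (?n * laplace G f x))" for x
    unfolding chern_scalar_conformal[OF tf] laplace_cmult[OF f2] by (simp add: mult_ac)
  have sm: "chern_scalar A G \<in> borel_measurable borel" "f \<in> borel_measurable borel"
    using smooth_chern_scalar f Ck_fun_measurable unfolding smooth_fun_Ck by blast+
  have Lm: "laplace G f \<in> borel_measurable borel"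
    using Ck_laplace[of 0 f] f2 by (intro Ck_fun_measurable[of 0]) (simp add: numeral_2_eq_2)
  have dens: "(\<integral>x. g x \<partial>vol A (conformal (\<lambda>x. t * f x) G)) = (\<integral>x. exp (t * (?n * f x)) * g x \<partial>vol A G)"
    if "g \<in> borel_measurable borel" for g :: "'m \<Rightarrow> real"
  proof -
    have "(\<integral>x. g x \<partial>density (vol A G) (\<lambda>x. ennreal (exp (?n * (t * f x))))) = (\<integral>x. exp (?n * (t * f x)) *\<^sub>R g x \<partial>vol A G)"
      by (rule integral_density) (use that sm in \<open>simp_all add: measurable_vol\<close>)
    then show ?thesis unfolding vol_conformal[OF tf] by (simp add: mult_ac)
  qed
  have pw: "exp (t * (?n * f x)) * \<bar>exp (- (t * f x)) * y\<bar> powr p = \<bar>y\<bar> powr p * exp (t * ((?n - p) * f x))" for x y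
    by (simp add: abs_mult powr_mult exp_powr_real algebra_simps flip: exp_add)
  have m1: "(\<lambda>x. \<bar>exp (- (t * f x)) * (chern_scalar A G x - t * (?n * laplace G f x))\<bar> powr p) \<in> borel_measurable borel"
    using sm Lm by measurable
  show ?thesis unfolding calabi_def cs dens[OF m1] pw dens[OF borel_measurable_const] by simp
qed

lemma measure_vol_pos: "0 < (\<integral>x. (1 :: real) \<partial>vol A G)"
proof -
  have "(\<integral>x. (1 :: real) \<partial>vol A G) \<noteq> 0"
    using integral_vol_eq_0[of "\<lambda>_. 1"] continuous_on_const by fastforce
  moreover have "0 \<le> (\<integral>x. (1 :: real) \<partial>vol A G)" by (rule Bochner_Integration.integral_nonneg) simp
  ultimately show ?thesis by linarith
qed

lemma continuous_chern_scalar: "continuous_on UNIV (chern_scalar A G)"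
  using smooth_chern_scalar Ck_fun_continuous unfolding smooth_fun_Ck by blast

lemma continuous_laplace: "Ck_fun 2 u \<Longrightarrow> continuous_on UNIV (laplace G u)"
  using Ck_laplace[of 0 u] by (intro Ck_fun_continuous[of 0]) (simp add: numeral_2_eq_2)

lemma extremal_equation:
  fixes f :: "'m \<Rightarrow> real" and p :: real
  assumes p: "2 \<le> p" and ext: "p_conformal_extremal A p G" and f: "smooth_fun A f"
  shows "p * CARD('n) * (\<integral>x. sgn (chern_scalar A G x) * \<bar>chern_scalar A G x\<bar> powr (p - 1) * laplace G f x \<partial>vol A G) =
    (CARD('n) - p) * ((\<integral>x. \<bar>chern_scalar A G x\<bar> powr p * f x \<partial>vol A G) -
      (\<integral>x. \<bar>chern_scalar A G x\<bar> powr p \<partial>vol A G) / (\<integral>x. 1 \<partial>vol A G) * (\<integral>x. f x \<partial>vol A G))"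
proof -
  let ?n = "real CARD('n)"
  let ?s = "chern_scalar A G"
  let ?L = "laplace G f"
  let ?\<phi> = "\<lambda>y. sgn y * \<bar>y\<bar> powr (p - 1)"
  define e where "e = - ((?n - p) / ?n)"
  have sc: "continuous_on UNIV ?s" by (rule continuous_chern_scalar)
  have fc: "continuous_on UNIV f" using f Ck_fun_continuous smooth_fun_Ck by blast
  have Lc: "continuous_on UNIV ?L" using f smooth_fun_Ck by (intro continuous_laplace) blast
  have snd: "continuous_on UNIV (\<lambda>z :: real \<times> 'm. g (snd z))" if "continuous_on UNIV g" for g :: "'m \<Rightarrow> real"
    by (rule continuous_on_compose2[OF that]) (auto intro: continuous_intros)
  \<comment> \<open>The curvature of the varied metric is e^(- t f) times this function, which is
    affine in t.\<close>
  define Y where "Y t x = ?s x - t * (?n * ?L x)" for t x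
  have Yc: "continuous_on UNIV (\<lambda>z. Y (fst z) (snd z))"
    unfolding Y_def by (intro continuous_intros snd sc Lc)
  have DY: "(Y' has_real_derivative - (?n * ?L x)) (at t)" if "Y' = (\<lambda>t. Y t x)" for Y' x t
    unfolding that Y_def by (auto intro!: derivative_eq_intros)
  define F where "F t x = \<bar>Y t x\<bar> powr p * exp (t * ((?n - p) * f x))" for t x
  define F' where "F' t x = \<bar>Y t x\<bar> powr p * (exp (t * ((?n - p) * f x)) * ((?n - p) * f x)) +
      p * ?\<phi> (Y t x) * (- (?n * ?L x)) * exp (t * ((?n - p) * f x))" for t x
  have pc: "continuous_on UNIV (\<lambda>z. \<bar>Y (fst z) (snd z)\<bar> powr p)"
    by (rule continuous_on_compose2[OF continuous_on_abs_powr Yc]) (use p in auto)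
  have \<phi>c: "continuous_on UNIV (\<lambda>z. ?\<phi> (Y (fst z) (snd z)))"
    by (rule continuous_on_compose2[OF continuous_on_sgn_abs_powr Yc]) (use p in auto)
  have ec: "continuous_on UNIV (\<lambda>z :: real \<times> 'm. exp (fst z * (a * f (snd z))))" for a
    by (intro continuous_intros snd fc)
  have D1: "((\<lambda>t. \<integral>x. F t x \<partial>vol A G) has_real_derivative (\<integral>x. F' 0 x \<partial>vol A G)) (at 0)"
  proof (rule has_real_derivative_integral_vol)
    show "continuous_on UNIV (\<lambda>z. F (fst z) (snd z))" unfolding F_def by (intro continuous_on_mult pc ec)
    show "continuous_on UNIV (\<lambda>z. F' (fst z) (snd z))"
      unfolding F'_def
      by (intro continuous_on_add continuous_on_mult continuous_on_minus continuous_on_const pc \<phi>c ec snd[OF fc] snd[OF Lc])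
    show "((\<lambda>t. F t x) has_real_derivative F' t x) (at t)" for t x
    proof -
      have "((\<lambda>t. \<bar>Y t x\<bar> powr p) has_real_derivative p * ?\<phi> (Y t x) * (- (?n * ?L x))) (at t)"
        by (rule DERIV_chain2[OF has_real_derivative_abs_powr(1) DY]) (use p in auto)
      moreover have "((\<lambda>t. exp (t * ((?n - p) * f x))) has_real_derivative exp (t * ((?n - p) * f x)) * ((?n - p) * f x)) (at t)"
        by (auto intro!: derivative_eq_intros)
      ultimately show ?thesis unfolding F_def F'_def by (rule DERIV_mult')
    qed
  qed
  define K where "K t = (\<integral>x. exp (t * (?n * f x)) \<partial>vol A G)" for t
  have D2: "(K has_real_derivative (\<integral>x. exp (0 * (?n * f x)) * (?n * f x) \<partial>vol A G)) (at 0)"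
    unfolding K_def[abs_def]
  proof (rule has_real_derivative_integral_vol)
    show "continuous_on UNIV (\<lambda>z. exp (fst z * (?n * f (snd z))))" by (rule ec)
    show "continuous_on UNIV (\<lambda>z. exp (fst z * (?n * f (snd z))) * (?n * f (snd z)))"
      by (intro continuous_on_mult continuous_on_const ec snd[OF fc])
    show "((\<lambda>t. exp (t * (?n * f x))) has_real_derivative exp (t * (?n * f x)) * (?n * f x)) (at t)" for t x
      by (auto intro!: derivative_eq_intros)
  qed
  define V where "V = (\<integral>x. (1 :: real) \<partial>vol A G)"
  define I where "I = (\<integral>x. \<bar>?s x\<bar> powr p \<partial>vol A G)"
  define f0 where "f0 = (\<integral>x. f x \<partial>vol A G)"
  have V: "0 < V" unfolding V_def by (rule measure_vol_pos)
  have K0: "K 0 = V" by (simp add: K_def V_def)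
  have F0: "(\<integral>x. F 0 x \<partial>vol A G) = I" by (simp add: F_def Y_def I_def)
  have "((\<lambda>t. K t powr e) has_real_derivative e * V powr (e - 1) * (?n * f0)) (at 0)"
    using DERIV_fun_powr[OF D2, of e] V by (simp add: K0 f0_def)
  from DERIV_mult'[OF D1 this]
  have "((\<lambda>t. calabi A p (conformal (\<lambda>x. t * f x) G)) has_real_derivative
      I * (e * V powr (e - 1) * (?n * f0)) + (\<integral>x. F' 0 x \<partial>vol A G) * V powr e) (at 0)"
    unfolding calabi_conformal[OF f] F0 K0 unfolding F_def Y_def K_def e_def .
  moreover have "((\<lambda>t. calabi A p (conformal (\<lambda>x. t * f x) G)) has_real_derivative 0) (at 0)"
    using ext f unfolding p_conformal_extremal_def by blast
  ultimately have "I * (e * V powr (e - 1) * (?n * f0)) + (\<integral>x. F' 0 x \<partial>vol A G) * V powr e = 0"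
    by (rule DERIV_unique)
  \<comment> \<open>This allows the positive factor \<open>V powr (e - 1)\<close> to be cancelled; e
    n = p - n then produces the factor n - p.\<close>
  moreover have "V powr e = V * V powr (e - 1)" using V by (simp add: powr_diff)
  ultimately have "V powr (e - 1) * (I * e * ?n * f0 + (\<integral>x. F' 0 x \<partial>vol A G) * V) = 0"
    by (simp add: algebra_simps)
  then have "I * e * ?n * f0 + (\<integral>x. F' 0 x \<partial>vol A G) * V = 0" using V by simp
  moreover have "I * e * ?n * f0 = - ((?n - p) * I * f0)" by (simp add: e_def)
  ultimately have eq: "(\<integral>x. F' 0 x \<partial>vol A G) = (?n - p) * (I / V * f0)"
    using V by (simp add: field_simps)
  have pc0: "continuous_on UNIV (\<lambda>x. \<bar>?s x\<bar> powr p)"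
    by (rule continuous_on_compose2[OF continuous_on_abs_powr sc]) (use p in auto)
  have \<phi>c0: "continuous_on UNIV (\<lambda>x. ?\<phi> (?s x))"
    by (rule continuous_on_compose2[OF continuous_on_sgn_abs_powr sc]) (use p in auto)
  have "(\<integral>x. F' 0 x \<partial>vol A G) = (\<integral>x. (?n - p) * (\<bar>?s x\<bar> powr p * f x) - p * ?n * (?\<phi> (?s x) * ?L x) \<partial>vol A G)"
    by (rule Bochner_Integration.integral_cong[OF refl]) (simp add: F'_def Y_def algebra_simps)
  also have "\<dots> = (\<integral>x. (?n - p) * (\<bar>?s x\<bar> powr p * f x) \<partial>vol A G) - (\<integral>x. p * ?n * (?\<phi> (?s x) * ?L x) \<partial>vol A G)"
    by (intro Bochner_Integration.integral_diff integrable_continuous_vol continuous_on_mult continuous_on_const pc0 \<phi>c0 fc Lc)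
  finally show ?thesis using eq unfolding integral_mult_right_zero V_def I_def f0_def
    by (simp add: algebra_simps)
qed

end

section \<open>Conformal extremal metrics\<close>

context hermitian_manifold
begin

text \<open>The second-order chain rule, to be used for |y|^p: its \<Phi>'' term carries the squared
  gradient that has to be shown to vanish.\<close>

lemma laplace_compose:
  fixes u :: "'m \<Rightarrow> real"
  assumes c: "c \<in> A" "z \<in> chart_image c" and u: "Ck_fun 2 u"
    and \<Phi>: "\<And>y. (\<Phi> has_real_derivative \<Phi>' y) (at y)" "\<And>y. (\<Phi>' has_real_derivative \<Phi>'' y) (at y)" "Ck_on 2 UNIV \<Phi>"
  shows "laplace G (\<lambda>x. \<Phi> (u x)) (chart_inv c z) =
    \<Phi>' (u (chart_inv c z)) * laplace G u (chart_inv c z) +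
    \<Phi>'' (u (chart_inv c z)) * Re (\<Sum>i\<in>UNIV. \<Sum>j\<in>UNIV. inv_metric (G c z) i j *
      wirt i (\<lambda>w. of_real (u (chart_inv c w))) z * cnj (wirt j (\<lambda>w. of_real (u (chart_inv c w))) z))"
proof -
  let ?S = "chart_image c"
  define U where "U w = u (chart_inv c w)" for w
  let ?U = "\<lambda>w. complex_of_real (U w)"
  have op: "open ?S" by (rule open_image[OF c(1)])
  have UC: "Ck_on 2 ?S U" using u c(1) unfolding Ck_fun_def U_def[abs_def] by blast
  have UC': "Ck_on 2 ?S ?U" unfolding U_def by (rule Ck_fun_complex[OF c(1) u])
  have dU: "U differentiable at w" "?U differentiable at w" if "w \<in> ?S" for w
    using UC UC' that by (simp_all add: numeral_2_eq_2)
  have dW: "wirt i ?U differentiable at z" for i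
    using Ck_on_wirt(1)[OF op, of "Suc 0" ?U i] UC' c(2) by (simp add: numeral_2_eq_2)
  have d\<Phi>': "(\<lambda>w. complex_of_real (\<Phi>' (U w))) differentiable at z"
  proof -
    have "(\<Phi>' \<circ> U) differentiable at z"
      using dU(1)[OF c(2)] \<Phi>(2) by (intro differentiable_chain_at) (auto simp: real_differentiable_def)
    then have "(\<lambda>w. \<Phi>' (U w)) differentiable at z" by (simp add: o_def)
    then show ?thesis
      unfolding differentiable_def using bounded_linear.has_derivative[OF bounded_linear_of_real] by blast
  qed
  have cj: "wirt_bar j ?U z = cnj (wirt j ?U z)" for j
    using wirt_cnj(2)[OF dU(2)[OF c(2)], of j] by simp
  have ij: "wirt_bar j (wirt i (\<lambda>w. complex_of_real (\<Phi> (U w)))) z =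
      of_real (\<Phi>' (U z)) * wirt_bar j (wirt i ?U) z + of_real (\<Phi>'' (U z)) * (wirt i ?U z * cnj (wirt j ?U z))" for i j
  proof -
    have "wirt_bar j (wirt i (\<lambda>w. complex_of_real (\<Phi> (U w)))) z =
        wirt_bar j (\<lambda>w. complex_of_real (\<Phi>' (U w)) * wirt i ?U w) z"
      by (rule wirt_cong(2)[OF op c(2)]) (rule wirt_real_compose(1)[OF dU(1) \<Phi>(1)])
    also have "\<dots> = of_real (\<Phi>' (U z)) * wirt_bar j (wirt i ?U) z + wirt_bar j (\<lambda>w. complex_of_real (\<Phi>' (U w))) z * wirt i ?U z"
      by (rule wirt_mult(2)[OF d\<Phi>' dW])
    also have "wirt_bar j (\<lambda>w. complex_of_real (\<Phi>' (U w))) z = of_real (\<Phi>'' (U z)) * cnj (wirt j ?U z)"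
      unfolding wirt_real_compose(2)[OF dU(1)[OF c(2)] \<Phi>(2)] cj ..
    finally show ?thesis by (simp add: mult_ac)
  qed
  have "lap (G c) (\<lambda>w. complex_of_real (\<Phi> (U w))) z = of_real (\<Phi>' (U z)) * lap (G c) ?U z +
      of_real (\<Phi>'' (U z)) * (\<Sum>i\<in>UNIV. \<Sum>j\<in>UNIV. inv_metric (G c z) i j * wirt i ?U z * cnj (wirt j ?U z))"
    unfolding lap_def ij by (simp add: sum_distrib_left sum.distrib algebra_simps)
  then have "Re (lap (G c) (\<lambda>w. complex_of_real (\<Phi> (U w))) z) = \<Phi>' (U z) * Re (lap (G c) ?U z) +
      \<Phi>'' (U z) * Re (\<Sum>i\<in>UNIV. \<Sum>j\<in>UNIV. inv_metric (G c z) i j * wirt i ?U z * cnj (wirt j ?U z))"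
    by (simp del: Re_sum)
  then show ?thesis
    unfolding laplace_chart[OF c u] laplace_chart[OF c Ck_fun_compose[OF u \<Phi>(3)]] U_def .
qed

end

section \<open>The gradient of the curvature and the two implications\<close>

context compact_hermitian_manifold
begin

text \<open>In a chart this is \<open>abs_powr_deriv2 p\<close> of s times the squared length of the
  (1,0)-gradient of s. As a difference of global functions it is continuous and integrable without
  that length being defined on the manifold.\<close>

definition gradient_term :: "real \<Rightarrow> 'm \<Rightarrow> real" where
  "gradient_term p x = laplace G (\<lambda>x. \<bar>chern_scalar A G x\<bar> powr p) x -
     p * (sgn (chern_scalar A G x) * \<bar>chern_scalar A G x\<bar> powr (p - 1)) * laplace G (chern_scalar A G) x"

lemma gradient_term_chart:
  assumes p: "2 \<le> p" and c: "c \<in> A" "z \<in> chart_image c"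
  shows "gradient_term p (chart_inv c z) = abs_powr_deriv2 p (chern_scalar A G (chart_inv c z)) *
    Re (\<Sum>i\<in>UNIV. \<Sum>j\<in>UNIV. inv_metric (G c z) i j *
      wirt i (\<lambda>w. of_real (chern_scalar A G (chart_inv c w))) z *
      cnj (wirt j (\<lambda>w. of_real (chern_scalar A G (chart_inv c w))) z))"
proof -
  have s2: "Ck_fun 2 (chern_scalar A G)" using smooth_chern_scalar smooth_fun_Ck by blast
  have "((\<lambda>y. \<bar>y\<bar> powr p) has_real_derivative p * (sgn y * \<bar>y\<bar> powr (p - 1))) (at y)" for y
    by (rule has_real_derivative_abs_powr(1)) (use p in simp)
  from laplace_compose[OF c s2 this abs_powr_deriv2(1)[OF p] Ck_on_abs_powr[OF p]]
  show ?thesis by (simp add: gradient_term_def)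
qed

lemma gradient_nonneg_eq_0:
  fixes v :: "'n \<Rightarrow> complex"
  assumes "pos_def_hermitian h"
  shows "0 \<le> Re (\<Sum>i\<in>UNIV. \<Sum>j\<in>UNIV. inv_metric h i j * v i * cnj (v j))"
    and "Re (\<Sum>i\<in>UNIV. \<Sum>j\<in>UNIV. inv_metric h i j * v i * cnj (v j)) = 0 \<Longrightarrow> v i = 0"
proof -
  define u where "u = (\<chi> i. v i)"
  have pos: "0 < Re (\<Sum>i\<in>UNIV. \<Sum>j\<in>UNIV. inv_metric h i j * v i * cnj (v j))" if "u \<noteq> 0"
    using inv_metric_pos[OF assms that] by (simp only: u_def vec_lambda_beta)
  have v0: "v i = 0" if "u = 0" for i using that by (simp add: u_def vec_eq_iff)
  show "0 \<le> Re (\<Sum>i\<in>UNIV. \<Sum>j\<in>UNIV. inv_metric h i j * v i * cnj (v j))"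
    by (cases "u = 0") (simp add: v0, rule less_imp_le[OF pos])
  show "v i = 0" if "Re (\<Sum>i\<in>UNIV. \<Sum>j\<in>UNIV. inv_metric h i j * v i * cnj (v j)) = 0"
    using pos v0[of i] unfolding that by blast
qed

lemma gradient_term_nonneg:
  assumes p: "2 \<le> p" shows "0 \<le> gradient_term p x"
proof -
  define c where "c = chart_at A x"
  have c: "c \<in> A" "x \<in> fst c" using chart_at_props[of x] by (simp_all add: c_def)
  have "0 \<le> gradient_term p (chart_inv c (snd c x))"
    unfolding gradient_term_chart[OF p c(1) chart_mem[OF c(2)]]
    by (intro mult_nonneg_nonneg abs_powr_deriv2(3) p gradient_nonneg_eq_0(1) pos_def c chart_mem)
  then show ?thesis by (simp only: chart_inv_chart[OF c])
qed

text \<open>The level set of a nonzero value is closed. Near each of its points s stays nonzero, so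
  the positive factor \<open>abs_powr_deriv2\<close> can be divided out, the gradient vanishes and
  the level set is open as well.\<close>

lemma constant_if_gradient_term_eq_0:
  assumes p: "2 \<le> p" and conn: "connected (UNIV :: 'm set)" and 0: "\<And>x. gradient_term p x = 0"
  shows "\<exists>\<kappa>. \<forall>x. chern_scalar A G x = \<kappa>"
proof (cases "\<forall>x. chern_scalar A G x = 0")
  case False
  let ?s = "chern_scalar A G"
  from False obtain x0 where x0: "?s x0 \<noteq> 0" by blast
  define E where "E = {x. ?s x = ?s x0}"
  have "closed E" unfolding E_def by (intro closed_Collect_eq continuous_chern_scalar continuous_on_const)
  have "open E"
  proof (subst open_subopen, intro ballI)
    fix x assume x: "x \<in> E"
    define c where "c = chart_at A x"
    have c: "c \<in> A" "x \<in> fst c" using chart_at_props[of x] by (simp_all add: c_def)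
    define S where "S w = ?s (chart_inv c w)" for w
    have SC: "Ck_on 1 (chart_image c) S"
      using smooth_chern_scalar c(1) unfolding smooth_fun_Ck Ck_fun_def S_def[abs_def] by blast
    define T where "T = chart_image c \<inter> S -` (- {0})"
    have "open T" unfolding T_def
      by (intro continuous_open_preimage Ck_on_continuous[OF SC] open_image c) auto
    moreover have "snd c x \<in> T"
      using x x0 chart_mem[OF c(2)] by (simp add: T_def S_def chart_inv_chart[OF c] E_def)
    ultimately obtain r where r: "0 < r" "ball (snd c x) r \<subseteq> T" using open_contains_ball by blast
    have D: "(S has_derivative (\<lambda>v. 0)) (at w)" if w: "w \<in> ball (snd c x) r" for w
    proof -
      have wc: "w \<in> chart_image c" "S w \<noteq> 0" using r(2) w by (auto simp: T_def)
      have dS: "S differentiable at w" using SC wc(1) by simp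
      let ?S = "\<lambda>w. complex_of_real (S w)"
      define R where "R = Re (\<Sum>i\<in>UNIV. \<Sum>j\<in>UNIV. inv_metric (G c w) i j * wirt i ?S w * cnj (wirt j ?S w))"
      have "abs_powr_deriv2 p (S w) * R = 0"
        using gradient_term_chart[OF p c(1) wc(1)] 0 unfolding R_def S_def by simp
      then have R: "R = 0" using abs_powr_deriv2(4)[OF p wc(2)] by simp
      have w0: "wirt i ?S w = 0" for i
        by (rule gradient_nonneg_eq_0(2)[OF pos_def[OF c(1) wc(1)] R[unfolded R_def]])
      have F: "(?S has_derivative (\<lambda>v. complex_of_real (frechet_derivative S (at w) v))) (at w)"
        by (rule bounded_linear.has_derivative[OF bounded_linear_of_real frechet_derivative_works'[OF dS]])
      \<comment> \<open>S is real, so its bar derivatives are the conjugates of the others and the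
        whole differential vanishes.\<close>
      have w1: "wirt_bar i ?S w = 0" for i
        using wirt_cnj(2)[of ?S w i] w0[of i] F by (auto simp: differentiable_def)
      have "frechet_derivative S (at w) v = 0" for v
        using has_derivative_wirt[OF F, of v] by (simp add: w0 w1)
      then have "frechet_derivative S (at w) = (\<lambda>v. 0)" by (rule ext)
      then show ?thesis using frechet_derivative_works'[OF dS] by simp
    qed
    obtain k where k: "\<forall>w\<in>ball (snd c x) r. S w = k"
      using has_derivative_zero_constant[OF convex_ball, of "snd c x" r S] D has_derivative_at_withinI by blast
    define W where "W = {y \<in> fst c. snd c y \<in> ball (snd c x) r}"
    have "S (snd c x) = k" using k r(1) by simp
    then have "k = ?s x0" using x by (simp add: S_def chart_inv_chart[OF c] E_def)
    moreover have "?s y = k" if "y \<in> W" for y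
      using that bspec[OF k, of "snd c y"] by (simp add: W_def S_def chart_inv_chart[OF c(1)])
    ultimately have "W \<subseteq> E" by (auto simp: E_def)
    moreover have "open W" unfolding W_def by (rule open_chart_ball[OF c(1)])
    moreover have "x \<in> W" using c(2) r(1) by (simp add: W_def)
    ultimately show "\<exists>T. open T \<and> x \<in> T \<and> T \<subseteq> E" by blast
  qed
  then have "E \<inter> UNIV = {} \<or> - E \<inter> UNIV = {}"
    using connectedD[OF conn, of E "- E"] \<open>closed E\<close> by auto
  moreover have "x0 \<in> E" by (simp add: E_def)
  ultimately have "E = UNIV" by blast
  then show ?thesis unfolding E_def by blast
qed blast

lemma constant_if_gauduchon_extremal:
  fixes p :: real
  assumes p: "2 \<le> p" and conn: "connected (UNIV :: 'm set)" and ext: "p_conformal_extremal A p G"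
    and gaud: "gauduchon A G" and sign: "\<And>x. 0 \<le> (CARD('n) - p) * chern_scalar A G x"
  shows "\<exists>\<kappa>. \<forall>x. chern_scalar A G x = \<kappa>"
proof (rule constant_if_gradient_term_eq_0[OF p conn])
  fix x
  let ?n = "real CARD('n)"
  let ?s = "chern_scalar A G"
  let ?\<phi> = "\<lambda>x. sgn (?s x) * \<bar>?s x\<bar> powr (p - 1)"
  let ?P = "\<lambda>x. \<bar>?s x\<bar> powr p"
  have s2: "Ck_fun 2 ?s" using smooth_chern_scalar smooth_fun_Ck by blast
  have P2: "Ck_fun 2 ?P" by (rule Ck_fun_compose[OF s2 Ck_on_abs_powr[OF p]])
  have sc: "continuous_on UNIV ?s" by (rule continuous_chern_scalar)
  have Pc: "continuous_on UNIV ?P" by (rule Ck_fun_continuous[OF P2])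
  have \<phi>c: "continuous_on UNIV ?\<phi>"
    by (rule continuous_on_compose2[OF continuous_on_sgn_abs_powr sc]) (use p in auto)
  have \<phi>L: "continuous_on UNIV (\<lambda>x. p * ?\<phi> x * laplace G ?s x)"
    by (intro continuous_on_mult continuous_on_const \<phi>c continuous_laplace s2)
  have gc: "continuous_on UNIV (gradient_term p)"
    unfolding gradient_term_def[abs_def] by (intro continuous_on_diff \<phi>L continuous_laplace P2)
  define V where "V = (\<integral>x. (1 :: real) \<partial>vol A G)"
  define I where "I = (\<integral>x. ?P x \<partial>vol A G)"
  have V: "0 < V" unfolding V_def by (rule measure_vol_pos)
  have I: "0 \<le> I" unfolding I_def by (rule Bochner_Integration.integral_nonneg) simp
  define a where "a = I / V"
  have a: "0 \<le> a" using I V by (simp add: a_def)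
  define k where "k = a powr (1 / p)"
  have "(\<integral>x. gradient_term p x \<partial>vol A G) = (\<integral>x. laplace G ?P x \<partial>vol A G) - (\<integral>x. p * ?\<phi> x * laplace G ?s x \<partial>vol A G)"
    unfolding gradient_term_def
    by (intro Bochner_Integration.integral_diff integrable_continuous_vol continuous_laplace P2 \<phi>L)
  also have "(\<integral>x. laplace G ?P x \<partial>vol A G) = 0" by (rule integral_laplace_gauduchon[OF gaud P2])
  also have "(\<integral>x. p * ?\<phi> x * laplace G ?s x \<partial>vol A G) = p * (\<integral>x. ?\<phi> x * laplace G ?s x \<partial>vol A G)"
    by (simp add: mult.assoc)
  finally have "?n * (\<integral>x. gradient_term p x \<partial>vol A G) = - (p * ?n * (\<integral>x. ?\<phi> x * laplace G ?s x \<partial>vol A G))"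
    by simp
  also have "\<dots> = - ((?n - p) * ((\<integral>x. ?P x * ?s x \<partial>vol A G) - a * (\<integral>x. ?s x \<partial>vol A G)))"
    unfolding extremal_equation[OF p ext smooth_chern_scalar] a_def I_def V_def ..
  also have "(\<integral>x. ?P x * ?s x \<partial>vol A G) - a * (\<integral>x. ?s x \<partial>vol A G) = (\<integral>x. ?P x * ?s x - a * ?s x \<partial>vol A G)"
    by (subst Bochner_Integration.integral_diff)
       (auto intro!: integrable_continuous_vol continuous_on_mult Pc sc)
  also have "(?n - p) * (\<integral>x. ?P x * ?s x - a * ?s x \<partial>vol A G) = (\<integral>x. (?n - p) * (?P x * ?s x - a * ?s x) \<partial>vol A G)"
    by simp
  also have "(\<integral>x. (?n - p) * (?P x * ?s x - a * ?s x) \<partial>vol A G) = (\<integral>x. \<bar>?n - p\<bar> * (\<bar>?s x\<bar> * (?P x - a)) \<partial>vol A G)"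
  proof (rule Bochner_Integration.integral_cong[OF refl])
    fix x
    \<comment> \<open>The use of the sign hypothesis: a nonnegative product equals the product of
      the absolute values.\<close>
    have "(?n - p) * ?s x = \<bar>?n - p\<bar> * \<bar>?s x\<bar>" using sign[of x] by (simp flip: abs_mult)
    then have "(?n - p) * ?s x * (?P x - a) = \<bar>?n - p\<bar> * \<bar>?s x\<bar> * (?P x - a)" by simp
    then show "(?n - p) * (?P x * ?s x - a * ?s x) = \<bar>?n - p\<bar> * (\<bar>?s x\<bar> * (?P x - a))" by (simp add: algebra_simps)
  qed
  \<comment> \<open>Comparison with the constant k = a^(1/p), for which the integral vanishes
    because a is the mean of |s|^p.\<close>
  also have "- \<dots> \<le> - (\<integral>x. \<bar>?n - p\<bar> * (k * (?P x - a)) \<partial>vol A G)"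
    unfolding neg_le_iff_le
  proof (rule integral_mono)
    show "integrable (vol A G) (\<lambda>x. \<bar>?n - p\<bar> * (k * (?P x - a)))" "integrable (vol A G) (\<lambda>x. \<bar>?n - p\<bar> * (\<bar>?s x\<bar> * (?P x - a)))"
      by (intro integrable_continuous_vol continuous_on_mult continuous_on_diff continuous_on_const Pc continuous_on_rabs sc)+
    show "\<bar>?n - p\<bar> * (k * (?P x - a)) \<le> \<bar>?n - p\<bar> * (\<bar>?s x\<bar> * (?P x - a))" for x
      unfolding k_def by (intro mult_left_mono abs_powr_chebyshev a) (use p in auto)
  qed
  also have "(\<integral>x. \<bar>?n - p\<bar> * (k * (?P x - a)) \<partial>vol A G) = \<bar>?n - p\<bar> * (k * (\<integral>x. ?P x - a * 1 \<partial>vol A G))"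
    by simp
  also have "(\<integral>x. ?P x - a * 1 \<partial>vol A G) = I - a * V"
    unfolding I_def V_def
    by (subst Bochner_Integration.integral_diff)
       (auto intro!: integrable_continuous_vol Pc simp del: mult_1_right integral_const)
  also have "I - a * V = 0" using V by (simp add: a_def)
  finally have "?n * (\<integral>x. gradient_term p x \<partial>vol A G) \<le> 0" by simp
  then have "(\<integral>x. gradient_term p x \<partial>vol A G) \<le> 0" by (simp add: mult_le_0_iff)
  moreover have "0 \<le> (\<integral>x. gradient_term p x \<partial>vol A G)"
    by (rule Bochner_Integration.integral_nonneg) (rule gradient_term_nonneg[OF p])
  ultimately show "gradient_term p x = 0"
    by (intro integral_vol_eq_0[OF gc gradient_term_nonneg[OF p]]) simp
qed

lemma gauduchon_if_constant_extremal:
  fixes p :: real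
  assumes p: "2 \<le> p" and ext: "p_conformal_extremal A p G"
    and \<kappa>: "\<kappa> \<noteq> 0" "\<And>x. chern_scalar A G x = \<kappa>"
  shows "gauduchon A G"
proof (rule gauduchon_if_integral_laplace)
  fix f :: "'m \<Rightarrow> real" assume f: "smooth_fun A f"
  define V where "V = (\<integral>x. (1 :: real) \<partial>vol A G)"
  have V: "0 < V" unfolding V_def by (rule measure_vol_pos)
  \<comment> \<open>The mean of a constant is the constant itself, so the two terms on the right of
    \<open>extremal_equation\<close> cancel for every f.\<close>
  have "(\<integral>x. \<bar>\<kappa>\<bar> powr p \<partial>vol A G) = \<bar>\<kappa>\<bar> powr p * V"
    using integral_mult_right_zero[of "vol A G" "\<bar>\<kappa>\<bar> powr p" "\<lambda>_. 1"] unfolding V_def mult_1_right .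
  then have "(\<integral>x. \<bar>\<kappa>\<bar> powr p \<partial>vol A G) / V = \<bar>\<kappa>\<bar> powr p" using V by (metis less_irrefl nonzero_mult_div_cancel_right)
  then have "p * CARD('n) * (sgn \<kappa> * \<bar>\<kappa>\<bar> powr (p - 1) * (\<integral>x. laplace G f x \<partial>vol A G)) = 0"
    using extremal_equation[OF p ext f] unfolding \<kappa>(2) V_def[symmetric] integral_mult_right_zero by simp
  then show "(\<integral>x. laplace G f x \<partial>vol A G) = 0" using p \<kappa>(1) by (simp add: sgn_zero_iff)
qed

end

theorem theorem1p6:
  fixes A :: "('m::{t2_space, second_countable_topology}, 'n::finite) chart set"
    and G Gp :: "('m, 'n) metric"
    and p :: real
  assumes "complex_atlas A"
    and "compact (UNIV :: 'm set)"
    and "connected (UNIV :: 'm set)"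
    and "CARD('n) \<ge> 2"
    and "hermitian_metric A G"
    and "p \<ge> 2"
    and "Gp \<in> conformal_class A G"
    and "p_conformal_extremal A p Gp"
  shows "(gauduchon A Gp \<and> (\<forall>x. (real CARD('n) - p) * chern_scalar A Gp x \<ge> 0)
            \<longrightarrow> (\<exists>\<kappa>. \<forall>x. chern_scalar A Gp x = \<kappa>)) \<and>
         ((\<exists>\<kappa>. \<kappa> \<noteq> 0 \<and> (\<forall>x. chern_scalar A Gp x = \<kappa>))
            \<longrightarrow> gauduchon A Gp)"
proof -
  interpret H: hermitian_manifold A G by unfold_locales fact+
  obtain f where f: "Gp = conformal f G" "smooth_fun A f"
    using assms(7) unfolding conformal_class_def by blast
  have Gp: "hermitian_metric A Gp" unfolding f(1) by (rule H.hermitian_metric_conformal[OF f(2)])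
  \<comment> \<open>The extremal metric itself is taken as the base point, so that its variations
    have conformal factor e^(t f).\<close>
  interpret C: compact_hermitian_manifold A Gp by unfold_locales (rule Gp assms(2))+
  show ?thesis
  proof (intro conjI impI)
    assume "gauduchon A Gp \<and> (\<forall>x. (real CARD('n) - p) * chern_scalar A Gp x \<ge> 0)"
    then show "\<exists>\<kappa>. \<forall>x. chern_scalar A Gp x = \<kappa>"
      using C.constant_if_gauduchon_extremal[OF assms(6,3,8)] by simp
  next
    assume "\<exists>\<kappa>. \<kappa> \<noteq> 0 \<and> (\<forall>x. chern_scalar A Gp x = \<kappa>)"
    then obtain \<kappa> where "\<kappa> \<noteq> 0" "\<And>x. chern_scalar A Gp x = \<kappa>" by blast
    then show "gauduchon A Gp" by (rule C.gauduchon_if_constant_extremal[OF assms(6,8)])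
  qed
qed

end
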